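(* Let $n\ge2$, let $\Omega\subset\mathbb{R}^n$ be open, and let $a:\Omega\times\mathbb{R}\times\mathbb{R}^n\to\mathbb{R}^n$ and $b:\Omega\times\mathbb{R}\times\mathbb{R}^n\to\mathbb{R}$ be Carathéodory functions. Let $1\le p\le q<p+1$, $\theta\ge0$, $\delta\ge1$, let $c_1,c_2,c_3,c_4,M>0$ be constants, and let $b_0,b_1\ge0$ with $b_0\in L^{s_0}_{\mathrm{loc}}(\Omega)$, $b_1\in L^{s_1}_{\mathrm{loc}}(\Omega)$ be such that for a.e. $x\in\Omega$ and all $u\in\mathbb{R}$, $\xi\in\mathbb{R}^n$: $$(a(x,u,\xi),\xi)\ge c_1|\xi|^p-c_2|u|^\theta-b_1(x),$$ $$|a(x,u,\xi)|\le c_3|\xi|^{q-1}+c_4|u|^{(q-1)\frac{2}{q-p+2}}+b_1(x),$$ $$|b(x,u,\xi)|\le M(1+|\xi|^2)^{\frac{p+q-2}{4}}+M|u|^{\delta-1}+b_0(x).$$ Assume the following on the exponents. If $p<n$: $\frac qp<1+\frac1n$, $\ \theta,\delta<p^*:=\frac{np}{n-p}$, and $s_0,s_1>\frac np$. If $p\ge n$: $s_0,s_1>1$ and $p^*$ is a fixed real number with $p^*>p$ and $p^*>\max\left\{\frac{p}{p-q+1},\theta,\delta,\frac{ps_1}{s_1-1},\frac{ps_0}{s_0-1}\right\}$. Let $u\in W^{1,q}_{\mathrm{loc}}(\Omega)$ be a weak solution of $\sum_{i=1}^n\frac{\partial}{\partial x_i}a^i(x,u,Du)=b(x,u,Du)$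 in $\Omega$, and let $0<R_0\le1$ with $B_{R_0}(x_0)\Subset\Omega$. Then there exists $\sigma>0$, explicitly $$\sigma=p^*-\max\left\{\tfrac{p}{p-q+1};\ \tfrac{p^*}{s_1}+1;\ \tfrac{p^*}{s_0}+1;\ \theta;\ \delta\right\},$$ such that for every $0<r\le R_0$ $$\|u\|_{L^\infty(B_{r/2}(x_0))}\le\frac{c}{r^{\frac{p}{\sigma(p-q+1)}}}\left(1+\|u\|_{L^{p^*}(B_r(x_0))}\right)^{\frac{p^*-p}{\sigma}},$$ where the constant $c$ depends on the structural data ($n$, the exponents and the constants above), on $\|b_0\|_{L^{s_0}(B_{R_0}(x_0))}$ and on $\|b_1\|_{L^{s_1}(B_{R_0}(x_0))}$, and is independent of $u$.
   Context: Weak solution: $u\in W^{1,q}_{\mathrm{loc}}(\Omega)$ is a weak solution of the equation if $\int_\Omega\left\{\sum_{i=1}^n a^i(x,u,Du)\varphi_{x_i}+b(x,u,Du)\varphi\right\}dx=0$ for all $\varphi\in W^{1,q}(\Omega)$ with support compactly contained in $\Omega$. Here $(\cdot,\cdot)$ is the scalar product in $\mathbb{R}^n$ and $B_r(x_0)$ is the open ball of radius $r$ centred at $x_0$. *)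

theory Defs
  imports "HOL-Analysis.Analysis" "HOL-Probability.Essential_Supremum"
begin

text \<open>Real powers of nonnegative reals with the convention \<open>t\<^sup>0 = 1\<close> also at \<open>t = 0\<close>;
  the library has \<open>0 powr 0 = 0\<close>, which would alter the growth conditions in the admissible
  cases \<open>q = 1\<close>, \<open>\<theta> = 0\<close> and \<open>\<delta> = 1\<close>.\<close>

definition rpow :: "real \<Rightarrow> real \<Rightarrow> real" where
  "rpow t s = (if s = 0 then 1 else t powr s)"

text \<open>Only used with exponents \<open>s > 0\<close>.\<close>

definition epow :: "ennreal \<Rightarrow> real \<Rightarrow> ennreal" where
  "epow t s = (if t = \<infinity> then \<infinity> else ennreal (enn2real t powr s))"

definition compactly_contained :: "'a::metric_space set \<Rightarrow> 'a set \<Rightarrow> bool" where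
  "compactly_contained S \<Omega> \<longleftrightarrow> compact (closure S) \<and> closure S \<subseteq> \<Omega>"

definition Lp :: "real \<Rightarrow> 'a::euclidean_space set \<Rightarrow> ('a \<Rightarrow> 'b::euclidean_space) \<Rightarrow> bool" where
  "Lp s A f \<longleftrightarrow> f \<in> borel_measurable (lebesgue_on A) \<and>
     integrable (lebesgue_on A) (\<lambda>x. norm (f x) powr s)"

definition Lp_loc :: "real \<Rightarrow> 'a::euclidean_space set \<Rightarrow> ('a \<Rightarrow> 'b::euclidean_space) \<Rightarrow> bool" where
  "Lp_loc s \<Omega> f \<longleftrightarrow> (\<forall>K. compact K \<and> K \<subseteq> \<Omega> \<longrightarrow> Lp s K f)"

text \<open>The norms are extended-valued: a measurable function outside the space has norm \<open>\<infinity>\<close>.\<close>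

definition Lp_norm :: "real \<Rightarrow> 'a::euclidean_space set \<Rightarrow> ('a \<Rightarrow> 'b::euclidean_space) \<Rightarrow> ennreal" where
  "Lp_norm s A f = epow (\<integral>\<^sup>+ x. ennreal (norm (f x) powr s) \<partial>lebesgue_on A) (1 / s)"

definition Linf_norm :: "'a::euclidean_space set \<Rightarrow> ('a \<Rightarrow> 'b::euclidean_space) \<Rightarrow> ennreal" where
  "Linf_norm A f = esssup (lebesgue_on A) (\<lambda>x. ennreal (norm (f x)))"

definition partial_deriv :: "'n::finite \<Rightarrow> (real ^ 'n \<Rightarrow> real) \<Rightarrow> real ^ 'n \<Rightarrow> real" where
  "partial_deriv i f x = frechet_derivative f (at x) (axis i 1)"

primrec Ck :: "nat \<Rightarrow> (real ^ 'n::finite \<Rightarrow> real) \<Rightarrow> bool" where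
  "Ck 0 f \<longleftrightarrow> continuous_on UNIV f"
| "Ck (Suc k) f \<longleftrightarrow> f differentiable_on UNIV \<and> (\<forall>i. Ck k (partial_deriv i f))"

text \<open>The space \<open>C\<^sub>c\<^sup>\<infinity>(\<Omega>)\<close>; its elements are regarded as functions on the whole space,
  extended by zero.\<close>

definition test_function :: "(real ^ 'n::finite) set \<Rightarrow> (real ^ 'n \<Rightarrow> real) \<Rightarrow> bool" where
  "test_function \<Omega> \<phi> \<longleftrightarrow> (\<forall>k. Ck k \<phi>) \<and> compactly_contained {x. \<phi> x \<noteq> 0} \<Omega>"

definition weak_gradient ::
    "(real ^ 'n::finite) set \<Rightarrow> (real ^ 'n \<Rightarrow> real) \<Rightarrow> (real ^ 'n \<Rightarrow> real ^ 'n) \<Rightarrow> bool" where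
  "weak_gradient \<Omega> u Du \<longleftrightarrow> Lp_loc 1 \<Omega> u \<and> Lp_loc 1 \<Omega> Du \<and>
     (\<forall>\<phi> i. test_function \<Omega> \<phi> \<longrightarrow>
        (LINT x|lebesgue_on \<Omega>. u x * partial_deriv i \<phi> x)
          = - (LINT x|lebesgue_on \<Omega>. (Du x $ i) * \<phi> x))"

text \<open>Membership in \<open>W\<^sup>1\<^sup>,\<^sup>q(\<Omega>)\<close> and \<open>W\<^sup>1\<^sup>,\<^sup>q\<^sub>l\<^sub>o\<^sub>c(\<Omega>)\<close>, together with a representative
  of the weak gradient, which is unique up to null sets.\<close>

definition sobolev ::
    "real \<Rightarrow> (real ^ 'n::finite) set \<Rightarrow> (real ^ 'n \<Rightarrow> real) \<Rightarrow> (real ^ 'n \<Rightarrow> real ^ 'n) \<Rightarrow> bool" where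
  "sobolev q \<Omega> u Du \<longleftrightarrow> weak_gradient \<Omega> u Du \<and> Lp q \<Omega> u \<and> Lp q \<Omega> Du"

definition sobolev_loc ::
    "real \<Rightarrow> (real ^ 'n::finite) set \<Rightarrow> (real ^ 'n \<Rightarrow> real) \<Rightarrow> (real ^ 'n \<Rightarrow> real ^ 'n) \<Rightarrow> bool" where
  "sobolev_loc q \<Omega> u Du \<longleftrightarrow> weak_gradient \<Omega> u Du \<and> Lp_loc q \<Omega> u \<and> Lp_loc q \<Omega> Du"

definition caratheodory ::
    "'a::euclidean_space set \<Rightarrow> ('a \<Rightarrow> real \<Rightarrow> 'a \<Rightarrow> 'b::euclidean_space) \<Rightarrow> bool" where
  "caratheodory \<Omega> f \<longleftrightarrow>
     (\<forall>t \<xi>. (\<lambda>x. f x t \<xi>) \<in> borel_measurable (lebesgue_on \<Omega>)) \<and>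
     (AE x in lebesgue_on \<Omega>. continuous_on UNIV (\<lambda>(t, \<xi>). f x t \<xi>))"

text \<open>The integral identity includes the existence of the integral: the Bochner integral of a
  non-integrable function is \<open>0\<close>, and integrability does not follow from growth conditions on
  \<open>a\<close> whose free term is not in the dual Lebesgue space.\<close>

definition weak_solution ::
    "real \<Rightarrow> (real ^ 'n::finite) set \<Rightarrow> (real ^ 'n \<Rightarrow> real \<Rightarrow> real ^ 'n \<Rightarrow> real ^ 'n) \<Rightarrow>
     (real ^ 'n \<Rightarrow> real \<Rightarrow> real ^ 'n \<Rightarrow> real) \<Rightarrow> (real ^ 'n \<Rightarrow> real) \<Rightarrow> bool" where
  "weak_solution q \<Omega> a b u \<longleftrightarrow>
     (\<exists>Du. sobolev_loc q \<Omega> u Du \<and>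
       (\<forall>\<phi> D\<phi>. sobolev q \<Omega> \<phi> D\<phi> \<and> compactly_contained {x \<in> \<Omega>. \<phi> x \<noteq> 0} \<Omega> \<longrightarrow>
          has_bochner_integral (lebesgue_on \<Omega>)
            (\<lambda>x. (\<Sum>i\<in>UNIV. a x (u x) (Du x) $ i * D\<phi> x $ i) + b x (u x) (Du x) * \<phi> x) 0))"

end

theory Submission
  imports Defs
begin

text \<open>Moser iteration. Testing the equation with \<open>u V\<^sub>k powr \<gamma>\<close> times a power of a cutoff, where
  \<open>V\<^sub>k\<close> is a smooth truncation of \<open>V = sqrt (1 + u\<^sup>2)\<close>, and absorbing the \<open>(p, q)\<close> terms with
  Young's inequality bounds the integral of \<open>V powr \<gamma> * norm Du powr p\<close> on a smaller ball
  by that of \<open>V powr (\<gamma> + m) + (b0 + b1) V powr (\<gamma> + l)\<close> on a ball of radius \<open>R\<close>, with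
  \<open>m = pstar - \<sigma>\<close>; Young's inequality for the cutoff terms costs the factor
  \<open>R powr (- p / (p - q + 1))\<close>. As \<open>m - l = pstar / s\<close>, Hoelder's inequality estimates the right
  hand side by the \<open>L^pstar\<close> norm of \<open>u\<close> and the integral of \<open>V powr ((\<gamma> + l) s / (s - 1))\<close>, while
  the Sobolev inequality controls the integral of \<open>V powr ((\<gamma> + p) pstar / p)\<close>. This improves the
  exponent by a factor larger than \<open>1\<close>, and the first step needs only \<open>V\<close> in \<open>L^pstar\<close>. The Sobolev
  inequality is Gagliardo's, applied to mollifications of \<open>u\<close>; it also covers \<open>p \<ge> n\<close>, where
  \<open>pstar\<close> is arbitrary.\<close>

section \<open>Mollifiers\<close>

text \<open>A priori only \<open>Du\<close> in \<open>L^q\<close> is known, so the weight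
  \<open>V powr \<gamma>\<close> yields neither an admissible test function nor a finite energy. The
  truncation settles both: a test function with bounded weight lies in the Sobolev space, and since
  \<open>p \<le> q\<close> its energy is finite. The bounds are independent of the truncation, which
  Fatou's lemma removes after each step. Absorbing \<open>norm Du powr (q - 1)\<close> into
  \<open>norm Du powr p\<close> requires \<open>q < p + 1\<close>; the dual exponent is
  \<open>p / (p - q + 1)\<close>, so it bounds \<open>m\<close> from below and governs the power of
  the radius. The number \<sigma> is the room between \<open>m\<close> and \<open>pstar\<close>:
  with \<open>\<gamma> = \<sigma>\<close> the leading term on the right is
  \<open>V powr pstar\<close>, so this is the starting exponent. One step multiplies the Lebesgue
  exponent, asymptotically, by \<open>chi = (\<sigma> + l) / p\<close>, and the conditions on
  \<open>s0\<close> and \<open>s1\<close> guarantee \<open>chi > 1\<close>. The constants grow only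
  geometrically in the number of steps while the exponents grow like \<open>chi ^ i\<close>, so the
  product of their roots converges. Working with \<open>V \<ge> 1\<close> merges all powers of
  \<open>u\<close> into one and explains the 1 beside the norm.\<close>

primrec smooth1 :: "nat \<Rightarrow> (real \<Rightarrow> real) \<Rightarrow> bool" where
  "smooth1 0 f \<longleftrightarrow> continuous_on UNIV f"
| "smooth1 (Suc k) f \<longleftrightarrow> (\<exists>f'. (\<forall>x. (f has_real_derivative f' x) (at x)) \<and> smooth1 k f')"

lemma smooth1_continuous: "smooth1 k f \<Longrightarrow> continuous_on UNIV f"
  by (cases k) (auto intro!: continuous_at_imp_continuous_on intro: DERIV_isCont)

lemma smooth1_Suc_D: "smooth1 (Suc k) f \<Longrightarrow> smooth1 k f"
proof (induction k arbitrary: f)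
  case 0
  then show ?case using smooth1_continuous[of "Suc 0" f] by simp
next
  case (Suc k)
  then obtain f' where "\<forall>x. (f has_real_derivative f' x) (at x)" "smooth1 (Suc k) f'"
    by auto
  then show ?case using Suc.IH[of f'] by auto
qed

lemma smooth1_add: "smooth1 k f \<Longrightarrow> smooth1 k g \<Longrightarrow> smooth1 k (\<lambda>x. f x + g x)"
proof (induction k arbitrary: f g)
  case 0
  then show ?case by (auto intro: continuous_intros)
next
  case (Suc k)
  then obtain f' g' where "\<And>x. (f has_real_derivative f' x) (at x)" "smooth1 k f'"
    "\<And>x. (g has_real_derivative g' x) (at x)" "smooth1 k g'" by auto
  then show ?case using Suc.IH[of f' g'] by (auto intro!: exI[of _ "\<lambda>x. f' x + g' x"] DERIV_add)
qed

lemma smooth1_mult: "smooth1 k f \<Longrightarrow> smooth1 k g \<Longrightarrow> smooth1 k (\<lambda>x. f x * g x)"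
proof (induction k arbitrary: f g)
  case 0
  then show ?case by (auto intro: continuous_intros)
next
  case (Suc k)
  then obtain f' g' where d: "\<And>x. (f has_real_derivative f' x) (at x)" "smooth1 k f'"
    "\<And>x. (g has_real_derivative g' x) (at x)" "smooth1 k g'" by auto
  have "smooth1 k f" "smooth1 k g" using Suc.prems smooth1_Suc_D by blast+
  then have "smooth1 k (\<lambda>x. f' x * g x + g' x * f x)"
    using d Suc.IH by (intro smooth1_add) auto
  then show ?case using d by (auto intro!: exI[of _ "\<lambda>x. f' x * g x + g' x * f x"] DERIV_mult)
qed

lemma smooth1_affine: "smooth1 k f \<Longrightarrow> smooth1 k (\<lambda>x. c * f (a * x + b))"
proof (induction k arbitrary: f c)
  case 0
  have "continuous_on UNIV (\<lambda>x. f (a * x + b))"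
    by (rule continuous_on_compose2[of UNIV f]) (use 0 in \<open>auto intro!: continuous_intros\<close>)
  then show ?case by (auto intro!: continuous_on_mult_left)
next
  case (Suc k)
  then obtain f' where d: "\<And>x. (f has_real_derivative f' x) (at x)" "smooth1 k f'" by auto
  have "((\<lambda>x. c * f (a * x + b)) has_real_derivative (c * a) * f' (a * x + b)) (at x)" for x
  proof -
    have "((\<lambda>x. a * x + b) has_real_derivative a) (at x)"
      by (auto intro!: derivative_eq_intros)
    from DERIV_cmult[OF DERIV_chain2[OF d(1) this], of c] show ?thesis by (simp only: ac_simps)
  qed
  then show ?case using Suc.IH[OF d(2), of "c * a"]
    by (auto intro!: exI[of _ "\<lambda>x. c * a * f' (a * x + b)"])
qed

text \<open>The factor \<open>P\<close> makes this class of functions closed under differentiation.\<close>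

definition flat_fun :: "real poly \<Rightarrow> real \<Rightarrow> real" where
  "flat_fun P t = (if 0 < t then poly P (inverse t) * exp (- inverse t) else 0)"

lemma poly_times_exp_minus_tendsto_0: "((\<lambda>y::real. poly Q y * exp (- y)) \<longlongrightarrow> 0) at_top"
proof -
  have "((\<lambda>y. \<Sum>i\<le>degree Q. coeff Q i * (y ^ i / exp y)) \<longlongrightarrow> (\<Sum>i\<le>degree Q. coeff Q i * 0)) at_top"
    by (intro tendsto_intros tendsto_power_div_exp_0)
  then show ?thesis
    by (simp add: poly_altdef sum_distrib_right exp_minus divide_inverse mult.assoc)
qed

text \<open>With y = 1/t the derivative of P(y) exp(-y) is y^2 (P - P')(y) exp(-y), and multiplying
  a polynomial by y^2 is the double \<open>pCons 0\<close>. At t = 0 both one-sided difference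
  quotients tend to 0: the left one is constantly 0, the right one is y P(y) exp(-y) with y tending
  to infinity.\<close>

lemma flat_fun_deriv:
  "(flat_fun P has_real_derivative flat_fun (pCons 0 (pCons 0 (P - pderiv P))) t) (at t)"
proof -
  consider "t > 0" | "t < 0" | "t = 0" by linarith
  then show ?thesis
  proof cases
    case 1
    have "((\<lambda>t. poly P (inverse t) * exp (- inverse t)) has_real_derivative
        flat_fun (pCons 0 (pCons 0 (P - pderiv P))) t) (at t)"
    proof -
      have i: "(inverse has_real_derivative - (inverse t * inverse t)) (at t)"
        using DERIV_inverse'[OF DERIV_ident, of t UNIV] 1 by simp
      have "((\<lambda>t. poly P (inverse t) * exp (- inverse t)) has_real_derivative
          (poly (pderiv P) (inverse t) * - (inverse t * inverse t)) * exp (- inverse t)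
          + (exp (- inverse t) * - (- (inverse t * inverse t))) * poly P (inverse t)) (at t)"
        by (intro DERIV_mult DERIV_chain2[OF poly_DERIV i] DERIV_chain2[OF DERIV_exp] DERIV_minus i)
      then show ?thesis using 1 by (simp add: flat_fun_def algebra_simps)
    qed
    then show ?thesis
      by (rule has_field_derivative_transform_within_open[of _ _ _ "{0<..}"])
        (use 1 in \<open>auto simp: flat_fun_def\<close>)
  next
    case 2
    have "((\<lambda>t. 0) has_real_derivative
        flat_fun (pCons 0 (pCons 0 (P - pderiv P))) t) (at t)"
      using 2 by (simp add: flat_fun_def)
    then show ?thesis
      by (rule has_field_derivative_transform_within_open[of _ _ _ "{..<0}"])
        (use 2 in \<open>auto simp: flat_fun_def\<close>)
  next
    case 3
    have "((\<lambda>y. poly (pCons 0 P) (inverse y) * exp (- inverse y)) \<longlongrightarrow> 0) (at_right 0)"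
      by (rule filterlim_compose[OF poly_times_exp_minus_tendsto_0 filterlim_inverse_at_top_right])
    then have "((\<lambda>y. flat_fun P y / y) \<longlongrightarrow> 0) (at_right 0)"
    proof (rule Lim_transform_eventually)
      show "\<forall>\<^sub>F y in at_right 0. poly (pCons 0 P) (inverse y) * exp (- inverse y) = flat_fun P y / y"
        using eventually_at_right_less[of "0::real"]
        by eventually_elim (simp add: flat_fun_def divide_inverse)
    qed
    moreover have "((\<lambda>y. flat_fun P y / y) \<longlongrightarrow> 0) (at_left 0)"
    proof (rule Lim_transform_eventually[of "\<lambda>_. 0"])
      show "\<forall>\<^sub>F y in at_left 0. 0 = flat_fun P y / y"
        by (auto simp: flat_fun_def eventually_at_filter)
    qed simp
    ultimately have "((\<lambda>y. flat_fun P y / y) \<longlongrightarrow> 0) (at 0)"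
      by (simp add: filterlim_split_at)
    then show ?thesis using 3 by (simp add: has_field_derivative_iff flat_fun_def)
  qed
qed

lemma smooth1_flat_fun: "smooth1 k (flat_fun P)"
proof (induction k arbitrary: P)
  case 0
  then show ?case using flat_fun_deriv by (auto intro!: continuous_at_imp_continuous_on DERIV_isCont)
next
  case (Suc k)
  then show ?case using flat_fun_deriv[of P] by auto
qed

definition bump1 :: "real \<Rightarrow> real" where
  "bump1 t = flat_fun 1 (1 + t) * flat_fun 1 (1 - t)"

lemma smooth1_bump1: "smooth1 k bump1"
proof -
  have "smooth1 k (\<lambda>t. 1 * flat_fun 1 (1 * t + 1))" "smooth1 k (\<lambda>t. 1 * flat_fun 1 ((-1) * t + 1))"
    by (intro smooth1_affine smooth1_flat_fun)+
  from smooth1_mult[OF this] have "smooth1 k (\<lambda>t. flat_fun 1 (t + 1) * flat_fun 1 (- t + 1))"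
    by (simp only: mult_1 mult_minus_left)
  moreover have "bump1 = (\<lambda>t. flat_fun 1 (t + 1) * flat_fun 1 (- t + 1))"
    by (auto simp: bump1_def fun_eq_iff add.commute)
  ultimately show ?thesis by simp
qed

lemma bump1_nonneg: "0 \<le> bump1 t"
  by (auto simp: bump1_def flat_fun_def)

lemma bump1_pos: "0 < bump1 0"
  by (simp add: bump1_def flat_fun_def)

lemma bump1_eq_0: "1 \<le> \<bar>t\<bar> \<Longrightarrow> bump1 t = 0"
  by (auto simp: bump1_def flat_fun_def)

lemma prod_coord_has_derivative:
  fixes f f' :: "'n::finite \<Rightarrow> real \<Rightarrow> real"
  assumes "\<And>i t. (f i has_real_derivative f' i t) (at t)"
  shows "((\<lambda>x::real^'n. \<Prod>i\<in>UNIV. f i (x $ i)) has_derivative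
     (\<lambda>h. \<Sum>i\<in>UNIV. (f' i (x $ i) * h $ i) * (\<Prod>j\<in>UNIV - {i}. f j (x $ j)))) (at x)"
proof (rule has_derivative_prod)
  fix i :: 'n
  have "((\<lambda>x. x $ i) has_derivative (\<lambda>h. h $ i)) (at x)"
    by (intro bounded_linear_imp_has_derivative bounded_linear_vec_nth)
  from has_derivative_compose[OF this, of "f i"] assms[of i "x $ i"]
  show "((\<lambda>x. f i (x $ i)) has_derivative (\<lambda>h. f' i (x $ i) * h $ i)) (at x within UNIV)"
    unfolding has_field_derivative_def by simp
qed

text \<open>A partial derivative of a product of one-variable functions is such a product again,
  with the factor \<open>f i\<close> replaced by \<open>f' i\<close>. The induction on
  \<open>k\<close> therefore runs over all families of factors, of which only one is differentiated
  at each stage.\<close>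

lemma Ck_prod:
  fixes f :: "'n::finite \<Rightarrow> real \<Rightarrow> real"
  assumes "\<And>i. smooth1 k (f i)"
  shows "Ck k (\<lambda>x::real^'n. \<Prod>i\<in>UNIV. f i (x $ i))"
  using assms
proof (induction k arbitrary: f)
  case 0
  have "continuous_on UNIV (\<lambda>x::real^'n. f i (x $ i))" for i
  proof (rule continuous_on_compose2[of UNIV "f i" UNIV "\<lambda>x. x $ i"])
    show "continuous_on UNIV (f i)" using 0 by simp
    show "continuous_on UNIV (\<lambda>x::real^'n. x $ i)" by (intro continuous_intros)
  qed simp
  then have "continuous_on UNIV (\<lambda>x::real^'n. \<Prod>i\<in>UNIV. f i (x $ i))"
    by (rule continuous_on_prod)
  then show ?case by simp
next
  case (Suc k)
  have "\<exists>f'. (\<forall>t. (f i has_real_derivative f' t) (at t)) \<and> smooth1 k f'" for i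
    using Suc.prems[of i] by simp
  then obtain f' where d: "\<And>i t. (f i has_real_derivative f' i t) (at t)" "\<And>i. smooth1 k (f' i)"
    by metis
  note der = prod_coord_has_derivative[of f f', OF d(1)]
  have "partial_deriv i (\<lambda>x::real^'n. \<Prod>i\<in>UNIV. f i (x $ i))
      = (\<lambda>x. \<Prod>j\<in>UNIV. (f(i := f' i)) j (x $ j))" (is "?L = ?R") for i
  proof
    fix x :: "real^'n"
    have "?L x = (\<Sum>j\<in>UNIV. (f' j (x $ j) * axis i 1 $ j) * (\<Prod>j\<in>UNIV - {j}. f j (x $ j)))"
      unfolding partial_deriv_def by (simp add: frechet_derivative_at[OF der, symmetric])
    also have "\<dots> = f' i (x $ i) * (\<Prod>j\<in>UNIV - {i}. f j (x $ j))"
      by (subst sum.remove[of _ i]) (auto simp: axis_def intro!: sum.neutral)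
    also have "\<dots> = ?R x"
      by (subst prod.remove[of _ i]) auto
    finally show "?L x = ?R x" .
  qed
  moreover have "Ck k (\<lambda>x. \<Prod>j\<in>UNIV. (f(i := f' i)) j (x $ j))" for i
  proof (rule Suc.IH)
    fix j show "smooth1 k ((f(i := f' i)) j)"
      using d(2) smooth1_Suc_D[OF Suc.prems] by auto
  qed
  moreover have "(\<lambda>x::real^'n. \<Prod>i\<in>UNIV. f i (x $ i)) differentiable_on UNIV"
    using der unfolding differentiable_on_def differentiable_def by blast
  ultimately show ?case by simp
qed

lemma Ck_cong_const_mult:
  "Ck k f \<Longrightarrow> Ck k (\<lambda>x. c * f x)"
proof (induction k arbitrary: f)
  case 0
  then show ?case by (auto intro: continuous_on_mult_left)
next
  case (Suc k)
  have "f differentiable (at x)" for x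
    using Suc.prems by (simp add: differentiable_on_def)
  then have d: "(f has_derivative frechet_derivative f (at x)) (at x)" for x
    by (simp add: frechet_derivative_works)
  have d': "((\<lambda>x. c * f x) has_derivative (\<lambda>h. c * frechet_derivative f (at x) h)) (at x)" for x
    by (rule has_derivative_mult_right[OF d])
  have "partial_deriv i (\<lambda>x. c * f x) = (\<lambda>x. c * partial_deriv i f x)" for i
    unfolding partial_deriv_def fun_eq_iff
    using frechet_derivative_at[OF d'] by metis
  moreover have "(\<lambda>x. c * f x) differentiable_on UNIV"
    using d' unfolding differentiable_on_def differentiable_def by blast
  ultimately show ?case using Suc by simp
qed

text \<open>The support condition on \<open>\<rho>\<close> is stated with \<open>norm\<close>; smoothness is stated for all
  reflected translates because these are the test functions that mollification uses.\<close>

lemma mollifier_exists: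
  fixes e :: real
  assumes "e > 0"
  obtains \<rho> :: "real ^ 'n::finite \<Rightarrow> real" where
    "\<And>k x. Ck k (\<lambda>y. \<rho> (x - y))" "\<And>k. Ck k \<rho>" "\<And>x. 0 \<le> \<rho> x" "\<And>x. \<rho> x \<noteq> 0 \<Longrightarrow> norm x \<le> e"
    "integrable lborel \<rho>" "(LINT x|lborel. \<rho> x) = 1"
proof -
  \<comment> \<open>The bumps live in a cube; half side \<open>e / n\<close> bounds the sum of the
    absolute coordinates, hence the Euclidean norm, by \<open>e\<close>.\<close>
  define d where "d = e / real CARD('n)"
  have d: "d > 0" using assms by (simp add: d_def)
  define h where "h = (\<lambda>t. bump1 (t / d))"
  define r where "r = (\<lambda>x::real^'n. \<Prod>i\<in>UNIV. h (x $ i))"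
  have h_smooth: "smooth1 k (\<lambda>t. h (a + b * t))" for k a b
    using smooth1_affine[OF smooth1_bump1, of k 1 "b / d" "a / d"]
    by (simp add: h_def add_divide_distrib add.commute)
  have "Ck k (\<lambda>x::real^'n. \<Prod>i\<in>UNIV. (\<lambda>t. h (0 + 1 * t)) (x $ i))" for k
    by (rule Ck_prod) (rule h_smooth)
  then have r1: "Ck k r" for k by (simp add: r_def)
  have "Ck k (\<lambda>y::real^'n. \<Prod>i\<in>UNIV. (\<lambda>t. h (x $ i + (-1) * t)) (y $ i))" for k x
    by (rule Ck_prod) (rule h_smooth)
  then have r2: "Ck k (\<lambda>y. r (x - y))" for k x by (simp add: r_def)
  have r_nonneg: "0 \<le> r x" for x
    by (auto simp: r_def h_def bump1_nonneg intro!: prod_nonneg)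
  have r_supp: "norm x \<le> e" if "r x \<noteq> 0" for x
  proof -
    have "\<bar>x $ i\<bar> \<le> d" for i
    proof -
      have "h (x $ i) \<noteq> 0" using that by (auto simp: r_def)
      then have "\<bar>x $ i / d\<bar> < 1" unfolding h_def using bump1_eq_0 not_le by blast
      then show ?thesis using d by (simp add: abs_divide)
    qed
    then have "(\<Sum>i\<in>UNIV. \<bar>x $ i\<bar>) \<le> (\<Sum>i\<in>(UNIV::'n set). d)" by (intro sum_mono)
    then have "(\<Sum>i\<in>UNIV. \<bar>x $ i\<bar>) \<le> e" by (simp add: d_def)
    then show ?thesis using norm_le_l1_cart[of x] by linarith
  qed
  have cont: "continuous_on UNIV r" using r1[of 0] by simp
  have "continuous_on (cball 0 e) r" using cont continuous_on_subset by blast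
  then have "set_integrable lborel (cball 0 e) r"
    unfolding set_integrable_def by (rule borel_integrable_compact[OF compact_cball])
  moreover have "(\<lambda>x. indicator (cball 0 e) x *\<^sub>R r x) = r"
    using r_supp by (fastforce simp: indicator_def)
  ultimately have int: "integrable lborel r" unfolding set_integrable_def by simp
  have pos: "0 < (LINT x|lborel. r x)"
  proof -
    have "r 0 > 0" unfolding r_def h_def using bump1_pos by (auto intro!: prod_pos)
    then have "open {x. r x > 0}" "0 \<in> {x. r x > 0}"
      using open_Collect_less[OF continuous_on_const cont, of 0] by auto
    then have "{x. r x > 0} \<notin> null_sets lborel"
      using open_not_negligible[of "{x. r x > 0}"] null_sets_completionI
      by (auto simp: negligible_iff_null_sets)
    moreover have "{x. r x > 0} \<in> sets lborel" using \<open>open {x. r x > 0}\<close> by auto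
    moreover have "{x. r x > 0} = {x \<in> space lborel. \<not> r x = 0}"
      using r_nonneg by (auto simp: less_le)
    ultimately have "\<not> (AE x in lborel. r x = 0)"
      by (subst AE_iff_null) auto
    then have "(LINT x|lborel. r x) \<noteq> 0"
      using integral_nonneg_eq_0_iff_AE[OF int] r_nonneg by auto
    then show ?thesis using Bochner_Integration.integral_nonneg[of lborel r] r_nonneg by (simp add: less_le)
  qed
  define \<rho> where "\<rho> = (\<lambda>x. inverse (LINT x|lborel. r x) * r x)"
  show ?thesis
  proof (rule that[of \<rho>])
    show "Ck k (\<lambda>y. \<rho> (x - y))" "Ck k \<rho>" for k x
      unfolding \<rho>_def by (intro Ck_cong_const_mult r1 r2)+
    show "0 \<le> \<rho> x" for x using r_nonneg pos by (simp add: \<rho>_def)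
    show "norm x \<le> e" if "\<rho> x \<noteq> 0" for x using that r_supp by (auto simp: \<rho>_def)
    show "integrable lborel \<rho>" "(LINT x|lborel. \<rho> x) = 1"
      using int pos by (auto simp: \<rho>_def)
  qed
qed

section \<open>The Gagliardo--Nirenberg inequality\<close>

lemma epow_ennreal: "0 \<le> a \<Longrightarrow> epow (ennreal a) s = ennreal (a powr s)"
  by (simp add: epow_def)

lemma epow_infinity [simp]: "epow \<infinity> s = \<infinity>" "epow top s = top"
  by (simp_all add: epow_def)

lemma epow_measurable [measurable]:
  assumes [measurable]: "f \<in> borel_measurable M"
  shows "(\<lambda>x. epow (f x) s) \<in> borel_measurable M"
  unfolding epow_def by measurable

lemma epow_mono:
  assumes "a \<le> b" "0 \<le> s"
  shows "epow a s \<le> epow b s"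
proof (cases b)
  case (real r)
  then obtain r' where "a = ennreal r'" "0 \<le> r'"
    using assms(1) by (cases a) (auto simp: top_unique)
  then show ?thesis using real assms
    by (auto simp: epow_ennreal intro!: ennreal_leI powr_mono2)
qed simp

lemma epow_eq_0_iff: "epow a s = 0 \<longleftrightarrow> a = 0"
  by (cases a) (auto simp: epow_ennreal)

lemma epow_add: "epow a (s + t) = epow a s * epow a t"
  by (cases a) (auto simp: epow_ennreal powr_add ennreal_mult ennreal_top_mult)

lemma epow_of_nat_mult:
  assumes "0 < n"
  shows "epow a (real n * e) = epow a e ^ n"
  using assms
proof (induction n rule: nat_induct_non_zero)
  case (Suc n)
  have "real (Suc n) * e = real n * e + e" by (simp add: distrib_right)
  then show ?case using Suc by (simp only: epow_add) (simp add: mult_ac)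
qed simp

lemma prod_eq_top_ennreal:
  fixes f :: "'i \<Rightarrow> ennreal"
  assumes "finite S" "i \<in> S" "f i = top" "\<And>j. j \<in> S \<Longrightarrow> f j \<noteq> 0"
  shows "(\<Prod>i\<in>S. f i) = top"
proof -
  have "(\<Prod>i\<in>S - {i}. f i) \<noteq> 0" using assms by auto
  then show ?thesis using assms by (simp add: prod.remove[of S i] ennreal_top_mult)
qed

text \<open>The arithmetic-geometric mean inequality for the quotients \<open>h i / c i\<close>. The
  free weights \<open>c i\<close> are there to be replaced by the integrals of the
  \<open>h i\<close>, which normalises each quotient to integral 1.\<close>

lemma ennreal_arith_geom_mean:
  fixes h :: "'i \<Rightarrow> ennreal" and c :: "'i \<Rightarrow> real"
  assumes S: "finite S" "S \<noteq> {}" and c: "\<And>i. i \<in> S \<Longrightarrow> 0 < c i"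
  shows "(\<Prod>i\<in>S. epow (h i) (1 / card S))
    \<le> ennreal (\<Prod>i\<in>S. c i powr (1 / card S)) * (\<Sum>i\<in>S. ennreal (1 / (card S * c i)) * h i)"
proof (cases "\<exists>i\<in>S. h i = top")
  case True
  then obtain i where i: "i \<in> S" "h i = top" by auto
  have "card S > 0" using S by (simp add: card_gt_0_iff)
  then have "ennreal (1 / (card S * c i)) * h i = top"
    using i c[OF i(1)] by (simp add: ennreal_mult_top ennreal_eq_0_iff not_le)
  then have "(\<Sum>i\<in>S. ennreal (1 / (card S * c i)) * h i) = top"
    using i S by (simp add: sum.remove[of S i])
  moreover have "(\<Prod>i\<in>S. c i powr (1 / card S)) > 0"
    using c by (intro prod_pos) (auto dest: c)
  ultimately show ?thesis by (simp add: ennreal_mult_top ennreal_eq_0_iff not_le)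
next
  case False
  define x where "x i = enn2real (h i)" for i
  have h: "h i = ennreal (x i)" if "i \<in> S" for i
    using False that by (auto simp: x_def less_top)
  have x: "0 \<le> x i" for i by (simp add: x_def)
  let ?m = "real (card S)"
  have m: "?m > 0" using S by (simp add: card_gt_0_iff)
  have "(\<Prod>i\<in>S. x i / c i) powr (1 / ?m) \<le> (\<Sum>i\<in>S. (x i / c i) / ?m)"
    using c x by (intro arith_geom_mean S) (auto intro!: divide_nonneg_pos)
  moreover have "(\<Prod>i\<in>S. x i / c i) powr (1 / ?m) = (\<Prod>i\<in>S. (x i / c i) powr (1 / ?m))"
    by (rule prod_powr_distrib)
  moreover have "(\<Prod>i\<in>S. x i powr (1 / ?m))
      = (\<Prod>i\<in>S. c i powr (1 / ?m)) * (\<Prod>i\<in>S. (x i / c i) powr (1 / ?m))"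
    unfolding prod.distrib[symmetric]
  proof (rule prod.cong)
    fix i assume "i \<in> S"
    then have "0 < c i" by (rule c)
    then show "x i powr (1 / ?m) = c i powr (1 / ?m) * (x i / c i) powr (1 / ?m)"
      using x[of i] by (simp add: powr_divide)
  qed simp
  moreover have "0 \<le> (\<Prod>i\<in>S. c i powr (1 / ?m))" by (intro prod_nonneg) auto
  ultimately have *: "(\<Prod>i\<in>S. x i powr (1 / ?m))
      \<le> (\<Prod>i\<in>S. c i powr (1 / ?m)) * (\<Sum>i\<in>S. (1 / (?m * c i)) * x i)"
    by (auto intro!: mult_left_mono simp: divide_simps mult_ac)
  have "(\<Prod>i\<in>S. epow (h i) (1 / ?m)) = ennreal (\<Prod>i\<in>S. x i powr (1 / ?m))"
    using h x by (simp add: epow_ennreal prod_ennreal)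
  moreover have "(\<Sum>i\<in>S. ennreal (1 / (?m * c i)) * h i)
      = ennreal (\<Sum>i\<in>S. (1 / (?m * c i)) * x i)"
  proof -
    have "(\<Sum>i\<in>S. ennreal (1 / (?m * c i)) * h i) = (\<Sum>i\<in>S. ennreal ((1 / (?m * c i)) * x i))"
    proof (intro sum.cong refl)
      fix i assume "i \<in> S"
      then have "0 \<le> 1 / (?m * c i)" using c[of i] m by (simp add: less_imp_le)
      then show "ennreal (1 / (?m * c i)) * h i = ennreal ((1 / (?m * c i)) * x i)"
        using h[OF \<open>i \<in> S\<close>] x by (simp only: ennreal_mult)
    qed
    also have "\<dots> = ennreal (\<Sum>i\<in>S. (1 / (?m * c i)) * x i)"
      using x c m by (intro sum_ennreal) (auto simp: less_imp_le intro!: mult_nonneg_nonneg)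
    finally show ?thesis .
  qed
  ultimately show ?thesis using *
    by (auto simp: ennreal_mult'[symmetric] prod_nonneg intro!: ennreal_leI)
qed

text \<open>Hoelder's inequality with equal exponents: with \<open>c i\<close> the integral of
  \<open>h i\<close>, the sum in the mean inequality integrates to exactly 1. This choice needs
  positive finite integrals; if one integral is 0 the product vanishes almost everywhere, and if
  none is 0 but one is infinite the right hand side is infinite.\<close>

lemma nn_integral_prod_epow_le:
  fixes h :: "'i \<Rightarrow> 'a \<Rightarrow> ennreal"
  assumes S: "finite S" "S \<noteq> {}" and [measurable]: "\<And>i. i \<in> S \<Longrightarrow> h i \<in> borel_measurable M"
  shows "(\<integral>\<^sup>+x. (\<Prod>i\<in>S. epow (h i x) (1 / card S)) \<partial>M) \<le> (\<Prod>i\<in>S. epow (\<integral>\<^sup>+x. h i x \<partial>M) (1 / card S))"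
proof -
  consider (zero) i where "i \<in> S" "(\<integral>\<^sup>+x. h i x \<partial>M) = 0"
    | (top) i where "i \<in> S" "(\<integral>\<^sup>+x. h i x \<partial>M) = top" "\<And>i. i \<in> S \<Longrightarrow> (\<integral>\<^sup>+x. h i x \<partial>M) \<noteq> 0"
    | (fin) "\<And>i. i \<in> S \<Longrightarrow> (\<integral>\<^sup>+x. h i x \<partial>M) \<noteq> 0" "\<And>i. i \<in> S \<Longrightarrow> (\<integral>\<^sup>+x. h i x \<partial>M) \<noteq> top"
    by blast
  then show ?thesis
  proof cases
    case zero
    then have "AE x in M. h i x = 0"
      by (subst nn_integral_0_iff_AE[symmetric]) auto
    then have "AE x in M. (\<Prod>i\<in>S. epow (h i x) (1 / card S)) = 0"
      by eventually_elim (use zero S in \<open>auto simp: epow_eq_0_iff\<close>)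
    then have "(\<integral>\<^sup>+x. (\<Prod>i\<in>S. epow (h i x) (1 / card S)) \<partial>M) = 0"
      by (simp add: nn_integral_0_iff_AE cong: nn_integral_cong_AE)
    then show ?thesis by simp
  next
    case top
    then have "(\<Prod>i\<in>S. epow (\<integral>\<^sup>+x. h i x \<partial>M) (1 / card S)) = top"
      using S by (intro prod_eq_top_ennreal[of _ i]) (auto simp: epow_eq_0_iff)
    then show ?thesis by simp
  next
    case fin
    define c where "c i = enn2real (\<integral>\<^sup>+x. h i x \<partial>M)" for i
    have c_eq: "(\<integral>\<^sup>+x. h i x \<partial>M) = ennreal (c i)" if "i \<in> S" for i
      using fin(2)[OF that] by (simp add: c_def less_top)
    have c: "0 < c i" if "i \<in> S" for i
      using fin(1)[OF that] c_eq[OF that] by (cases "c i > 0") (auto simp: not_less ennreal_neg)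
    have m: "real (card S) > 0" using S by (simp add: card_gt_0_iff)
    have "(\<integral>\<^sup>+x. (\<Prod>i\<in>S. epow (h i x) (1 / card S)) \<partial>M)
      \<le> (\<integral>\<^sup>+x. ennreal (\<Prod>i\<in>S. c i powr (1 / card S)) * (\<Sum>i\<in>S. ennreal (1 / (card S * c i)) * h i x) \<partial>M)"
      by (intro nn_integral_mono ennreal_arith_geom_mean S c)
    also have "\<dots> = ennreal (\<Prod>i\<in>S. c i powr (1 / card S)) * (\<Sum>i\<in>S. ennreal (1 / (card S * c i)) * ennreal (c i))"
      using c_eq by (simp add: nn_integral_cmult nn_integral_sum)
    also have "(\<Sum>i\<in>S. ennreal (1 / (card S * c i)) * ennreal (c i)) = (\<Sum>i\<in>S. ennreal (1 / card S))"
    proof (intro sum.cong refl)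
      fix i assume "i \<in> S"
      then show "ennreal (1 / (card S * c i)) * ennreal (c i) = ennreal (1 / card S)"
        using c[of i] m by (simp add: ennreal_mult'[symmetric] less_imp_le)
    qed
    also have "\<dots> = 1" using m
      by (simp add: ennreal_of_nat_eq_real_of_nat ennreal_mult'[symmetric])
    also have "ennreal (\<Prod>i\<in>S. c i powr (1 / card S)) = (\<Prod>i\<in>S. epow (\<integral>\<^sup>+x. h i x \<partial>M) (1 / card S))"
      using c_eq c by (simp add: epow_ennreal less_imp_le prod_ennreal)
    finally show ?thesis by simp
  qed
qed

text \<open>Integrates out the coordinates in \<open>J\<close> and keeps the remaining ones of
  \<open>x\<close>. The result is still a function on the whole space, constant in the directions of
  \<open>J\<close>, so an induction on \<open>J\<close> never changes the underlying space.\<close>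

definition slice_nn :: "'a::euclidean_space set \<Rightarrow> ('a \<Rightarrow> ennreal) \<Rightarrow> 'a \<Rightarrow> ennreal" where
  "slice_nn J g x = (\<integral>\<^sup>+y. g ((\<Sum>b\<in>J. y b *\<^sub>R b) + (\<Sum>b\<in>Basis - J. (x \<bullet> b) *\<^sub>R b)) \<partial>(\<Pi>\<^sub>M b\<in>J. lborel))"

interpretation lborel_product: product_sigma_finite "\<lambda>_::'a::euclidean_space. lborel :: real measure"
  by standard

lemma slice_nn_empty: "slice_nn {} g x = g x"
  unfolding slice_nn_def
  by (subst lborel_product.nn_integral_empty) (simp_all add: euclidean_representation)

lemma slice_nn_Basis:
  assumes [measurable]: "g \<in> borel_measurable borel"
  shows "slice_nn Basis g x = (\<integral>\<^sup>+y. g y \<partial>lborel)"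
  unfolding slice_nn_def
  by (subst lborel_eq) (simp add: nn_integral_distr)

lemma slice_nn_measurable [measurable]:
  assumes [measurable]: "g \<in> borel_measurable borel" and "finite J"
  shows "slice_nn J g \<in> borel_measurable borel"
proof -
  interpret finite_product_sigma_finite "\<lambda>_::'a. lborel :: real measure" J
    by standard (rule assms)
  show ?thesis
    unfolding slice_nn_def by measurable
qed

lemma slice_nn_insert:
  assumes [measurable]: "g \<in> borel_measurable borel" and J: "J \<subseteq> Basis" "j \<in> Basis" "j \<notin> J"
  shows "slice_nn (insert j J) g x = (\<integral>\<^sup>+t. slice_nn J g (x + (t - x \<bullet> j) *\<^sub>R j) \<partial>lborel)"
proof -
  have fin: "finite J" using J finite_subset[OF _ finite_Basis] by auto
  have "slice_nn (insert j J) g x = (\<integral>\<^sup>+t. \<integral>\<^sup>+y. g ((\<Sum>b\<in>insert j J. (y(j := t)) b *\<^sub>R b)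
      + (\<Sum>b\<in>Basis - insert j J. (x \<bullet> b) *\<^sub>R b)) \<partial>(\<Pi>\<^sub>M b\<in>J. lborel) \<partial>lborel)"
    unfolding slice_nn_def
    by (rule lborel_product.product_nn_integral_insert_rev[OF fin J(3)]) measurable
  also have "\<dots> = (\<integral>\<^sup>+t. slice_nn J g (x + (t - x \<bullet> j) *\<^sub>R j) \<partial>lborel)"
    unfolding slice_nn_def
  proof (intro nn_integral_cong arg_cong[of _ _ g])
    fix t :: real and y :: "'a \<Rightarrow> real"
    have 1: "(\<Sum>b\<in>insert j J. (y(j := t)) b *\<^sub>R b) = t *\<^sub>R j + (\<Sum>b\<in>J. y b *\<^sub>R b)"
      using fin J by (simp add: sum.insert) (auto intro!: sum.cong)
    have "(\<Sum>b\<in>Basis - J. ((x + (t - x \<bullet> j) *\<^sub>R j) \<bullet> b) *\<^sub>R b)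
        = t *\<^sub>R j + (\<Sum>b\<in>Basis - J - {j}. ((x + (t - x \<bullet> j) *\<^sub>R j) \<bullet> b) *\<^sub>R b)"
      using J by (subst sum.remove[of _ j]) (auto simp: inner_simps)
    also have "(\<Sum>b\<in>Basis - J - {j}. ((x + (t - x \<bullet> j) *\<^sub>R j) \<bullet> b) *\<^sub>R b)
        = (\<Sum>b\<in>Basis - insert j J. (x \<bullet> b) *\<^sub>R b)"
      using J by (intro sum.cong) (auto simp: inner_simps inner_Basis)
    finally show "(\<Sum>b\<in>insert j J. (y(j := t)) b *\<^sub>R b) + (\<Sum>b\<in>Basis - insert j J. (x \<bullet> b) *\<^sub>R b)
      = (\<Sum>b\<in>J. y b *\<^sub>R b) + (\<Sum>b\<in>Basis - J. ((x + (t - x \<bullet> j) *\<^sub>R j) \<bullet> b) *\<^sub>R b)"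
      using 1 by simp
  qed
  finally show ?thesis .
qed

lemma slice_nn_shift:
  assumes "j \<in> J" "j \<in> Basis"
  shows "slice_nn J g (x + c *\<^sub>R j) = slice_nn J g x"
proof -
  have "(\<Sum>b\<in>Basis - J. ((x + c *\<^sub>R j) \<bullet> b) *\<^sub>R b) = (\<Sum>b\<in>Basis - J. (x \<bullet> b) *\<^sub>R b)"
    using assms by (intro sum.cong) (auto simp: inner_simps inner_Basis)
  then show ?thesis by (simp add: slice_nn_def)
qed

text \<open>Gagliardo's argument: integrate out one coordinate at a time, pulling the single factor
  that does not depend on it out of the integral.\<close>

lemma gagliardo_slices:
  fixes f :: "'a::euclidean_space \<Rightarrow> ennreal" and g :: "'a \<Rightarrow> 'a \<Rightarrow> ennreal"
  assumes dim: "2 \<le> DIM('a)"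
    and [measurable]: "f \<in> borel_measurable borel" "\<And>b. g b \<in> borel_measurable borel"
    and le: "\<And>b x. b \<in> Basis \<Longrightarrow> f x \<le> slice_nn {b} (g b) x"
    and J: "J \<subseteq> Basis"
  defines "e \<equiv> 1 / real (DIM('a) - 1)"
  shows "slice_nn J (\<lambda>x. epow (f x) (1 + e)) x
     \<le> (\<Prod>b\<in>J. epow (slice_nn J (g b) x) e) * (\<Prod>b\<in>Basis - J. epow (slice_nn (insert b J) (g b) x) e)"
  using finite_subset[OF J finite_Basis] J
proof (induction J arbitrary: x rule: finite_induct)
  case empty
  \<comment> \<open>With \<open>e = 1 / (n - 1)\<close> the power \<open>1 + e\<close> equals
    \<open>n * e\<close>, so \<open>f x\<close> can be estimated once in each of the
    \<open>n\<close> directions, each time with power \<open>e\<close>.\<close>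
  have e: "0 < e" "1 + e = real (DIM('a)) * e"
    using dim by (auto simp: e_def field_simps of_nat_diff)
  have "epow (f x) (1 + e) = (\<Prod>b\<in>(Basis::'a set). epow (f x) e)"
    using epow_of_nat_mult[of "DIM('a)" "f x" e] e by simp
  also have "\<dots> \<le> (\<Prod>b\<in>Basis. epow (slice_nn {b} (g b) x) e)"
    using e by (intro prod_mono_ennreal epow_mono le) auto
  finally show ?case by (simp add: slice_nn_empty)
next
  case (insert j J)
  then have J: "J \<subseteq> Basis" "j \<in> Basis" "j \<notin> J" "finite J" by auto
  define S where "S = Basis - {j}"
  have S: "finite S" "S \<noteq> {}" "card S = DIM('a) - 1"
    using J dim by (auto simp: S_def card_Diff_singleton)
      (metis Diff_eq_empty_iff card_mono card_1_singleton_iff finite.emptyI finite_insert Suc_1 card.insert card.empty not_less_eq_eq One_nat_def empty_iff)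
  define h where "h b t = slice_nn (if b \<in> J then J else insert b J) (g b) (x + (t - x \<bullet> j) *\<^sub>R j)" for b t
  have [measurable]: "h b \<in> borel_measurable borel" for b
    unfolding h_def
  proof (rule measurable_compose[where N = borel and f = "\<lambda>t. x + (t - x \<bullet> j) *\<^sub>R j"
        and g = "slice_nn (if b \<in> J then J else insert b J) (g b)"])
    show "(\<lambda>t. x + (t - x \<bullet> j) *\<^sub>R j) \<in> borel_measurable borel"
      by (intro borel_measurable_continuous_onI continuous_intros)
    show "slice_nn (if b \<in> J then J else insert b J) (g b) \<in> borel_measurable borel"
      using J(4) by (intro slice_nn_measurable) auto
  qed
  have h_int: "(\<integral>\<^sup>+t. h b t \<partial>lborel) = slice_nn (insert j (if b \<in> J then J else insert b J)) (g b) x"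
    if "b \<in> S" for b
    unfolding h_def by (subst slice_nn_insert) (use J that in \<open>auto simp: S_def\<close>)
  have "slice_nn (insert j J) (\<lambda>x. epow (f x) (1 + e)) x
     = (\<integral>\<^sup>+t. slice_nn J (\<lambda>x. epow (f x) (1 + e)) (x + (t - x \<bullet> j) *\<^sub>R j) \<partial>lborel)"
    by (rule slice_nn_insert) (use J in auto)
  also have "\<dots> \<le> (\<integral>\<^sup>+t. epow (slice_nn (insert j J) (g j) x) e * (\<Prod>b\<in>S. epow (h b t) e) \<partial>lborel)"
  proof (rule nn_integral_mono)
    fix t
    let ?x = "x + (t - x \<bullet> j) *\<^sub>R j"
    have "(\<Prod>b\<in>S. epow (h b t) e) = (\<Prod>b\<in>J. epow (h b t) e) * (\<Prod>b\<in>Basis - J - {j}. epow (h b t) e)"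
      using J by (subst prod.union_disjoint[symmetric]) (auto simp: S_def intro!: prod.cong)
    also have "(\<Prod>b\<in>J. epow (h b t) e) = (\<Prod>b\<in>J. epow (slice_nn J (g b) ?x) e)"
      by (intro prod.cong) (auto simp: h_def)
    also have "(\<Prod>b\<in>Basis - J - {j}. epow (h b t) e)
       = (\<Prod>b\<in>Basis - J - {j}. epow (slice_nn (insert b J) (g b) ?x) e)"
      by (intro prod.cong) (auto simp: h_def)
    finally have "epow (slice_nn (insert j J) (g j) x) e * (\<Prod>b\<in>S. epow (h b t) e)
       = (\<Prod>b\<in>J. epow (slice_nn J (g b) ?x) e) * (\<Prod>b\<in>Basis - J. epow (slice_nn (insert b J) (g b) ?x) e)"
      using J by (subst prod.remove[of "Basis - J" j]) (auto simp: slice_nn_shift mult_ac)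
    then show "slice_nn J (\<lambda>x. epow (f x) (1 + e)) ?x
      \<le> epow (slice_nn (insert j J) (g j) x) e * (\<Prod>b\<in>S. epow (h b t) e)"
      using insert.IH[OF J(1), of ?x] by simp
  qed
  also have "\<dots> = epow (slice_nn (insert j J) (g j) x) e * (\<integral>\<^sup>+t. (\<Prod>b\<in>S. epow (h b t) e) \<partial>lborel)"
    by (rule nn_integral_cmult) measurable
  also have "\<dots> \<le> epow (slice_nn (insert j J) (g j) x) e * (\<Prod>b\<in>S. epow (\<integral>\<^sup>+t. h b t \<partial>lborel) e)"
    using nn_integral_prod_epow_le[OF S(1,2), of h lborel] S(3)
    by (intro mult_left_mono) (auto simp: e_def)
  also have "(\<Prod>b\<in>S. epow (\<integral>\<^sup>+t. h b t \<partial>lborel) e)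
     = (\<Prod>b\<in>S. epow (slice_nn (insert j (if b \<in> J then J else insert b J)) (g b) x) e)"
    using h_int by (intro prod.cong) auto
  also have "\<dots> = (\<Prod>b\<in>J. epow (slice_nn (insert j J) (g b) x) e)
      * (\<Prod>b\<in>Basis - insert j J. epow (slice_nn (insert b (insert j J)) (g b) x) e)"
  proof -
    have "S = J \<union> (Basis - insert j J)" using J by (auto simp: S_def)
    then have *: "(\<Prod>b\<in>S. k b) = (\<Prod>b\<in>J. k b) * (\<Prod>b\<in>Basis - insert j J. k b)" for k :: "'a \<Rightarrow> ennreal"
      using prod.union_disjoint[of J "Basis - insert j J" k] J by auto
    show ?thesis unfolding *
      by (intro arg_cong2[of _ _ _ _ times] prod.cong) (auto simp: insert_commute)
  qed
  finally show ?case using J by (simp add: mult_ac)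
qed

text \<open>The fundamental theorem of calculus on the line through \<open>x\<close> in direction
  \<open>b\<close>, started at a point beyond the support, where \<open>F\<close> vanishes; the
  integral up to \<open>x\<close> is at most that of the absolute derivative over the whole
  line.\<close>

lemma C1_compact_support_le_slice:
  fixes F :: "'a::euclidean_space \<Rightarrow> real"
  assumes der: "\<And>x. (F has_derivative (\<lambda>h. G x \<bullet> h)) (at x)" and G: "continuous_on UNIV G"
    and K: "bounded K" "\<And>x. x \<notin> K \<Longrightarrow> F x = 0" and b: "b \<in> Basis"
  shows "ennreal \<bar>F x\<bar> \<le> slice_nn {b} (\<lambda>y. ennreal \<bar>G y \<bullet> b\<bar>) x"
proof -
  obtain B where B: "\<And>y. y \<in> K \<Longrightarrow> norm y \<le> B" using K(1) by (auto simp: bounded_iff)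
  define l where "l = (\<lambda>t. x + (t - x \<bullet> b) *\<^sub>R b)"
  define a where "a = min (x \<bullet> b) (- (\<bar>B\<bar> + 1))"
  have "F (l a) = 0"
  proof (rule K(2), rule)
    assume "l a \<in> K"
    then have "norm (l a) \<le> B" by (rule B)
    moreover have "\<bar>l a \<bullet> b\<bar> \<le> norm (l a)" using Basis_le_norm[OF b] by blast
    moreover have "l a \<bullet> b = a" using b by (simp add: l_def inner_simps)
    ultimately show False by (auto simp: a_def)
  qed
  have Gb: "continuous_on UNIV (\<lambda>y. G y \<bullet> b)" by (intro continuous_intros G)
  have l: "continuous_on UNIV l" unfolding l_def by (intro continuous_intros)
  have cont: "continuous_on UNIV (\<lambda>t. G (l t) \<bullet> b)"
    by (rule continuous_on_compose2[OF Gb l]) auto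
  have dF: "((\<lambda>t. F (l t)) has_real_derivative G (l t) \<bullet> b) (at t)" for t
  proof -
    have "((\<lambda>t. x + (t - x \<bullet> b) *\<^sub>R b) has_derivative (\<lambda>s. 0 + (s - 0) *\<^sub>R b)) (at t)"
      by (intro has_derivative_add has_derivative_const has_derivative_scaleR_left
          has_derivative_diff has_derivative_ident)
    then have "(l has_derivative (\<lambda>s. s *\<^sub>R b)) (at t)" by (simp add: l_def)
    from has_derivative_compose[OF this, of F, OF der]
    show ?thesis by (simp add: has_field_derivative_def mult_commute_abs)
  qed
  have "has_bochner_integral lborel (\<lambda>t. (G (l t) \<bullet> b) * indicator {a..x \<bullet> b} t) (F (l (x \<bullet> b)) - F (l a))"
  proof (rule has_bochner_integral_FTC_Icc_real)
    show "a \<le> x \<bullet> b" by (simp add: a_def)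
    show "((\<lambda>t. F (l t)) has_real_derivative G (l t) \<bullet> b) (at t)" for t by (rule dF)
    show "isCont (\<lambda>t. G (l t) \<bullet> b) t" for t
      using cont by (simp add: continuous_on_eq_continuous_at)
  qed
  then have 1: "integrable lborel (\<lambda>t. (G (l t) \<bullet> b) * indicator {a..x \<bullet> b} t)"
    "(LINT t|lborel. (G (l t) \<bullet> b) * indicator {a..x \<bullet> b} t) = F x"
    using \<open>F (l a) = 0\<close> by (auto simp: has_bochner_integral_iff l_def)
  have "ennreal \<bar>F x\<bar> \<le> (\<integral>\<^sup>+t. ennreal (norm ((G (l t) \<bullet> b) * indicator {a..x \<bullet> b} t)) \<partial>lborel)"
    using integral_norm_bound_ennreal[OF 1(1)] 1(2) by simp
  also have "\<dots> \<le> (\<integral>\<^sup>+t. ennreal \<bar>G (l t) \<bullet> b\<bar> \<partial>lborel)"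
    by (intro nn_integral_mono ennreal_leI) (auto simp: indicator_def)
  also have "\<dots> = slice_nn {b} (\<lambda>y. ennreal \<bar>G y \<bullet> b\<bar>) x"
    using b borel_measurable_continuous_onI[OF Gb]
    by (subst slice_nn_insert) (auto simp: slice_nn_empty l_def)
  finally show ?thesis .
qed

text \<open>For \<open>J = Basis\<close> every slice is the full integral, so the \<open>n\<close>
  factors have the same bound and their powers \<open>e\<close> add up to
  \<open>q = n * e\<close>.\<close>

lemma gagliardo_nirenberg:
  fixes F :: "'a::euclidean_space \<Rightarrow> real"
  assumes dim: "2 \<le> DIM('a)"
    and der: "\<And>x. (F has_derivative (\<lambda>h. G x \<bullet> h)) (at x)" and G: "continuous_on UNIV G"
    and K: "bounded K" "\<And>x. x \<notin> K \<Longrightarrow> F x = 0"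
  defines "q \<equiv> real DIM('a) / (real DIM('a) - 1)"
  shows "(\<integral>\<^sup>+x. ennreal (\<bar>F x\<bar> powr q) \<partial>lborel) \<le> epow (\<integral>\<^sup>+x. ennreal (norm (G x)) \<partial>lborel) q"
proof -
  define e where "e = 1 / real (DIM('a) - 1)"
  have e: "0 < e" "q = 1 + e" "q = real DIM('a) * e"
    using dim by (auto simp: e_def q_def field_simps of_nat_diff)
  have "continuous_on UNIV F"
    by (rule has_derivative_continuous_on) (rule has_derivative_at_withinI[OF der])
  then have [measurable]: "F \<in> borel_measurable borel" by (rule borel_measurable_continuous_onI)
  have [measurable]: "G \<in> borel_measurable borel" using G by (rule borel_measurable_continuous_onI)
  have "(\<integral>\<^sup>+x. ennreal (\<bar>F x\<bar> powr q) \<partial>lborel) = slice_nn Basis (\<lambda>x. epow (ennreal \<bar>F x\<bar>) (1 + e)) 0"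
    by (subst slice_nn_Basis) (simp_all add: epow_ennreal e(2))
  also have "\<dots> \<le> (\<Prod>b\<in>Basis. epow (slice_nn Basis (\<lambda>y. ennreal \<bar>G y \<bullet> b\<bar>) 0) e)
     * (\<Prod>b\<in>Basis - Basis. epow (slice_nn (insert b Basis) (\<lambda>y. ennreal \<bar>G y \<bullet> b\<bar>) 0) e)"
    unfolding e_def
    by (rule gagliardo_slices[OF dim]) (simp_all add: C1_compact_support_le_slice[OF der G K])
  also have "\<dots> = (\<Prod>b\<in>Basis. epow (\<integral>\<^sup>+y. ennreal \<bar>G y \<bullet> b\<bar> \<partial>lborel) e)"
    by (simp add: slice_nn_Basis)
  also have "\<dots> \<le> (\<Prod>b\<in>(Basis::'a set). epow (\<integral>\<^sup>+y. ennreal (norm (G y)) \<partial>lborel) e)"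
    using e(1) Basis_le_norm by (intro prod_mono_ennreal epow_mono nn_integral_mono ennreal_leI) auto
  also have "\<dots> = epow (\<integral>\<^sup>+x. ennreal (norm (G x)) \<partial>lborel) q"
    using epow_of_nat_mult[of "DIM('a)" _ e] e by simp
  finally show ?thesis .
qed

section \<open>Approximation by mollification\<close>

lemma nn_integral_lborel_shift:
  fixes g :: "'a::euclidean_space \<Rightarrow> ennreal"
  assumes [measurable]: "g \<in> borel_measurable borel"
  shows "(\<integral>\<^sup>+x. g (x - c) \<partial>lborel) = (\<integral>\<^sup>+x. g x \<partial>lborel)"
proof -
  have "(\<integral>\<^sup>+x. g x \<partial>lborel) = (\<integral>\<^sup>+x. g x \<partial>distr lborel borel ((+) (- c)))"
    by (simp only: lborel_distr_plus)
  also have "\<dots> = (\<integral>\<^sup>+x. g (- c + x) \<partial>lborel)"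
    by (rule nn_integral_distr) auto
  finally show ?thesis by simp
qed

lemma lborel_distr_reflect: "distr lborel borel (\<lambda>x. c - x) = (lborel :: 'a::euclidean_space measure)"
proof -
  have "(lborel :: 'a measure)
      = density (distr lborel borel (\<lambda>x. c + (-1) *\<^sub>R x)) (\<lambda>_. ennreal (\<bar>-1::real\<bar> ^ DIM('a)))"
    by (rule lborel_affine) simp
  also have "\<dots> = distr lborel borel (\<lambda>x. c - x)" by (simp add: density_1)
  finally show ?thesis by (rule sym)
qed

lemma integral_lborel_reflect:
  fixes g :: "'a::euclidean_space \<Rightarrow> real"
  assumes "g \<in> borel_measurable borel"
  shows "(LINT x|lborel. g (c - x)) = (LINT x|lborel. g x)"
proof -
  have "(LINT x|lborel. g x) = (LINT x|distr lborel borel (\<lambda>x. c - x). g x)"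
    by (simp only: lborel_distr_reflect)
  also have "\<dots> = (LINT x|lborel. g (c - x))"
    by (rule integral_distr) (use assms in auto)
  finally show ?thesis by simp
qed

lemma integrable_lborel_reflect:
  fixes g :: "'a::euclidean_space \<Rightarrow> real"
  assumes "integrable lborel g"
  shows "integrable lborel (\<lambda>x. g (c - x))"
proof -
  have "integrable (distr lborel borel (\<lambda>x. c - x)) g" using assms by (simp only: lborel_distr_reflect)
  then show ?thesis by (rule integrable_distr[rotated]) simp
qed

text \<open>Outer regularity supplies \<open>U\<close>, inner regularity a closed subset
  \<open>T\<close>, and cutting \<open>T\<close> with a large ball makes it compact, since the part
  of \<open>A\<close> outside large balls has small measure. Each of the three losses is below
  \<open>e / 3\<close>.\<close>

lemma compact_open_approximation:
  fixes A :: "'a::euclidean_space set"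
  assumes A: "A \<in> sets lborel" "emeasure lborel A < \<infinity>" and e: "0 < (e::real)"
  obtains K U where "compact K" "K \<subseteq> A" "open U" "A \<subseteq> U" "emeasure lborel (U - K) \<le> ennreal e"
proof -
  have A': "A \<in> sets borel" using A by simp
  have e3: "0 < e / 3" using e by simp
  obtain U where U: "open U" "A \<subseteq> U" "emeasure lborel (U - A) < ennreal (e / 3)"
    using outer_regular_lborel[OF A' e3] by blast
  have "A \<in> sets lebesgue" using A(1) by (rule sets_completionI_sets)
  then obtain T where T: "closed T" "T \<subseteq> A" "A - T \<in> lmeasurable" "emeasure lebesgue (A - T) < ennreal (e / 3)"
    by (rule sets_lebesgue_inner_closed[OF _ e3])
  have "(\<lambda>n. emeasure lborel (A - cball 0 (real n))) \<longlonglongrightarrow> emeasure lborel (\<Inter>n. A - cball 0 (real n))"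
  proof (rule Lim_emeasure_decseq)
    show "decseq (\<lambda>n. A - cball 0 (real n))"
      unfolding decseq_def by (intro allI impI Diff_mono order_refl cball_subset_cball_iff[THEN iffD2]) simp
    show "emeasure lborel (A - cball 0 (real n)) \<noteq> \<infinity>" for n
    proof -
      have "emeasure lborel (A - cball 0 (real n)) \<le> emeasure lborel A"
        using A' by (intro emeasure_mono) auto
      then show ?thesis using A(2) by (metis infinity_ennreal_def less_top order_le_less_trans)
    qed
  qed (use A' in auto)
  also have "(\<Inter>n. A - cball 0 (real n)) = {}"
  proof -
    have "x \<notin> A - cball 0 (real (nat \<lceil>norm x\<rceil>))" for x by (simp add: real_nat_ceiling_ge)
    then show ?thesis by blast
  qed
  finally have "(\<lambda>n. emeasure lborel (A - cball 0 (real n))) \<longlonglongrightarrow> 0" by simp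
  then have "eventually (\<lambda>n. emeasure lborel (A - cball 0 (real n)) < ennreal (e / 3)) sequentially"
    using e by (intro order_tendstoD) auto
  then obtain n where n: "emeasure lborel (A - cball 0 (real n)) < ennreal (e / 3)"
    unfolding eventually_sequentially by blast
  define K where "K = T \<inter> cball 0 (real n)"
  have K: "compact K" using T by (simp add: K_def closed_Int_compact)
  have meas: "U \<in> sets borel" "T \<in> sets borel" "A \<in> sets borel" using U(1) T(1) A' by auto
  have "emeasure lborel (U - K) \<le> emeasure lborel ((U - A) \<union> (A - T) \<union> (A - cball 0 (real n)))"
    using meas by (intro emeasure_mono) (auto simp: K_def)
  also have "\<dots> \<le> emeasure lborel ((U - A) \<union> (A - T)) + emeasure lborel (A - cball 0 (real n))"
    using meas by (intro emeasure_subadditive) auto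
  also have "\<dots> \<le> emeasure lborel (U - A) + emeasure lborel (A - T) + emeasure lborel (A - cball 0 (real n))"
    using meas by (intro add_mono emeasure_subadditive) auto
  also have "\<dots> \<le> ennreal (e / 3) + ennreal (e / 3) + ennreal (e / 3)"
  proof -
    have "emeasure lborel (A - T) = emeasure lebesgue (A - T)" using meas by simp
    then show ?thesis using U(3) T(4) n by (intro add_mono) simp_all
  qed
  also have "\<dots> = ennreal e" using e by (simp add: ennreal_plus[symmetric] del: ennreal_plus)
  finally have "emeasure lborel (U - K) \<le> ennreal e" .
  moreover have "K \<subseteq> A" using T(2) by (auto simp: K_def)
  ultimately show ?thesis using that K U(1,2) by blast
qed

text \<open>By density the main case is that of indicators. There \<open>A\<close> separates
  \<open>x\<close> from \<open>x - z\<close> only if one of them lies in the thin set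
  \<open>U - K\<close>, as soon as \<open>norm z\<close> is below the distance of \<open>K\<close>
  from the complement of \<open>U\<close>; this set is counted twice and weighted with the constant,
  whence \<open>e'\<close>. Limits are handled by dominated convergence and the invariance of the
  error under translation.\<close>

lemma L1_translation_continuous:
  fixes f :: "'a::euclidean_space \<Rightarrow> real"
  assumes "integrable lborel f" "0 < (e::real)"
  shows "\<exists>d>0. \<forall>z. norm z < d \<longrightarrow> (\<integral>\<^sup>+x. ennreal \<bar>f (x - z) - f x\<bar> \<partial>lborel) \<le> ennreal e"
  using assms
proof (induction arbitrary: e rule: integrable_induct)
  case (base A c)
  define e' where "e' = e / (2 * (\<bar>c\<bar> + 1))"
  have e': "0 < e'" "2 * (\<bar>c\<bar> * e') \<le> e" using base by (auto simp: e'_def field_simps)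
  obtain K U where K: "compact K" "K \<subseteq> A" and U: "open U" "A \<subseteq> U" and m: "emeasure lborel (U - K) \<le> ennreal e'"
    using compact_open_approximation[OF base(1,2) e'(1)] by blast
  have [measurable]: "K \<in> sets borel" "U \<in> sets borel" "A \<in> sets borel"
    using K U base(1) by (auto intro: borel_compact)
  have "K \<inter> - U = {}" "closed (- U)" using U K by auto
  then obtain d where d: "d > 0" "\<And>x y. x \<in> K \<Longrightarrow> y \<in> - U \<Longrightarrow> d \<le> dist x y"
    using separate_compact_closed[OF K(1), of "- U"] by blast
  show ?case
  proof (intro exI[of _ d] conjI allI impI d(1))
    fix z :: 'a assume z: "norm z < d"
    have KU: "x + w \<in> U" if "x \<in> K" "norm w < d" for x w
      using d(2)[OF that(1), of "x + w"] that(2) by (auto simp: dist_norm)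
    have "ennreal \<bar>indicator A (x - z) *\<^sub>R c - indicator A x *\<^sub>R c\<bar>
        \<le> ennreal \<bar>c\<bar> * (indicator (U - K) x + indicator (U - K) (x - z))" for x
    proof (cases "x \<in> A \<longleftrightarrow> x - z \<in> A")
      case True
      then show ?thesis by (auto simp: indicator_def)
    next
      case False
      have "x \<in> K \<Longrightarrow> x - z \<in> U" using KU[of x "- z"] z by simp
      moreover have "x - z \<in> K \<Longrightarrow> x \<in> U" using KU[of "x - z" z] z by simp
      ultimately have "x \<in> U - K \<or> x - z \<in> U - K" using False K U by auto
      then have "1 \<le> (indicator (U - K) x + indicator (U - K) (x - z) :: ennreal)"
        by (auto simp: indicator_def)
      then have "ennreal \<bar>c\<bar> * 1 \<le> ennreal \<bar>c\<bar> * (indicator (U - K) x + indicator (U - K) (x - z))"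
        by (intro mult_left_mono) auto
      then show ?thesis using False by (auto simp: indicator_def)
    qed
    then have "(\<integral>\<^sup>+x. ennreal \<bar>indicator A (x - z) *\<^sub>R c - indicator A x *\<^sub>R c\<bar> \<partial>lborel)
      \<le> (\<integral>\<^sup>+x. ennreal \<bar>c\<bar> * (indicator (U - K) x + indicator (U - K) (x - z)) \<partial>lborel)"
      by (intro nn_integral_mono) auto
    also have "\<dots> = ennreal \<bar>c\<bar> * (emeasure lborel (U - K) + emeasure lborel (U - K))"
      by (simp add: nn_integral_cmult nn_integral_add nn_integral_lborel_shift[of "indicator (U - K)"])
    also have "\<dots> \<le> ennreal \<bar>c\<bar> * (ennreal e' + ennreal e')"
      using m by (intro mult_left_mono add_mono) auto
    also have "\<dots> = ennreal (2 * (\<bar>c\<bar> * e'))"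
      using e' by (simp add: ennreal_mult'[symmetric] ennreal_plus[symmetric] del: ennreal_plus)
    also have "\<dots> \<le> ennreal e" using e' by (intro ennreal_leI)
    finally show "(\<integral>\<^sup>+x. ennreal \<bar>indicator A (x - z) *\<^sub>R c - indicator A x *\<^sub>R c\<bar> \<partial>lborel) \<le> ennreal e" .
  qed
next
  case (add f g)
  have [measurable]: "f \<in> borel_measurable borel" "g \<in> borel_measurable borel" using add by auto
  have e2: "e / 2 > 0" using add.prems by simp
  obtain d1 d2 where d: "0 < d1" "0 < d2"
    "\<And>z. norm z < d1 \<Longrightarrow> (\<integral>\<^sup>+x. ennreal \<bar>f (x - z) - f x\<bar> \<partial>lborel) \<le> ennreal (e / 2)"
    "\<And>z. norm z < d2 \<Longrightarrow> (\<integral>\<^sup>+x. ennreal \<bar>g (x - z) - g x\<bar> \<partial>lborel) \<le> ennreal (e / 2)"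
    using add.IH(1)[OF e2] add.IH(2)[OF e2] by blast
  show ?case
  proof (intro exI[of _ "min d1 d2"] conjI allI impI)
    fix z :: 'a assume z: "norm z < min d1 d2"
    have "(\<integral>\<^sup>+x. ennreal \<bar>f (x - z) + g (x - z) - (f x + g x)\<bar> \<partial>lborel)
      \<le> (\<integral>\<^sup>+x. ennreal \<bar>f (x - z) - f x\<bar> + ennreal \<bar>g (x - z) - g x\<bar> \<partial>lborel)"
      by (intro nn_integral_mono) (auto simp: ennreal_plus[symmetric] simp del: ennreal_plus intro!: ennreal_leI)
    also have "\<dots> = (\<integral>\<^sup>+x. ennreal \<bar>f (x - z) - f x\<bar> \<partial>lborel) + (\<integral>\<^sup>+x. ennreal \<bar>g (x - z) - g x\<bar> \<partial>lborel)"
      by (rule nn_integral_add) measurable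
    also have "\<dots> \<le> ennreal (e / 2) + ennreal (e / 2)" using d z by (intro add_mono) auto
    also have "\<dots> = ennreal e" using add.prems by (simp add: ennreal_plus[symmetric] del: ennreal_plus)
    finally show "(\<integral>\<^sup>+x. ennreal \<bar>f (x - z) + g (x - z) - (f x + g x)\<bar> \<partial>lborel) \<le> ennreal e" .
  qed (use d in auto)
next
  case (lim f s)
  have [measurable]: "f \<in> borel_measurable borel" "\<And>i. s i \<in> borel_measurable borel" using lim.hyps by auto
  have "(\<lambda>i. \<integral>\<^sup>+x. ennreal (norm (f x - s i x)) \<partial>lborel) \<longlonglongrightarrow> 0"
  proof (rule nn_integral_dominated_convergence_norm[where w = "\<lambda>x. 2 * norm (f x)"])
    show "(\<integral>\<^sup>+x. ennreal (2 * norm (f x)) \<partial>lborel) < \<infinity>"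
      using integrable_mult_right[OF integrable_norm[OF lim.hyps(4)], of 2]
      by (subst (asm) integrable_iff_bounded) auto
  qed (use lim.hyps in auto)
  then have "eventually (\<lambda>i. (\<integral>\<^sup>+x. ennreal \<bar>s i x - f x\<bar> \<partial>lborel) < ennreal (e / 3)) sequentially"
    using lim.prems by (intro order_tendstoD) (auto simp: abs_minus_commute)
  then obtain i where i: "(\<integral>\<^sup>+x. ennreal \<bar>s i x - f x\<bar> \<partial>lborel) < ennreal (e / 3)"
    by (auto simp: eventually_sequentially)
  have "e / 3 > 0" using lim.prems by simp
  from lim.IH[OF this] obtain d where d: "0 < d"
    "\<And>z. norm z < d \<Longrightarrow> (\<integral>\<^sup>+x. ennreal \<bar>s i (x - z) - s i x\<bar> \<partial>lborel) \<le> ennreal (e / 3)" by blast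
  show ?case
  proof (intro exI[of _ d] conjI allI impI d(1))
    fix z :: 'a assume z: "norm z < d"
    have "(\<integral>\<^sup>+x. ennreal \<bar>f (x - z) - f x\<bar> \<partial>lborel) \<le> (\<integral>\<^sup>+x. ennreal \<bar>s i (x - z) - f (x - z)\<bar>
        + (ennreal \<bar>s i (x - z) - s i x\<bar> + ennreal \<bar>s i x - f x\<bar>) \<partial>lborel)"
      by (intro nn_integral_mono) (auto simp: ennreal_plus[symmetric] simp del: ennreal_plus intro!: ennreal_leI)
    also have "\<dots> = (\<integral>\<^sup>+x. ennreal \<bar>s i (x - z) - f (x - z)\<bar> \<partial>lborel)
        + ((\<integral>\<^sup>+x. ennreal \<bar>s i (x - z) - s i x\<bar> \<partial>lborel) + (\<integral>\<^sup>+x. ennreal \<bar>s i x - f x\<bar> \<partial>lborel))"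
      by (simp add: nn_integral_add)
    also have "(\<integral>\<^sup>+x. ennreal \<bar>s i (x - z) - f (x - z)\<bar> \<partial>lborel) = (\<integral>\<^sup>+x. ennreal \<bar>s i x - f x\<bar> \<partial>lborel)"
      by (rule nn_integral_lborel_shift[of "\<lambda>x. ennreal \<bar>s i x - f x\<bar>"]) measurable
    also have "\<dots> + ((\<integral>\<^sup>+x. ennreal \<bar>s i (x - z) - s i x\<bar> \<partial>lborel) + (\<integral>\<^sup>+x. ennreal \<bar>s i x - f x\<bar> \<partial>lborel))
       \<le> ennreal (e / 3) + (ennreal (e / 3) + ennreal (e / 3))"
      using i d(2)[OF z] by (intro add_mono) auto
    also have "\<dots> = ennreal e" using lim.prems by (simp add: ennreal_plus[symmetric] del: ennreal_plus)
    finally show "(\<integral>\<^sup>+x. ennreal \<bar>f (x - z) - f x\<bar> \<partial>lborel) \<le> ennreal e" .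
  qed
qed

section \<open>Convolution with a mollifier\<close>

definition mollifier :: "real \<Rightarrow> ('a::euclidean_space \<Rightarrow> real) \<Rightarrow> bool" where
  "mollifier d \<rho> \<longleftrightarrow> continuous_on UNIV \<rho> \<and> (\<forall>x. 0 \<le> \<rho> x) \<and> (\<forall>x. \<rho> x \<noteq> 0 \<longrightarrow> norm x \<le> d) \<and>
     integrable lborel \<rho> \<and> (LINT x|lborel. \<rho> x) = 1"

lemma mollifier_mono: "mollifier d \<rho> \<Longrightarrow> d \<le> d' \<Longrightarrow> mollifier d' \<rho>"
  by (force simp: mollifier_def)

text \<open>As \<open>\<rho>\<close> has mass 1, the error is an average over \<open>z\<close> of
  \<open>f (x - z) - f x\<close>, and Fubini's theorem reduces the claim to continuity of
  translations. The radius \<open>d\<close> depends on \<open>f\<close> and \<open>e\<close> alone,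
  not on \<open>\<rho>\<close>, which later lets a single mollifier serve a function and all
  components of its weak gradient.\<close>

lemma mollification_L1:
  fixes f :: "'a::euclidean_space \<Rightarrow> real"
  assumes f: "integrable lborel f" and e: "0 < (e::real)"
  shows "\<exists>d>0. \<forall>\<rho>. mollifier d \<rho> \<longrightarrow>
      (\<integral>\<^sup>+x. ennreal \<bar>(LINT y|lborel. f y * \<rho> (x - y)) - f x\<bar> \<partial>lborel) \<le> ennreal e"
proof -
  obtain d where d: "d > 0" "\<And>z. norm z < d \<Longrightarrow> (\<integral>\<^sup>+x. ennreal \<bar>f (x - z) - f x\<bar> \<partial>lborel) \<le> ennreal e"
    using L1_translation_continuous[OF f e] by blast
  have [measurable]: "f \<in> borel_measurable borel" using f by auto
  show ?thesis
  \<comment> \<open>\<open>mollifier\<close> allows equality at the radius, whereas the translation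
    estimate needs \<open>norm z < d\<close>.\<close>
  proof (intro exI[of _ "d / 2"] conjI allI impI)
    fix \<rho> :: "'a \<Rightarrow> real"
    assume "mollifier (d / 2) \<rho>"
    then have \<rho>: "continuous_on UNIV \<rho>" "\<And>x. 0 \<le> \<rho> x" "\<And>x. \<rho> x \<noteq> 0 \<Longrightarrow> norm x \<le> d / 2"
      "integrable lborel \<rho>" "(LINT x|lborel. \<rho> x) = 1"
      for x by (auto simp: mollifier_def)
    have [measurable]: "\<rho> \<in> borel_measurable borel" using \<rho>(4) by auto
    have "bounded (\<rho> ` cball 0 (d / 2))"
      using \<rho>(1) by (intro compact_imp_bounded compact_continuous_image) (auto intro: continuous_on_subset)
    then obtain B where "\<forall>x\<in>cball 0 (d / 2). \<bar>\<rho> x\<bar> \<le> B" by (auto simp: bounded_iff)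
    then have B: "\<bar>\<rho> x\<bar> \<le> B" if "norm x \<le> d / 2" for x using that by simp
    have B': "\<bar>\<rho> x\<bar> \<le> \<bar>B\<bar>" for x using B[of x] \<rho>(3)[of x] by (cases "\<rho> x = 0") auto
    have int: "integrable lborel (\<lambda>z. f (x - z) * \<rho> z)" for x
    proof (rule Bochner_Integration.integrable_bound[where f = "\<lambda>z. \<bar>B\<bar> * f (x - z)"])
      show "integrable lborel (\<lambda>z. \<bar>B\<bar> * f (x - z))"
        using integrable_lborel_reflect[OF f] by simp
      show "AE z in lborel. norm (f (x - z) * \<rho> z) \<le> norm (\<bar>B\<bar> * f (x - z))"
        using B' by (auto simp: abs_mult mult.commute intro!: mult_mono)
    qed simp
    have eq: "(LINT y|lborel. f y * \<rho> (x - y)) - f x = (LINT z|lborel. (f (x - z) - f x) * \<rho> z)" for x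
    proof -
      have "(LINT y|lborel. f y * \<rho> (x - y)) = (LINT z|lborel. f (x - z) * \<rho> (x - (x - z)))"
        by (rule integral_lborel_reflect[symmetric]) measurable
      then show ?thesis using int[of x] \<rho>(4,5)
        by (simp add: left_diff_distrib Bochner_Integration.integral_diff)
    qed
    have "(\<integral>\<^sup>+x. ennreal \<bar>(LINT y|lborel. f y * \<rho> (x - y)) - f x\<bar> \<partial>lborel)
      \<le> (\<integral>\<^sup>+x. \<integral>\<^sup>+z. ennreal (\<bar>f (x - z) - f x\<bar> * \<rho> z) \<partial>lborel \<partial>lborel)"
    proof (rule nn_integral_mono)
      fix x
      have "integrable lborel (\<lambda>z. (f (x - z) - f x) * \<rho> z)"
        using int[of x] \<rho>(4) by (simp add: left_diff_distrib)
      from integral_norm_bound_ennreal[OF this]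
      show "ennreal \<bar>(LINT y|lborel. f y * \<rho> (x - y)) - f x\<bar> \<le> (\<integral>\<^sup>+z. ennreal (\<bar>f (x - z) - f x\<bar> * \<rho> z) \<partial>lborel)"
        using \<rho>(2) by (simp add: eq abs_mult)
    qed
    also have "\<dots> = (\<integral>\<^sup>+z. \<integral>\<^sup>+x. ennreal (\<bar>f (x - z) - f x\<bar> * \<rho> z) \<partial>lborel \<partial>lborel)"
      by (rule lborel_pair.Fubini') measurable
    also have "\<dots> \<le> (\<integral>\<^sup>+z. ennreal e * ennreal (\<rho> z) \<partial>lborel)"
    proof (rule nn_integral_mono)
      fix z :: 'a
      have "(\<integral>\<^sup>+x. ennreal (\<bar>f (x - z) - f x\<bar> * \<rho> z) \<partial>lborel) = (\<integral>\<^sup>+x. ennreal \<bar>f (x - z) - f x\<bar> \<partial>lborel) * ennreal (\<rho> z)"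
        using \<rho>(2) by (simp add: ennreal_mult' nn_integral_multc)
      also have "\<dots> \<le> ennreal e * ennreal (\<rho> z)"
      proof (cases "\<rho> z = 0")
        case False
        then have "norm z < d" using \<rho>(3)[of z] d(1) by auto
        then show ?thesis using d(2) by (intro mult_right_mono) auto
      qed simp
      finally show "(\<integral>\<^sup>+x. ennreal (\<bar>f (x - z) - f x\<bar> * \<rho> z) \<partial>lborel) \<le> ennreal e * ennreal (\<rho> z)" .
    qed
    also have "\<dots> = ennreal e * ennreal (LINT z|lborel. \<rho> z)"
      using \<rho> by (simp add: nn_integral_cmult nn_integral_eq_integral)
    finally show "(\<integral>\<^sup>+x. ennreal \<bar>(LINT y|lborel. f y * \<rho> (x - y)) - f x\<bar> \<partial>lborel) \<le> ennreal e"
      using \<rho>(5) by simp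
  qed (use d in simp)
qed

lemma gradient_eq_0_outside_support:
  fixes F :: "'a::euclidean_space \<Rightarrow> real"
  assumes der: "\<And>x. (F has_derivative (\<lambda>h. G x \<bullet> h)) (at x)"
    and K: "closed K" "\<And>x. x \<notin> K \<Longrightarrow> F x = 0" and x: "x \<notin> K"
  shows "G x = 0"
proof -
  have "((\<lambda>_. 0) has_derivative (\<lambda>h. G x \<bullet> h)) (at x)"
    by (rule has_derivative_transform_within_open[OF der, of "- K"]) (use K x in auto)
  then have "(\<lambda>h. G x \<bullet> h) = (\<lambda>h. 0)" by (rule has_derivative_unique) simp
  then have "G x \<bullet> G x = 0" by meson
  then show ?thesis by simp
qed

lemma compact_support_uniformly_continuous:
  fixes G :: "'a::euclidean_space \<Rightarrow> 'b::real_normed_vector"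
  assumes G: "continuous_on UNIV G" and B: "\<And>x. B < norm x \<Longrightarrow> G x = 0" and e: "0 < e"
  obtains d where "0 < d" "\<And>x y. norm (y - x) < d \<Longrightarrow> norm (G y - G x) < e"
proof -
  have "uniformly_continuous_on (cball 0 (B + 1)) G"
    using G by (intro compact_uniformly_continuous) (auto intro: continuous_on_subset)
  then obtain d where d: "d > 0" "\<And>x y. x \<in> cball 0 (B + 1) \<Longrightarrow> y \<in> cball 0 (B + 1) \<Longrightarrow> dist y x < d \<Longrightarrow> dist (G y) (G x) < e"
    using e unfolding uniformly_continuous_on_def by metis
  show ?thesis
  proof (rule that[of "min d 1"])
    fix x y :: 'a assume xy: "norm (y - x) < min d 1"
    have n: "norm x \<le> norm y + norm (y - x)" "norm y \<le> norm x + norm (y - x)"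
      using norm_triangle_ineq4[of y "y - x"] norm_triangle_ineq[of x "y - x"] by auto
    show "norm (G y - G x) < e"
    proof (cases "norm x \<le> B + 1 \<and> norm y \<le> B + 1")
      case True
      then show ?thesis using d(2)[of x y] xy by (simp add: dist_norm)
    next
      case False
      then have "B < norm x" "B < norm y" using n xy by auto
      then show ?thesis using B e by simp
    qed
  qed (use d in auto)
qed

text \<open>The mean value inequality for \<open>F\<close> minus its linear part at
  \<open>x\<close>, whose gradient \<open>G z - G x\<close> is small uniformly in \<open>x\<close>
  by uniform continuity. This uniformity is what permits differentiation under an integral
  below.\<close>

lemma C1_compact_support_uniformly_differentiable:
  fixes F :: "'a::euclidean_space \<Rightarrow> real"
  assumes der: "\<And>x. (F has_derivative (\<lambda>h. G x \<bullet> h)) (at x)" and G: "continuous_on UNIV G"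
    and B: "\<And>x. B < norm x \<Longrightarrow> F x = 0" and e: "0 < e"
  obtains d where "0 < d" "\<And>x y. norm (y - x) < d \<Longrightarrow> \<bar>F y - F x - G x \<bullet> (y - x)\<bar> \<le> e * norm (y - x)"
proof -
  have "G x = 0" if "B < norm x" for x
    by (rule gradient_eq_0_outside_support[OF der, of "cball 0 B"]) (use B that in auto)
  then obtain d where d: "0 < d" "\<And>x y. norm (y - x) < d \<Longrightarrow> norm (G y - G x) < e"
    using compact_support_uniformly_continuous[OF G _ e] by metis
  show ?thesis
  proof (rule that[OF d(1)])
    fix x y :: 'a assume xy: "norm (y - x) < d"
    define k where "k = (\<lambda>z. F z - G x \<bullet> z)"
    have "norm (k y - k x) \<le> e * norm (y - x)"
    proof (rule differentiable_bound[where S = "ball x d"])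
      fix z assume z: "z \<in> ball x d"
      have "(k has_derivative (\<lambda>h. G z \<bullet> h - G x \<bullet> h)) (at z)"
        unfolding k_def by (intro has_derivative_diff der bounded_linear_imp_has_derivative bounded_linear_inner_right)
      then show "(k has_derivative (\<lambda>h. (G z - G x) \<bullet> h)) (at z within ball x d)"
        by (simp add: inner_diff_left has_derivative_at_withinI)
      show "onorm (\<lambda>h. (G z - G x) \<bullet> h) \<le> e"
      proof (rule onorm_le)
        fix h
        have "norm ((G z - G x) \<bullet> h) \<le> norm (G z - G x) * norm h"
          by (rule Cauchy_Schwarz_ineq2[of "G z - G x" h, folded real_norm_def])
        also have "\<dots> \<le> e * norm h"
          using d(2)[of z x] z by (intro mult_right_mono) (auto simp: dist_norm norm_minus_commute)
        finally show "norm ((G z - G x) \<bullet> h) \<le> e * norm h" .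
      qed
    qed (use d xy in \<open>auto simp: dist_norm norm_minus_commute\<close>)
    then show "\<bar>F y - F x - G x \<bullet> (y - x)\<bar> \<le> e * norm (y - x)"
      by (simp add: k_def inner_diff_right algebra_simps)
  qed
qed

lemma integrable_scaleR_bounded:
  fixes f :: "'a \<Rightarrow> real" and g :: "'a \<Rightarrow> 'b::{banach, second_countable_topology}"
  assumes "integrable M f" and [measurable]: "g \<in> borel_measurable M" and "\<And>x. norm (g x) \<le> B"
  shows "integrable M (\<lambda>x. f x *\<^sub>R g x)"
proof (rule Bochner_Integration.integrable_bound[where f = "\<lambda>x. B * f x"])
  have [measurable]: "f \<in> borel_measurable M" using assms(1) by simp
  show "(\<lambda>x. f x *\<^sub>R g x) \<in> borel_measurable M" by measurable
  have "0 \<le> B" using norm_ge_zero assms(3) order_trans by blast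
  then show "AE x in M. norm (f x *\<^sub>R g x) \<le> norm (B * f x)"
    using assms(3) by (simp add: abs_mult mult.commute[of B] mult_left_mono)
qed (use assms(1) in simp)

lemma compact_support_bounded:
  fixes G :: "'a::euclidean_space \<Rightarrow> 'b::real_normed_vector"
  assumes G: "continuous_on UNIV G" and B: "\<And>x. B < norm x \<Longrightarrow> G x = 0"
  obtains C where "\<And>x. norm (G x) \<le> C"
proof -
  have "bounded (G ` cball 0 B)"
    using G by (intro compact_imp_bounded compact_continuous_image) (auto intro: continuous_on_subset)
  then obtain C where C: "\<forall>x\<in>cball 0 B. norm (G x) \<le> C" by (auto simp: bounded_iff)
  have "norm (G x) \<le> \<bar>C\<bar>" for x
    using C B[of x] by (cases "norm x \<le> B") force+
  then show ?thesis by (rule that)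
qed

text \<open>Differentiation under the integral by a uniform estimate: the remainder of
  \<open>\<rho>\<close> is at most \<open>e / A\<close> times the increment, uniformly in the
  integration variable, and \<open>A\<close> bounds the \<open>L^1\<close> norm of \<open>f\<close>.
  The added 1 in \<open>A\<close> keeps the division legitimate.\<close>

lemma mollification_has_derivative:
  fixes f :: "'a::euclidean_space \<Rightarrow> real"
  assumes f: "integrable lborel f"
    and der: "\<And>x. (\<rho> has_derivative (\<lambda>h. G x \<bullet> h)) (at x)" and G: "continuous_on UNIV G"
    and B: "\<And>x. B < norm x \<Longrightarrow> \<rho> x = 0"
  shows "((\<lambda>x. LINT y|lborel. f y * \<rho> (x - y)) has_derivative (\<lambda>h. (LINT y|lborel. f y *\<^sub>R G (x - y)) \<bullet> h)) (at x)"
    and "continuous_on UNIV (\<lambda>x. LINT y|lborel. f y *\<^sub>R G (x - y))"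
proof -
  have [measurable]: "f \<in> borel_measurable borel" using f by auto
  have \<rho>: "continuous_on UNIV \<rho>"
    by (rule has_derivative_continuous_on) (rule has_derivative_at_withinI[OF der])
  have G0: "G x = 0" if "B < norm x" for x
    by (rule gradient_eq_0_outside_support[OF der, of "cball 0 B"]) (use B that in auto)
  have [measurable]: "\<rho> \<in> borel_measurable borel" "G \<in> borel_measurable borel"
    using \<rho> G by (auto intro: borel_measurable_continuous_onI)
  obtain C where C: "\<And>x. norm (G x) \<le> C" using compact_support_bounded[OF G G0] by blast
  obtain C' where C': "\<And>x. norm (\<rho> x) \<le> C'" using compact_support_bounded[OF \<rho> B] by blast
  have iG: "integrable lborel (\<lambda>y. f y *\<^sub>R G (x - y))" for x
    by (rule integrable_scaleR_bounded[OF f _ C]) measurable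
  have ir: "integrable lborel (\<lambda>y. f y * \<rho> (x - y))" for x
    using integrable_scaleR_bounded[OF f _ C', of "\<lambda>y. x - y"] by simp
  define A where "A = (LINT y|lborel. \<bar>f y\<bar>) + 1"
  have A: "A > 0" "(LINT y|lborel. \<bar>f y\<bar>) \<le> A"
  proof -
    have "0 \<le> (LINT y|lborel. \<bar>f y\<bar>)" by (rule Bochner_Integration.integral_nonneg) simp
    then show "A > 0" "(LINT y|lborel. \<bar>f y\<bar>) \<le> A" unfolding A_def by linarith+
  qed
  have bound: "norm (LINT y|lborel. f y *\<^sub>R k y) \<le> A * c"
    if [measurable]: "k \<in> borel_measurable borel" and c: "\<And>y. norm (k y) \<le> c" for k :: "'a \<Rightarrow> 'c::{banach, second_countable_topology}" and c
  proof -
    have "0 \<le> c" using c norm_ge_zero order_trans by blast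
    have "norm (LINT y|lborel. f y *\<^sub>R k y) \<le> (LINT y|lborel. norm (f y *\<^sub>R k y))" by (rule integral_norm_bound)
    also have "\<dots> \<le> (LINT y|lborel. \<bar>f y\<bar> * c)"
    proof (rule integral_mono)
      show "integrable lborel (\<lambda>y. norm (f y *\<^sub>R k y))"
        by (intro integrable_norm integrable_scaleR_bounded[OF f _ c]) measurable
      show "integrable lborel (\<lambda>y. \<bar>f y\<bar> * c)" using f by simp
    qed (use c in \<open>auto intro!: mult_left_mono\<close>)
    also have "\<dots> \<le> A * c" using A \<open>0 \<le> c\<close> by (auto intro!: mult_right_mono)
    finally show ?thesis .
  qed
  show "((\<lambda>x. LINT y|lborel. f y * \<rho> (x - y)) has_derivative (\<lambda>h. (LINT y|lborel. f y *\<^sub>R G (x - y)) \<bullet> h)) (at x)"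
    unfolding has_derivative_at_alt
  proof (intro conjI allI impI bounded_linear_inner_right)
    fix e :: real assume e: "0 < e"
    then have "0 < e / A" using A by simp
    then obtain d where d: "0 < d" "\<And>x y. norm (y - x) < d \<Longrightarrow> \<bar>\<rho> y - \<rho> x - G x \<bullet> (y - x)\<bar> \<le> e / A * norm (y - x)"
      using C1_compact_support_uniformly_differentiable[OF der G B] by metis
    show "\<exists>d>0. \<forall>x'. norm (x' - x) < d \<longrightarrow> norm ((LINT y|lborel. f y * \<rho> (x' - y)) - (LINT y|lborel. f y * \<rho> (x - y))
        - (LINT y|lborel. f y *\<^sub>R G (x - y)) \<bullet> (x' - x)) \<le> e * norm (x' - x)"
    proof (intro exI[of _ d] conjI allI impI d(1))
      fix x' assume x': "norm (x' - x) < d"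
      have "(LINT y|lborel. f y * \<rho> (x' - y)) - (LINT y|lborel. f y * \<rho> (x - y))
          - (LINT y|lborel. f y *\<^sub>R G (x - y)) \<bullet> (x' - x)
        = (LINT y|lborel. f y *\<^sub>R (\<rho> (x' - y) - \<rho> (x - y) - G (x - y) \<bullet> (x' - x)))"
      proof -
        have "(LINT y|lborel. f y *\<^sub>R G (x - y)) \<bullet> (x' - x) = (LINT y|lborel. (f y *\<^sub>R G (x - y)) \<bullet> (x' - x))"
          by (rule integral_inner_left[symmetric]) (rule iG)
        moreover have "integrable lborel (\<lambda>y. (f y *\<^sub>R G (x - y)) \<bullet> (x' - x))"
          by (rule integrable_inner_left) (rule iG)
        ultimately show ?thesis using ir
          by (simp add: right_diff_distrib Bochner_Integration.integral_diff)
      qed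
      also have "norm \<dots> \<le> A * (e / A * norm (x' - x))"
      proof (rule bound)
        fix y show "norm (\<rho> (x' - y) - \<rho> (x - y) - G (x - y) \<bullet> (x' - x)) \<le> e / A * norm (x' - x)"
          using d(2)[of "x' - y" "x - y"] x' by simp
      qed measurable
      finally show "norm ((LINT y|lborel. f y * \<rho> (x' - y)) - (LINT y|lborel. f y * \<rho> (x - y))
        - (LINT y|lborel. f y *\<^sub>R G (x - y)) \<bullet> (x' - x)) \<le> e * norm (x' - x)" using A by simp
    qed
  qed
  show "continuous_on UNIV (\<lambda>x. LINT y|lborel. f y *\<^sub>R G (x - y))"
    unfolding continuous_on_iff
  proof (intro ballI allI impI)
    fix x :: 'a and e :: real assume e: "0 < e"
    then have "0 < e / (2 * A)" using A by simp
    then obtain d where d: "0 < d" "\<And>x y. norm (y - x) < d \<Longrightarrow> norm (G y - G x) < e / (2 * A)"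
      using compact_support_uniformly_continuous[OF G G0] by metis
    show "\<exists>d>0. \<forall>x'\<in>UNIV. dist x' x < d \<longrightarrow> dist (LINT y|lborel. f y *\<^sub>R G (x' - y)) (LINT y|lborel. f y *\<^sub>R G (x - y)) < e"
    proof (intro exI[of _ d] conjI ballI impI d(1))
      fix x' assume x': "dist x' x < d"
      have "(LINT y|lborel. f y *\<^sub>R G (x' - y)) - (LINT y|lborel. f y *\<^sub>R G (x - y))
          = (LINT y|lborel. f y *\<^sub>R (G (x' - y) - G (x - y)))"
        using iG by (simp add: scaleR_diff_right)
      also have "norm \<dots> \<le> A * (e / (2 * A))"
      proof (rule bound)
        fix y show "norm (G (x' - y) - G (x - y)) \<le> e / (2 * A)"
          using d(2)[of "x' - y" "x - y"] x' by (simp add: dist_norm)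
      qed measurable
      also have "\<dots> < e" using A e by simp
      finally show "dist (LINT y|lborel. f y *\<^sub>R G (x' - y)) (LINT y|lborel. f y *\<^sub>R G (x - y)) < e"
        by (simp add: dist_norm)
    qed
  qed
qed

section \<open>Gradients as vectors and the mollification of weak gradients\<close>

definition grad :: "(real ^ 'n::finite \<Rightarrow> real) \<Rightarrow> real ^ 'n \<Rightarrow> real ^ 'n" where
  "grad f x = (\<chi> i. partial_deriv i f x)"

lemma partial_deriv_eq_inner:
  assumes "(f has_derivative (\<lambda>h. v \<bullet> h)) (at x)"
  shows "partial_deriv i f x = v $ i"
  unfolding partial_deriv_def using frechet_derivative_at[OF assms, symmetric]
  by (simp add: inner_axis)

lemma differentiable_has_grad:
  assumes "f differentiable (at x)"
  shows "(f has_derivative (\<lambda>h. grad f x \<bullet> h)) (at x)"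
proof -
  have d: "(f has_derivative frechet_derivative f (at x)) (at x)"
    using assms by (simp add: frechet_derivative_works)
  then interpret bounded_linear "frechet_derivative f (at x)" by (rule has_derivative_bounded_linear)
  have "frechet_derivative f (at x) h = grad f x \<bullet> h" for h
  proof -
    have "frechet_derivative f (at x) h = frechet_derivative f (at x) (\<Sum>i\<in>UNIV. h $ i *\<^sub>R axis i 1)"
      by (subst basis_expansion[of h, symmetric]) (simp add: scalar_mult_eq_scaleR)
    also have "\<dots> = grad f x \<bullet> h"
      by (simp add: sum scale grad_def partial_deriv_def inner_vec_def mult.commute)
    finally show ?thesis .
  qed
  then have "frechet_derivative f (at x) = (\<lambda>h. grad f x \<bullet> h)" by blast
  then show ?thesis using d by simp
qed

lemma Ck_has_grad:
  assumes "Ck (Suc 0) f"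
  shows "(f has_derivative (\<lambda>h. grad f x \<bullet> h)) (at x)" "continuous_on UNIV (grad f)"
proof -
  show "(f has_derivative (\<lambda>h. grad f x \<bullet> h)) (at x)"
    using assms by (intro differentiable_has_grad) (auto simp: differentiable_on_def)
  show "continuous_on UNIV (grad f)"
    unfolding grad_def using assms by (intro continuous_intros) simp
qed

text \<open>Weak gradients are Lebesgue measurable, while convolutions and Fubini's theorem are
  carried out with Borel functions and \<open>lborel\<close>. Extension by zero off \<open>K\<close>
  gives a globally integrable function, which agrees almost everywhere with a Borel one.\<close>

lemma lebesgue_borel_representative:
  fixes f :: "'a::euclidean_space \<Rightarrow> real"
  assumes K: "K \<in> sets lebesgue" and f: "integrable (lebesgue_on K) f"
  obtains g where "integrable lborel g" "AE x in lebesgue. (if x \<in> K then f x else 0) = g x"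
proof -
  let ?f = "\<lambda>x. if x \<in> K then f x else 0"
  have "integrable lebesgue (\<lambda>x. indicator K x *\<^sub>R f x)"
    using f K by (simp add: integrable_restrict_space)
  moreover have "(\<lambda>x. indicator K x *\<^sub>R f x) = ?f" by (auto simp: indicator_def)
  ultimately have i: "integrable lebesgue ?f" by simp
  then have "?f \<in> borel_measurable lebesgue" by simp
  from completion_ex_borel_measurable_real[OF this]
  obtain g where g: "g \<in> borel_measurable lborel" "AE x in lborel. ?f x = g x" by blast
  have AE: "AE x in lebesgue. ?f x = g x" using g(2) by (rule AE_completion)
  have gm: "g \<in> borel_measurable lebesgue" using g(1) by (rule measurable_completion)
  have "integrable lebesgue g"
    using i by (rule integrable_cong_AE_imp) (use gm AE in \<open>auto elim: eventually_mono\<close>)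
  then have "integrable lborel g" using g(1) by (simp add: integrable_completion)
  then show ?thesis using AE by (rule that)
qed

lemma compact_neighbourhood_in_open:
  fixes K :: "'a::euclidean_space set"
  assumes "compact K" "open \<Omega>" "K \<subseteq> \<Omega>"
  obtains d K' where "0 < d" "compact K'" "K' \<subseteq> \<Omega>" "\<And>x. x \<in> K \<Longrightarrow> cball x d \<subseteq> K'"
proof -
  have "K \<inter> - \<Omega> = {}" "closed (- \<Omega>)" using assms by auto
  then obtain d where d: "d > 0" "\<And>x y. x \<in> K \<Longrightarrow> y \<in> - \<Omega> \<Longrightarrow> d \<le> dist x y"
    using separate_compact_closed[OF assms(1), of "- \<Omega>"] by blast
  define K' where "K' = {x + y | x y. x \<in> K \<and> y \<in> cball 0 (d / 2)}"
  have "compact K'" unfolding K'_def by (intro compact_sums assms compact_cball)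
  moreover have "K' \<subseteq> \<Omega>"
  proof
    fix z assume "z \<in> K'"
    then obtain x y where "z = x + y" "x \<in> K" "norm y \<le> d / 2" by (auto simp: K'_def)
    then have "dist x z < d" "x \<in> K" using d(1) by (auto simp: dist_norm)
    then show "z \<in> \<Omega>" using d(2)[of x z] by force
  qed
  moreover have "cball x (d / 2) \<subseteq> K'" if "x \<in> K" for x
  proof
    fix z assume "z \<in> cball x (d / 2)"
    then have "z = x + (z - x)" "z - x \<in> cball 0 (d / 2)" by (auto simp: dist_norm norm_minus_commute)
    then show "z \<in> K'" unfolding K'_def using that by blast
  qed
  ultimately show ?thesis using that[of "d / 2" K'] d(1) by auto
qed

text \<open>The reflected translate of \<open>\<rho>\<close> is supported in
  \<open>cball x d\<close> inside \<Omega>, hence admissible in the definition of the weak gradient.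
  Reflection changes the sign of the derivative, which cancels the minus sign of that definition.
  \<open>f\<close> and \<open>g\<close> are Borel versions of the data set to zero off
  \<open>K'\<close>, where the test function vanishes anyway.\<close>

lemma mollified_weak_derivative:
  fixes u :: "real ^ 'n::finite \<Rightarrow> real"
  assumes u: "weak_gradient \<Omega> u Du" and \<Omega>: "open \<Omega>" and K': "compact K'" "K' \<subseteq> \<Omega>" "cball x d \<subseteq> K'"
    and \<rho>: "\<And>k x. Ck k (\<lambda>y. \<rho> (x - y))" "\<And>k. Ck k \<rho>" "\<And>x. \<rho> x \<noteq> 0 \<Longrightarrow> norm x \<le> d"
    and f: "integrable lborel f" "AE x in lebesgue. (if x \<in> K' then u x else 0) = f x"
    and g: "integrable lborel g" "AE x in lebesgue. (if x \<in> K' then Du x $ i else 0) = g x"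
  shows "(LINT y|lborel. f y * partial_deriv i \<rho> (x - y)) = (LINT y|lborel. g y * \<rho> (x - y))"
proof -
  define \<phi> where "\<phi> = (\<lambda>y. \<rho> (x - y))"
  have "{y. \<phi> y \<noteq> 0} \<subseteq> cball x d" using \<rho>(3) by (auto simp: \<phi>_def dist_norm)
  then have cl: "closure {y. \<phi> y \<noteq> 0} \<subseteq> cball x d" by (simp add: closure_minimal)
  have "test_function \<Omega> \<phi>"
    unfolding test_function_def compactly_contained_def
  proof (intro conjI allI)
    show "Ck k \<phi>" for k unfolding \<phi>_def by (rule \<rho>(1))
    show "closure {x. \<phi> x \<noteq> 0} \<subseteq> \<Omega>" using cl K' by auto
    show "compact (closure {x. \<phi> x \<noteq> 0})"
      using cl by (meson bounded_cball bounded_subset closed_closure compact_eq_bounded_closed)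
  qed
  then have wg: "(LINT x|lebesgue_on \<Omega>. u x * partial_deriv i \<phi> x) = - (LINT x|lebesgue_on \<Omega>. (Du x $ i) * \<phi> x)"
    using u by (auto simp: weak_gradient_def)
  have d\<rho>: "(\<rho> has_derivative (\<lambda>h. grad \<rho> z \<bullet> h)) (at z)" for z by (rule Ck_has_grad[OF \<rho>(2)])
  have c\<rho>: "continuous_on UNIV (grad \<rho>)" by (rule Ck_has_grad[OF \<rho>(2)])
  have d\<phi>': "(\<phi> has_derivative (\<lambda>h. (- grad \<rho> (x - y)) \<bullet> h)) (at y)" for y
  proof -
    have "((\<lambda>y. x - y) has_derivative (\<lambda>h. 0 - h)) (at y)"
      by (intro has_derivative_diff has_derivative_const has_derivative_ident)
    from has_derivative_compose[OF this d\<rho>] show ?thesis by (simp add: \<phi>_def)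
  qed
  have d\<phi>: "partial_deriv i \<phi> y = - partial_deriv i \<rho> (x - y)" for y
    using partial_deriv_eq_inner[OF d\<phi>', of i y] by (simp add: grad_def)
  have g0: "partial_deriv i \<rho> (x - y) = 0" if "y \<notin> K'" for y
  proof -
    have "y \<notin> cball x d" using that K'(3) by blast
    then have "x - y \<notin> cball 0 d" by (simp add: dist_norm norm_minus_commute)
    then have "grad \<rho> (x - y) = 0"
      by (intro gradient_eq_0_outside_support[OF d\<rho>, of "cball 0 d"]) (use \<rho>(3) in force)+
    then show ?thesis by (metis grad_def vec_lambda_beta zero_index)
  qed
  have \<rho>0: "\<rho> (x - y) = 0" if "y \<notin> K'" for y
  proof (rule ccontr)
    assume "\<rho> (x - y) \<noteq> 0"
    then have "y \<in> cball x d" using \<rho>(3) by (auto simp: dist_norm)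
    then show False using that K'(3) by auto
  qed
  have "continuous_on UNIV (\<lambda>z. partial_deriv i \<rho> z)"
    using \<rho>(2)[of "Suc 0"] by simp
  then have [measurable]: "partial_deriv i \<rho> \<in> borel_measurable borel" by (rule borel_measurable_continuous_onI)
  have "continuous_on UNIV \<rho>" using \<rho>(2)[of 0] by simp
  then have [measurable]: "\<rho> \<in> borel_measurable borel" by (rule borel_measurable_continuous_onI)
  have [measurable]: "f \<in> borel_measurable borel" "g \<in> borel_measurable borel" using f g by auto
  have transfer: "(LINT y|lebesgue_on \<Omega>. w y * k y) = (LINT y|lborel. h y * k y)"
    if [measurable]: "h \<in> borel_measurable borel" "k \<in> borel_measurable borel" and
      k0: "\<And>y. y \<notin> K' \<Longrightarrow> k y = 0" and h: "AE x in lebesgue. (if x \<in> K' then w x else 0) = h x"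
    for h k w :: "real ^ 'n \<Rightarrow> real"
  proof -
    have "(LINT y|lebesgue_on \<Omega>. w y * k y) = (LINT y|lebesgue. indicator \<Omega> y *\<^sub>R (w y * k y))"
      using \<Omega> by (intro integral_restrict_space) auto
    also have "\<dots> = (LINT y|lebesgue. (if y \<in> K' then w y else 0) * k y)"
      by (rule Bochner_Integration.integral_cong) (use k0 K' in \<open>auto simp: indicator_def\<close>)
    also have "\<dots> = (LINT y|lebesgue. h y * k y)"
    proof (rule integral_cong_AE)
      have hk: "h \<in> borel_measurable lebesgue" "k \<in> borel_measurable lebesgue"
        by (auto intro: measurable_completion)
      then show hk': "(\<lambda>y. h y * k y) \<in> borel_measurable lebesgue" by measurable
      show AE: "AE y in lebesgue. (if y \<in> K' then w y else 0) * k y = h y * k y"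
        using h by eventually_elim simp
      show "(\<lambda>y. (if y \<in> K' then w y else 0) * k y) \<in> borel_measurable lebesgue"
        by (rule borel_measurable_AE[OF hk']) (use AE in \<open>auto elim: eventually_mono\<close>)
    qed
    also have "\<dots> = (LINT y|lborel. h y * k y)"
      by (rule integral_completion) measurable
    finally show ?thesis .
  qed
  have "(LINT y|lborel. f y * partial_deriv i \<rho> (x - y)) = - (LINT y|lborel. f y * partial_deriv i \<phi> y)"
    by (simp add: d\<phi>)
  also have "(LINT y|lborel. f y * partial_deriv i \<phi> y) = (LINT x|lebesgue_on \<Omega>. u x * partial_deriv i \<phi> x)"
    by (rule transfer[symmetric]) (use f g0 in \<open>simp_all add: d\<phi>\<close>)
  also have "\<dots> = - (LINT y|lborel. g y * \<phi> y)"
    unfolding wg by (subst transfer) (use g \<rho>0 in \<open>simp_all add: \<phi>_def\<close>)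
  finally show ?thesis by (simp add: \<phi>_def)
qed

text \<open>\<open>U\<close> mollifies \<open>u\<close> set to zero outside \<open>K'\<close>. Its
  gradient is identified with the mollified \<open>Du\<close> only at points whose
  \<open>d\<close>-ball stays inside \<open>K'\<close>, hence the estimates on the smaller compact
  set \<open>K\<close>. The tolerance \<open>e / n\<close> per component suffices because the
  Euclidean norm is at most the sum of the absolute components.\<close>

lemma weak_gradient_approx:
  fixes u :: "real ^ 'n::finite \<Rightarrow> real"
  assumes u: "weak_gradient \<Omega> u Du" and \<Omega>: "open \<Omega>" and K: "compact K" "K \<subseteq> \<Omega>" and e: "0 < (e::real)"
  obtains U G where "\<And>x. (U has_derivative (\<lambda>h. G x \<bullet> h)) (at x)" "continuous_on UNIV G"
    "(\<integral>\<^sup>+x. ennreal \<bar>U x - u x\<bar> * indicator K x \<partial>lebesgue) \<le> ennreal e"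
    "(\<integral>\<^sup>+x. ennreal (norm (G x - Du x)) * indicator K x \<partial>lebesgue) \<le> ennreal e"
proof -
  obtain d K' where d: "0 < d" and K': "compact K'" "K' \<subseteq> \<Omega>" and KK': "\<And>x. x \<in> K \<Longrightarrow> cball x d \<subseteq> K'"
    using compact_neighbourhood_in_open[OF K(1) \<Omega> K(2)] by blast
  have KsubK': "K \<subseteq> K'" using KK' d by force
  have K'm: "K' \<in> sets lebesgue" using K'(1) by (simp add: borel_compact)
  have Lu: "Lp 1 K' u" "Lp 1 K' Du" using u K' by (auto simp: weak_gradient_def Lp_loc_def)
  have "integrable (lebesgue_on K') u"
    using Lu(1) integrable_norm_cancel[of "lebesgue_on K'" u] by (auto simp: Lp_def)
  then obtain f where f: "integrable lborel f" "AE x in lebesgue. (if x \<in> K' then u x else 0) = f x"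
    using lebesgue_borel_representative[OF K'm] by blast
  have "integrable (lebesgue_on K') Du"
    using Lu(2) integrable_norm_cancel[of "lebesgue_on K'" Du] by (auto simp: Lp_def)
  then have Dui: "integrable (lebesgue_on K') (\<lambda>x. Du x $ i)" for i
    using integrable_inner_left[of "axis i 1" "lebesgue_on K'" Du] by (simp add: inner_axis)
  have "\<exists>g. integrable lborel g \<and> (AE x in lebesgue. (if x \<in> K' then Du x $ i else 0) = g x)" for i
    by (rule lebesgue_borel_representative[OF K'm Dui[of i]]) blast
  then have "\<exists>g. \<forall>i. integrable lborel (g i) \<and> (AE x in lebesgue. (if x \<in> K' then Du x $ i else 0) = g i x)"
    by (intro choice allI)
  then obtain g where "\<forall>i. integrable lborel (g i) \<and> (AE x in lebesgue. (if x \<in> K' then Du x $ i else 0) = g i x)" ..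
  then have g: "integrable lborel (g i)" "AE x in lebesgue. (if x \<in> K' then Du x $ i else 0) = g i x" for i
    by simp_all
  let ?N = "real CARD('n)"
  have eN: "0 < e / ?N" using e by simp
  obtain d0 where d0: "0 < d0" "\<And>\<rho>. mollifier d0 \<rho> \<Longrightarrow>
      (\<integral>\<^sup>+x. ennreal \<bar>(LINT y|lborel. f y * \<rho> (x - y)) - f x\<bar> \<partial>lborel) \<le> ennreal e"
    using mollification_L1[OF f(1) e] by blast
  have "\<forall>i. \<exists>d>0. \<forall>\<rho>. mollifier d \<rho> \<longrightarrow>
      (\<integral>\<^sup>+x. ennreal \<bar>(LINT y|lborel. g i y * \<rho> (x - y)) - g i x\<bar> \<partial>lborel) \<le> ennreal (e / ?N)"
    by (intro allI mollification_L1 g(1) eN)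
  from choice[OF this] obtain d1 where d1: "\<And>i. 0 < d1 i" "\<And>i \<rho>. mollifier (d1 i) \<rho> \<Longrightarrow>
      (\<integral>\<^sup>+x. ennreal \<bar>(LINT y|lborel. g i y * \<rho> (x - y)) - g i x\<bar> \<partial>lborel) \<le> ennreal (e / ?N)"
    by blast
  \<comment> \<open>One radius for all requirements: supports inside \<open>K'\<close>, the
    approximation of \<open>f\<close>, and that of each of the finitely many
    \<open>g i\<close>.\<close>
  define r where "r = min (min d d0) (Min (range d1))"
  have r: "0 < r" "r \<le> d" "r \<le> d0" "\<And>i. r \<le> d1 i"
    using d d0(1) d1(1) by (auto simp: r_def min_le_iff_disj)
  obtain \<rho> :: "real ^ 'n \<Rightarrow> real" where \<rho>: "\<And>k x. Ck k (\<lambda>y. \<rho> (x - y))" "\<And>k. Ck k \<rho>" "\<And>x. 0 \<le> \<rho> x"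
    "\<And>x. \<rho> x \<noteq> 0 \<Longrightarrow> norm x \<le> r" "integrable lborel \<rho>" "(LINT x|lborel. \<rho> x) = 1"
    using mollifier_exists[OF r(1)] by metis
  have \<rho>d: "norm x \<le> d" if "\<rho> x \<noteq> 0" for x using \<rho>(4)[OF that] r(2) by linarith
  have c\<rho>: "continuous_on UNIV \<rho>" using \<rho>(2)[of 0] by simp
  then have moll: "mollifier r \<rho>" using \<rho> by (auto simp: mollifier_def)
  from c\<rho> have [measurable]: "\<rho> \<in> borel_measurable borel" by (rule borel_measurable_continuous_onI)
  have [measurable]: "f \<in> borel_measurable borel" "\<And>i. g i \<in> borel_measurable borel" using f g by auto
  have d\<rho>: "(\<rho> has_derivative (\<lambda>h. grad \<rho> z \<bullet> h)) (at z)" for z by (rule Ck_has_grad[OF \<rho>(2)])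
  have cg: "continuous_on UNIV (grad \<rho>)" by (rule Ck_has_grad[OF \<rho>(2)])
  have B: "\<rho> x = 0" if "r < norm x" for x using \<rho>(4)[of x] that by force
  define U where "U x = (LINT y|lborel. f y * \<rho> (x - y))" for x
  define G where "G x = (LINT y|lborel. f y *\<^sub>R grad \<rho> (x - y))" for x
  have "grad \<rho> x = 0" if "r < norm x" for x
    by (rule gradient_eq_0_outside_support[OF d\<rho>, of "cball 0 r"]) (use B that in auto)
  then obtain C where C: "\<And>x. norm (grad \<rho> x) \<le> C" using compact_support_bounded[OF cg] by blast
  have [measurable]: "grad \<rho> \<in> borel_measurable borel" using cg by (rule borel_measurable_continuous_onI)
  have G_eq: "G x $ i = (LINT y|lborel. g i y * \<rho> (x - y))" if "x \<in> K" for x i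
  proof -
    have "integrable lborel (\<lambda>y. f y *\<^sub>R grad \<rho> (x - y))"
      by (rule integrable_scaleR_bounded[OF f(1) _ C]) measurable
    then have "G x \<bullet> axis i 1 = (LINT y|lborel. (f y *\<^sub>R grad \<rho> (x - y)) \<bullet> axis i 1)"
      unfolding G_def by (intro integral_inner_left[symmetric])
    then have "G x $ i = (LINT y|lborel. f y * partial_deriv i \<rho> (x - y))"
      by (simp add: inner_axis grad_def)
    also have "\<dots> = (LINT y|lborel. g i y * \<rho> (x - y))"
      by (rule mollified_weak_derivative[OF u \<Omega> K', of x d])
        (use KK'[OF that] \<rho> \<rho>d f g in auto)
    finally show ?thesis .
  qed
  have AEu: "AE x in lebesgue. x \<in> K \<longrightarrow> u x = f x"
    using f(2) by eventually_elim (use KsubK' in auto)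
  have "AE x in lebesgue. \<forall>i\<in>UNIV. (if x \<in> K' then Du x $ i else 0) = g i x"
    using g(2) by (intro AE_finite_allI) auto
  then have AEg: "AE x in lebesgue. x \<in> K \<longrightarrow> (\<forall>i. Du x $ i = g i x)"
    by eventually_elim (use KsubK' in auto)
  show ?thesis
  proof (rule that[of U G])
    show "(U has_derivative (\<lambda>h. G x \<bullet> h)) (at x)" for x
      unfolding U_def G_def by (rule mollification_has_derivative[OF f(1) d\<rho> cg B])
    show "continuous_on UNIV G"
      unfolding G_def by (rule mollification_has_derivative[OF f(1) d\<rho> cg B])
    have "(\<integral>\<^sup>+x. ennreal \<bar>U x - u x\<bar> * indicator K x \<partial>lebesgue) \<le> (\<integral>\<^sup>+x. ennreal \<bar>U x - f x\<bar> \<partial>lebesgue)"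
      using AEu by (intro nn_integral_mono_AE, eventually_elim) (auto simp: indicator_def)
    also have "\<dots> \<le> ennreal e"
      unfolding nn_integral_completion U_def
      by (rule d0(2)) (rule mollifier_mono[OF moll r(3)])
    finally show "(\<integral>\<^sup>+x. ennreal \<bar>U x - u x\<bar> * indicator K x \<partial>lebesgue) \<le> ennreal e" .
    have "(\<integral>\<^sup>+x. ennreal (norm (G x - Du x)) * indicator K x \<partial>lebesgue)
      \<le> (\<integral>\<^sup>+x. (\<Sum>i\<in>UNIV. ennreal \<bar>(LINT y|lborel. g i y * \<rho> (x - y)) - g i x\<bar>) \<partial>lebesgue)"
      using AEg
    proof (intro nn_integral_mono_AE, eventually_elim)
      fix x assume *: "x \<in> K \<longrightarrow> (\<forall>i. Du x $ i = g i x)"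
      show "ennreal (norm (G x - Du x)) * indicator K x
        \<le> (\<Sum>i\<in>UNIV. ennreal \<bar>(LINT y|lborel. g i y * \<rho> (x - y)) - g i x\<bar>)"
      proof (cases "x \<in> K")
        case True
        have "norm (G x - Du x) \<le> (\<Sum>i\<in>UNIV. \<bar>(LINT y|lborel. g i y * \<rho> (x - y)) - g i x\<bar>)"
          using norm_le_l1_cart[of "G x - Du x"] * True by (simp add: G_eq)
        then show ?thesis using True by (simp add: sum_ennreal ennreal_leI)
      qed simp
    qed
    also have "\<dots> = (\<Sum>i\<in>UNIV. (\<integral>\<^sup>+x. ennreal \<bar>(LINT y|lborel. g i y * \<rho> (x - y)) - g i x\<bar> \<partial>lborel))"
      unfolding nn_integral_completion by (rule nn_integral_sum) measurable
    also have "\<dots> \<le> (\<Sum>i\<in>(UNIV::'n set). ennreal (e / ?N))"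
      by (intro sum_mono d1(2) mollifier_mono[OF moll r(4)])
    also have "\<dots> = ennreal e"
      using e by (simp add: ennreal_of_nat_eq_real_of_nat ennreal_mult'[symmetric])
    finally show "(\<integral>\<^sup>+x. ennreal (norm (G x - Du x)) * indicator K x \<partial>lebesgue) \<le> ennreal e" .
  qed
qed

section \<open>Chain rule with a cutoff\<close>

lemma continuous_measurable_lebesgue_on:
  fixes f :: "'a::euclidean_space \<Rightarrow> 'b::{second_countable_topology, real_normed_vector}"
  assumes "continuous_on UNIV f"
  shows "f \<in> borel_measurable (lebesgue_on S)"
proof -
  have "f \<in> borel_measurable borel" using assms by (rule borel_measurable_continuous_onI)
  then have "f \<in> borel_measurable lborel" by simp
  then have "f \<in> borel_measurable lebesgue" by (rule measurable_completion)
  then show ?thesis by (rule measurable_restrict_space1)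
qed

lemma finite_measure_lebesgue_on_compact:
  fixes K :: "'a::euclidean_space set"
  assumes "compact K"
  shows "finite_measure (lebesgue_on K)"
proof
  have "K \<in> sets lborel" using assms by (simp add: borel_compact)
  then have "emeasure (lebesgue_on K) (space (lebesgue_on K)) = emeasure lborel K"
    by (simp add: emeasure_restrict_space)
  then show "emeasure (lebesgue_on K) (space (lebesgue_on K)) \<noteq> \<infinity>"
    using emeasure_compact_finite[OF assms] by auto
qed

lemma continuous_integrable_lebesgue_on:
  fixes f :: "'a::euclidean_space \<Rightarrow> 'b::{second_countable_topology, banach}"
  assumes f: "continuous_on UNIV f" and K: "compact K"
  shows "integrable (lebesgue_on K) f"
proof -
  interpret finite_measure "lebesgue_on K" by (rule finite_measure_lebesgue_on_compact[OF K])
  have "bounded (f ` K)"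
    using f K by (intro compact_imp_bounded compact_continuous_image) (auto intro: continuous_on_subset)
  then obtain B where "\<forall>x\<in>K. norm (f x) \<le> B" by (auto simp: bounded_iff)
  then show ?thesis
    by (intro integrable_const_bound[of _ B] continuous_measurable_lebesgue_on f AE_I2) (auto simp: space_restrict_space)
qed

lemma set_integral_lebesgue_on_vanish:
  fixes f :: "'a::euclidean_space \<Rightarrow> real"
  assumes "S \<in> sets lebesgue" "T \<in> sets lebesgue" "S \<subseteq> T" "\<And>x. x \<in> T - S \<Longrightarrow> f x = 0"
  shows "(LINT x|lebesgue_on T. f x) = (LINT x|lebesgue_on S. f x)"
proof -
  have "(LINT x|lebesgue_on T. f x) = (LINT x|lebesgue. indicator T x *\<^sub>R f x)"
    using assms by (intro integral_restrict_space) auto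
  also have "\<dots> = (LINT x|lebesgue. indicator S x *\<^sub>R f x)"
    using assms(3,4) by (intro Bochner_Integration.integral_cong) (auto simp: indicator_def)
  also have "\<dots> = (LINT x|lebesgue_on S. f x)"
    using assms by (intro integral_restrict_space[symmetric]) auto
  finally show ?thesis .
qed

lemma nn_integral_lebesgue_on_vanish:
  fixes f :: "'a::euclidean_space \<Rightarrow> ennreal"
  assumes "S \<in> sets lebesgue" "\<And>x. x \<notin> S \<Longrightarrow> f x = 0"
  shows "(\<integral>\<^sup>+x. f x \<partial>lebesgue_on S) = (\<integral>\<^sup>+x. f x \<partial>lborel)"
proof -
  have "(\<integral>\<^sup>+x. f x \<partial>lebesgue_on S) = (\<integral>\<^sup>+x. f x * indicator S x \<partial>lebesgue)"
    using assms by (intro nn_integral_restrict_space) auto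
  also have "\<dots> = (\<integral>\<^sup>+x. f x \<partial>lebesgue)"
    using assms(2) by (intro nn_integral_cong) (auto simp: indicator_def)
  finally show ?thesis by (simp add: nn_integral_completion)
qed

text \<open>The integral of \<open>F (x + t *\<^sub>R b) - F x\<close> vanishes by translation
  invariance; dividing by \<open>t\<close> leaves only the error of the linear approximation, which
  is uniformly small on a fixed ball.\<close>

lemma C1_compact_support_integral_zero:
  fixes F :: "'a::euclidean_space \<Rightarrow> real"
  assumes der: "\<And>x. (F has_derivative (\<lambda>h. G x \<bullet> h)) (at x)" and G: "continuous_on UNIV G"
    and K: "compact K" "\<And>x. x \<notin> K \<Longrightarrow> F x = 0"
  shows "(LINT x|lebesgue_on K. G x \<bullet> b) = 0"
proof -
  obtain B where B: "\<And>x. x \<in> K \<Longrightarrow> norm x \<le> B" using compact_imp_bounded[OF K(1)] by (auto simp: bounded_iff)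
  define C where "C = cball (0::'a) (\<bar>B\<bar> + norm b)"
  have C: "compact C" by (simp add: C_def)
  have KC: "K \<subseteq> C"
  proof
    fix x assume "x \<in> K"
    then have "norm x \<le> \<bar>B\<bar> + norm b" using B[of x] norm_ge_zero[of b] by linarith
    then show "x \<in> C" by (simp add: C_def)
  qed
  have F: "continuous_on UNIV F"
    by (rule has_derivative_continuous_on) (rule has_derivative_at_withinI[OF der])
  have [measurable]: "F \<in> borel_measurable borel" "G \<in> borel_measurable borel"
    using F G by (auto intro: borel_measurable_continuous_onI)
  have F0: "F x = 0" if "\<bar>B\<bar> < norm x" for x using B[of x] that K(2)[of x] by force
  have G0: "G x = 0" if "x \<notin> K" for x
    by (rule gradient_eq_0_outside_support[OF der _ K(2) that]) (use K in \<open>auto intro: compact_imp_closed\<close>)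
  have iF: "integrable lborel F"
  proof -
    have "integrable lborel (\<lambda>x. indicator K x *\<^sub>R F x)"
      by (rule borel_integrable_compact[OF K(1)]) (use F continuous_on_subset in blast)
    moreover have "(\<lambda>x. indicator K x *\<^sub>R F x) = F" using K(2) by (auto simp: indicator_def fun_eq_iff)
    ultimately show ?thesis by simp
  qed
  have iG: "integrable lborel (\<lambda>x. G x \<bullet> b)"
  proof -
    have "integrable lborel (\<lambda>x. indicator K x *\<^sub>R (G x \<bullet> b))"
      by (rule borel_integrable_compact[OF K(1)]) (intro continuous_intros continuous_on_subset[OF G], simp)
    moreover have "(\<lambda>x. indicator K x *\<^sub>R (G x \<bullet> b)) = (\<lambda>x. G x \<bullet> b)" using G0 by (auto simp: indicator_def fun_eq_iff)
    ultimately show ?thesis by simp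
  qed
  have m: "emeasure lborel C < \<infinity>" using C by (rule emeasure_compact_finite)
  have key: "\<bar>LINT x|lborel. G x \<bullet> b\<bar> \<le> e * (norm b * measure lborel C)" if e: "0 < e" for e
  proof -
    obtain d where d: "0 < d" "\<And>x y. norm (y - x) < d \<Longrightarrow> \<bar>F y - F x - G x \<bullet> (y - x)\<bar> \<le> e * norm (y - x)"
      using C1_compact_support_uniformly_differentiable[OF der G F0 e] by metis
    \<comment> \<open>\<open>t \<le> 1\<close> confines all changes of \<open>F\<close> to the
      enlarged ball \<open>C\<close>, and \<open>t * norm b < d\<close> makes the linear
      approximation applicable.\<close>
    define t where "t = min 1 (d / (norm b + 1))"
    have b1: "0 < norm b + 1" by (rule add_nonneg_pos) auto
    have t: "0 < t" "t \<le> 1" using d(1) b1 by (auto simp: t_def)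
    have "t * norm b \<le> d / (norm b + 1) * norm b" by (intro mult_right_mono) (auto simp: t_def)
    also have "\<dots> < d" using d(1) b1 by (simp add: divide_less_eq)
    finally have td: "t * norm b < d" .
    have shift: "(LINT x|lborel. F (x + t *\<^sub>R b)) = (LINT x|lborel. F x)"
    proof -
      have "(LINT x|lborel. F x) = (LINT x|distr lborel borel ((+) (t *\<^sub>R b)). F x)" by (simp only: lborel_distr_plus)
      also have "\<dots> = (LINT x|lborel. F (t *\<^sub>R b + x))" by (rule integral_distr) auto
      finally show ?thesis by (simp add: add.commute)
    qed
    have iF': "integrable lborel (\<lambda>x. F (x + t *\<^sub>R b))"
    proof -
      have "integrable (distr lborel borel ((+) (t *\<^sub>R b))) F" using iF by (simp only: lborel_distr_plus)
      then have "integrable lborel (\<lambda>x. F (t *\<^sub>R b + x))" by (rule integrable_distr[rotated]) simp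
      then show ?thesis by (simp add: add.commute)
    qed
    have ptw: "\<bar>F (x + t *\<^sub>R b) - F x - t * (G x \<bullet> b)\<bar> \<le> indicator C x * (e * (t * norm b))" for x
    proof (cases "x \<in> C")
      case True
      then show ?thesis using d(2)[of "x + t *\<^sub>R b" x] td t by (simp add: abs_mult)
    next
      case False
      have "norm x \<le> norm (x + t *\<^sub>R b) + norm (t *\<^sub>R b)" using norm_triangle_ineq4[of "x + t *\<^sub>R b" "t *\<^sub>R b"] by simp
      moreover have "norm (t *\<^sub>R b) \<le> norm b" using t by (simp add: mult_left_le_one_le)
      ultimately have "\<bar>B\<bar> < norm (x + t *\<^sub>R b)" using False by (simp add: C_def)
      moreover have "x \<notin> K" using False KC by blast
      ultimately show ?thesis using F0 K(2) G0 False by simp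
    qed
    have "t * \<bar>LINT x|lborel. G x \<bullet> b\<bar> = \<bar>LINT x|lborel. F (x + t *\<^sub>R b) - F x - t * (G x \<bullet> b)\<bar>"
      using iF iF' iG t by (simp add: shift abs_mult)
    also have "\<dots> \<le> (LINT x|lborel. \<bar>F (x + t *\<^sub>R b) - F x - t * (G x \<bullet> b)\<bar>)" by (rule integral_abs_bound)
    also have "\<dots> \<le> (LINT x|lborel. indicator C x * (e * (t * norm b)))"
    proof (rule integral_mono)
      show "integrable lborel (\<lambda>x. \<bar>F (x + t *\<^sub>R b) - F x - t * (G x \<bullet> b)\<bar>)"
        using iF iF' iG by simp
      show "integrable lborel (\<lambda>x. indicator C x * (e * (t * norm b)))"
        using m C by (intro integrable_mult_left integrable_real_indicator) (auto simp: borel_compact)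
    qed (rule ptw)
    also have "\<dots> = t * (e * (norm b * measure lborel C))" using C by (simp add: borel_compact)
    finally show ?thesis using t by simp
  qed
  have "\<bar>LINT x|lborel. G x \<bullet> b\<bar> \<le> 0"
  proof (rule field_le_epsilon)
    fix e :: real assume e: "0 < e"
    define A where "A = norm b * measure lborel C"
    have A: "0 \<le> A" "0 < A + 1" by (auto simp: A_def add_nonneg_pos)
    have "\<bar>LINT x|lborel. G x \<bullet> b\<bar> \<le> e / (A + 1) * A"
      unfolding A_def by (rule key) (use e A in \<open>simp add: A_def\<close>)
    also have "\<dots> \<le> e" using e A by (simp add: divide_le_eq)
    finally show "\<bar>LINT x|lborel. G x \<bullet> b\<bar> \<le> 0 + e" by simp
  qed
  then have "(LINT x|lborel. G x \<bullet> b) = 0" by simp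
  moreover have "(LINT x|lebesgue_on K. G x \<bullet> b) = (LINT x|lebesgue_on UNIV. G x \<bullet> b)"
    using G0 K(1) by (intro set_integral_lebesgue_on_vanish[symmetric]) (auto simp: borel_compact)
  moreover have "(LINT x|lebesgue_on UNIV. G x \<bullet> b) = (LINT x|lborel. G x \<bullet> b)"
    by (simp add: integral_completion lebesgue_on_UNIV_eq)
  ultimately show ?thesis by simp
qed

lemma weak_gradient_L1_on_compact:
  assumes "weak_gradient \<Omega> u Du" "compact K" "K \<subseteq> \<Omega>"
  shows "integrable (lebesgue_on K) u" "integrable (lebesgue_on K) Du"
proof -
  have Lu: "Lp 1 K u" "Lp 1 K Du" using assms by (auto simp: weak_gradient_def Lp_loc_def)
  show "integrable (lebesgue_on K) u"
    using Lu(1) integrable_norm_cancel[of "lebesgue_on K" u] by (auto simp: Lp_def)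
  show "integrable (lebesgue_on K) Du"
    using Lu(2) integrable_norm_cancel[of "lebesgue_on K" Du] by (auto simp: Lp_def)
qed

text \<open>Convergence in \<open>L^1\<close> is turned into convergence almost everywhere along a
  subsequence. The latter is required for the nonlinear factor \<open>\<Phi>' (u x)\<close> of the
  chain rule, where \<open>\<Phi>'\<close> is merely continuous.\<close>

lemma weak_gradient_approx_seq:
  fixes u :: "real ^ 'n::finite \<Rightarrow> real"
  assumes u: "weak_gradient \<Omega> u Du" and \<Omega>: "open \<Omega>" and K: "compact K" "K \<subseteq> \<Omega>"
  obtains U G where "\<And>k x. (U k has_derivative (\<lambda>h. G k x \<bullet> h)) (at x)" "\<And>k::nat. continuous_on UNIV (G k)"
    "(\<lambda>k. \<integral>\<^sup>+x. ennreal \<bar>U k x - u x\<bar> \<partial>lebesgue_on K) \<longlonglongrightarrow> 0"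
    "(\<lambda>k. \<integral>\<^sup>+x. ennreal (norm (G k x - Du x)) \<partial>lebesgue_on K) \<longlonglongrightarrow> 0"
    "AE x in lebesgue_on K. (\<lambda>k. U k x) \<longlonglongrightarrow> u x"
proof -
  have Km: "K \<in> sets lebesgue" using K(1) by (simp add: borel_compact)
  have res: "(\<integral>\<^sup>+x. f x * indicator K x \<partial>lebesgue) = (\<integral>\<^sup>+x. f x \<partial>lebesgue_on K)" for f :: "real ^ 'n \<Rightarrow> ennreal"
    using Km by (intro nn_integral_restrict_space[symmetric]) auto
  define P where "P k U G \<longleftrightarrow> (\<forall>x. (U has_derivative (\<lambda>h. G x \<bullet> h)) (at x)) \<and> continuous_on UNIV G \<and>
    (\<integral>\<^sup>+x. ennreal \<bar>U x - u x\<bar> \<partial>lebesgue_on K) \<le> ennreal (1 / real (Suc k)) \<and>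
    (\<integral>\<^sup>+x. ennreal (norm (G x - Du x)) \<partial>lebesgue_on K) \<le> ennreal (1 / real (Suc k))" for k U G
  have "\<exists>UG. P k (fst UG) (snd UG)" for k
  proof -
    have "0 < 1 / real (Suc k)" by simp
    from weak_gradient_approx[OF u \<Omega> K this] obtain U G where "P k U G"
      unfolding P_def res by blast
    then show ?thesis by (intro exI[of _ "(U, G)"]) simp
  qed
  then obtain UG where UG: "\<And>k. P k (fst (UG k)) (snd (UG k))" by metis
  define U where "U k = fst (UG k)" for k
  define G where "G k = snd (UG k)" for k
  have der: "(U k has_derivative (\<lambda>h. G k x \<bullet> h)) (at x)" and cG: "continuous_on UNIV (G k)"
    and eU: "(\<integral>\<^sup>+x. ennreal \<bar>U k x - u x\<bar> \<partial>lebesgue_on K) \<le> ennreal (1 / real (Suc k))"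
    and eG: "(\<integral>\<^sup>+x. ennreal (norm (G k x - Du x)) \<partial>lebesgue_on K) \<le> ennreal (1 / real (Suc k))" for k x
    using UG[of k] by (auto simp: P_def U_def G_def)
  have lim: "(\<lambda>k. ennreal (1 / real (Suc k))) \<longlonglongrightarrow> 0"
    using tendsto_ennrealI[OF LIMSEQ_inverse_real_of_nat] by (simp add: inverse_eq_divide)
  have cU: "continuous_on UNIV (U k)" for k
    by (rule has_derivative_continuous_on) (rule has_derivative_at_withinI[OF der])
  have iu: "integrable (lebesgue_on K) u" by (rule weak_gradient_L1_on_compact[OF u K])
  have int: "integrable (lebesgue_on K) (\<lambda>x. U k x - u x)" for k
    by (intro Bochner_Integration.integrable_diff continuous_integrable_lebesgue_on cU K iu)
  have "(\<lambda>k. LINT x|lebesgue_on K. norm (U k x - u x)) \<longlonglongrightarrow> 0"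
  proof (rule tendsto_sandwich[of "\<lambda>_. 0" _ _ "\<lambda>k. 1 / real (Suc k)"])
    show "\<forall>\<^sub>F k in sequentially. (LINT x|lebesgue_on K. norm (U k x - u x)) \<le> 1 / real (Suc k)"
    proof (intro always_eventually allI)
      fix k
      have "ennreal (LINT x|lebesgue_on K. norm (U k x - u x)) = (\<integral>\<^sup>+x. ennreal \<bar>U k x - u x\<bar> \<partial>lebesgue_on K)"
        using nn_integral_eq_integral[OF integrable_norm[OF int[of k]]] by simp
      then have "ennreal (LINT x|lebesgue_on K. norm (U k x - u x)) \<le> ennreal (1 / real (Suc k))"
        using eU[of k] by simp
      then show "(LINT x|lebesgue_on K. norm (U k x - u x)) \<le> 1 / real (Suc k)"
        by (subst (asm) ennreal_le_iff) simp_all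
    qed
    show "(\<lambda>k. 1 / real (Suc k)) \<longlonglongrightarrow> 0"
      using LIMSEQ_inverse_real_of_nat by (simp add: inverse_eq_divide)
  qed (auto intro!: always_eventually)
  from tendsto_L1_AE_subseq[OF int this]
  obtain r :: "nat \<Rightarrow> nat" where r: "strict_mono r" "AE x in lebesgue_on K. (\<lambda>n. U (r n) x - u x) \<longlonglongrightarrow> 0"
    by blast
  show ?thesis
  proof (rule that[of "\<lambda>k. U (r k)" "\<lambda>k. G (r k)"])
    have lim': "(\<lambda>k. ennreal (1 / real (Suc (r k)))) \<longlonglongrightarrow> 0"
      using LIMSEQ_subseq_LIMSEQ[OF lim r(1)] by (simp add: o_def)
    show "(\<lambda>k. \<integral>\<^sup>+x. ennreal \<bar>U (r k) x - u x\<bar> \<partial>lebesgue_on K) \<longlonglongrightarrow> 0"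
      by (rule tendsto_sandwich[OF _ _ tendsto_const lim']) (intro always_eventually allI eU zero_le)+
    show "(\<lambda>k. \<integral>\<^sup>+x. ennreal (norm (G (r k) x - Du x)) \<partial>lebesgue_on K) \<longlonglongrightarrow> 0"
      by (rule tendsto_sandwich[OF _ _ tendsto_const lim']) (intro always_eventually allI eG zero_le)+
    show "AE x in lebesgue_on K. (\<lambda>k. U (r k) x) \<longlonglongrightarrow> u x"
      using r(2) by eventually_elim (simp add: LIM_zero_iff)
  qed (use der cG in auto)
qed

lemma bounded_derivative_lipschitz:
  fixes \<Phi> :: "real \<Rightarrow> real"
  assumes "\<And>t. (\<Phi> has_real_derivative \<Phi>' t) (at t)" "\<And>t. \<bar>\<Phi>' t\<bar> \<le> L"
  shows "\<bar>\<Phi> s - \<Phi> t\<bar> \<le> L * \<bar>s - t\<bar>"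
  using field_differentiable_bound[of UNIV \<Phi> \<Phi>' L s t] assms by simp

text \<open>Serves twice: for the test function in the equation and for the function to which the
  Sobolev inequality is applied. In both cases \<open>\<Phi>\<close> is built from the truncation,
  which provides the bound \<open>L\<close>; a bounded derivative makes the composition locally as
  integrable as \<open>u\<close>, although \<open>u\<close> itself is not known to be
  bounded.\<close>

locale cutoff_composition =
  fixes \<Omega> :: "(real ^ 'n::finite) set" and u :: "real ^ 'n \<Rightarrow> real" and Du
    and \<Phi> \<Phi>' :: "real \<Rightarrow> real" and L :: real and \<zeta> :: "real ^ 'n \<Rightarrow> real" and D\<zeta> and K
  assumes u: "weak_gradient \<Omega> u Du" and \<Omega>: "open \<Omega>" and K: "compact K" "K \<subseteq> \<Omega>"
    and \<Phi>: "\<And>t. (\<Phi> has_real_derivative \<Phi>' t) (at t)" and \<Phi>': "continuous_on UNIV \<Phi>'" "\<And>t. \<bar>\<Phi>' t\<bar> \<le> L"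
    and \<zeta>: "\<And>x. (\<zeta> has_derivative (\<lambda>h. D\<zeta> x \<bullet> h)) (at x)" and D\<zeta>: "continuous_on UNIV D\<zeta>"
    and \<zeta>0: "\<And>x. x \<notin> K \<Longrightarrow> \<zeta> x = 0"
begin

definition w where "w x = \<Phi> (u x) * \<zeta> x"
definition Dw where "Dw x = (\<Phi>' (u x) * \<zeta> x) *\<^sub>R Du x + \<Phi> (u x) *\<^sub>R D\<zeta> x"

lemma Km: "K \<in> sets lebesgue" using K(1) by (simp add: borel_compact)

lemma cont: "continuous_on UNIV \<Phi>" "continuous_on UNIV \<zeta>"
proof -
  show "continuous_on UNIV \<Phi>"
    using \<Phi> DERIV_isCont by (intro continuous_at_imp_continuous_on) blast
  show "continuous_on UNIV \<zeta>"
    by (rule has_derivative_continuous_on) (rule has_derivative_at_withinI[OF \<zeta>])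
qed

lemma meas [measurable]: "\<Phi> \<in> borel_measurable borel" "\<Phi>' \<in> borel_measurable borel"
  "\<zeta> \<in> borel_measurable (lebesgue_on S)" "D\<zeta> \<in> borel_measurable (lebesgue_on S)"
  using cont \<Phi>' D\<zeta> by (auto intro: borel_measurable_continuous_onI continuous_measurable_lebesgue_on)

lemma D\<zeta>0: "x \<notin> K \<Longrightarrow> D\<zeta> x = 0"
  by (rule gradient_eq_0_outside_support[OF \<zeta> _ \<zeta>0]) (use K in \<open>auto intro: compact_imp_closed\<close>)

lemma vanish: "x \<notin> K \<Longrightarrow> w x = 0" "x \<notin> K \<Longrightarrow> Dw x = 0"
  using \<zeta>0 D\<zeta>0 by (auto simp: w_def Dw_def)

lemma bounds: obtains Z where "0 \<le> Z" "\<And>x. \<bar>\<zeta> x\<bar> \<le> Z" "\<And>x. norm (D\<zeta> x) \<le> Z"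
proof -
  have "bounded K" using K(1) by (rule compact_imp_bounded)
  then obtain B where B: "\<And>x. x \<in> K \<Longrightarrow> norm x \<le> B" by (auto simp: bounded_iff)
  have 1: "\<And>x. B < norm x \<Longrightarrow> \<zeta> x = 0" "\<And>x. B < norm x \<Longrightarrow> D\<zeta> x = 0"
    using B \<zeta>0 D\<zeta>0 by (meson not_le)+
  obtain C C' where "\<And>x. norm (\<zeta> x) \<le> C" "\<And>x. norm (D\<zeta> x) \<le> C'"
    using compact_support_bounded[OF cont(2) 1(1)] compact_support_bounded[OF D\<zeta> 1(2)] by metis
  then have "\<bar>\<zeta> x\<bar> \<le> max \<bar>C\<bar> \<bar>C'\<bar>" "norm (D\<zeta> x) \<le> max \<bar>C\<bar> \<bar>C'\<bar>" for x
    by (metis abs_ge_self max.coboundedI1 order_trans real_norm_def, metis abs_ge_self max.coboundedI2 order_trans)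
  then show ?thesis using that[of "max \<bar>C\<bar> \<bar>C'\<bar>"] by auto
qed

lemma L_nonneg: "0 \<le> L" using \<Phi>'(2)[of 0] by linarith

lemma ubm [measurable]: "u \<in> borel_measurable (lebesgue_on K)" "Du \<in> borel_measurable (lebesgue_on K)"
  using weak_gradient_L1_on_compact[OF u K] by auto

lemma wbm [measurable]: "w \<in> borel_measurable (lebesgue_on K)" "Dw \<in> borel_measurable (lebesgue_on K)"
  unfolding w_def Dw_def by measurable

text \<open>The mode of convergence suits both applications: \<open>L^1\<close> convergence of
  functions and gradients for integration by parts, convergence almost everywhere for Fatou's lemma
  in the Gagliardo--Nirenberg inequality.\<close>

definition C1_approx :: "(nat \<Rightarrow> real ^ 'n \<Rightarrow> real) \<Rightarrow> (nat \<Rightarrow> real ^ 'n \<Rightarrow> real ^ 'n) \<Rightarrow> bool" where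
  "C1_approx f G \<longleftrightarrow> (\<forall>k x. (f k has_derivative (\<lambda>h. G k x \<bullet> h)) (at x)) \<and> (\<forall>k. continuous_on UNIV (G k)) \<and>
    (\<forall>k x. x \<notin> K \<longrightarrow> f k x = 0) \<and>
    (\<lambda>k. \<integral>\<^sup>+x. ennreal \<bar>f k x - w x\<bar> \<partial>lebesgue_on K) \<longlonglongrightarrow> 0 \<and>
    (\<lambda>k. \<integral>\<^sup>+x. ennreal (norm (G k x - Dw x)) \<partial>lebesgue_on K) \<longlonglongrightarrow> 0 \<and>
    (AE x in lebesgue_on K. (\<lambda>k. f k x) \<longlonglongrightarrow> w x)"

text \<open>The approximants are \<open>\<Phi> (U k x)\<close> times the cutoff. The error of the
  gradients splits into three parts: \<open>G k - Du\<close> with a bounded factor, the change of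
  \<open>\<Phi>'\<close> against the fixed function \<open>Du\<close>, and the change of
  \<open>\<Phi>\<close> against the gradient of the cutoff. The first and last are controlled by
  Lipschitz bounds; the middle one vanishes by dominated convergence with a multiple of
  \<open>norm (Du x)\<close> as majorant.\<close>

lemma C1_approx_exists: "\<exists>f G. C1_approx f G"
proof -
  obtain Z where Z: "0 \<le> Z" "\<And>x. \<bar>\<zeta> x\<bar> \<le> Z" "\<And>x. norm (D\<zeta> x) \<le> Z" using bounds by blast
  obtain U G where U: "\<And>k x. (U k has_derivative (\<lambda>h. G k x \<bullet> h)) (at x)" "\<And>k::nat. continuous_on UNIV (G k)"
    and eU: "(\<lambda>k. \<integral>\<^sup>+x. ennreal \<bar>U k x - u x\<bar> \<partial>lebesgue_on K) \<longlonglongrightarrow> 0"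
    and eG: "(\<lambda>k. \<integral>\<^sup>+x. ennreal (norm (G k x - Du x)) \<partial>lebesgue_on K) \<longlonglongrightarrow> 0"
    and AE: "AE x in lebesgue_on K. (\<lambda>k. U k x) \<longlonglongrightarrow> u x"
    using weak_gradient_approx_seq[OF u \<Omega> K] by blast
  have cU: "continuous_on UNIV (U k)" for k
    by (rule has_derivative_continuous_on) (rule has_derivative_at_withinI[OF U(1)])
  have [measurable]: "U k \<in> borel_measurable (lebesgue_on K)" "G k \<in> borel_measurable (lebesgue_on K)" for k
    using cU U(2) by (auto intro: continuous_measurable_lebesgue_on)
  define f where "f k x = \<Phi> (U k x) * \<zeta> x" for k x
  define H where "H k x = (\<Phi>' (U k x) * \<zeta> x) *\<^sub>R G k x + \<Phi> (U k x) *\<^sub>R D\<zeta> x" for k x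
  have lip: "\<bar>\<Phi> s - \<Phi> t\<bar> \<le> L * \<bar>s - t\<bar>" for s t
    by (rule bounded_derivative_lipschitz[OF \<Phi> \<Phi>'(2)])
  have "C1_approx f H"
    unfolding C1_approx_def
  proof (intro conjI allI impI)
    show "(f k has_derivative (\<lambda>h. H k x \<bullet> h)) (at x)" for k x
    proof -
      have "((\<lambda>x. \<Phi> (U k x)) has_derivative (\<lambda>h. \<Phi>' (U k x) * (G k x \<bullet> h))) (at x)"
        using has_derivative_compose[OF U(1) \<Phi>[unfolded has_field_derivative_def]] by simp
      from has_derivative_mult[OF this \<zeta>[of x]]
      show ?thesis unfolding f_def H_def by (simp add: inner_add_left inner_scaleR_left algebra_simps)
    qed
    show "continuous_on UNIV (H k)" for k
      unfolding H_def
      by (intro continuous_intros U(2) D\<zeta> cont(2) continuous_on_compose2[OF cont(1) cU] continuous_on_compose2[OF \<Phi>'(1) cU]) auto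
    show "f k x = 0" if "x \<notin> K" for k x using \<zeta>0[OF that] by (simp add: f_def)
    show "AE x in lebesgue_on K. (\<lambda>k. f k x) \<longlonglongrightarrow> w x"
      using AE
    proof eventually_elim
      fix x assume "(\<lambda>k. U k x) \<longlonglongrightarrow> u x"
      moreover have "isCont \<Phi> (u x)" using \<Phi> DERIV_isCont by blast
      ultimately have "(\<lambda>k. \<Phi> (U k x)) \<longlonglongrightarrow> \<Phi> (u x)" by (rule isCont_tendsto_compose[rotated])
      then show "(\<lambda>k. f k x) \<longlonglongrightarrow> w x" unfolding f_def w_def by (intro tendsto_intros)
    qed
    have up: "(\<lambda>k. ennreal (Z * L) * (\<integral>\<^sup>+x. ennreal \<bar>U k x - u x\<bar> \<partial>lebesgue_on K)) \<longlonglongrightarrow> ennreal (Z * L) * 0"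
      by (intro ennreal_tendsto_cmult eU) simp
    have "(\<integral>\<^sup>+x. ennreal \<bar>f k x - w x\<bar> \<partial>lebesgue_on K) \<le> ennreal (Z * L) * (\<integral>\<^sup>+x. ennreal \<bar>U k x - u x\<bar> \<partial>lebesgue_on K)" for k
    proof -
      have "\<bar>f k x - w x\<bar> \<le> Z * L * \<bar>U k x - u x\<bar>" for x
      proof -
        have "\<bar>f k x - w x\<bar> = \<bar>\<zeta> x\<bar> * \<bar>\<Phi> (U k x) - \<Phi> (u x)\<bar>"
          by (simp add: f_def w_def abs_mult[symmetric] algebra_simps)
        also have "\<dots> \<le> Z * (L * \<bar>U k x - u x\<bar>)" by (intro mult_mono Z lip) auto
        finally show ?thesis by (simp add: mult.assoc)
      qed
      then have "(\<integral>\<^sup>+x. ennreal \<bar>f k x - w x\<bar> \<partial>lebesgue_on K) \<le> (\<integral>\<^sup>+x. ennreal (Z * L) * ennreal \<bar>U k x - u x\<bar> \<partial>lebesgue_on K)"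
        using Z L_nonneg by (intro nn_integral_mono) (auto simp: ennreal_mult[symmetric] intro!: ennreal_leI)
      then show ?thesis by (simp add: nn_integral_cmult)
    qed
    then show "(\<lambda>k. \<integral>\<^sup>+x. ennreal \<bar>f k x - w x\<bar> \<partial>lebesgue_on K) \<longlonglongrightarrow> 0"
      using up by (intro tendsto_sandwich[OF _ _ tendsto_const up[simplified]]) (auto intro!: always_eventually)
    have "(\<lambda>k. \<integral>\<^sup>+x. ennreal (Z * (\<bar>\<Phi>' (U k x) - \<Phi>' (u x)\<bar> * norm (Du x))) \<partial>lebesgue_on K)
        \<longlonglongrightarrow> (\<integral>\<^sup>+x. ennreal (Z * (0 * norm (Du x))) \<partial>lebesgue_on K)"
    proof (rule nn_integral_dominated_convergence[where w = "\<lambda>x. ennreal (Z * (2 * L * norm (Du x)))"])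
      show "AE x in lebesgue_on K. ennreal (Z * (\<bar>\<Phi>' (U k x) - \<Phi>' (u x)\<bar> * norm (Du x))) \<le> ennreal (Z * (2 * L * norm (Du x)))" for k
      proof (intro AE_I2 ennreal_leI mult_left_mono mult_right_mono Z)
        fix x show "\<bar>\<Phi>' (U k x) - \<Phi>' (u x)\<bar> \<le> 2 * L" using \<Phi>'(2)[of "U k x"] \<Phi>'(2)[of "u x"] by linarith
      qed simp
      have "integrable (lebesgue_on K) (\<lambda>x. Z * (2 * L * norm (Du x)))"
        using weak_gradient_L1_on_compact[OF u K] by simp
      then show "(\<integral>\<^sup>+x. ennreal (Z * (2 * L * norm (Du x))) \<partial>lebesgue_on K) < \<infinity>"
        using Z L_nonneg by (subst nn_integral_eq_integral) auto
      show "AE x in lebesgue_on K. (\<lambda>k. ennreal (Z * (\<bar>\<Phi>' (U k x) - \<Phi>' (u x)\<bar> * norm (Du x)))) \<longlonglongrightarrow> ennreal (Z * (0 * norm (Du x)))"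
        using AE
      proof eventually_elim
        fix x assume "(\<lambda>k. U k x) \<longlonglongrightarrow> u x"
        moreover have "isCont \<Phi>' (u x)" using \<Phi>'(1) by (simp add: continuous_on_eq_continuous_at)
        ultimately have "(\<lambda>k. \<Phi>' (U k x)) \<longlonglongrightarrow> \<Phi>' (u x)" by (rule isCont_tendsto_compose[rotated])
        then have "(\<lambda>k. \<bar>\<Phi>' (U k x) - \<Phi>' (u x)\<bar>) \<longlonglongrightarrow> 0" by (simp add: LIM_zero_iff tendsto_rabs_zero_iff)
        then show "(\<lambda>k. ennreal (Z * (\<bar>\<Phi>' (U k x) - \<Phi>' (u x)\<bar> * norm (Du x)))) \<longlonglongrightarrow> ennreal (Z * (0 * norm (Du x)))"
          by (intro tendsto_ennrealI tendsto_intros)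
      qed
    qed measurable
    then have lim2: "(\<lambda>k. \<integral>\<^sup>+x. ennreal (Z * (\<bar>\<Phi>' (U k x) - \<Phi>' (u x)\<bar> * norm (Du x))) \<partial>lebesgue_on K) \<longlonglongrightarrow> 0"
      by simp
    have lim1: "(\<lambda>k. ennreal (L * Z) * (\<integral>\<^sup>+x. ennreal (norm (G k x - Du x)) \<partial>lebesgue_on K)) \<longlonglongrightarrow> ennreal (L * Z) * 0"
      by (intro ennreal_tendsto_cmult eG) simp
    have lim: "(\<lambda>k. ennreal (L * Z) * (\<integral>\<^sup>+x. ennreal (norm (G k x - Du x)) \<partial>lebesgue_on K)
       + ((\<integral>\<^sup>+x. ennreal (Z * (\<bar>\<Phi>' (U k x) - \<Phi>' (u x)\<bar> * norm (Du x))) \<partial>lebesgue_on K)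
       + ennreal (Z * L) * (\<integral>\<^sup>+x. ennreal \<bar>U k x - u x\<bar> \<partial>lebesgue_on K))) \<longlonglongrightarrow> 0"
      using tendsto_add[OF lim1 tendsto_add[OF lim2 up]] by simp
    have "(\<integral>\<^sup>+x. ennreal (norm (H k x - Dw x)) \<partial>lebesgue_on K)
      \<le> ennreal (L * Z) * (\<integral>\<^sup>+x. ennreal (norm (G k x - Du x)) \<partial>lebesgue_on K)
       + ((\<integral>\<^sup>+x. ennreal (Z * (\<bar>\<Phi>' (U k x) - \<Phi>' (u x)\<bar> * norm (Du x))) \<partial>lebesgue_on K)
       + ennreal (Z * L) * (\<integral>\<^sup>+x. ennreal \<bar>U k x - u x\<bar> \<partial>lebesgue_on K))" for k
    proof -
      have "norm (H k x - Dw x) \<le> L * Z * norm (G k x - Du x)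
        + (Z * (\<bar>\<Phi>' (U k x) - \<Phi>' (u x)\<bar> * norm (Du x)) + Z * L * \<bar>U k x - u x\<bar>)" for x
      proof -
        let ?a = "(\<Phi>' (U k x) * \<zeta> x) *\<^sub>R (G k x - Du x)"
        let ?b = "(\<zeta> x * (\<Phi>' (U k x) - \<Phi>' (u x))) *\<^sub>R Du x"
        let ?c = "(\<Phi> (U k x) - \<Phi> (u x)) *\<^sub>R D\<zeta> x"
        have eq: "H k x - Dw x = ?a + (?b + ?c)" by (simp add: H_def Dw_def algebra_simps)
        have "norm (H k x - Dw x) \<le> norm ?a + (norm ?b + norm ?c)"
          unfolding eq by (rule order_trans[OF norm_triangle_ineq add_left_mono[OF norm_triangle_ineq]])
        moreover have "norm ?a \<le> L * Z * norm (G k x - Du x)"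
          unfolding norm_scaleR abs_mult
          by (intro mult_right_mono mult_mono[OF \<Phi>'(2) Z(2) L_nonneg abs_ge_zero] norm_ge_zero)
        moreover have "norm ?b \<le> Z * (\<bar>\<Phi>' (U k x) - \<Phi>' (u x)\<bar> * norm (Du x))"
          unfolding norm_scaleR abs_mult mult.assoc by (intro mult_right_mono Z) simp
        moreover have "norm ?c \<le> (L * \<bar>U k x - u x\<bar>) * Z"
          unfolding norm_scaleR by (rule mult_mono[OF lip Z(3)]) (use L_nonneg in auto)
        moreover have "(L * \<bar>U k x - u x\<bar>) * Z = Z * L * \<bar>U k x - u x\<bar>" by simp
        ultimately show ?thesis by linarith
      qed
      then have "(\<integral>\<^sup>+x. ennreal (norm (H k x - Dw x)) \<partial>lebesgue_on K)
        \<le> (\<integral>\<^sup>+x. ennreal (L * Z) * ennreal (norm (G k x - Du x)) + (ennreal (Z * (\<bar>\<Phi>' (U k x) - \<Phi>' (u x)\<bar> * norm (Du x)))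
          + ennreal (Z * L) * ennreal \<bar>U k x - u x\<bar>) \<partial>lebesgue_on K)"
        using Z L_nonneg
        by (intro nn_integral_mono) (auto simp: ennreal_mult[symmetric] ennreal_plus[symmetric] simp del: ennreal_plus intro!: ennreal_leI)
      also have "\<dots> = ennreal (L * Z) * (\<integral>\<^sup>+x. ennreal (norm (G k x - Du x)) \<partial>lebesgue_on K)
       + ((\<integral>\<^sup>+x. ennreal (Z * (\<bar>\<Phi>' (U k x) - \<Phi>' (u x)\<bar> * norm (Du x))) \<partial>lebesgue_on K)
       + ennreal (Z * L) * (\<integral>\<^sup>+x. ennreal \<bar>U k x - u x\<bar> \<partial>lebesgue_on K))"
        by (simp add: nn_integral_add nn_integral_cmult)
      finally show ?thesis .
    qed
    then show "(\<lambda>k. \<integral>\<^sup>+x. ennreal (norm (H k x - Dw x)) \<partial>lebesgue_on K) \<longlonglongrightarrow> 0"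
      by (intro tendsto_sandwich[OF _ _ tendsto_const lim]) (auto intro!: always_eventually)
  qed
  then show ?thesis by blast
qed

lemma w_integrable: "integrable (lebesgue_on K) w" "integrable (lebesgue_on K) Dw"
proof -
  obtain Z where Z: "0 \<le> Z" "\<And>x. \<bar>\<zeta> x\<bar> \<le> Z" "\<And>x. norm (D\<zeta> x) \<le> Z" using bounds by blast
  interpret finite_measure "lebesgue_on K" by (rule finite_measure_lebesgue_on_compact[OF K(1)])
  note i = weak_gradient_L1_on_compact[OF u K]
  have gr: "\<bar>\<Phi> t\<bar> \<le> \<bar>\<Phi> 0\<bar> + L * \<bar>t\<bar>" for t
    using bounded_derivative_lipschitz[OF \<Phi> \<Phi>'(2), of t 0] by simp
  have i1: "integrable (lebesgue_on K) (\<lambda>x. (\<bar>\<Phi> 0\<bar> + L * \<bar>u x\<bar>) * Z)" using i by simp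
  have i2: "integrable (lebesgue_on K) (\<lambda>x. L * Z * norm (Du x) + (\<bar>\<Phi> 0\<bar> + L * \<bar>u x\<bar>) * Z)" using i by simp
  show "integrable (lebesgue_on K) w"
  proof (rule Bochner_Integration.integrable_bound[OF i1 wbm(1)], intro AE_I2)
    fix x
    have "\<bar>\<Phi> (u x)\<bar> * \<bar>\<zeta> x\<bar> \<le> (\<bar>\<Phi> 0\<bar> + L * \<bar>u x\<bar>) * Z" using gr Z L_nonneg by (intro mult_mono) auto
    also have "\<dots> \<le> norm ((\<bar>\<Phi> 0\<bar> + L * \<bar>u x\<bar>) * Z)" unfolding real_norm_def by (rule abs_ge_self)
    finally show "norm (w x) \<le> norm ((\<bar>\<Phi> 0\<bar> + L * \<bar>u x\<bar>) * Z)" by (simp add: w_def abs_mult)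
  qed
  show "integrable (lebesgue_on K) Dw"
  proof (rule Bochner_Integration.integrable_bound[OF i2 wbm(2)], intro AE_I2)
    fix x
    have "norm (Dw x) \<le> \<bar>\<Phi>' (u x)\<bar> * \<bar>\<zeta> x\<bar> * norm (Du x) + \<bar>\<Phi> (u x)\<bar> * norm (D\<zeta> x)"
      unfolding Dw_def by (rule norm_triangle_le) (simp add: abs_mult)
    also have "\<dots> \<le> L * Z * norm (Du x) + (\<bar>\<Phi> 0\<bar> + L * \<bar>u x\<bar>) * Z"
      using gr Z L_nonneg \<Phi>' by (intro add_mono mult_mono) auto
    also have "\<dots> \<le> norm (L * Z * norm (Du x) + (\<bar>\<Phi> 0\<bar> + L * \<bar>u x\<bar>) * Z)"
      unfolding real_norm_def by (rule abs_ge_self)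
    finally show "norm (Dw x) \<le> norm (L * Z * norm (Du x) + (\<bar>\<Phi> 0\<bar> + L * \<bar>u x\<bar>) * Z)" .
  qed
qed

text \<open>For a \<open>C^1\<close> approximant the product with \<open>\<phi>\<close> has compact
  support, so the integral of its derivative vanishes; the identity passes to the limit in
  \<open>L^1\<close> because \<open>\<phi>\<close> and its gradient are bounded on
  \<open>K\<close>.\<close>

lemma integration_by_parts:
  assumes \<phi>: "\<And>x. (\<phi> has_derivative (\<lambda>h. D\<phi> x \<bullet> h)) (at x)" "continuous_on UNIV D\<phi>"
  shows "(LINT x|lebesgue_on K. w x * D\<phi> x $ i) = - (LINT x|lebesgue_on K. Dw x $ i * \<phi> x)"
proof -
  obtain f G where fG: "C1_approx f G" using C1_approx_exists by blast
  have f: "(f k has_derivative (\<lambda>h. G k x \<bullet> h)) (at x)" "continuous_on UNIV (G k)" "x \<notin> K \<Longrightarrow> f k x = 0" for k x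
    using fG by (simp_all add: C1_approx_def)
  have e: "(\<lambda>k. \<integral>\<^sup>+x. ennreal \<bar>f k x - w x\<bar> \<partial>lebesgue_on K) \<longlonglongrightarrow> 0"
    "(\<lambda>k. \<integral>\<^sup>+x. ennreal (norm (G k x - Dw x)) \<partial>lebesgue_on K) \<longlonglongrightarrow> 0"
    and AE: "AE x in lebesgue_on K. (\<lambda>k. f k x) \<longlonglongrightarrow> w x"
    using fG by (simp_all add: C1_approx_def)
  have cf: "continuous_on UNIV (f k)" for k
    by (rule has_derivative_continuous_on) (rule has_derivative_at_withinI[OF f(1)])
  have c\<phi>: "continuous_on UNIV \<phi>"
    by (rule has_derivative_continuous_on) (rule has_derivative_at_withinI[OF \<phi>(1)])
  have [measurable]: "f k \<in> borel_measurable (lebesgue_on K)" "G k \<in> borel_measurable (lebesgue_on K)"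
     "\<phi> \<in> borel_measurable (lebesgue_on K)" "D\<phi> \<in> borel_measurable (lebesgue_on K)" for k
    using cf f(2) \<phi> c\<phi> by (auto intro: continuous_measurable_lebesgue_on)
  have [measurable]: "(\<lambda>x. D\<phi> x $ i) \<in> borel_measurable (lebesgue_on K)"
    by (intro continuous_measurable_lebesgue_on continuous_intros \<phi>(2))
  have zero: "(LINT x|lebesgue_on K. f k x * D\<phi> x $ i + G k x $ i * \<phi> x) = 0" for k
  proof -
    have d: "((\<lambda>x. f k x * \<phi> x) has_derivative (\<lambda>h. (f k x *\<^sub>R D\<phi> x + \<phi> x *\<^sub>R G k x) \<bullet> h)) (at x)" for x
      using has_derivative_mult[OF f(1) \<phi>(1)] by (simp add: inner_add_left mult.commute)
    have "continuous_on UNIV (\<lambda>x. f k x *\<^sub>R D\<phi> x + \<phi> x *\<^sub>R G k x)"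
      by (intro continuous_intros cf \<phi>(2) c\<phi> f(2))
    from C1_compact_support_integral_zero[OF d this K(1), of "axis i 1"] f(3)
    show ?thesis by (simp add: inner_add_left inner_axis mult.commute)
  qed
  have "bounded ((\<lambda>x. (D\<phi> x, \<phi> x)) ` K)"
    using K(1) by (intro compact_imp_bounded compact_continuous_image continuous_on_Pair)
      (auto intro: continuous_on_subset[OF \<phi>(2)] continuous_on_subset[OF c\<phi>])
  then obtain B where B: "\<forall>x\<in>K. norm (D\<phi> x, \<phi> x) \<le> B" by (auto simp: bounded_iff)
  have B1: "\<bar>D\<phi> x $ i\<bar> \<le> \<bar>B\<bar>" "\<bar>\<phi> x\<bar> \<le> \<bar>B\<bar>" if "x \<in> K" for x
    using B that norm_fst_le[of "D\<phi> x" "\<phi> x"] norm_snd_le[of "\<phi> x" "D\<phi> x"] component_le_norm_cart[of "D\<phi> x" i]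
    by (fastforce)+
  have bd: "integrable (lebesgue_on K) (\<lambda>x. a x * c x)"
    if "integrable (lebesgue_on K) a" and [measurable]: "c \<in> borel_measurable (lebesgue_on K)" and "\<And>x. x \<in> K \<Longrightarrow> \<bar>c x\<bar> \<le> \<bar>B\<bar>"
    for a c :: "real ^ 'n \<Rightarrow> real"
  proof (rule Bochner_Integration.integrable_bound[where f = "\<lambda>x. \<bar>B\<bar> * a x"])
    show "integrable (lebesgue_on K) (\<lambda>x. \<bar>B\<bar> * a x)" using that(1) by simp
    have [measurable]: "a \<in> borel_measurable (lebesgue_on K)" using that(1) by simp
    show "(\<lambda>x. a x * c x) \<in> borel_measurable (lebesgue_on K)" by measurable
    show "AE x in lebesgue_on K. norm (a x * c x) \<le> norm (\<bar>B\<bar> * a x)"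
      using that(3) by (intro AE_I2) (auto simp: abs_mult space_restrict_space mult.commute[of "\<bar>B\<bar>"] intro!: mult_left_mono)
  qed
  have Dwi: "integrable (lebesgue_on K) (\<lambda>x. Dw x $ i)"
    using integrable_inner_left[of "axis i 1" "lebesgue_on K" Dw] w_integrable(2) by (simp add: inner_axis)
  have Gi: "integrable (lebesgue_on K) (\<lambda>x. G k x $ i)" for k
    by (rule continuous_integrable_lebesgue_on[OF _ K(1)]) (intro continuous_intros f(2))
  have fi: "integrable (lebesgue_on K) (f k)" for k
    by (rule continuous_integrable_lebesgue_on[OF cf K(1)])
  have i1: "integrable (lebesgue_on K) (\<lambda>x. w x * D\<phi> x $ i)" by (rule bd[OF w_integrable(1)]) (use B1 in simp_all)
  have i2: "integrable (lebesgue_on K) (\<lambda>x. Dw x $ i * \<phi> x)" by (rule bd[OF Dwi]) (use B1 in simp_all)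
  have i3: "integrable (lebesgue_on K) (\<lambda>x. f k x * D\<phi> x $ i)" for k by (rule bd[OF fi]) (use B1 in simp_all)
  have i4: "integrable (lebesgue_on K) (\<lambda>x. G k x $ i * \<phi> x)" for k by (rule bd[OF Gi]) (use B1 in simp_all)
  have "(\<lambda>k. LINT x|lebesgue_on K. f k x * D\<phi> x $ i + G k x $ i * \<phi> x)
     \<longlonglongrightarrow> (LINT x|lebesgue_on K. w x * D\<phi> x $ i + Dw x $ i * \<phi> x)"
  proof (rule tendsto_L1_int)
    have lim: "(\<lambda>k. ennreal \<bar>B\<bar> * (\<integral>\<^sup>+x. ennreal \<bar>f k x - w x\<bar> \<partial>lebesgue_on K)
       + ennreal \<bar>B\<bar> * (\<integral>\<^sup>+x. ennreal (norm (G k x - Dw x)) \<partial>lebesgue_on K)) \<longlonglongrightarrow> 0"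
      using tendsto_add[OF ennreal_tendsto_cmult[OF _ e(1), of "ennreal \<bar>B\<bar>"] ennreal_tendsto_cmult[OF _ e(2), of "ennreal \<bar>B\<bar>"]]
      by simp
    have "(\<integral>\<^sup>+x. norm (f k x * D\<phi> x $ i + G k x $ i * \<phi> x - (w x * D\<phi> x $ i + Dw x $ i * \<phi> x)) \<partial>lebesgue_on K)
       \<le> ennreal \<bar>B\<bar> * (\<integral>\<^sup>+x. ennreal \<bar>f k x - w x\<bar> \<partial>lebesgue_on K)
       + ennreal \<bar>B\<bar> * (\<integral>\<^sup>+x. ennreal (norm (G k x - Dw x)) \<partial>lebesgue_on K)" for k
    proof -
      have "(\<integral>\<^sup>+x. norm (f k x * D\<phi> x $ i + G k x $ i * \<phi> x - (w x * D\<phi> x $ i + Dw x $ i * \<phi> x)) \<partial>lebesgue_on K)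
        \<le> (\<integral>\<^sup>+x. ennreal \<bar>B\<bar> * ennreal \<bar>f k x - w x\<bar> + ennreal \<bar>B\<bar> * ennreal (norm (G k x - Dw x)) \<partial>lebesgue_on K)"
      proof (rule nn_integral_mono)
        fix x assume "x \<in> space (lebesgue_on K)"
        then have x: "x \<in> K" by (simp add: space_restrict_space)
        have "norm (f k x * D\<phi> x $ i + G k x $ i * \<phi> x - (w x * D\<phi> x $ i + Dw x $ i * \<phi> x))
          = norm ((f k x - w x) * D\<phi> x $ i + (G k x - Dw x) $ i * \<phi> x)" by (simp add: algebra_simps)
        also have "\<dots> \<le> \<bar>f k x - w x\<bar> * \<bar>D\<phi> x $ i\<bar> + \<bar>(G k x - Dw x) $ i\<bar> * \<bar>\<phi> x\<bar>"
          by (rule norm_triangle_le) (simp add: abs_mult)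
        also have "\<dots> \<le> \<bar>f k x - w x\<bar> * \<bar>B\<bar> + norm (G k x - Dw x) * \<bar>B\<bar>"
          using B1[OF x] component_le_norm_cart[of "G k x - Dw x" i] by (intro add_mono mult_mono) auto
        finally show "ennreal (norm (f k x * D\<phi> x $ i + G k x $ i * \<phi> x - (w x * D\<phi> x $ i + Dw x $ i * \<phi> x)))
           \<le> ennreal \<bar>B\<bar> * ennreal \<bar>f k x - w x\<bar> + ennreal \<bar>B\<bar> * ennreal (norm (G k x - Dw x))"
          by (simp add: ennreal_mult[symmetric] ennreal_plus[symmetric] mult.commute ennreal_leI del: ennreal_plus)
      qed
      also have "\<dots> = ennreal \<bar>B\<bar> * (\<integral>\<^sup>+x. ennreal \<bar>f k x - w x\<bar> \<partial>lebesgue_on K)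
       + ennreal \<bar>B\<bar> * (\<integral>\<^sup>+x. ennreal (norm (G k x - Dw x)) \<partial>lebesgue_on K)"
        by (simp add: nn_integral_add nn_integral_cmult)
      finally show ?thesis .
    qed
    then show "(\<lambda>k. \<integral>\<^sup>+x. norm (f k x * D\<phi> x $ i + G k x $ i * \<phi> x - (w x * D\<phi> x $ i + Dw x $ i * \<phi> x)) \<partial>lebesgue_on K) \<longlonglongrightarrow> 0"
      by (intro tendsto_sandwich[OF _ _ tendsto_const lim]) (auto intro!: always_eventually)
  qed (use i1 i2 i3 i4 in auto)
  then have "(LINT x|lebesgue_on K. w x * D\<phi> x $ i + Dw x $ i * \<phi> x) = 0"
    unfolding zero using LIMSEQ_unique tendsto_const by blast
  then show ?thesis using i1 i2 by (simp add: add_eq_0_iff2)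
qed

text \<open>The inequality for the approximants passes to the limit by Fatou's lemma on the left. On
  the right the \<open>L^1\<close> norms of the gradients are eventually below
  \<open>A + \<epsilon>\<close>, and \<epsilon> is sent to 0 by continuity of the power.\<close>

lemma gagliardo_nirenberg_w:
  assumes dim: "2 \<le> CARD('n)"
  defines "N' \<equiv> real CARD('n) / (real CARD('n) - 1)"
  shows "(\<integral>\<^sup>+x. ennreal (\<bar>w x\<bar> powr N') \<partial>lebesgue_on K) \<le> epow (\<integral>\<^sup>+x. ennreal (norm (Dw x)) \<partial>lebesgue_on K) N'"
proof -
  obtain f G where fG: "C1_approx f G" using C1_approx_exists by blast
  have f: "(f k has_derivative (\<lambda>h. G k x \<bullet> h)) (at x)" "continuous_on UNIV (G k)" "x \<notin> K \<Longrightarrow> f k x = 0" for k x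
    using fG by (simp_all add: C1_approx_def)
  have e: "(\<lambda>k. \<integral>\<^sup>+x. ennreal \<bar>f k x - w x\<bar> \<partial>lebesgue_on K) \<longlonglongrightarrow> 0"
    "(\<lambda>k. \<integral>\<^sup>+x. ennreal (norm (G k x - Dw x)) \<partial>lebesgue_on K) \<longlonglongrightarrow> 0"
    and AE: "AE x in lebesgue_on K. (\<lambda>k. f k x) \<longlonglongrightarrow> w x"
    using fG by (simp_all add: C1_approx_def)
  have cf: "continuous_on UNIV (f k)" for k
    by (rule has_derivative_continuous_on) (rule has_derivative_at_withinI[OF f(1)])
  have [measurable]: "f k \<in> borel_measurable (lebesgue_on K)" "G k \<in> borel_measurable (lebesgue_on K)" for k
    using cf f(2) by (auto intro: continuous_measurable_lebesgue_on)
  have N': "0 < N'" using dim by (auto simp: N'_def)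
  define A where "A = (LINT x|lebesgue_on K. norm (Dw x))"
  have A: "0 \<le> A" "(\<integral>\<^sup>+x. ennreal (norm (Dw x)) \<partial>lebesgue_on K) = ennreal A"
    unfolding A_def using w_integrable(2) by (auto simp: nn_integral_eq_integral)
  have G0: "G k x = 0" if "x \<notin> K" for k x
    by (rule gradient_eq_0_outside_support[OF f(1) _ f(3) that]) (use K in \<open>auto intro: compact_imp_closed\<close>)
  have GN: "(\<integral>\<^sup>+x. ennreal (\<bar>f k x\<bar> powr N') \<partial>lebesgue_on K) \<le> epow (\<integral>\<^sup>+x. ennreal (norm (G k x)) \<partial>lebesgue_on K) N'" for k
    using gagliardo_nirenberg[OF _ f(1) f(2) compact_imp_bounded[OF K(1)] f(3)] dim f(3) G0 Km
    by (simp add: nn_integral_lebesgue_on_vanish N'_def)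
  have bound: "(\<integral>\<^sup>+x. ennreal (\<bar>w x\<bar> powr N') \<partial>lebesgue_on K) \<le> ennreal ((A + \<epsilon>) powr N')" if \<epsilon>: "0 < \<epsilon>" for \<epsilon>
  proof -
    have "(\<integral>\<^sup>+x. ennreal (\<bar>w x\<bar> powr N') \<partial>lebesgue_on K) = (\<integral>\<^sup>+x. liminf (\<lambda>k. ennreal (\<bar>f k x\<bar> powr N')) \<partial>lebesgue_on K)"
    proof (rule nn_integral_cong_AE, use AE in eventually_elim)
      fix x assume "(\<lambda>k. f k x) \<longlonglongrightarrow> w x"
      then have "(\<lambda>k. \<bar>f k x\<bar> powr N') \<longlonglongrightarrow> \<bar>w x\<bar> powr N'"
        using N' by (intro tendsto_powr' tendsto_intros) auto
      then have "(\<lambda>k. ennreal (\<bar>f k x\<bar> powr N')) \<longlonglongrightarrow> ennreal (\<bar>w x\<bar> powr N')" by (rule tendsto_ennrealI)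
      then show "ennreal (\<bar>w x\<bar> powr N') = liminf (\<lambda>k. ennreal (\<bar>f k x\<bar> powr N'))"
        by (intro lim_imp_Liminf[symmetric]) auto
    qed
    also have "\<dots> \<le> liminf (\<lambda>k. \<integral>\<^sup>+x. ennreal (\<bar>f k x\<bar> powr N') \<partial>lebesgue_on K)"
      by (rule nn_integral_liminf) measurable
    also have "\<dots> \<le> liminf (\<lambda>k. ennreal ((A + \<epsilon>) powr N'))"
    proof (rule Liminf_mono)
      have "eventually (\<lambda>k. (\<integral>\<^sup>+x. ennreal (norm (G k x - Dw x)) \<partial>lebesgue_on K) < ennreal \<epsilon>) sequentially"
        using e(2) \<epsilon> by (intro order_tendstoD) auto
      then show "\<forall>\<^sub>F k in sequentially. (\<integral>\<^sup>+x. ennreal (\<bar>f k x\<bar> powr N') \<partial>lebesgue_on K) \<le> ennreal ((A + \<epsilon>) powr N')"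
      proof eventually_elim
        fix k assume k: "(\<integral>\<^sup>+x. ennreal (norm (G k x - Dw x)) \<partial>lebesgue_on K) < ennreal \<epsilon>"
        have "(\<integral>\<^sup>+x. ennreal (norm (G k x)) \<partial>lebesgue_on K)
          \<le> (\<integral>\<^sup>+x. ennreal (norm (Dw x)) + ennreal (norm (G k x - Dw x)) \<partial>lebesgue_on K)"
          by (intro nn_integral_mono) (auto simp: ennreal_plus[symmetric] simp del: ennreal_plus intro!: ennreal_leI norm_triangle_sub)
        also have "\<dots> = ennreal A + (\<integral>\<^sup>+x. ennreal (norm (G k x - Dw x)) \<partial>lebesgue_on K)"
          using A(2) by (simp add: nn_integral_add)
        also have "\<dots> \<le> ennreal (A + \<epsilon>)" using k A \<epsilon> by (simp add: less_imp_le add_left_mono)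
        finally have "epow (\<integral>\<^sup>+x. ennreal (norm (G k x)) \<partial>lebesgue_on K) N' \<le> epow (ennreal (A + \<epsilon>)) N'"
          using N' by (intro epow_mono) simp_all
        also have "epow (ennreal (A + \<epsilon>)) N' = ennreal ((A + \<epsilon>) powr N')"
          using A(1) \<epsilon> by (intro epow_ennreal) simp
        finally have "epow (\<integral>\<^sup>+x. ennreal (norm (G k x)) \<partial>lebesgue_on K) N' \<le> ennreal ((A + \<epsilon>) powr N')" .
        then show "(\<integral>\<^sup>+x. ennreal (\<bar>f k x\<bar> powr N') \<partial>lebesgue_on K) \<le> ennreal ((A + \<epsilon>) powr N')"
          by (rule order_trans[OF GN[of k]])
      qed
    qed
    also have "\<dots> = ennreal ((A + \<epsilon>) powr N')" by (simp add: Liminf_const)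
    finally show ?thesis .
  qed
  have "(\<lambda>n. ennreal ((A + inverse (real (Suc n))) powr N')) \<longlonglongrightarrow> ennreal ((A + 0) powr N')"
    using N' A by (intro tendsto_ennrealI tendsto_powr' tendsto_intros LIMSEQ_inverse_real_of_nat) auto
  then have "(\<integral>\<^sup>+x. ennreal (\<bar>w x\<bar> powr N') \<partial>lebesgue_on K) \<le> ennreal ((A + 0) powr N')"
    by (rule LIMSEQ_le_const) (auto intro!: exI[of _ 0] bound)
  then show ?thesis using A by (simp add: epow_ennreal)
qed

end

section \<open>Sobolev membership of the composed functions\<close>

lemma powr_add_le_2:
  assumes "0 \<le> a" "0 \<le> b" "0 \<le> (s::real)"
  shows "(a + b) powr s \<le> 2 powr s * (a powr s + b powr s)"
proof -
  have "(a + b) powr s \<le> (2 * max a b) powr s" using assms by (intro powr_mono2) auto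
  also have "\<dots> = 2 powr s * (max a b) powr s" by (rule powr_mult)
  also have "\<dots> \<le> 2 powr s * (a powr s + b powr s)"
    by (intro mult_left_mono) (auto simp: max_def)
  finally show ?thesis .
qed

lemma Lp_extend:
  fixes f :: "'a::euclidean_space \<Rightarrow> 'b::euclidean_space"
  assumes f: "Lp s K f" and K: "K \<in> sets lebesgue" "\<Omega> \<in> sets lebesgue" "K \<subseteq> \<Omega>" and 0: "\<And>x. x \<notin> K \<Longrightarrow> f x = 0"
  shows "Lp s \<Omega> f"
proof -
  have eq: "(\<lambda>x. indicator \<Omega> x *\<^sub>R f x) = (\<lambda>x. indicator K x *\<^sub>R f x)"
    and eq': "(\<lambda>x. indicator \<Omega> x *\<^sub>R (norm (f x) powr s)) = (\<lambda>x. indicator K x *\<^sub>R (norm (f x) powr s))"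
    using 0 K(3) by (auto simp: indicator_def fun_eq_iff)
  have sp: "\<Omega> \<inter> space lebesgue \<in> sets lebesgue" "K \<inter> space lebesgue \<in> sets lebesgue" using K by auto
  show ?thesis using f
    unfolding Lp_def borel_measurable_restrict_space_iff[OF sp(1)] borel_measurable_restrict_space_iff[OF sp(2)]
      integrable_restrict_space[OF sp(1)] integrable_restrict_space[OF sp(2)] eq eq' .
qed

lemma Lp_subset:
  fixes f :: "'a::euclidean_space \<Rightarrow> 'b::euclidean_space"
  assumes f: "Lp s \<Omega> f" and K: "K \<in> sets lebesgue" "\<Omega> \<in> sets lebesgue" "K \<subseteq> \<Omega>"
  shows "Lp s K f"
proof -
  have sp: "\<Omega> \<inter> space lebesgue \<in> sets lebesgue" "K \<inter> space lebesgue \<in> sets lebesgue" using K by auto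
  have "integrable lebesgue (\<lambda>x. indicator \<Omega> x *\<^sub>R (norm (f x) powr s))"
    using f unfolding Lp_def integrable_restrict_space[OF sp(1)] by simp
  from integrable_mult_indicator[OF K(1) this]
  have "integrable lebesgue (\<lambda>x. indicator K x *\<^sub>R (indicator \<Omega> x *\<^sub>R (norm (f x) powr s)))" .
  moreover have "(\<lambda>x. indicator K x *\<^sub>R (indicator \<Omega> x *\<^sub>R (norm (f x) powr s))) = (\<lambda>x. indicator K x *\<^sub>R (norm (f x) powr s))"
    using K(3) by (auto simp: indicator_def fun_eq_iff)
  ultimately have "integrable (lebesgue_on K) (\<lambda>x. norm (f x) powr s)"
    unfolding integrable_restrict_space[OF sp(2)] by simp
  moreover have "f \<in> borel_measurable (lebesgue_on K)"
    using f K(3) measurable_restrict_mono unfolding Lp_def by blast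
  ultimately show ?thesis unfolding Lp_def by simp
qed

lemma Lp_dominated:
  fixes f :: "'a::euclidean_space \<Rightarrow> 'b::euclidean_space" and g :: "'a \<Rightarrow> 'c::euclidean_space" and h :: "'a \<Rightarrow> 'd::euclidean_space"
  assumes K: "compact K" and f [measurable]: "f \<in> borel_measurable (lebesgue_on K)" and g: "Lp s K g" and h: "Lp s K h"
    and s: "0 \<le> s" and AB: "0 \<le> A" "0 \<le> B" "0 \<le> C"
    and le: "\<And>x. x \<in> K \<Longrightarrow> norm (f x) \<le> A + (B * norm (g x) + C * norm (h x))"
  shows "Lp s K f"
proof -
  interpret finite_measure "lebesgue_on K" by (rule finite_measure_lebesgue_on_compact[OF K])
  define F where "F x = 2 powr s * (A powr s + 2 powr s * (B powr s * norm (g x) powr s + C powr s * norm (h x) powr s))" for x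
  have i: "integrable (lebesgue_on K) F" using g h unfolding F_def Lp_def by simp
  have "integrable (lebesgue_on K) (\<lambda>x. norm (f x) powr s)"
  proof (rule Bochner_Integration.integrable_bound[OF i])
    show "AE x in lebesgue_on K. norm (norm (f x) powr s) \<le> norm (F x)"
    proof (rule AE_I2)
      fix x assume "x \<in> space (lebesgue_on K)"
      then have x: "x \<in> K" by (simp add: space_restrict_space)
      have "norm (f x) powr s \<le> (A + (B * norm (g x) + C * norm (h x))) powr s"
        using le[OF x] s by (intro powr_mono2) auto
      also have "\<dots> \<le> 2 powr s * (A powr s + (B * norm (g x) + C * norm (h x)) powr s)"
        using AB s by (intro powr_add_le_2) auto
      also have "\<dots> \<le> 2 powr s * (A powr s + 2 powr s * ((B * norm (g x)) powr s + (C * norm (h x)) powr s))"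
        using AB s by (intro mult_left_mono add_left_mono powr_add_le_2) auto
      also have "\<dots> = F x" unfolding F_def by (simp only: powr_mult)
      finally have "norm (f x) powr s \<le> F x" .
      then show "norm (norm (f x) powr s) \<le> norm (F x)" unfolding real_norm_def using abs_ge_self[of "F x"] by (simp only: abs_of_nonneg powr_ge_zero)
    qed
  qed measurable
  then show ?thesis by (simp add: Lp_def)
qed

context cutoff_composition
begin

lemma sobolev_w:
  assumes q: "1 \<le> q" and Lp: "Lp_loc q \<Omega> u" "Lp_loc q \<Omega> Du"
  shows "sobolev q \<Omega> w Dw"
proof -
  obtain Z where Z: "0 \<le> Z" "\<And>x. \<bar>\<zeta> x\<bar> \<le> Z" "\<And>x. norm (D\<zeta> x) \<le> Z" using bounds by blast
  have \<Omega>m: "\<Omega> \<in> sets lebesgue" using \<Omega> by auto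
  have gr: "\<bar>\<Phi> t\<bar> \<le> \<bar>\<Phi> 0\<bar> + L * \<bar>t\<bar>" for t
    using bounded_derivative_lipschitz[OF \<Phi> \<Phi>'(2), of t 0] by simp
  have Lu: "Lp q K u" "Lp q K Du" using Lp K by (auto simp: Lp_loc_def)
  have wK: "Lp q K w"
  proof (rule Lp_dominated[OF K(1) wbm(1) Lu(1) Lu(1), of "\<bar>\<Phi> 0\<bar> * Z" "L * Z" 0])
    fix x
    have "\<bar>\<Phi> (u x)\<bar> * \<bar>\<zeta> x\<bar> \<le> (\<bar>\<Phi> 0\<bar> + L * \<bar>u x\<bar>) * Z" using gr Z L_nonneg by (intro mult_mono) auto
    then show "norm (w x) \<le> \<bar>\<Phi> 0\<bar> * Z + (L * Z * norm (u x) + 0 * norm (u x))" by (simp add: w_def abs_mult algebra_simps)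
  qed (use q Z L_nonneg in auto)
  have DwK: "Lp q K Dw"
  proof (rule Lp_dominated[OF K(1) wbm(2) Lu(1) Lu(2), of "\<bar>\<Phi> 0\<bar> * Z" "L * Z" "L * Z"])
    fix x
    have "norm (Dw x) \<le> \<bar>\<Phi>' (u x)\<bar> * \<bar>\<zeta> x\<bar> * norm (Du x) + \<bar>\<Phi> (u x)\<bar> * norm (D\<zeta> x)"
      unfolding Dw_def by (rule norm_triangle_le) (simp add: abs_mult)
    also have "\<dots> \<le> L * Z * norm (Du x) + (\<bar>\<Phi> 0\<bar> + L * \<bar>u x\<bar>) * Z"
      using gr Z L_nonneg \<Phi>' by (intro add_mono mult_mono) auto
    finally show "norm (Dw x) \<le> \<bar>\<Phi> 0\<bar> * Z + (L * Z * norm (u x) + L * Z * norm (Du x))" by (simp add: algebra_simps)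
  qed (use q Z L_nonneg in auto)
  have w1: "Lp 1 K w" "Lp 1 K Dw" using w_integrable by (auto simp: Lp_def)
  have loc: "Lp_loc 1 \<Omega> w" "Lp_loc 1 \<Omega> Dw"
    unfolding Lp_loc_def
    using Lp_subset[OF Lp_extend[OF w1(1) Km \<Omega>m K(2) vanish(1)] _ \<Omega>m]
      Lp_subset[OF Lp_extend[OF w1(2) Km \<Omega>m K(2) vanish(2)] _ \<Omega>m] by (auto simp: borel_compact)
  have "(LINT x|lebesgue_on \<Omega>. w x * partial_deriv i \<phi> x) = - (LINT x|lebesgue_on \<Omega>. (Dw x $ i) * \<phi> x)"
    if "test_function \<Omega> \<phi>" for \<phi> i
  proof -
    have "Ck (Suc 0) \<phi>" using that unfolding test_function_def by blast
    note g = Ck_has_grad[OF this]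
    have "(LINT x|lebesgue_on K. w x * grad \<phi> x $ i) = - (LINT x|lebesgue_on K. Dw x $ i * \<phi> x)"
      by (rule integration_by_parts[OF g])
    moreover have "(LINT x|lebesgue_on \<Omega>. w x * partial_deriv i \<phi> x) = (LINT x|lebesgue_on K. w x * partial_deriv i \<phi> x)"
      using vanish by (intro set_integral_lebesgue_on_vanish Km \<Omega>m K) auto
    moreover have "(LINT x|lebesgue_on \<Omega>. (Dw x $ i) * \<phi> x) = (LINT x|lebesgue_on K. (Dw x $ i) * \<phi> x)"
      using vanish by (intro set_integral_lebesgue_on_vanish Km \<Omega>m K) auto
    ultimately show ?thesis by (simp add: grad_def)
  qed
  then have "weak_gradient \<Omega> w Dw" unfolding weak_gradient_def using loc by blast
  moreover have "Lp q \<Omega> w" by (rule Lp_extend[OF wK Km \<Omega>m K(2) vanish(1)])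
  moreover have "Lp q \<Omega> Dw" by (rule Lp_extend[OF DwK Km \<Omega>m K(2) vanish(2)])
  ultimately show ?thesis unfolding sobolev_def by blast
qed

lemma compactly_contained_w: "compactly_contained {x \<in> \<Omega>. w x \<noteq> 0} \<Omega>"
proof -
  have "{x \<in> \<Omega>. w x \<noteq> 0} \<subseteq> K" using vanish(1) by blast
  then have "closure {x \<in> \<Omega>. w x \<noteq> 0} \<subseteq> K" by (simp add: closure_minimal K(1) compact_imp_closed)
  then show ?thesis unfolding compactly_contained_def
    using K by (meson bounded_subset closed_closure compact_eq_bounded_closed subset_trans)
qed

end


section \<open>Hoelder's inequality with the reciprocal exponents as weights\<close>

lemma powr_mult_le_weighted:
  assumes "0 \<le> \<alpha>" "0 \<le> \<beta>" "\<alpha> + \<beta> = 1" "0 \<le> a" "0 \<le> (b::real)"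
  shows "a powr \<alpha> * b powr \<beta> \<le> \<alpha> * a + \<beta> * b"
proof (cases "a = 0 \<or> b = 0")
  case False
  then show ?thesis using assms by (intro Youngs_inequality_0) auto
qed (use assms in auto)

text \<open>Divide by the integrals and use the weighted arithmetic-geometric mean inequality. The
  weights are allowed to vanish, which occurs in the Sobolev estimate: there the weight
  \<open>rst\<close> is zero for the critical exponent.\<close>

lemma holder_powr:
  fixes f g :: "'a \<Rightarrow> real"
  assumes f: "integrable M f" and g: "integrable M g" and f0: "\<And>x. 0 \<le> f x" and g0: "\<And>x. 0 \<le> g x"
    and ab: "0 \<le> \<alpha>" "0 \<le> \<beta>" "\<alpha> + \<beta> = 1"
  shows "integrable M (\<lambda>x. f x powr \<alpha> * g x powr \<beta>)"
    and "(LINT x|M. f x powr \<alpha> * g x powr \<beta>) \<le> (LINT x|M. f x) powr \<alpha> * (LINT x|M. g x) powr \<beta>"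
proof -
  have [measurable]: "f \<in> borel_measurable M" "g \<in> borel_measurable M" using f g by auto
  show i: "integrable M (\<lambda>x. f x powr \<alpha> * g x powr \<beta>)"
  proof (rule Bochner_Integration.integrable_bound[where f = "\<lambda>x. \<alpha> * f x + \<beta> * g x"])
    show "AE x in M. norm (f x powr \<alpha> * g x powr \<beta>) \<le> norm (\<alpha> * f x + \<beta> * g x)"
      using powr_mult_le_weighted[OF ab f0 g0] ab f0 g0 by (intro AE_I2) (simp add: abs_mult)
  qed (use f g in auto)
  let ?F = "LINT x|M. f x" and ?G = "LINT x|M. g x"
  have F0: "0 \<le> ?F" "0 \<le> ?G" using f0 g0 by (auto intro: Bochner_Integration.integral_nonneg)
  show "(LINT x|M. f x powr \<alpha> * g x powr \<beta>) \<le> ?F powr \<alpha> * ?G powr \<beta>"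
  proof (cases "?F = 0 \<or> ?G = 0")
    case True
    then have "(AE x in M. f x = 0) \<or> (AE x in M. g x = 0)"
      using integral_nonneg_eq_0_iff_AE[OF f] integral_nonneg_eq_0_iff_AE[OF g] f0 g0 by auto
    then have "AE x in M. f x powr \<alpha> * g x powr \<beta> = 0"
      by (elim disjE) (auto elim!: eventually_mono)
    then have "(LINT x|M. f x powr \<alpha> * g x powr \<beta>) = 0" by (simp add: integral_eq_zero_AE)
    then show ?thesis by simp
  next
    case False
    then have pos: "0 < ?F" "0 < ?G" using F0 by auto
    have "f x powr \<alpha> * g x powr \<beta> \<le> ?F powr \<alpha> * ?G powr \<beta> * (\<alpha> * (f x / ?F) + \<beta> * (g x / ?G))" for x
    proof -
      have "(f x / ?F) powr \<alpha> * (g x / ?G) powr \<beta> \<le> \<alpha> * (f x / ?F) + \<beta> * (g x / ?G)"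
        using f0 g0 pos by (intro powr_mult_le_weighted ab) auto
      then have "?F powr \<alpha> * ?G powr \<beta> * ((f x / ?F) powr \<alpha> * (g x / ?G) powr \<beta>)
        \<le> ?F powr \<alpha> * ?G powr \<beta> * (\<alpha> * (f x / ?F) + \<beta> * (g x / ?G))"
        by (intro mult_left_mono) auto
      moreover have "?F powr \<alpha> * ?G powr \<beta> * ((f x / ?F) powr \<alpha> * (g x / ?G) powr \<beta>) = f x powr \<alpha> * g x powr \<beta>"
        using f0 g0 pos by (simp add: powr_divide)
      ultimately show ?thesis by simp
    qed
    then have "(LINT x|M. f x powr \<alpha> * g x powr \<beta>)
        \<le> (LINT x|M. ?F powr \<alpha> * ?G powr \<beta> * (\<alpha> * (f x / ?F) + \<beta> * (g x / ?G)))"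
      using f g by (intro integral_mono i) auto
    also have "\<dots> = ?F powr \<alpha> * ?G powr \<beta> * (\<alpha> * (?F / ?F) + \<beta> * (?G / ?G))"
      using f g by simp
    also have "\<dots> = ?F powr \<alpha> * ?G powr \<beta>" using pos ab(3) by simp
    finally show ?thesis .
  qed
qed

lemma holder_powr_3:
  fixes f g h :: "'a \<Rightarrow> real"
  assumes f: "integrable M f" and g: "integrable M g" and h: "integrable M h"
    and f0: "\<And>x. 0 \<le> f x" and g0: "\<And>x. 0 \<le> g x" and h0: "\<And>x. 0 \<le> h x"
    and ab: "0 < \<alpha>" "0 \<le> \<beta>" "0 \<le> \<gamma>" "\<alpha> + \<beta> + \<gamma> = 1"
  shows "integrable M (\<lambda>x. f x powr \<alpha> * g x powr \<beta> * h x powr \<gamma>)"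
    and "(LINT x|M. f x powr \<alpha> * g x powr \<beta> * h x powr \<gamma>)
       \<le> (LINT x|M. f x) powr \<alpha> * (LINT x|M. g x) powr \<beta> * (LINT x|M. h x) powr \<gamma>"
proof -
  define s where "s = \<alpha> + \<beta>"
  have s: "0 < s" "\<alpha> / s + \<beta> / s = 1" using ab by (auto simp: s_def add_divide_distrib[symmetric])
  define F where "F x = f x powr (\<alpha> / s) * g x powr (\<beta> / s)" for x
  have F: "integrable M F" "(LINT x|M. F x) \<le> (LINT x|M. f x) powr (\<alpha> / s) * (LINT x|M. g x) powr (\<beta> / s)"
    unfolding F_def using holder_powr[OF f g f0 g0 _ _ s(2)] ab s by auto
  have F0: "0 \<le> F x" for x by (simp add: F_def)
  have eq: "F x powr s = f x powr \<alpha> * g x powr \<beta>" for x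
    using s by (simp add: F_def powr_mult powr_powr)
  have s1: "s + \<gamma> = 1" using ab by (simp add: s_def)
  note H = holder_powr[OF F(1) h F0 h0 less_imp_le[OF s(1)] ab(3) s1, unfolded eq]
  show "integrable M (\<lambda>x. f x powr \<alpha> * g x powr \<beta> * h x powr \<gamma>)" by (rule H(1))
  have "(LINT x|M. F x) powr s \<le> ((LINT x|M. f x) powr (\<alpha> / s) * (LINT x|M. g x) powr (\<beta> / s)) powr s"
    using F F0 s by (intro powr_mono2) auto
  also have "\<dots> = (LINT x|M. f x) powr \<alpha> * (LINT x|M. g x) powr \<beta>"
    using s by (simp add: powr_mult powr_powr)
  finally show "(LINT x|M. f x powr \<alpha> * g x powr \<beta> * h x powr \<gamma>)
       \<le> (LINT x|M. f x) powr \<alpha> * (LINT x|M. g x) powr \<beta> * (LINT x|M. h x) powr \<gamma>"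
    using H(2) by (meson mult_right_mono order_trans powr_ge_zero)
qed

section \<open>Truncations and cutoffs\<close>

lemma powr_pos_part_has_derivative:
  assumes "1 < (\<mu>::real)"
  shows "((\<lambda>t. max 0 t powr \<mu>) has_real_derivative \<mu> * max 0 t powr (\<mu> - 1)) (at t)"
proof -
  consider "t > 0" | "t < 0" | "t = 0" by linarith
  then show ?thesis
  proof cases
    case 1
    have "((\<lambda>t. t powr \<mu>) has_real_derivative \<mu> * t powr (\<mu> - 1)) (at t)"
      using 1 by (rule has_real_derivative_powr)
    then have "((\<lambda>t. max 0 t powr \<mu>) has_real_derivative \<mu> * t powr (\<mu> - 1)) (at t)"
      by (rule has_field_derivative_transform_within_open[of _ _ _ "{0<..}"]) (use 1 in auto)
    then show ?thesis using 1 by (simp add: max_def)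
  next
    case 2
    have "((\<lambda>t. 0) has_real_derivative 0) (at t)" by simp
    then have "((\<lambda>t. max 0 t powr \<mu>) has_real_derivative 0) (at t)"
      by (rule has_field_derivative_transform_within_open[of _ _ _ "{..<0}"]) (use 2 in auto)
    then show ?thesis using 2 by (simp add: max_def)
  next
    case 3
    have "((\<lambda>y. max 0 y powr \<mu> / y) \<longlongrightarrow> 0) (at 0)"
    proof (rule Lim_null_comparison)
      have "norm (max 0 y powr \<mu> / y) \<le> \<bar>y\<bar> powr (\<mu> - 1)" for y :: real
      proof (cases "y > 0")
        case True
        then show ?thesis by (simp add: powr_diff)
      next
        case False
        then have "max 0 y = 0" by simp
        then show ?thesis by simp
      qed
      then show "\<forall>\<^sub>F y in at 0. norm (max 0 y powr \<mu> / y) \<le> \<bar>y\<bar> powr (\<mu> - 1)" by simp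
      show "((\<lambda>y::real. \<bar>y\<bar> powr (\<mu> - 1)) \<longlongrightarrow> 0) (at 0)"
        by (rule tendsto_eq_rhs[OF tendsto_powr'[of "\<lambda>y. \<bar>y\<bar>" 0 _ "\<lambda>_. \<mu> - 1"]])
          (use assms in \<open>auto intro!: tendsto_rabs_zero\<close>)
    qed
    then show ?thesis using 3 assms by (simp add: has_field_derivative_iff)
  qed
qed

text \<open>A paraboloid cut at zero: it is only Lipschitz, but its powers above 1 are
  \<open>C^1\<close>, with gradient bounded by \<open>2 * \<mu> / R\<close> times the next lower
  power. It is not constant on an inner ball; the lower bound \<open>1 - \<rho> / R\<close> there
  takes the place of the value 1.\<close>

definition cutoff :: "'a::euclidean_space \<Rightarrow> real \<Rightarrow> 'a \<Rightarrow> real" where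
  "cutoff x0 R x = max 0 (1 - (norm (x - x0))\<^sup>2 / R\<^sup>2)"

definition grad_cutoff_powr :: "'a::euclidean_space \<Rightarrow> real \<Rightarrow> real \<Rightarrow> 'a \<Rightarrow> 'a" where
  "grad_cutoff_powr x0 R \<mu> x = (- (2 * \<mu> / R\<^sup>2) * cutoff x0 R x powr (\<mu> - 1)) *\<^sub>R (x - x0)"

lemma cutoff_range: "0 \<le> cutoff x0 R x" "cutoff x0 R x \<le> 1"
  by (auto simp: cutoff_def)

lemma cutoff_outside: "0 < R \<Longrightarrow> x \<notin> ball x0 R \<Longrightarrow> cutoff x0 R x = 0"
  by (auto simp: cutoff_def dist_norm norm_minus_commute divide_simps intro!: power_mono)

lemma cutoff_inside:
  assumes "0 < \<rho>" "\<rho> \<le> R" "x \<in> cball x0 \<rho>"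
  shows "1 - \<rho> / R \<le> cutoff x0 R x"
proof -
  have n: "norm (x - x0) \<le> \<rho>" using assms by (simp add: dist_norm norm_minus_commute)
  have "(norm (x - x0))\<^sup>2 / R\<^sup>2 \<le> \<rho>\<^sup>2 / R\<^sup>2" using n by (intro divide_right_mono power_mono) auto
  also have "\<dots> = (\<rho> / R) * (\<rho> / R)" by (simp add: power2_eq_square)
  also have "\<dots> \<le> (\<rho> / R) * 1" using assms by (intro mult_left_mono) auto
  finally show ?thesis by (simp add: cutoff_def)
qed

lemma continuous_cutoff: "continuous_on UNIV (cutoff x0 R)"
  unfolding cutoff_def divide_inverse by (intro continuous_intros)

lemma cutoff_powr_has_derivative:
  assumes "1 < \<mu>"
  shows "((\<lambda>x. cutoff x0 R x powr \<mu>) has_derivative (\<lambda>h. grad_cutoff_powr x0 R \<mu> x \<bullet> h)) (at x)"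
proof -
  have "((\<lambda>x. (x - x0) \<bullet> (x - x0)) has_derivative (\<lambda>h. (x - x0) \<bullet> (h - 0) + (h - 0) \<bullet> (x - x0))) (at x)"
    by (intro has_derivative_inner has_derivative_diff has_derivative_ident has_derivative_const)
  then have "((\<lambda>x. (x - x0) \<bullet> (x - x0)) has_derivative (\<lambda>h. 2 * ((x - x0) \<bullet> h))) (at x)"
    by (simp add: inner_commute)
  from has_derivative_mult_right[OF this, of "- inverse (R\<^sup>2)"]
  have "((\<lambda>x. 1 + (- inverse (R\<^sup>2)) * ((x - x0) \<bullet> (x - x0))) has_derivative (\<lambda>h. 0 + (- inverse (R\<^sup>2)) * (2 * ((x - x0) \<bullet> h)))) (at x)"
    by (intro has_derivative_add has_derivative_const)
  then have d: "((\<lambda>x. 1 - (norm (x - x0))\<^sup>2 / R\<^sup>2) has_derivative (\<lambda>h. - (2 / R\<^sup>2) * ((x - x0) \<bullet> h))) (at x)"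
    by (simp add: power2_norm_eq_inner divide_inverse mult_ac)
  have "((\<lambda>x. max 0 (1 - (norm (x - x0))\<^sup>2 / R\<^sup>2) powr \<mu>) has_derivative
     (\<lambda>h. (\<mu> * max 0 (1 - (norm (x - x0))\<^sup>2 / R\<^sup>2) powr (\<mu> - 1)) * (- (2 / R\<^sup>2) * ((x - x0) \<bullet> h)))) (at x)"
    using has_derivative_compose[OF d powr_pos_part_has_derivative[OF assms, unfolded has_field_derivative_def]] by simp
  then show ?thesis by (simp add: cutoff_def[abs_def] grad_cutoff_powr_def mult_ac)
qed

lemma continuous_grad_cutoff_powr:
  assumes "1 < \<mu>"
  shows "continuous_on UNIV (grad_cutoff_powr x0 R \<mu>)"
  unfolding grad_cutoff_powr_def
  by (intro continuous_intros continuous_on_powr' continuous_on_subset[OF continuous_cutoff])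
    (use assms cutoff_range in auto)

lemma norm_grad_cutoff_powr:
  assumes "1 < \<mu>" "0 < R"
  shows "norm (grad_cutoff_powr x0 R \<mu> x) \<le> (2 * \<mu> / R) * cutoff x0 R x powr (\<mu> - 1)"
proof (cases "x \<in> ball x0 R")
  case True
  then have n: "norm (x - x0) \<le> R" by (simp add: dist_norm norm_minus_commute)
  have "norm (grad_cutoff_powr x0 R \<mu> x) = (2 * \<mu> / R\<^sup>2) * cutoff x0 R x powr (\<mu> - 1) * norm (x - x0)"
    using assms by (simp add: grad_cutoff_powr_def abs_mult)
  also have "\<dots> \<le> (2 * \<mu> / R\<^sup>2) * cutoff x0 R x powr (\<mu> - 1) * R"
    using n assms by (intro mult_left_mono) auto
  also have "\<dots> = (2 * \<mu> / R) * cutoff x0 R x powr (\<mu> - 1)"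
    using assms by (simp add: power2_eq_square)
  finally show ?thesis .
next
  case False
  have "cutoff x0 R x = 0" by (rule cutoff_outside[OF assms(2) False])
  then show ?thesis by (simp add: grad_cutoff_powr_def)
qed

text \<open>Smooth in \<open>t\<close>, unlike \<open>\<bar>t\<bar>\<close>, and at least 1, so that
  its powers increase with the exponent and terms of different homogeneity can be merged into a
  single power.\<close>

definition jbr :: "real \<Rightarrow> real" where "jbr t = sqrt (1 + t\<^sup>2)"

text \<open>A smooth substitute for the truncation \<open>min k (jbr t)\<close>: with it, all compositions below are
  \<open>C\<^sup>1\<close> and no chain rule for Lipschitz functions is needed.\<close>

definition jtr :: "real \<Rightarrow> real \<Rightarrow> real" where "jtr k t = k * jbr t / (k + jbr t)"

definition jtr' :: "real \<Rightarrow> real \<Rightarrow> real" where "jtr' k t = k\<^sup>2 / (k + jbr t)\<^sup>2 * (t / jbr t)"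

lemma jbr_ge: "1 \<le> jbr t" "\<bar>t\<bar> \<le> jbr t" "jbr t \<le> 1 + \<bar>t\<bar>"
proof -
  show "1 \<le> jbr t" by (simp add: jbr_def)
  show "\<bar>t\<bar> \<le> jbr t" unfolding jbr_def by (rule real_le_rsqrt) simp
  show "jbr t \<le> 1 + \<bar>t\<bar>" unfolding jbr_def by (rule real_le_lsqrt) (simp_all add: power2_sum)
qed

lemma jbr_pos: "0 < jbr t" using jbr_ge(1)[of t] by linarith

lemma jbr_has_derivative: "(jbr has_real_derivative t / jbr t) (at t)"
proof -
  have p: "0 < 1 + t\<^sup>2" by (simp add: add_pos_nonneg)
  have "((\<lambda>t. 1 + t\<^sup>2) has_real_derivative 2 * t) (at t)"
    by (auto intro!: derivative_eq_intros)
  from DERIV_chain2[OF DERIV_real_sqrt[OF p] this] show ?thesis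
    by (simp add: jbr_def[abs_def] field_simps)
qed

lemma jtr_bounds:
  assumes "1 \<le> k"
  shows "1 / 2 \<le> jtr k t" "jtr k t \<le> k" "jtr k t \<le> jbr t" "0 < jtr k t"
proof -
  have j: "1 \<le> jbr t" by (rule jbr_ge)
  have p: "0 < k + jbr t" using assms j by linarith
  show "jtr k t \<le> k" "jtr k t \<le> jbr t"
    unfolding jtr_def using assms j p by (auto simp: divide_le_eq algebra_simps)
  have "k + jbr t \<le> 2 * (k * jbr t)"
  proof -
    have "k * 1 \<le> k * jbr t" "1 * jbr t \<le> k * jbr t" using assms j by (intro mult_left_mono mult_right_mono; simp)+
    then show ?thesis by simp
  qed
  then show "1 / 2 \<le> jtr k t" unfolding jtr_def using p by (simp add: le_divide_eq)
  then show "0 < jtr k t" by linarith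
qed

lemma jtr_has_derivative:
  assumes "1 \<le> k"
  shows "(jtr k has_real_derivative jtr' k t) (at t)"
proof -
  have p: "k + jbr t \<noteq> 0" using assms jbr_pos[of t] by linarith
  have "((\<lambda>t. k * jbr t / (k + jbr t)) has_real_derivative
     ((k * (t / jbr t)) * (k + jbr t) - k * jbr t * (0 + t / jbr t)) / ((k + jbr t) * (k + jbr t))) (at t)"
    by (intro DERIV_divide DERIV_cmult DERIV_add DERIV_const jbr_has_derivative p)
  moreover have "((k * (t / jbr t)) * (k + jbr t) - k * jbr t * (0 + t / jbr t)) / ((k + jbr t) * (k + jbr t)) = jtr' k t"
  proof -
    have "(k * v) * (k + jbr t) - k * jbr t * (0 + v) = k\<^sup>2 * v" for v
      by (simp add: power2_eq_square algebra_simps)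
    from this[of "t / jbr t"] show ?thesis by (simp only: jtr'_def power2_eq_square[of "k + jbr t"] times_divide_eq_left)
  qed
  ultimately show ?thesis by (simp add: jtr_def[abs_def])
qed

lemma jtr'_bound:
  assumes "1 \<le> k"
  shows "\<bar>jtr' k t\<bar> \<le> 1" "0 \<le> t * jtr' k t" "t * jtr' k t \<le> jtr k t"
proof -
  have j: "0 < jbr t" by (rule jbr_pos)
  have p: "0 < k + jbr t" using assms j by linarith
  have c: "0 \<le> k\<^sup>2 / (k + jbr t)\<^sup>2" "k\<^sup>2 / (k + jbr t)\<^sup>2 \<le> 1"
    using assms j p by (auto simp: divide_le_eq intro!: power_mono)
  have r: "\<bar>t / jbr t\<bar> \<le> 1" using jbr_ge(2)[of t] j by (simp add: abs_divide divide_le_eq)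
  have "\<bar>jtr' k t\<bar> = k\<^sup>2 / (k + jbr t)\<^sup>2 * \<bar>t / jbr t\<bar>" unfolding jtr'_def using c(1) by (simp add: abs_mult)
  also have "\<dots> \<le> 1 * 1" using c r by (intro mult_mono) auto
  finally show "\<bar>jtr' k t\<bar> \<le> 1" by simp
  have eq: "t * jtr' k t = k\<^sup>2 / (k + jbr t)\<^sup>2 * (t\<^sup>2 / jbr t)" by (simp add: jtr'_def power2_eq_square)
  show "0 \<le> t * jtr' k t" unfolding eq using j c by (intro mult_nonneg_nonneg) auto
  have t2: "t\<^sup>2 / jbr t \<le> jbr t"
  proof -
    have "t\<^sup>2 \<le> (jbr t)\<^sup>2" by (simp add: jbr_def)
    then show ?thesis using j by (simp add: divide_le_eq power2_eq_square)
  qed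
  have "k\<^sup>2 / (k + jbr t)\<^sup>2 \<le> k / (k + jbr t)"
  proof -
    have "k / (k + jbr t) * (k / (k + jbr t)) \<le> k / (k + jbr t) * 1"
      using assms j p by (intro mult_left_mono) (auto simp: divide_le_eq)
    then show ?thesis by (simp add: power2_eq_square)
  qed
  then have "k\<^sup>2 / (k + jbr t)\<^sup>2 * (t\<^sup>2 / jbr t) \<le> k / (k + jbr t) * jbr t"
    using t2 assms j p by (intro mult_mono) auto
  then show "t * jtr' k t \<le> jtr k t" unfolding eq by (simp add: jtr_def)
qed

lemma continuous_jbr: "continuous_on UNIV jbr" unfolding jbr_def by (intro continuous_intros)

lemma continuous_jtr: "1 \<le> k \<Longrightarrow> continuous_on UNIV (jtr k)"
  unfolding jtr_def using jbr_pos by (intro continuous_intros continuous_jbr) (metis add_pos_pos less_irrefl less_le_trans zero_less_one)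

lemma continuous_jtr': "1 \<le> k \<Longrightarrow> continuous_on UNIV (jtr' k)"
  unfolding jtr'_def using jbr_pos
  by (intro continuous_intros continuous_jbr) (metis add_pos_pos less_irrefl less_le_trans zero_less_one power_eq_0_iff)+

lemma jtr_powr_has_derivative:
  assumes "1 \<le> k"
  shows "((\<lambda>t. jtr k t powr a) has_real_derivative a * jtr k t powr (a - 1) * jtr' k t) (at t)"
  using DERIV_chain2[OF has_real_derivative_powr[OF jtr_bounds(4)[OF assms]] jtr_has_derivative[OF assms]] by simp

lemma jtr_tendsto: "(\<lambda>k. jtr (real k + 1) t) \<longlonglongrightarrow> jbr t"
proof -
  have "(\<lambda>k. inverse (inverse (jbr t) + inverse (real (Suc k)))) \<longlonglongrightarrow> inverse (inverse (jbr t) + 0)"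
    using jbr_pos[of t] by (intro tendsto_intros LIMSEQ_inverse_real_of_nat) auto
  moreover have "inverse (inverse (jbr t) + inverse (real (Suc k))) = jtr (real k + 1) t" for k
    using jbr_pos[of t] by (simp add: jtr_def divide_simps add_eq_0_iff) (simp add: algebra_simps)
  ultimately show ?thesis by simp
qed

text \<open>Since \<open>t * jtr' k t\<close> lies between 0 and \<open>jtr k t\<close>,
  differentiating the weight only adds a nonnegative term of size at most \<open>\<gamma>\<close>
  times the weight. Hence the coercive term keeps the full weight, and the factor
  \<open>1 + \<gamma>\<close> appears only in the error terms.\<close>

lemma incr_composite_bound:
  assumes k: "1 \<le> k" and \<gamma>: "0 \<le> \<gamma>"
  defines "F' \<equiv> \<lambda>t. jtr k t powr \<gamma> + t * (\<gamma> * jtr k t powr (\<gamma> - 1) * jtr' k t)"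
  shows "((\<lambda>t. t * jtr k t powr \<gamma>) has_real_derivative F' t) (at t)"
    and "jtr k t powr \<gamma> \<le> F' t" "F' t \<le> (1 + \<gamma>) * jtr k t powr \<gamma>"
    and "\<bar>F' t\<bar> \<le> (1 + \<gamma>) * k powr \<gamma>" "\<bar>t * jtr k t powr \<gamma>\<bar> \<le> jbr t * jtr k t powr \<gamma>"
    and "continuous_on UNIV F'"
proof -
  note J = jtr_bounds[OF k]
  show "((\<lambda>t. t * jtr k t powr \<gamma>) has_real_derivative F' t) (at t)"
    unfolding F'_def using DERIV_mult[OF DERIV_ident jtr_powr_has_derivative[OF k]] by (simp add: mult.commute)
  have e: "t * (\<gamma> * jtr k t powr (\<gamma> - 1) * jtr' k t) = \<gamma> * jtr k t powr (\<gamma> - 1) * (t * jtr' k t)" for t by simp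
  have nn: "0 \<le> t * (\<gamma> * jtr k t powr (\<gamma> - 1) * jtr' k t)" for t
    unfolding e by (rule mult_nonneg_nonneg[OF mult_nonneg_nonneg[OF \<gamma> powr_ge_zero] jtr'_bound(2)[OF k]])
  show 1: "jtr k t powr \<gamma> \<le> F' t" for t unfolding F'_def using nn[of t] by simp
  show 2: "F' t \<le> (1 + \<gamma>) * jtr k t powr \<gamma>" for t
  proof -
    have "\<gamma> * jtr k t powr (\<gamma> - 1) * (t * jtr' k t) \<le> \<gamma> * jtr k t powr (\<gamma> - 1) * jtr k t"
      using \<gamma> jtr'_bound(3)[OF k] by (intro mult_left_mono) auto
    also have "\<dots> = \<gamma> * jtr k t powr \<gamma>" using J(4)[of t] by (simp add: powr_diff)
    finally show ?thesis unfolding F'_def e by (simp add: algebra_simps)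
  qed
  have "0 \<le> F' t" using 1[of t] powr_ge_zero[of "jtr k t" \<gamma>] by linarith
  moreover have "F' t \<le> (1 + \<gamma>) * k powr \<gamma>"
    using 2[of t] \<gamma> J(2)[of t] J(4)[of t]
    by (meson add_nonneg_nonneg less_imp_le mult_left_mono order_trans powr_mono2 zero_le_one)
  ultimately show "\<bar>F' t\<bar> \<le> (1 + \<gamma>) * k powr \<gamma>" by simp
  show "\<bar>t * jtr k t powr \<gamma>\<bar> \<le> jbr t * jtr k t powr \<gamma>"
    using jbr_ge(2)[of t] by (simp add: abs_mult mult_right_mono)
  have nz: "jtr k t \<noteq> 0" for t using J(4)[of t] by simp
  show "continuous_on UNIV F'"
    unfolding F'_def
    by (intro continuous_intros continuous_on_powr continuous_jtr[OF k] continuous_jtr'[OF k]) (use nz in auto)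
qed

section \<open>The energy estimate\<close>

lemma rpow_nonneg: "0 \<le> rpow t s"
  by (simp add: rpow_def)

lemma rpow_abs_le_jbr:
  assumes "0 \<le> s" "s \<le> e"
  shows "rpow \<bar>t\<bar> s \<le> jbr t powr e"
proof (cases "s = 0")
  case True
  then show ?thesis using assms jbr_ge(1)[of t] by (simp add: rpow_def ge_one_powr_ge_zero)
next
  case False
  have "\<bar>t\<bar> powr s \<le> jbr t powr s" using assms jbr_ge(2)[of t] by (intro powr_mono2) auto
  also have "\<dots> \<le> jbr t powr e" using assms jbr_ge(1)[of t] by (intro powr_mono) auto
  finally show ?thesis using False by (simp add: rpow_def)
qed

text \<open>A form of Young's inequality with \<open>\<epsilon>\<close>; splitting according to which term dominates also
  covers the degenerate exponent \<open>q = 1\<close>.\<close>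

lemma rpow_mult_le:
  fixes X y \<epsilon> p q :: real
  assumes "0 \<le> X" "0 \<le> y" "0 < \<epsilon>" "1 \<le> q" "q < p + 1"
  shows "rpow X (q - 1) * y \<le> \<epsilon> * X powr p + \<epsilon> powr (- ((q - 1) / (p - q + 1))) * y powr (p / (p - q + 1))"
proof (cases "y \<le> \<epsilon> * X powr (p - q + 1)")
  case True
  have "rpow X (q - 1) * y \<le> \<epsilon> * X powr p"
  proof (cases "X = 0")
    case True
    then have "y = 0" using \<open>y \<le> \<epsilon> * X powr (p - q + 1)\<close> assms by simp
    then show ?thesis using assms by simp
  next
    case False
    then have "rpow X (q - 1) = X powr (q - 1)" using assms by (simp add: rpow_def)
    then have "rpow X (q - 1) * y \<le> X powr (q - 1) * (\<epsilon> * X powr (p - q + 1))"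
      using True by (simp add: mult_left_mono)
    also have "\<dots> = \<epsilon> * X powr p" by (simp add: powr_add[symmetric])
    finally show ?thesis .
  qed
  then show ?thesis by (rule order_trans) simp
next
  case False
  define d where "d = p - q + 1"
  have d: "0 < d" using assms by (simp add: d_def)
  have "0 \<le> \<epsilon> * X powr (p - q + 1)" using assms by simp
  then have y: "0 < y" using False by linarith
  have "X \<le> (y / \<epsilon>) powr (1 / d)"
  proof -
    have "X powr d \<le> y / \<epsilon>" using False assms by (simp add: d_def pos_le_divide_eq mult.commute)
    then have "(X powr d) powr (1 / d) \<le> (y / \<epsilon>) powr (1 / d)" using d by (intro powr_mono2) auto
    then show ?thesis using d assms by (simp add: powr_powr)
  qed
  then have "rpow X (q - 1) \<le> (y / \<epsilon>) powr ((q - 1) / d)"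
  proof (cases "q = 1")
    case True
    then show ?thesis using y assms by (simp add: rpow_def)
  next
    case False
    have "X powr (q - 1) \<le> ((y / \<epsilon>) powr (1 / d)) powr (q - 1)"
      using \<open>X \<le> _\<close> assms by (intro powr_mono2) auto
    then show ?thesis using False by (simp add: rpow_def powr_powr)
  qed
  then have "rpow X (q - 1) * y \<le> (y / \<epsilon>) powr ((q - 1) / d) * y" using y by (intro mult_right_mono) auto
  also have "\<dots> = \<epsilon> powr (- ((q - 1) / d)) * (y powr ((q - 1) / d) * y powr 1)"
    using y assms by (simp add: powr_divide powr_minus_divide)
  also have "y powr ((q - 1) / d) * y powr 1 = y powr (p / d)"
  proof -
    have "(q - 1) / d + 1 = p / d" using d by (simp add: d_def field_simps)
    then show ?thesis by (simp only: powr_add[symmetric])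
  qed
  finally show ?thesis using assms by (simp add: d_def add_increasing)
qed

text \<open>Because \<open>p \<le> q\<close>, the exponent on the left is at most
  \<open>(q - 1) / 2\<close>. The gradient term of \<open>b\<close> thus grows no faster than that
  of the flux and is absorbed by the same form of Young's inequality.\<close>

lemma rpow_one_plus_sq_le:
  assumes "1 \<le> p" "p \<le> q" "0 \<le> X"
  shows "rpow (1 + X\<^sup>2) ((p + q - 2) / 4) \<le> 2 powr ((q - 1) / 2) * (1 + rpow X (q - 1))"
proof -
  have b: "1 \<le> 1 + X\<^sup>2" by simp
  have "1 + X\<^sup>2 \<noteq> 0" using b by linarith
  then have "rpow (1 + X\<^sup>2) ((p + q - 2) / 4) = (1 + X\<^sup>2) powr ((p + q - 2) / 4)"
    by (simp add: rpow_def)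
  also have "\<dots> \<le> (1 + X\<^sup>2) powr ((q - 1) / 2)" using assms by (intro powr_mono) auto
  also have "\<dots> \<le> 2 powr ((q - 1) / 2) * (1 + rpow X (q - 1))"
  proof (cases "X \<le> 1")
    case True
    then have "X\<^sup>2 \<le> 1" using assms by (simp add: power_le_one)
    then have "(1 + X\<^sup>2) powr ((q - 1) / 2) \<le> 2 powr ((q - 1) / 2)" using assms by (intro powr_mono2) auto
    also have "\<dots> = 2 powr ((q - 1) / 2) * 1" by simp
    also have "\<dots> \<le> 2 powr ((q - 1) / 2) * (1 + rpow X (q - 1))"
      by (intro mult_left_mono) (auto simp: rpow_nonneg)
    finally show ?thesis .
  next
    case False
    then have X: "1 < X" by simp
    then have "1 \<le> X\<^sup>2" by (simp add: one_le_power)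
    then have "(1 + X\<^sup>2) powr ((q - 1) / 2) \<le> (2 * X\<^sup>2) powr ((q - 1) / 2)" using assms by (intro powr_mono2) auto
    also have "\<dots> = 2 powr ((q - 1) / 2) * (X powr 2) powr ((q - 1) / 2)" using X by (simp add: powr_mult)
    also have "(X powr 2) powr ((q - 1) / 2) = X powr (q - 1)"
    proof -
      have "2 * ((q - 1) / 2) = q - 1" by simp
      then show ?thesis by (simp only: powr_powr)
    qed
    also have "X powr (q - 1) = rpow X (q - 1)" using X by (simp add: rpow_def)
    also have "2 powr ((q - 1) / 2) * rpow X (q - 1) \<le> 2 powr ((q - 1) / 2) * (1 + rpow X (q - 1))"
      by (intro mult_left_mono) auto
    finally show ?thesis .
  qed
  finally show ?thesis .
qed

text \<open>The factor left by \<open>rpow_mult_le\<close> for \<open>\<epsilon> = c1 / 4\<close>.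
  Two terms are absorbed at this price, one from the flux and one from \<open>b\<close>, and half of
  the coercive term remains.\<close>

definition young_const :: "real \<Rightarrow> real \<Rightarrow> real \<Rightarrow> real" where
  "young_const p q c = (c / 4) powr (- ((q - 1) / (p - q + 1)))"

text \<open>Sum of the coefficients of all error terms: \<open>c2\<close> from coercivity, the next
  two brackets from the flux and from \<open>b\<close>, then \<open>1 + 4 * P\<close> for
  \<open>b1\<close>, which enters through coercivity and through the flux, and finally 1 for
  \<open>b0\<close>.\<close>

definition energy_const :: "real \<Rightarrow> real \<Rightarrow> real \<Rightarrow> real \<Rightarrow> real \<Rightarrow> real \<Rightarrow> real \<Rightarrow> real" where
  "energy_const p q c1 c2 c3 c4 M = (let P = p / (p - q + 1); K = young_const p q c1; M2 = M * 2 powr ((q - 1) / 2) in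
     c2 + (K * (c3 * (4 * P)) powr P + c4 * (4 * P)) + (M2 + K * M2 powr P + M) + (1 + 4 * P) + 1)"

lemma energy_const_ge_0:
  assumes "q < p + 1" "1 \<le> p" "0 < c2" "0 < c3" "0 < c4" "0 < M"
  shows "0 \<le> energy_const p q c1 c2 c3 c4 M"
proof -
  have "0 \<le> p / (p - q + 1)" using assms by simp
  then show ?thesis
    using assms(3-6) unfolding energy_const_def Let_def young_const_def
    by (intro add_nonneg_nonneg mult_nonneg_nonneg) auto
qed

text \<open>Young's inequality has to leave the weight \<open>\<psi>\<close> on the coercive term.
  Writing \<open>\<psi> powr (1 - 1 / P)\<close> as \<open>\<psi>\<close> times
  \<open>\<psi> powr (- (1 / P))\<close> and moving the second factor into \<open>y\<close>, the
  power \<open>P\<close> turns it into \<open>1 / \<psi>\<close>, which cancels. The gradient of the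
  cutoff thus costs \<open>R powr (- P)\<close>; the other two terms of the flux cost only
  \<open>1 / R\<close>, which is no larger.\<close>

lemma flux_term_bound:
  fixes A D :: "'a::euclidean_space"
  assumes p: "1 \<le> p" "p \<le> q" "q < p + 1" and c: "0 < c1" "0 < c3" "0 < c4"
    and A: "norm A \<le> c3 * rpow X (q - 1) + c4 * rpow \<bar>t\<bar> ((q - 1) * (2 / (q - p + 2))) + b1"
    and X: "0 \<le> X" and b1: "0 \<le> b1" and \<psi>: "0 \<le> \<psi>" "\<psi> \<le> 1" and R: "0 < R" "R \<le> 1"
    and m: "p / (p - q + 1) \<le> m" and l: "1 \<le> l"
    and D: "norm D \<le> (4 * (p / (p - q + 1)) / R) * \<psi> powr (1 - (p - q + 1) / p)"
  defines "P \<equiv> p / (p - q + 1)"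
  shows "norm A * norm D * jbr t \<le> (c1 / 4) * (\<psi> * X powr p)
     + R powr (- P) * ((young_const p q c1 * (c3 * (4 * P)) powr P + c4 * (4 * P)) * jbr t powr m + (4 * P) * (b1 * jbr t powr l))"
proof -
  define V where "V = jbr t"
  define K where "K = young_const p q c1"
  have V: "1 \<le> V" unfolding V_def by (rule jbr_ge)
  have d: "0 < p - q + 1" using p by simp
  have P: "1 \<le> P" "1 / P = (p - q + 1) / p" using p d by (auto simp: P_def le_divide_eq)
  have K0: "0 \<le> K" by (simp add: K_def young_const_def)
  have D': "norm D \<le> (4 * P / R) * \<psi> powr (1 - 1 / P)" using D P(2) by (simp add: P_def)
  have "1 / P \<le> 1" using P(1) by simp
  then have "\<psi> powr (1 - 1 / P) \<le> 1" using \<psi> by (intro powr_le1) auto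
  then have "(4 * P / R) * \<psi> powr (1 - 1 / P) \<le> (4 * P / R) * 1" using P R by (intro mult_left_mono) auto
  then have D1: "norm D \<le> 4 * P / R" using D' by simp
  have rR: "1 / R \<le> R powr (- P)"
  proof -
    have "1 / R = R powr (- 1)" using R by (simp add: powr_minus_divide)
    also have "\<dots> \<le> R powr (- P)" using R P by (intro powr_mono') auto
    finally show ?thesis .
  qed
  define r where "r = R powr (- P)"
  have r: "0 \<le> r" "1 / R \<le> r" using rR by (auto simp: r_def)
  have D2: "norm D \<le> 4 * P * r"
  proof -
    have "4 * P / R = 4 * P * (1 / R)" by simp
    also have "\<dots> \<le> 4 * P * r" using r P by (intro mult_left_mono) auto
    finally show ?thesis using D1 by simp
  qed
  have VPm: "V powr P \<le> V powr m" using V m by (intro powr_mono) (auto simp: P_def)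
  have term1: "c3 * rpow X (q - 1) * norm D * V \<le> (c1 / 4) * (\<psi> * X powr p) + r * (K * (c3 * (4 * P)) powr P * V powr m)"
  proof (cases "\<psi> = 0")
    case True
    \<comment> \<open>Also for \<open>P = 1\<close>, by the convention
      \<open>0 powr 0 = 0\<close>.\<close>
    then have "norm D \<le> 0" using D' by simp
    then show ?thesis using True r K0 by simp
  next
    case False
    then have \<psi>0: "0 < \<psi>" using \<psi> by simp
    define y where "y = c3 * (4 * P / R) * V * \<psi> powr (- (1 / P))"
    have y0: "0 \<le> y" using c P R V by (simp add: y_def)
    have "c3 * rpow X (q - 1) * norm D * V \<le> c3 * rpow X (q - 1) * ((4 * P / R) * \<psi> powr (1 - 1 / P)) * V"
      using D' c V rpow_nonneg by (intro mult_right_mono mult_left_mono) auto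
    also have "\<psi> powr (1 - 1 / P) = \<psi> * \<psi> powr (- (1 / P))"
      using \<psi>0 by (simp add: powr_diff powr_minus divide_inverse)
    also have "c3 * rpow X (q - 1) * ((4 * P / R) * (\<psi> * \<psi> powr (- (1 / P)))) * V = \<psi> * (rpow X (q - 1) * y)"
      by (simp add: y_def mult_ac)
    also have "\<dots> \<le> \<psi> * ((c1 / 4) * X powr p + K * y powr P)"
      using rpow_mult_le[OF X y0, of "c1 / 4" q p] c p \<psi> by (intro mult_left_mono) (auto simp: K_def young_const_def P_def)
    also have "\<psi> * ((c1 / 4) * X powr p + K * y powr P) = (c1 / 4) * (\<psi> * X powr p) + K * (\<psi> * y powr P)"
      by (simp add: algebra_simps)
    also have "\<psi> * y powr P = r * ((c3 * (4 * P)) powr P * V powr P)"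
    proof -
      have "y = (c3 * (4 * P)) * (R powr (- 1)) * V * \<psi> powr (- (1 / P))"
        using R by (simp add: y_def powr_minus_divide)
      then have "y powr P = (c3 * (4 * P)) powr P * (R powr (- 1)) powr P * V powr P * (\<psi> powr (- (1 / P))) powr P"
        by (simp only: powr_mult)
      also have "(\<psi> powr (- (1 / P))) powr P = \<psi> powr (- 1)" using P(1) by (simp add: powr_powr)
      also have "(R powr (- 1)) powr P = r" by (simp only: powr_powr r_def) simp
      finally show ?thesis using \<psi>0 by (simp add: powr_minus mult_ac)
    qed
    also have "K * (r * ((c3 * (4 * P)) powr P * V powr P)) \<le> K * (r * ((c3 * (4 * P)) powr P * V powr m))"
      using VPm K0 r by (intro mult_left_mono) auto
    finally show ?thesis by (simp add: mult_ac)
  qed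
  have term2: "c4 * rpow \<bar>t\<bar> ((q - 1) * (2 / (q - p + 2))) * norm D * V \<le> r * (c4 * (4 * P) * V powr m)"
  proof -
    define e where "e = (q - 1) * (2 / (q - p + 2))"
    have e0: "0 \<le> e" using p by (simp add: e_def)
    \<comment> \<open>The growth of the flux in \<open>u\<close> fits below \<open>P\<close> since
      \<open>2 / (q - p + 2) \<le> 1 / (p - q + 1)\<close>, which amounts to
      \<open>p \<le> q\<close>.\<close>
    have "e + 1 \<le> P"
    proof -
      have "2 / (q - p + 2) \<le> 1 / (p - q + 1)" using p d by (simp add: divide_simps)
      then have "e \<le> (q - 1) * (1 / (p - q + 1))" unfolding e_def using p by (intro mult_left_mono) auto
      also have "\<dots> + 1 = P" using d by (simp add: P_def field_simps)
      finally show ?thesis by simp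
    qed
    then have Ve: "V powr e * V \<le> V powr m"
    proof -
      have "V powr e * V = V powr (e + 1)" using V by (simp add: powr_add)
      also have "\<dots> \<le> V powr m" using V \<open>e + 1 \<le> P\<close> m by (intro powr_mono) (auto simp: P_def)
      finally show ?thesis .
    qed
    have "c4 * rpow \<bar>t\<bar> e * norm D * V \<le> c4 * V powr e * (4 * P * r) * V"
      using rpow_abs_le_jbr[OF e0 order_refl, of t] c D2 V P r by (intro mult_mono mult_nonneg_nonneg) (auto simp: V_def rpow_nonneg)
    also have "\<dots> = c4 * (4 * P * r) * (V powr e * V)" by (simp add: mult_ac)
    also have "\<dots> \<le> c4 * (4 * P * r) * V powr m" using Ve c P r by (intro mult_left_mono) auto
    finally show ?thesis by (simp add: e_def mult_ac)
  qed
  have term3: "b1 * norm D * V \<le> r * (4 * P * (b1 * V powr l))"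
  proof -
    have "V powr 1 \<le> V powr l" using V l by (intro powr_mono) auto
    then have Vl: "V \<le> V powr l" using V by simp
    have "b1 * norm D * V \<le> b1 * (4 * P * r) * V powr l"
      using b1 D2 Vl V P r by (intro mult_mono mult_nonneg_nonneg) auto
    then show ?thesis by (simp add: mult_ac)
  qed
  have "norm A * norm D * V \<le> (c3 * rpow X (q - 1) + c4 * rpow \<bar>t\<bar> ((q - 1) * (2 / (q - p + 2))) + b1) * norm D * V"
    using A V by (intro mult_right_mono) auto
  also have "\<dots> = c3 * rpow X (q - 1) * norm D * V + c4 * rpow \<bar>t\<bar> ((q - 1) * (2 / (q - p + 2))) * norm D * V + b1 * norm D * V"
    by (simp add: distrib_right)
  also have "\<dots> \<le> (c1 / 4) * (\<psi> * X powr p) + r * (K * (c3 * (4 * P)) powr P * V powr m)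
     + r * (c4 * (4 * P) * V powr m) + r * (4 * P * (b1 * V powr l))"
    by (intro add_mono term1 term2 term3)
  also have "\<dots> = (c1 / 4) * (\<psi> * X powr p) + r * ((K * (c3 * (4 * P)) powr P + c4 * (4 * P)) * V powr m + (4 * P) * (b1 * V powr l))"
    by (simp add: algebra_simps)
  finally show ?thesis unfolding V_def K_def r_def .
qed

text \<open>Here the cutoff is not differentiated, so neither \<open>1 / R\<close> nor a negative
  power of \<open>\<psi>\<close> occurs, and \<open>\<psi> \<le> 1\<close> is simply dropped from
  the error terms.\<close>

lemma lower_order_term_bound:
  assumes p: "1 \<le> p" "p \<le> q" "q < p + 1" and c: "0 < c1" "0 < M" and \<delta>: "1 \<le> \<delta>" "\<delta> \<le> m"
    and B: "\<bar>B\<bar> \<le> M * rpow (1 + X\<^sup>2) ((p + q - 2) / 4) + M * rpow \<bar>t\<bar> (\<delta> - 1) + b0"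
    and X: "0 \<le> X" and b0: "0 \<le> b0" and \<psi>: "0 \<le> \<psi>" "\<psi> \<le> 1"
    and m: "p / (p - q + 1) \<le> m" and l: "1 \<le> l"
  defines "P \<equiv> p / (p - q + 1)" and "M2 \<equiv> M * 2 powr ((q - 1) / 2)"
  shows "\<bar>B\<bar> * jbr t * \<psi> \<le> (c1 / 4) * (\<psi> * X powr p)
     + ((M2 + young_const p q c1 * M2 powr P + M) * jbr t powr m + b0 * jbr t powr l)"
proof -
  define V where "V = jbr t"
  define K where "K = young_const p q c1"
  have V: "1 \<le> V" unfolding V_def by (rule jbr_ge)
  have d: "0 < p - q + 1" using p by simp
  have P: "1 \<le> P" using p d by (auto simp: P_def le_divide_eq)
  have K0: "0 \<le> K" by (simp add: K_def young_const_def)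
  have M2: "0 \<le> M2" using c by (simp add: M2_def)
  have VPm: "V powr P \<le> V powr m" using V m by (intro powr_mono) (auto simp: P_def)
  have V1m: "V \<le> V powr m"
  proof -
    have "V powr 1 \<le> V powr m" using V P m by (intro powr_mono) (auto simp: P_def)
    then show ?thesis using V by simp
  qed
  have Vl: "V \<le> V powr l"
  proof -
    have "V powr 1 \<le> V powr l" using V l by (intro powr_mono) auto
    then show ?thesis using V by simp
  qed
  have t1: "M * rpow (1 + X\<^sup>2) ((p + q - 2) / 4) * V \<le> (c1 / 4) * X powr p + (M2 + K * M2 powr P) * V powr m"
  proof -
    have "M * rpow (1 + X\<^sup>2) ((p + q - 2) / 4) * V \<le> M * (2 powr ((q - 1) / 2) * (1 + rpow X (q - 1))) * V"
      using rpow_one_plus_sq_le[OF p(1,2) X] c V by (intro mult_right_mono mult_left_mono) auto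
    also have "\<dots> = M2 * V + rpow X (q - 1) * (M2 * V)" by (simp add: M2_def algebra_simps)
    also have "\<dots> \<le> M2 * V powr m + ((c1 / 4) * X powr p + K * (M2 * V) powr P)"
      using V1m M2 V rpow_mult_le[OF X, of "M2 * V" "c1 / 4" q p] c p
      by (intro add_mono mult_left_mono) (auto simp: K_def young_const_def P_def)
    also have "K * (M2 * V) powr P \<le> K * (M2 powr P * V powr m)"
      using K0 VPm by (simp add: powr_mult mult_left_mono)
    finally show ?thesis by (simp add: algebra_simps)
  qed
  have t2: "M * rpow \<bar>t\<bar> (\<delta> - 1) * V \<le> M * V powr m"
  proof -
    have "rpow \<bar>t\<bar> (\<delta> - 1) * V \<le> V powr (\<delta> - 1) * V powr 1"
      using rpow_abs_le_jbr[of "\<delta> - 1" "\<delta> - 1" t] \<delta> V by (simp add: V_def mult_right_mono)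
    also have "\<dots> = V powr \<delta>" by (simp only: powr_add[symmetric]) simp
    also have "\<dots> \<le> V powr m" using V \<delta> by (intro powr_mono) auto
    finally show ?thesis using c by (simp add: mult.assoc mult_left_mono)
  qed
  have t3: "b0 * V \<le> b0 * V powr l" using b0 Vl by (intro mult_left_mono)
  have "\<bar>B\<bar> * V \<le> (M * rpow (1 + X\<^sup>2) ((p + q - 2) / 4) + M * rpow \<bar>t\<bar> (\<delta> - 1) + b0) * V"
    using B V by (intro mult_right_mono) auto
  also have "\<dots> = M * rpow (1 + X\<^sup>2) ((p + q - 2) / 4) * V + M * rpow \<bar>t\<bar> (\<delta> - 1) * V + b0 * V"
    by (simp add: distrib_right)
  also have "\<dots> \<le> ((c1 / 4) * X powr p + (M2 + K * M2 powr P) * V powr m) + M * V powr m + b0 * V powr l"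
    by (intro add_mono t1 t2 t3)
  finally have "\<bar>B\<bar> * V * \<psi> \<le> (((c1 / 4) * X powr p + (M2 + K * M2 powr P) * V powr m) + M * V powr m + b0 * V powr l) * \<psi>"
    using \<psi> by (intro mult_right_mono)
  also have "\<dots> = (c1 / 4) * (\<psi> * X powr p) + \<psi> * ((M2 + K * M2 powr P + M) * V powr m + b0 * V powr l)"
    by (simp add: algebra_simps)
  also have "\<dots> \<le> (c1 / 4) * (\<psi> * X powr p) + 1 * ((M2 + K * M2 powr P + M) * V powr m + b0 * V powr l)"
    using \<psi> M2 K0 c b0 by (intro add_left_mono mult_right_mono) auto
  finally show ?thesis by (simp add: V_def K_def)
qed

text \<open>The testing argument at a single point: \<open>t\<close>, \<open>\<xi>\<close>,
  \<open>A\<close>, \<open>B\<close> are the values of \<open>u\<close>, \<open>Du\<close>,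
  \<open>a\<close>, \<open>b\<close>, while \<open>W\<close> is the truncated weight,
  \<open>F\<close> and \<open>F'\<close> the composition in the test function and its derivative,
  \<open>\<psi>\<close> the power of the cutoff and \<open>D\<close> its gradient. The first bracket
  on the right is then the integrand of the weak formulation and integrates to zero.\<close>

lemma pointwise_energy:
  fixes A \<xi> D :: "'a::euclidean_space"
  assumes p: "1 \<le> p" "p \<le> q" "q < p + 1" and \<theta>: "0 \<le> \<theta>" "\<theta> \<le> m" and \<delta>: "1 \<le> \<delta>" "\<delta> \<le> m"
    and c: "0 < c1" "0 < c2" "0 < c3" "0 < c4" "0 < M"
    and m: "p / (p - q + 1) \<le> m" and l: "1 \<le> l"
    and coercive: "A \<bullet> \<xi> \<ge> c1 * rpow (norm \<xi>) p - c2 * rpow \<bar>t\<bar> \<theta> - b1"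
    and A: "norm A \<le> c3 * rpow (norm \<xi>) (q - 1) + c4 * rpow \<bar>t\<bar> ((q - 1) * (2 / (q - p + 2))) + b1"
    and B: "\<bar>B\<bar> \<le> M * rpow (1 + (norm \<xi>)\<^sup>2) ((p + q - 2) / 4) + M * rpow \<bar>t\<bar> (\<delta> - 1) + b0"
    and b: "0 \<le> b0" "0 \<le> b1" and \<psi>: "0 \<le> \<psi>" "\<psi> \<le> 1" and R: "0 < R" "R \<le> 1"
    and D: "norm D \<le> (4 * (p / (p - q + 1)) / R) * \<psi> powr (1 - (p - q + 1) / p)"
    and W: "0 \<le> W" "W \<le> F'" "F' \<le> (1 + \<gamma>) * W" "\<bar>F\<bar> \<le> jbr t * W" and \<gamma>: "0 \<le> \<gamma>"
  shows "(c1 / 2) * (W * norm \<xi> powr p * \<psi>) \<le> ((F' * \<psi>) * (A \<bullet> \<xi>) + F * (A \<bullet> D) + B * (F * \<psi>))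
     + energy_const p q c1 c2 c3 c4 M * ((1 + \<gamma>) * R powr (- (p / (p - q + 1)))) * (W * (jbr t powr m + (b0 + b1) * jbr t powr l))"
proof -
  define P where "P = p / (p - q + 1)"
  define V where "V = jbr t"
  define X where "X = norm \<xi>"
  define K where "K = young_const p q c1"
  define M2 where "M2 = M * 2 powr ((q - 1) / 2)"
  define r where "r = R powr (- P)"
  define a1 where "a1 = K * (c3 * (4 * P)) powr P + c4 * (4 * P)"
  define a3 where "a3 = M2 + K * M2 powr P + M"
  define E where "E = W * (\<psi> * X powr p)"
  define T1 where "T1 = W * V powr m"
  define T2 where "T2 = W * (b1 * V powr l)"
  define T3 where "T3 = W * (b0 * V powr l)"
  have V: "1 \<le> V" unfolding V_def by (rule jbr_ge)
  have X: "0 \<le> X" by (simp add: X_def)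
  have P: "1 \<le> P" using p by (auto simp: P_def le_divide_eq)
  have K0: "0 \<le> K" by (simp add: K_def young_const_def)
  have nn: "0 \<le> a1" "0 \<le> a3" "0 \<le> T1" "0 \<le> T2" "0 \<le> T3"
    using c K0 P W b by (auto simp: a1_def a3_def M2_def T1_def T2_def T3_def)
  have r: "1 \<le> r"
  proof -
    have "R powr 0 \<le> R powr (- P)" using R P by (intro powr_mono') auto
    then show ?thesis using R by (simp add: r_def)
  qed
  have S1: "F' * \<psi> * (A \<bullet> \<xi>) \<ge> c1 * E - (1 + \<gamma>) * (c2 * T1 + T2)"
  proof -
    have Vl: "1 \<le> V powr l" using V l by (intro ge_one_powr_ge_zero) auto
    have th: "rpow \<bar>t\<bar> \<theta> \<le> V powr m" unfolding V_def by (rule rpow_abs_le_jbr[OF \<theta>])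
    have F0: "0 \<le> F' * \<psi>" using W \<psi> by simp
    have "c1 * E = W * \<psi> * (c1 * X powr p)" by (simp add: E_def)
    also have "\<dots> \<le> F' * \<psi> * (c1 * X powr p)" using W \<psi> c by (intro mult_right_mono) auto
    finally have 1: "c1 * E \<le> F' * \<psi> * (c1 * X powr p)" .
    have f1: "F' * \<psi> \<le> (1 + \<gamma>) * W * 1"
      using W \<psi> \<gamma> by (intro mult_mono) auto
    have f2: "c2 * rpow \<bar>t\<bar> \<theta> + b1 \<le> c2 * V powr m + b1 * V powr l"
    proof (rule add_mono)
      show "b1 \<le> b1 * V powr l" using b(2) Vl mult_left_mono[of 1 "V powr l" b1] by simp
      show "c2 * rpow \<bar>t\<bar> \<theta> \<le> c2 * V powr m" using th c by simp
    qed
    have "F' * \<psi> * (c2 * rpow \<bar>t\<bar> \<theta> + b1) \<le> ((1 + \<gamma>) * W * 1) * (c2 * V powr m + b1 * V powr l)"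
      by (rule mult_mono[OF f1 f2]) (use W \<gamma> c b rpow_nonneg in auto)
    also have "\<dots> = (1 + \<gamma>) * (c2 * T1 + T2)" by (simp add: T1_def T2_def algebra_simps)
    finally have 2: "F' * \<psi> * (c2 * rpow \<bar>t\<bar> \<theta> + b1) \<le> (1 + \<gamma>) * (c2 * T1 + T2)" .
    have "rpow X p = X powr p" using p by (simp add: rpow_def)
    then have "c1 * X powr p - (c2 * rpow \<bar>t\<bar> \<theta> + b1) \<le> A \<bullet> \<xi>" using coercive by (simp add: X_def)
    then have "F' * \<psi> * (c1 * X powr p - (c2 * rpow \<bar>t\<bar> \<theta> + b1)) \<le> F' * \<psi> * (A \<bullet> \<xi>)"
      using F0 by (intro mult_left_mono)
    then show ?thesis using 1 2 by (simp add: right_diff_distrib)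
  qed
  have S2: "\<bar>F * (A \<bullet> D)\<bar> \<le> (c1 / 4) * E + r * (a1 * T1 + (4 * P) * T2)"
  proof -
    have "\<bar>F * (A \<bullet> D)\<bar> \<le> (V * W) * (norm A * norm D)"
      unfolding abs_mult using W(1,4) V by (intro mult_mono Cauchy_Schwarz_ineq2) (auto simp: V_def)
    also have "\<dots> = W * (norm A * norm D * V)" by (simp add: mult_ac)
    also have "\<dots> \<le> W * ((c1 / 4) * (\<psi> * X powr p) + r * (a1 * V powr m + (4 * P) * (b1 * V powr l)))"
      using flux_term_bound[OF p c(1,3,4) A[folded X_def] X b(2) \<psi> R m l D] W(1)
      unfolding P_def[symmetric] V_def[symmetric] r_def[symmetric] K_def[symmetric] a1_def[symmetric]
      by (intro mult_left_mono)
    also have "\<dots> = (c1 / 4) * E + r * (a1 * T1 + (4 * P) * T2)"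
      by (simp add: E_def T1_def T2_def algebra_simps)
    finally show ?thesis .
  qed
  have S3: "\<bar>B * (F * \<psi>)\<bar> \<le> (c1 / 4) * E + (a3 * T1 + T3)"
  proof -
    have "\<bar>B * (F * \<psi>)\<bar> = \<bar>B\<bar> * (\<bar>F\<bar> * \<psi>)" using \<psi> by (simp add: abs_mult)
    also have "\<dots> \<le> \<bar>B\<bar> * ((V * W) * \<psi>)" using W(4) \<psi> by (intro mult_left_mono mult_right_mono) (auto simp: V_def)
    also have "\<dots> = W * (\<bar>B\<bar> * V * \<psi>)" by (simp add: mult_ac)
    also have "\<dots> \<le> W * ((c1 / 4) * (\<psi> * X powr p) + (a3 * V powr m + b0 * V powr l))"
      using lower_order_term_bound[OF p c(1,5) \<delta> B[folded X_def] X b(1) \<psi> m l] W(1)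
      unfolding P_def[symmetric] V_def[symmetric] K_def[symmetric] M2_def[symmetric] a3_def[symmetric]
      by (intro mult_left_mono)
    also have "\<dots> = (c1 / 4) * E + (a3 * T1 + T3)"
      by (simp add: E_def T1_def T3_def algebra_simps)
    finally show ?thesis .
  qed
  \<comment> \<open>A common factor: it dominates the \<open>1 + \<gamma>\<close> of the coercive
    term, the power of \<open>R\<close> of the flux term and the 1 of the term with
    \<open>b\<close>.\<close>
  define g where "g = (1 + \<gamma>) * r"
  have g: "1 + \<gamma> \<le> g" "r \<le> g" "1 \<le> g" "0 \<le> g"
  proof -
    show "1 + \<gamma> \<le> g" using \<gamma> r mult_left_mono[of 1 r "1 + \<gamma>"] by (simp add: g_def)
    then show "1 \<le> g" "0 \<le> g" using \<gamma> by auto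
    show "r \<le> g" using \<gamma> r mult_right_mono[of 1 "1 + \<gamma>" r] by (simp add: g_def)
  qed
  have G1: "(1 + \<gamma>) * (c2 * T1 + T2) \<le> g * (c2 * T1 + T2)" using g c nn by (intro mult_right_mono) auto
  have G2: "r * (a1 * T1 + (4 * P) * T2) \<le> g * (a1 * T1 + (4 * P) * T2)" using g nn P by (intro mult_right_mono) auto
  have G3: "a3 * T1 + T3 \<le> g * (a3 * T1 + T3)" using g nn mult_right_mono[of 1 g "a3 * T1 + T3"] by simp
  let ?C = "energy_const p q c1 c2 c3 c4 M"
  have C_eq: "?C = c2 + a1 + a3 + (1 + 4 * P) + 1"
    by (simp add: energy_const_def Let_def a1_def a3_def P_def K_def M2_def)
  have "(c2 + a1 + a3) * T1 + (1 + 4 * P) * T2 + T3 \<le> ?C * T1 + ?C * T2 + ?C * T3"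
  proof (intro add_mono)
    have "1 * T3 \<le> ?C * T3" using nn c P unfolding C_eq by (intro mult_right_mono) auto
    then show "T3 \<le> ?C * T3" by simp
  qed (use nn c P in \<open>auto simp: C_eq intro!: mult_right_mono\<close>)
  then have "g * ((c2 + a1 + a3) * T1 + (1 + 4 * P) * T2 + T3) \<le> g * (?C * T1 + ?C * T2 + ?C * T3)"
    using g by (intro mult_left_mono)
  moreover have "g * (c2 * T1 + T2) + g * (a1 * T1 + (4 * P) * T2) + g * (a3 * T1 + T3)
     = g * ((c2 + a1 + a3) * T1 + (1 + 4 * P) * T2 + T3)" by (simp add: algebra_simps)
  moreover have "g * (?C * T1 + ?C * T2 + ?C * T3) = ?C * g * (W * (V powr m + (b0 + b1) * V powr l))"
    by (simp add: T1_def T2_def T3_def algebra_simps)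
  ultimately have "(c1 / 2) * E \<le> (F' * \<psi> * (A \<bullet> \<xi>) + F * (A \<bullet> D) + B * (F * \<psi>))
     + ?C * g * (W * (V powr m + (b0 + b1) * V powr l))"
    using S1 S2 S3 G1 G2 G3 by linarith
  then show ?thesis by (simp add: E_def V_def X_def g_def r_def P_def mult_ac)
qed

section \<open>Integrating the pointwise inequality over a ball\<close>

lemma integrable_lebesgue_on_subset:
  fixes f :: "'a::euclidean_space \<Rightarrow> 'b::euclidean_space"
  assumes f: "integrable (lebesgue_on T) f" and "S \<in> sets lebesgue" "T \<in> sets lebesgue" "S \<subseteq> T"
  shows "integrable (lebesgue_on S) f"
proof -
  have sp: "T \<inter> space lebesgue \<in> sets lebesgue" "S \<inter> space lebesgue \<in> sets lebesgue" using assms by auto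
  have "integrable lebesgue (\<lambda>x. indicator S x *\<^sub>R (indicator T x *\<^sub>R f x))"
    using f unfolding integrable_restrict_space[OF sp(1)] by (rule integrable_mult_indicator[OF assms(2)])
  moreover have "(\<lambda>x. indicator S x *\<^sub>R (indicator T x *\<^sub>R f x)) = (\<lambda>x. indicator S x *\<^sub>R f x)"
    using assms(4) by (auto simp: indicator_def fun_eq_iff)
  ultimately show ?thesis unfolding integrable_restrict_space[OF sp(2)] by simp
qed

lemma AE_lebesgue_on_subset:
  assumes "AE x in lebesgue_on T. Q x" "S \<in> sets lebesgue" "T \<in> sets lebesgue" "S \<subseteq> T"
  shows "AE x in lebesgue_on S. Q x"
proof -
  have sp: "T \<inter> space lebesgue \<in> sets lebesgue" "S \<inter> space lebesgue \<in> sets lebesgue" using assms by auto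
  have "AE x in lebesgue. x \<in> T \<longrightarrow> Q x" using assms(1) unfolding AE_restrict_space_iff[OF sp(1)] .
  then have "AE x in lebesgue. x \<in> S \<longrightarrow> Q x" by eventually_elim (use assms(4) in auto)
  then show ?thesis unfolding AE_restrict_space_iff[OF sp(2)] .
qed

text \<open>In the application \<open>m\<close> is the maximum in the definition of \<open>\<sigma>\<close> and
  \<open>l = m - pstar / s\<close> with \<open>s = min s0 s1\<close>, so that \<open>V powr m\<close> is \<open>V powr l\<close> times a
  function in \<open>L\<^sup>s\<close>, just as the terms with \<open>b0\<close> and \<open>b1\<close>.\<close>

locale moser_solution =
  fixes p q \<theta> \<delta> c1 c2 c3 c4 M m l pstar :: real
    and \<Omega> :: "(real ^ 'n::finite) set"
    and a :: "real ^ 'n \<Rightarrow> real \<Rightarrow> real ^ 'n \<Rightarrow> real ^ 'n" and b :: "real ^ 'n \<Rightarrow> real \<Rightarrow> real ^ 'n \<Rightarrow> real"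
    and b0 b1 u :: "real ^ 'n \<Rightarrow> real" and Du :: "real ^ 'n \<Rightarrow> real ^ 'n"
  assumes dim: "2 \<le> CARD('n)"
    and p: "1 \<le> p" "p \<le> q" "q < p + 1" and \<theta>: "0 \<le> \<theta>" "\<theta> \<le> m" and \<delta>: "1 \<le> \<delta>" "\<delta> \<le> m"
    and c: "0 < c1" "0 < c2" "0 < c3" "0 < c4" "0 < M"
    and m: "p / (p - q + 1) \<le> m" and l: "1 \<le> l" and pstar: "p < pstar"
    and tau: "1 \<le> pstar * (real CARD('n) - 1) / real CARD('n)"
    and rest: "0 \<le> 1 / real CARD('n) - 1 / p + 1 / pstar"
    and \<Omega>: "open \<Omega>" and u: "sobolev_loc q \<Omega> u Du"
    and nonneg: "AE x in lebesgue_on \<Omega>. 0 \<le> b0 x \<and> 0 \<le> b1 x"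
    and struct: "AE x in lebesgue_on \<Omega>. \<forall>t \<xi>.
            a x t \<xi> \<bullet> \<xi> \<ge> c1 * rpow (norm \<xi>) p - c2 * rpow \<bar>t\<bar> \<theta> - b1 x \<and>
            norm (a x t \<xi>) \<le> c3 * rpow (norm \<xi>) (q - 1)
              + c4 * rpow \<bar>t\<bar> ((q - 1) * (2 / (q - p + 2))) + b1 x \<and>
            \<bar>b x t \<xi>\<bar> \<le> M * rpow (1 + (norm \<xi>)\<^sup>2) ((p + q - 2) / 4)
              + M * rpow \<bar>t\<bar> (\<delta> - 1) + b0 x"
    and weak: "\<And>\<phi> D\<phi>. sobolev q \<Omega> \<phi> D\<phi> \<Longrightarrow> compactly_contained {x \<in> \<Omega>. \<phi> x \<noteq> 0} \<Omega> \<Longrightarrow>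
          has_bochner_integral (lebesgue_on \<Omega>)
            (\<lambda>x. (\<Sum>i\<in>UNIV. a x (u x) (Du x) $ i * D\<phi> x $ i) + b x (u x) (Du x) * \<phi> x) 0"
begin

definition "P = p / (p - q + 1)"
text \<open>\<open>\<tau>\<close> is the power for which the exponent \<open>n / (n - 1)\<close> of
  Gagliardo's inequality becomes \<open>pstar\<close>. \<open>rst\<close> is the weight that
  Hoelder's inequality leaves to the constant function; in the application it is zero for
  \<open>p < n\<close>, where \<open>pstar\<close> is critical, and positive for
  \<open>p \<ge> n\<close>, where the volume of the ball enters.\<close>

definition "\<tau> = pstar * (real CARD('n) - 1) / real CARD('n)"
definition "rst = 1 / real CARD('n) - 1 / p + 1 / pstar"

abbreviation V where "V x \<equiv> jbr (u x)"
abbreviation Vk where "Vk k x \<equiv> jtr k (u x)"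

definition source where "source \<gamma> x = V x powr \<gamma> * (V x powr m + (b0 x + b1 x) * V x powr l)"

lemma P: "1 \<le> P" "p \<le> P" "P \<le> m"
proof -
  have d: "0 < p - q + 1" using p by simp
  show "1 \<le> P" using p d by (simp add: P_def le_divide_eq)
  have "p * (p - q + 1) \<le> p * 1" using p by (intro mult_left_mono) auto
  then show "p \<le> P" using d by (simp add: P_def le_divide_eq)
  show "P \<le> m" using m by (simp add: P_def)
qed

lemma \<tau>: "1 \<le> \<tau>" "\<tau> * (real CARD('n) / (real CARD('n) - 1)) = pstar" "0 < pstar"
  using tau pstar p dim by (auto simp: \<tau>_def)

lemma wg: "weak_gradient \<Omega> u Du" and Lpu: "Lp_loc q \<Omega> u" "Lp_loc q \<Omega> Du"
  using u by (auto simp: sobolev_loc_def)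

lemma cutoff_composition_powr:
  assumes R: "0 < R" "cball x0 R \<subseteq> \<Omega>" and \<mu>: "1 < \<mu>"
    and "\<And>t. (\<Phi> has_real_derivative \<Phi>' t) (at t)" "continuous_on UNIV \<Phi>'" "\<And>t. \<bar>\<Phi>' t\<bar> \<le> L"
  shows "cutoff_composition \<Omega> u Du \<Phi> \<Phi>' L (\<lambda>x. cutoff x0 R x powr \<mu>) (grad_cutoff_powr x0 R \<mu>) (cball x0 R)"
proof
  show "cutoff x0 R x powr \<mu> = 0" if "x \<notin> cball x0 R" for x
    using cutoff_outside[OF R(1), of x x0] that by auto
qed (use assms wg \<Omega> cutoff_powr_has_derivative[OF \<mu>] continuous_grad_cutoff_powr[OF \<mu>] in auto)

context
  fixes x0 :: "real ^ 'n" and R k \<gamma> :: real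
  assumes R: "0 < R" "R \<le> 1" and KR: "cball x0 R \<subseteq> \<Omega>" and k: "1 \<le> k" and \<gamma>: "0 \<le> \<gamma>"
    and src: "integrable (lebesgue_on (cball x0 R)) (source \<gamma>)"
begin

abbreviation "K \<equiv> cball x0 R"
abbreviation "ct \<equiv> cutoff x0 R"

lemma Ks: "K \<in> sets lebesgue" "\<Omega> \<in> sets lebesgue" "compact K"
  using \<Omega> by auto

lemma ubm [measurable]: "u \<in> borel_measurable (lebesgue_on K)" "Du \<in> borel_measurable (lebesgue_on K)"
  using weak_gradient_L1_on_compact[OF wg Ks(3) KR] by auto

lemma jm [measurable]: "jbr \<in> borel_measurable borel" "jtr k \<in> borel_measurable borel" "jtr' k \<in> borel_measurable borel"
  using continuous_jbr continuous_jtr[OF k] continuous_jtr'[OF k] by (auto intro: borel_measurable_continuous_onI)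

lemma ctm [measurable]: "ct \<in> borel_measurable (lebesgue_on S)"
  by (rule continuous_measurable_lebesgue_on[OF continuous_cutoff])

lemma bounded_integrable:
  assumes [measurable]: "f \<in> borel_measurable (lebesgue_on K)" and "\<And>x. \<bar>f x\<bar> \<le> (B::real)"
  shows "integrable (lebesgue_on K) f"
proof -
  interpret finite_measure "lebesgue_on K" by (rule finite_measure_lebesgue_on_compact[OF Ks(3)])
  show ?thesis using assms(2) by (intro integrable_const_bound[of _ B]) auto
qed

text \<open>The cutoff carries the power \<open>2 * P\<close> rather than \<open>P\<close> because
  the power must exceed 1 for the cutoff to be \<open>C^1\<close>, also when
  \<open>P = 1\<close>.\<close>

definition energy where "energy x = Vk k x powr \<gamma> * norm (Du x) powr p * ct x powr (2 * P)"

text \<open>The weight is bounded by \<open>k powr \<gamma>\<close>, and \<open>p \<le> q\<close>.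
  This is the point of the truncation: the Bochner integral of the energy carries information only
  once the energy is known to be integrable.\<close>

lemma energy_integrable: "integrable (lebesgue_on K) energy"
proof -
  interpret finite_measure "lebesgue_on K" by (rule finite_measure_lebesgue_on_compact[OF Ks(3)])
  have "Lp q K Du" using Lpu(2) KR Ks(3) by (auto simp: Lp_loc_def)
  then have i: "integrable (lebesgue_on K) (\<lambda>x. k powr \<gamma> * (1 + norm (Du x) powr q))" by (simp add: Lp_def)
  show ?thesis
  proof (rule Bochner_Integration.integrable_bound[OF i])
    show "energy \<in> borel_measurable (lebesgue_on K)" unfolding energy_def by measurable
    show "AE x in lebesgue_on K. norm (energy x) \<le> norm (k powr \<gamma> * (1 + norm (Du x) powr q))"
    proof (rule AE_I2)
      fix x
      have 1: "Vk k x powr \<gamma> \<le> k powr \<gamma>" using jtr_bounds[OF k] \<gamma> by (intro powr_mono2) (auto simp: less_imp_le)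
      have 2: "norm (Du x) powr p \<le> 1 + norm (Du x) powr q"
      proof (cases "norm (Du x) \<le> 1")
        case True
        then have "norm (Du x) powr p \<le> 1" using p by (intro powr_le1) auto
        then show ?thesis by (rule order_trans) simp
      next
        case False
        then have "norm (Du x) powr p \<le> norm (Du x) powr q" using p by (intro powr_mono) auto
        then show ?thesis by simp
      qed
      have 3: "ct x powr (2 * P) \<le> 1" using P by (intro powr_le1) (simp_all add: cutoff_range)
      have "energy x \<le> (k powr \<gamma> * (1 + norm (Du x) powr q)) * 1"
        unfolding energy_def by (rule mult_mono[OF mult_mono[OF 1 2] 3]) auto
      moreover have "0 \<le> energy x" by (simp add: energy_def)
      ultimately show "norm (energy x) \<le> norm (k powr \<gamma> * (1 + norm (Du x) powr q))" by simp
    qed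
  qed
qed

text \<open>The weak formulation makes the integral of \<open>f\<close> vanish, so integrating the
  pointwise inequality leaves only the error terms. These are enlarged from the truncated weight to
  \<open>V\<close>, whence a right hand side independent of \<open>k\<close>.\<close>

lemma energy_estimate:
  "(c1 / 2) * (LINT x|lebesgue_on K. energy x)
    \<le> energy_const p q c1 c2 c3 c4 M * ((1 + \<gamma>) * R powr (- P)) * (LINT x|lebesgue_on K. source \<gamma> x)"
proof -
  define F' where "F' = (\<lambda>t. jtr k t powr \<gamma> + t * (\<gamma> * jtr k t powr (\<gamma> - 1) * jtr' k t))"
  define F where "F = (\<lambda>t. t * jtr k t powr \<gamma>)"
  have Fb: "(F has_real_derivative F' t) (at t)" "jtr k t powr \<gamma> \<le> F' t" "F' t \<le> (1 + \<gamma>) * jtr k t powr \<gamma>"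
    "\<bar>F' t\<bar> \<le> (1 + \<gamma>) * k powr \<gamma>" "\<bar>F t\<bar> \<le> jbr t * jtr k t powr \<gamma>" "continuous_on UNIV F'" for t
    unfolding F_def F'_def by (fact incr_composite_bound[OF k \<gamma>])+
  interpret cc: cutoff_composition \<Omega> u Du F F' "(1 + \<gamma>) * k powr \<gamma>" "\<lambda>x. ct x powr (2 * P)" "grad_cutoff_powr x0 R (2 * P)" K
    by (rule cutoff_composition_powr[OF R(1) KR _ Fb(1,6,4)]) (use P in auto)
  define D where "D = grad_cutoff_powr x0 R (2 * P)"
  define f where "f x = (F' (u x) * ct x powr (2 * P)) * (a x (u x) (Du x) \<bullet> Du x) + F (u x) * (a x (u x) (Du x) \<bullet> D x)
      + b x (u x) (Du x) * (F (u x) * ct x powr (2 * P))" for x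
  have f_eq: "(\<Sum>i\<in>UNIV. a x (u x) (Du x) $ i * cc.Dw x $ i) + b x (u x) (Du x) * cc.w x = f x" for x
  proof -
    have "(\<Sum>i\<in>UNIV. a x (u x) (Du x) $ i * cc.Dw x $ i) = a x (u x) (Du x) \<bullet> cc.Dw x" by (simp add: inner_vec_def)
    then show ?thesis by (simp add: cc.Dw_def cc.w_def f_def D_def inner_add_right)
  qed
  have hb: "has_bochner_integral (lebesgue_on \<Omega>) f 0"
    using weak[OF cc.sobolev_w[OF _ Lpu] cc.compactly_contained_w] p by (simp add: f_eq)
  have f0: "f x = 0" if "x \<notin> K" for x
    using cc.vanish[OF that] unfolding f_eq[symmetric] by simp
  have fi: "integrable (lebesgue_on K) f"
    using hb KR by (intro integrable_lebesgue_on_subset[OF _ Ks(1,2)]) (auto simp: has_bochner_integral_iff)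
  have fz: "(LINT x|lebesgue_on K. f x) = 0"
    using hb set_integral_lebesgue_on_vanish[OF Ks(1,2) KR, of f] f0 by (simp add: has_bochner_integral_iff)
  let ?C = "energy_const p q c1 c2 c3 c4 M * ((1 + \<gamma>) * R powr (- P))"
  have C0: "0 \<le> ?C"
    using c P \<gamma> by (auto simp: energy_const_def Let_def young_const_def P_def[symmetric] intro!: mult_nonneg_nonneg add_nonneg_nonneg)
  have "AE x in lebesgue_on K. (c1 / 2) * energy x \<le> f x + ?C * source \<gamma> x"
    using AE_lebesgue_on_subset[OF struct Ks(1,2) KR] AE_lebesgue_on_subset[OF nonneg Ks(1,2) KR]
  proof eventually_elim
    fix x
    assume st: "\<forall>t \<xi>.
            a x t \<xi> \<bullet> \<xi> \<ge> c1 * rpow (norm \<xi>) p - c2 * rpow \<bar>t\<bar> \<theta> - b1 x \<and>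
            norm (a x t \<xi>) \<le> c3 * rpow (norm \<xi>) (q - 1)
              + c4 * rpow \<bar>t\<bar> ((q - 1) * (2 / (q - p + 2))) + b1 x \<and>
            \<bar>b x t \<xi>\<bar> \<le> M * rpow (1 + (norm \<xi>)\<^sup>2) ((p + q - 2) / 4)
              + M * rpow \<bar>t\<bar> (\<delta> - 1) + b0 x" and nn: "0 \<le> b0 x \<and> 0 \<le> b1 x"
    let ?W = "Vk k x powr \<gamma>"
    have D: "norm (D x) \<le> (4 * (p / (p - q + 1)) / R) * (ct x powr (2 * P)) powr (1 - (p - q + 1) / p)"
    proof -
      have "norm (D x) \<le> (2 * (2 * P) / R) * ct x powr (2 * P - 1)"
        unfolding D_def by (rule norm_grad_cutoff_powr) (use P R in auto)
      \<comment> \<open>The exponent on the right is \<open>2 * P - 2\<close>; as the cutoff is at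
        most 1, one power of it is given away to reach the form that \<open>pointwise_energy\<close>
        expects.\<close>
      also have "\<dots> \<le> (2 * (2 * P) / R) * ct x powr (2 * P * (1 - (p - q + 1) / p))"
      proof (intro mult_left_mono powr_mono')
        have "P * ((p - q + 1) / p) = 1" using p by (simp add: P_def)
        then have "2 * P * (1 - (p - q + 1) / p) = 2 * P - 2" by (simp add: right_diff_distrib mult.assoc)
        then show "2 * P * (1 - (p - q + 1) / p) \<le> 2 * P - 1" by simp
      qed (use cutoff_range P R in auto)
      finally show ?thesis by (simp add: P_def powr_powr)
    qed
    have "(c1 / 2) * (?W * norm (Du x) powr p * ct x powr (2 * P))
      \<le> ((F' (u x) * ct x powr (2 * P)) * (a x (u x) (Du x) \<bullet> Du x) + F (u x) * (a x (u x) (Du x) \<bullet> D x) + b x (u x) (Du x) * (F (u x) * ct x powr (2 * P)))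
       + energy_const p q c1 c2 c3 c4 M * ((1 + \<gamma>) * R powr (- (p / (p - q + 1)))) * (?W * (jbr (u x) powr m + (b0 x + b1 x) * jbr (u x) powr l))"
      by (rule pointwise_energy[OF p \<theta> \<delta> c m l _ _ _ _ _ _ _ R D _ _ _ _ \<gamma>])
        (use st nn Fb P in \<open>simp_all add: cutoff_range powr_le1\<close>)
    then have "(c1 / 2) * energy x \<le> f x + ?C * (?W * (V x powr m + (b0 x + b1 x) * V x powr l))"
      by (simp add: energy_def f_def P_def)
    also have "?C * (?W * (V x powr m + (b0 x + b1 x) * V x powr l)) \<le> ?C * source \<gamma> x"
      unfolding source_def using C0 nn jtr_bounds[OF k] \<gamma>
      by (intro mult_left_mono mult_right_mono powr_mono2) (auto simp: less_imp_le)
    finally show "(c1 / 2) * energy x \<le> f x + ?C * source \<gamma> x" by simp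
  qed
  then have "(LINT x|lebesgue_on K. (c1 / 2) * energy x) \<le> (LINT x|lebesgue_on K. f x + ?C * source \<gamma> x)"
    using energy_integrable fi src by (intro integral_mono_AE) auto
  then show ?thesis using fi src fz by simp
qed


section \<open>The Sobolev inequality for powers of the truncation\<close>

definition "ex = (\<gamma> + p) / p"

lemma ex: "1 \<le> ex" "ex * p = \<gamma> + p" "(ex - 1) * p = \<gamma>" "ex \<le> 1 + \<gamma>"
proof -
  show "1 \<le> ex" "ex * p = \<gamma> + p" "(ex - 1) * p = \<gamma>" using p \<gamma> by (simp_all add: ex_def field_simps)
  have "\<gamma> / p \<le> \<gamma>" using p \<gamma> by (simp add: divide_le_eq mult_left_mono[of 1 p \<gamma>, simplified])
  then show "ex \<le> 1 + \<gamma>" using p by (simp add: ex_def add_divide_distrib)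
qed

text \<open>\<open>ex\<close> and the power of the cutoff are chosen so that
  \<open>zz x powr p\<close> is \<open>Vk k x powr (\<gamma> + p) * ct x powr (2 * P)\<close>: the
  part of the gradient that contains \<open>Du\<close> then has its \<open>p\<close>-th power
  controlled by \<open>ex powr p * energy x\<close>.\<close>

definition zz where "zz x = Vk k x powr ex * ct x powr (2 * P / p)"

text \<open>Dominates the \<open>p\<close>-th power of the norm of the gradient of \<open>zz\<close>.\<close>

definition QQ where "QQ x = 2 powr p * (ex powr p * energy x + (4 * P / R) powr p * Vk k x powr (\<gamma> + p))"

lemma Vk_pos: "0 < Vk k x" "Vk k x \<le> k" "Vk k x \<le> V x"
  using jtr_bounds[OF k] by auto

lemma Vk_integrable:
  assumes "0 \<le> e" shows "integrable (lebesgue_on K) (\<lambda>x. Vk k x powr e)"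
proof (rule bounded_integrable)
  show "\<bar>Vk k x powr e\<bar> \<le> k powr e" for x using Vk_pos[of x] assms by (simp add: powr_mono2)
qed measurable

lemma zz_integrable: "integrable (lebesgue_on K) (\<lambda>x. zz x powr pstar)"
proof (rule bounded_integrable)
  show "(\<lambda>x. zz x powr pstar) \<in> borel_measurable (lebesgue_on K)" unfolding zz_def by measurable
  fix x
  have "zz x \<le> k powr ex * 1"
    unfolding zz_def using Vk_pos[of x] ex P p by (intro mult_mono powr_mono2 powr_le1) (simp_all add: cutoff_range)
  moreover have "0 \<le> zz x" by (simp add: zz_def)
  ultimately show "\<bar>zz x powr pstar\<bar> \<le> (k powr ex) powr pstar" using \<tau>(3) by (simp add: powr_mono2)
qed

lemma QQ_integrable: "integrable (lebesgue_on K) QQ"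
  unfolding QQ_def using energy_integrable Vk_integrable[of "\<gamma> + p"] \<gamma> p by simp

lemma QQ_nonneg: "0 \<le> QQ x"
  by (simp add: QQ_def energy_def)

text \<open>The vector is the gradient of \<open>zz x powr \<tau>\<close> as delivered by the chain
  rule. Splitting off \<open>\<tau> * zz x powr (\<tau> - 1)\<close> leaves a bound for the gradient
  of \<open>zz\<close> itself, which is the form to which Hoelder's inequality applies. The cutoff
  appears with a power above 1 because \<open>p \<le> P\<close>, and what remains of it in the
  second term is at most 1.\<close>

lemma sobolev_gradient_bound:
  "norm ((ex * \<tau> * Vk k x powr (ex * \<tau> - 1) * jtr' k (u x) * ct x powr (2 * P * \<tau> / p)) *\<^sub>R Du x
      + Vk k x powr (ex * \<tau>) *\<^sub>R grad_cutoff_powr x0 R (2 * P * \<tau> / p) x)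
    \<le> \<tau> * (zz x powr (\<tau> - 1) * QQ x powr (1 / p))"
proof -
  define A where "A = ex * Vk k x powr (ex - 1) * ct x powr (2 * P / p) * norm (Du x)"
  define B where "B = Vk k x powr ex * (4 * P / R)"
  have Pp: "1 \<le> P / p" using P(2) p by (simp add: le_divide_eq)
  have zt: "zz x powr (\<tau> - 1) = Vk k x powr (ex * (\<tau> - 1)) * ct x powr (2 * P / p * (\<tau> - 1))"
    by (simp add: zz_def powr_mult powr_powr)
  have AB: "0 \<le> A" "0 \<le> B" using ex P R p by (auto simp: A_def B_def)
  have "norm ((ex * \<tau> * Vk k x powr (ex * \<tau> - 1) * jtr' k (u x) * ct x powr (2 * P * \<tau> / p)) *\<^sub>R Du x)
     = ex * \<tau> * Vk k x powr (ex * \<tau> - 1) * \<bar>jtr' k (u x)\<bar> * ct x powr (2 * P * \<tau> / p) * norm (Du x)"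
    using ex \<tau> by (simp add: abs_mult)
  also have "\<dots> \<le> ex * \<tau> * Vk k x powr (ex * \<tau> - 1) * 1 * ct x powr (2 * P * \<tau> / p) * norm (Du x)"
    using ex \<tau> jtr'_bound(1)[OF k] by (intro mult_right_mono mult_left_mono) auto
  also have "\<dots> = \<tau> * (zz x powr (\<tau> - 1) * A)"
  proof -
    have e1: "ex * \<tau> - 1 = ex * (\<tau> - 1) + (ex - 1)" by (simp add: algebra_simps)
    have e2: "2 * P * \<tau> / p = 2 * P / p * (\<tau> - 1) + 2 * P / p" by (simp add: algebra_simps diff_divide_distrib)
    show ?thesis unfolding zt A_def e1 e2 powr_add by (simp add: mult_ac)
  qed
  finally have 1: "norm ((ex * \<tau> * Vk k x powr (ex * \<tau> - 1) * jtr' k (u x) * ct x powr (2 * P * \<tau> / p)) *\<^sub>R Du x)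
     \<le> \<tau> * (zz x powr (\<tau> - 1) * A)" .
  have mu: "1 < 2 * P * \<tau> / p"
  proof -
    have "1 * 1 \<le> (P / p) * \<tau>" using Pp \<tau> by (intro mult_mono) auto
    then show ?thesis by simp
  qed
  have "norm (Vk k x powr (ex * \<tau>) *\<^sub>R grad_cutoff_powr x0 R (2 * P * \<tau> / p) x)
     \<le> Vk k x powr (ex * \<tau>) * ((2 * (2 * P * \<tau> / p) / R) * ct x powr (2 * P * \<tau> / p - 1))"
    unfolding norm_scaleR abs_of_nonneg[OF powr_ge_zero]
    by (intro mult_left_mono norm_grad_cutoff_powr mu R(1) powr_ge_zero)
  also have "\<dots> = Vk k x powr (ex * \<tau>) * ((\<tau> / p * (4 * P / R)) * (ct x powr (2 * P / p * (\<tau> - 1)) * ct x powr (2 * P / p - 1)))"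
  proof -
    have e: "2 * P * \<tau> / p - 1 = 2 * P / p * (\<tau> - 1) + (2 * P / p - 1)" by (simp add: algebra_simps diff_divide_distrib)
    have pe: "ct x powr (2 * P * \<tau> / p - 1) = ct x powr (2 * P / p * (\<tau> - 1)) * ct x powr (2 * P / p - 1)"
      unfolding e by (rule powr_add)
    show ?thesis unfolding pe by (simp add: mult_ac)
  qed
  also have "\<dots> \<le> Vk k x powr (ex * \<tau>) * ((\<tau> * (4 * P / R)) * (ct x powr (2 * P / p * (\<tau> - 1)) * 1))"
  proof (intro mult_left_mono mult_mono)
    show "\<tau> / p \<le> \<tau>" using \<tau> p by (simp add: divide_le_eq mult_left_mono[of 1 p \<tau>, simplified])
    show "ct x powr (2 * P / p - 1) \<le> 1" using Pp by (intro powr_le1) (simp_all add: cutoff_range)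
  qed (use \<tau> P R p in auto)
  also have "\<dots> = \<tau> * (zz x powr (\<tau> - 1) * B)"
  proof -
    have e1: "ex * \<tau> = ex * (\<tau> - 1) + ex" by (simp add: algebra_simps)
    show ?thesis unfolding zt B_def e1 powr_add by (simp add: mult_ac)
  qed
  finally have 2: "norm (Vk k x powr (ex * \<tau>) *\<^sub>R grad_cutoff_powr x0 R (2 * P * \<tau> / p) x) \<le> \<tau> * (zz x powr (\<tau> - 1) * B)" .
  have "A + B \<le> QQ x powr (1 / p)"
  proof -
    have "A powr p = ex powr p * energy x"
    proof -
      have "A powr p = ex powr p * Vk k x powr ((ex - 1) * p) * ct x powr (2 * P / p * p) * norm (Du x) powr p"
        by (simp only: A_def powr_mult powr_powr)
      then show ?thesis using p ex(3) by (simp add: energy_def mult_ac)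
    qed
    moreover have "B powr p = (4 * P / R) powr p * Vk k x powr (\<gamma> + p)"
      unfolding B_def powr_mult powr_powr ex(2) by (rule mult.commute)
    ultimately have "(A + B) powr p \<le> QQ x"
      using powr_add_le_2[OF AB, of p] p by (simp add: QQ_def)
    then have "((A + B) powr p) powr (1 / p) \<le> QQ x powr (1 / p)" using p by (intro powr_mono2) auto
    then show ?thesis using AB p by (simp add: powr_powr)
  qed
  then have "\<tau> * (zz x powr (\<tau> - 1) * (A + B)) \<le> \<tau> * (zz x powr (\<tau> - 1) * QQ x powr (1 / p))"
    using \<tau> by (intro mult_left_mono) auto
  moreover have "\<tau> * (zz x powr (\<tau> - 1) * A) + \<tau> * (zz x powr (\<tau> - 1) * B) = \<tau> * (zz x powr (\<tau> - 1) * (A + B))"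
    by (simp add: algebra_simps)
  ultimately show ?thesis using norm_triangle_le[OF add_mono[OF 1 2]] by linarith
qed

text \<open>Gagliardo's inequality for \<open>zz x powr \<tau>\<close>, followed by Hoelder's
  inequality with the weights \<open>1 / p\<close>, \<open>(\<tau> - 1) / pstar\<close> and
  \<open>rst\<close>. A power of \<open>Y\<close> reappears on the right and is divided out, which
  is legitimate because the truncation makes the integrand of \<open>Y\<close> integrable; by
  \<open>1 / N' - (\<tau> - 1) / pstar = 1 / pstar\<close> the power \<open>1 / pstar\<close>
  remains.\<close>

lemma sobolev_estimate:
  "(LINT x|lebesgue_on K. zz x powr pstar) powr (p / pstar)
    \<le> (\<tau> * measure lebesgue K powr rst) powr p * (LINT x|lebesgue_on K. QQ x)"
proof -
  define N' where "N' = real CARD('n) / (real CARD('n) - 1)"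
  have N': "0 < N'" "\<tau> * N' = pstar" using dim \<tau>(2) by (auto simp: N'_def)
  define H where "H = (\<lambda>t. jtr k t powr (ex * \<tau>))"
  define H' where "H' = (\<lambda>t. ex * \<tau> * jtr k t powr (ex * \<tau> - 1) * jtr' k t)"
  have et: "1 \<le> ex * \<tau>" using mult_mono[OF ex(1) \<tau>(1)] ex by simp
  have jp: "0 < jtr k t" "jtr k t \<le> k" for t using jtr_bounds[OF k] by auto
  have H: "(H has_real_derivative H' t) (at t)" for t
    unfolding H_def H'_def by (rule jtr_powr_has_derivative[OF k])
  have cH': "continuous_on UNIV H'"
    unfolding H'_def
    by (intro continuous_intros continuous_on_powr continuous_jtr[OF k] continuous_jtr'[OF k]) (use jp in \<open>auto simp: less_imp_neq[symmetric]\<close>)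
  have bH': "\<bar>H' t\<bar> \<le> ex * \<tau> * k powr (ex * \<tau> - 1)" for t
  proof -
    have "\<bar>H' t\<bar> = ex * \<tau> * jtr k t powr (ex * \<tau> - 1) * \<bar>jtr' k t\<bar>" using et by (simp add: H'_def abs_mult[of "_ * _" "jtr' k t"])
    also have "\<dots> \<le> ex * \<tau> * k powr (ex * \<tau> - 1) * 1"
      using et jp[of t] jtr'_bound(1)[OF k] by (intro mult_mono mult_left_mono powr_mono2) auto
    finally show ?thesis by simp
  qed
  have Pp: "1 \<le> P / p" using P(2) p by (simp add: le_divide_eq)
  have mu: "1 < 2 * P * \<tau> / p"
  proof -
    have "1 * 1 \<le> (P / p) * \<tau>" using Pp \<tau> by (intro mult_mono) auto
    then show ?thesis by simp
  qed
  interpret cc: cutoff_composition \<Omega> u Du H H' "ex * \<tau> * k powr (ex * \<tau> - 1)"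
     "\<lambda>x. ct x powr (2 * P * \<tau> / p)" "grad_cutoff_powr x0 R (2 * P * \<tau> / p)" K
    by (rule cutoff_composition_powr[OF R(1) KR mu H cH' bH'])
  have w_eq: "cc.w x = zz x powr \<tau>" for x
    unfolding cc.w_def by (simp add: H_def zz_def powr_mult powr_powr)
  have Dw_le: "norm (cc.Dw x) \<le> \<tau> * (zz x powr (\<tau> - 1) * QQ x powr (1 / p))" for x
    unfolding cc.Dw_def using sobolev_gradient_bound[of x] by (simp add: H_def H'_def)
  define Y where "Y = (LINT x|lebesgue_on K. zz x powr pstar)"
  define Q where "Q = (LINT x|lebesgue_on K. QQ x)"
  have Y0: "0 \<le> Y" "0 \<le> Q" unfolding Y_def Q_def using QQ_nonneg by (auto intro!: Bochner_Integration.integral_nonneg)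
  have "(\<integral>\<^sup>+x. ennreal (\<bar>cc.w x\<bar> powr N') \<partial>lebesgue_on K) = ennreal Y"
    unfolding w_eq Y_def using zz_integrable by (simp add: powr_powr N'(2) nn_integral_eq_integral)
  moreover have "(\<integral>\<^sup>+x. ennreal (norm (cc.Dw x)) \<partial>lebesgue_on K) = ennreal (LINT x|lebesgue_on K. norm (cc.Dw x))"
    using cc.w_integrable(2) by (intro nn_integral_eq_integral) auto
  ultimately have GN: "Y \<le> (LINT x|lebesgue_on K. norm (cc.Dw x)) powr N'"
    using cc.gagliardo_nirenberg_w[OF dim] by (simp add: N'_def epow_ennreal)
  interpret finite_measure "lebesgue_on K" by (rule finite_measure_lebesgue_on_compact[OF Ks(3)])
  have i1: "integrable (lebesgue_on K) (\<lambda>x. 1::real)" by simp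
  have sum1: "1 / p + (\<tau> - 1) / pstar + rst = 1"
  proof -
    have "\<tau> / pstar = 1 - 1 / real CARD('n)" using \<tau>(3) dim by (simp add: \<tau>_def field_simps)
    then show ?thesis by (simp add: rst_def diff_divide_distrib)
  qed
  have r0: "0 \<le> rst" using rest by (simp add: rst_def)
  note HO = holder_powr_3[OF QQ_integrable zz_integrable i1 QQ_nonneg powr_ge_zero zero_le_one _ _ r0 sum1]
  have p0: "0 < 1 / p" "0 \<le> (\<tau> - 1) / pstar" using p \<tau> by auto
  have zr: "(zz x powr pstar) powr ((\<tau> - 1) / pstar) = zz x powr (\<tau> - 1)" for x using \<tau>(3) by (simp add: powr_powr)
  have HO1: "integrable (lebesgue_on K) (\<lambda>x. QQ x powr (1 / p) * zz x powr (\<tau> - 1))"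
    using HO(1)[OF p0] by (simp add: zr)
  have HO2: "(LINT x|lebesgue_on K. QQ x powr (1 / p) * zz x powr (\<tau> - 1))
      \<le> Q powr (1 / p) * Y powr ((\<tau> - 1) / pstar) * measure lebesgue K powr rst"
    using HO(2)[OF p0] Ks(1) by (simp add: zr Q_def Y_def measure_restrict_space)
  have "(LINT x|lebesgue_on K. norm (cc.Dw x)) \<le> (LINT x|lebesgue_on K. \<tau> * (QQ x powr (1 / p) * zz x powr (\<tau> - 1)))"
    using cc.w_integrable(2) HO1 Dw_le by (intro integral_mono) (auto simp: mult.commute)
  also have "\<dots> \<le> \<tau> * (Q powr (1 / p) * Y powr ((\<tau> - 1) / pstar) * measure lebesgue K powr rst)"
    using HO2 \<tau> by simp
  finally have J: "(LINT x|lebesgue_on K. norm (cc.Dw x)) \<le> \<tau> * (Q powr (1 / p) * Y powr ((\<tau> - 1) / pstar) * measure lebesgue K powr rst)" .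
  show ?thesis
  proof (cases "Y = 0")
    case True
    then show ?thesis using Y0 by (simp add: Y_def Q_def)
  next
    case False
    then have Y: "0 < Y" using Y0 by simp
    let ?c = "\<tau> * measure lebesgue K powr rst"
    have "Y powr (1 / N') \<le> ((LINT x|lebesgue_on K. norm (cc.Dw x)) powr N') powr (1 / N')"
      using GN Y N' by (intro powr_mono2) auto
    also have "\<dots> = (LINT x|lebesgue_on K. norm (cc.Dw x))"
      using N' by (simp add: powr_powr Bochner_Integration.integral_nonneg)
    also have "\<dots> \<le> (?c * Q powr (1 / p)) * Y powr ((\<tau> - 1) / pstar)" using J by (simp add: mult_ac)
    finally have "Y powr (1 / N') / Y powr ((\<tau> - 1) / pstar) \<le> ?c * Q powr (1 / p)"
      using Y by (simp add: divide_le_eq)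
    moreover have "Y powr (1 / N') / Y powr ((\<tau> - 1) / pstar) = Y powr (1 / pstar)"
    proof -
      have "1 / N' - (\<tau> - 1) / pstar = 1 / pstar"
      proof -
        have "\<tau> / pstar = \<tau> / (\<tau> * N')" by (simp only: N'(2))
        then have "1 / N' = \<tau> / pstar" using \<tau>(1) by simp
        then show ?thesis by (simp add: diff_divide_distrib)
      qed
      then show ?thesis by (simp add: powr_diff[symmetric])
    qed
    ultimately have "(Y powr (1 / pstar)) powr p \<le> (?c * Q powr (1 / p)) powr p"
      using p by (intro powr_mono2) auto
    also have "\<dots> = ?c powr p * Q" using Y0 p by (simp add: powr_mult powr_powr)
    finally show ?thesis by (simp add: powr_powr Y_def Q_def)
  qed
qed

end

end

section \<open>Moser iteration\<close>

lemma measure_cball_le_unit_ball: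
  fixes x0 :: "'a::euclidean_space"
  assumes "0 < R" "R \<le> 1"
  shows "measure lebesgue (cball x0 R) \<le> unit_ball_vol (real DIM('a))"
proof -
  have "measure lebesgue (cball x0 R) = unit_ball_vol (real DIM('a)) * R ^ DIM('a)"
    using assms content_cball[of R x0] by simp
  also have "\<dots> \<le> unit_ball_vol (real DIM('a)) * 1"
    using assms by (intro mult_left_mono power_le_one) auto
  finally show ?thesis by simp
qed

lemma nn_integral_powr_jtr_limit:
  assumes [measurable]: "v \<in> borel_measurable M"
    and "\<And>j::nat. (\<integral>\<^sup>+x. ennreal (jtr (real j + 1) (v x) powr e) \<partial>M) \<le> C"
  shows "(\<integral>\<^sup>+x. ennreal (jbr (v x) powr e) \<partial>M) \<le> C"
proof -
  have [measurable]: "jtr (real j + 1) \<in> borel_measurable borel" for j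
    using continuous_jtr[of "real j + 1"] by (intro borel_measurable_continuous_onI) simp
  have "(\<integral>\<^sup>+x. ennreal (jbr (v x) powr e) \<partial>M) = (\<integral>\<^sup>+x. liminf (\<lambda>j. ennreal (jtr (real j + 1) (v x) powr e)) \<partial>M)"
  proof (rule nn_integral_cong)
    fix x
    have "(\<lambda>j. ennreal (jtr (real j + 1) (v x) powr e)) \<longlonglongrightarrow> ennreal (jbr (v x) powr e)"
      using jbr_pos[of "v x"] by (intro tendsto_ennrealI tendsto_powr tendsto_const jtr_tendsto) auto
    then show "ennreal (jbr (v x) powr e) = liminf (\<lambda>j. ennreal (jtr (real j + 1) (v x) powr e))"
      by (intro lim_imp_Liminf[symmetric]) auto
  qed
  also have "\<dots> \<le> liminf (\<lambda>j. \<integral>\<^sup>+x. ennreal (jtr (real j + 1) (v x) powr e) \<partial>M)"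
    by (rule nn_integral_liminf) measurable
  also have "\<dots> \<le> liminf (\<lambda>j::nat. C)" by (intro Liminf_mono always_eventually allI assms)
  finally show ?thesis by (simp add: Liminf_const)
qed

context moser_solution
begin

definition "\<kappa> = pstar / p"
definition "\<omega> = unit_ball_vol (real CARD('n))"
text \<open>The first factor is the constant of \<open>sobolev_estimate\<close> with the volume of
  the ball replaced by a bound valid for all radii up to 1; the second collects the two parts of
  \<open>QQ\<close>.\<close>

definition "step_const = (\<tau> * (1 + \<omega>) powr rst) powr p
  * (2 powr p * (2 * energy_const p q c1 c2 c3 c4 M / c1 + (4 * P) powr p))"

lemma energy_const_nonneg: "0 \<le> energy_const p q c1 c2 c3 c4 M"
  by (rule energy_const_ge_0[OF p(3,1) c(2-5)])

lemma \<omega>: "0 \<le> \<omega>" by (simp add: \<omega>_def)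

lemma source_nonneg_AE:
  assumes "S \<in> sets lebesgue" "S \<subseteq> \<Omega>"
  shows "AE x in lebesgue_on S. 0 \<le> source \<gamma> x \<and> V x powr (\<gamma> + m) \<le> source \<gamma> x"
proof -
  have "\<Omega> \<in> sets lebesgue" using \<Omega> by auto
  from AE_lebesgue_on_subset[OF nonneg assms(1) this assms(2)] show ?thesis
  proof eventually_elim
    fix x assume b: "0 \<le> b0 x \<and> 0 \<le> b1 x"
    have "V x powr (\<gamma> + m) = V x powr \<gamma> * V x powr m" by (rule powr_add)
    also have "\<dots> \<le> source \<gamma> x" unfolding source_def using b by (intro mult_left_mono) auto
    finally show "0 \<le> source \<gamma> x \<and> V x powr (\<gamma> + m) \<le> source \<gamma> x"
      using powr_ge_zero[of "V x" "\<gamma> + m"] by linarith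
  qed
qed

text \<open>Both parts of \<open>QQ\<close> are brought to the same form:
  \<open>ex \<gamma> \<le> 1 + \<gamma>\<close> turns the energy factor into
  \<open>(1 + \<gamma>) powr (p + 1)\<close>, and the cutoff part is covered because
  \<open>R powr (- p) \<le> R powr (- P)\<close> for \<open>R \<le> 1\<close> and because
  \<open>V x powr (\<gamma> + p) \<le> V x powr (\<gamma> + m)\<close>, which is one summand of the
  source.\<close>

lemma QQ_integral_le:
  assumes R: "0 < R" "R \<le> 1" and KR: "cball x0 R \<subseteq> \<Omega>" and k: "1 \<le> k" and \<gamma>: "0 \<le> \<gamma>"
    and src: "integrable (lebesgue_on (cball x0 R)) (source \<gamma>)"
  defines "I \<equiv> LINT x|lebesgue_on (cball x0 R). source \<gamma> x"
  shows "(LINT x|lebesgue_on (cball x0 R). QQ x0 R k \<gamma> x)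
    \<le> 2 powr p * (2 * energy_const p q c1 c2 c3 c4 M / c1 + (4 * P) powr p) * ((1 + \<gamma>) powr (p + 1) * R powr (- P) * I)"
proof -
  note asm = R KR k \<gamma> src
  let ?K = "lebesgue_on (cball x0 R)"
  let ?Ce = "energy_const p q c1 c2 c3 c4 M"
  let ?r = "R powr (- P)"
  define E where "E = (LINT x|?K. energy x0 R k \<gamma> x)"
  define W where "W = (LINT x|?K. jtr k (u x) powr (\<gamma> + p))"
  have cm: "cball x0 R \<in> sets lebesgue" by simp
  have I0: "0 \<le> I" unfolding I_def
    using source_nonneg_AE[OF cm KR, of \<gamma>] by (intro integral_nonneg_AE) (auto elim: eventually_mono)
  have WI: "W \<le> I" unfolding W_def I_def
  proof (rule integral_mono_AE[OF Vk_integrable[OF asm] src])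
    show "AE x in ?K. jtr k (u x) powr (\<gamma> + p) \<le> source \<gamma> x"
      using source_nonneg_AE[OF cm KR, of \<gamma>]
    proof eventually_elim
      fix x assume s: "0 \<le> source \<gamma> x \<and> V x powr (\<gamma> + m) \<le> source \<gamma> x"
      have "jtr k (u x) powr (\<gamma> + p) \<le> V x powr (\<gamma> + p)"
        using jtr_bounds[OF k, of "u x"] \<gamma> p by (intro powr_mono2) auto
      also have "\<dots> \<le> V x powr (\<gamma> + m)" using jbr_ge(1)[of "u x"] P by (intro powr_mono) auto
      finally show "jtr k (u x) powr (\<gamma> + p) \<le> source \<gamma> x" using s by linarith
    qed
  qed (use \<gamma> p in simp)
  have EI: "E \<le> (2 * ?Ce / c1) * ((1 + \<gamma>) * ?r * I)"
    using energy_estimate[OF asm] c(1) by (simp add: E_def I_def field_simps)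
  have E0: "0 \<le> E" unfolding E_def by (intro Bochner_Integration.integral_nonneg) (simp add: energy_def[OF asm])
  have ex: "ex \<gamma> \<le> 1 + \<gamma>" "1 \<le> ex \<gamma>" using ex[OF asm] by auto
  have g1: "1 \<le> (1 + \<gamma>) powr (p + 1)" using \<gamma> p by (intro ge_one_powr_ge_zero) auto
  have t1: "ex \<gamma> powr p * E \<le> (2 * ?Ce / c1) * ((1 + \<gamma>) powr (p + 1) * ?r * I)"
  proof -
    have "ex \<gamma> powr p * E \<le> (1 + \<gamma>) powr p * ((2 * ?Ce / c1) * ((1 + \<gamma>) * ?r * I))"
      using ex p EI E0 by (intro mult_mono powr_mono2) auto
    also have "\<dots> = (2 * ?Ce / c1) * (((1 + \<gamma>) powr p * (1 + \<gamma>) powr 1) * ?r * I)" using \<gamma> by simp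
    finally show ?thesis by (simp only: powr_add)
  qed
  have t2: "(4 * P / R) powr p * W \<le> (4 * P) powr p * ((1 + \<gamma>) powr (p + 1) * ?r * I)"
  proof -
    have "(4 * P / R) powr p = (4 * P) powr p * R powr (- p)" using R P by (simp add: powr_divide powr_minus_divide)
    also have "\<dots> \<le> (4 * P) powr p * ?r" using R P by (intro mult_left_mono powr_mono') auto
    finally have "(4 * P / R) powr p * W \<le> ((4 * P) powr p * ?r) * I"
      using WI I0 by (intro mult_mono) (auto simp: W_def intro!: Bochner_Integration.integral_nonneg)
    also have "\<dots> = (4 * P) powr p * (1 * (?r * I))" by simp
    also have "\<dots> \<le> (4 * P) powr p * ((1 + \<gamma>) powr (p + 1) * (?r * I))"
      using g1 I0 by (intro mult_left_mono mult_right_mono) auto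
    finally show ?thesis by (simp add: mult.assoc)
  qed
  have "(LINT x|?K. QQ x0 R k \<gamma> x) = 2 powr p * (ex \<gamma> powr p * E + (4 * P / R) powr p * W)"
    unfolding QQ_def[OF asm] E_def W_def
    using energy_integrable[OF asm] Vk_integrable[OF asm, of "\<gamma> + p"] \<gamma> p by simp
  also have "\<dots> \<le> 2 powr p * ((2 * ?Ce / c1) * ((1 + \<gamma>) powr (p + 1) * ?r * I) + (4 * P) powr p * ((1 + \<gamma>) powr (p + 1) * ?r * I))"
    using t1 t2 by (intro mult_left_mono add_mono) auto
  finally show ?thesis by (simp add: algebra_simps)
qed

text \<open>On the inner ball the cutoff is at least \<open>1 - \<rho> / R\<close>, so its power can
  be divided out of the Sobolev estimate. The resulting bound does not involve \<open>k\<close>, and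
  Fatou's lemma removes the truncation; this also yields the integrability on which the next step
  relies.\<close>

lemma moser_step:
  assumes R: "0 < R" "R \<le> 1" and KR: "cball x0 R \<subseteq> \<Omega>" and \<gamma>: "0 \<le> \<gamma>" and \<rho>: "0 < \<rho>" "\<rho> < R"
    and src: "integrable (lebesgue_on (cball x0 R)) (source \<gamma>)"
  defines "Z \<equiv> ((1 - \<rho> / R) powr (- (2 * P)) * (step_const * ((1 + \<gamma>) powr (p + 1) * R powr (- P) * (LINT x|lebesgue_on (cball x0 R). source \<gamma> x)))) powr \<kappa>"
  shows "integrable (lebesgue_on (cball x0 \<rho>)) (\<lambda>x. V x powr ((\<gamma> + p) * \<kappa>))"
    and "(LINT x|lebesgue_on (cball x0 \<rho>). V x powr ((\<gamma> + p) * \<kappa>)) \<le> Z"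
proof -
  let ?K = "lebesgue_on (cball x0 R)" and ?L = "lebesgue_on (cball x0 \<rho>)"
  define I where "I = (LINT x|?K. source \<gamma> x)"
  define h where "h = 1 - \<rho> / R"
  have h: "0 < h" using \<rho> R by (simp add: h_def)
  have cm: "cball x0 R \<in> sets lebesgue" "cball x0 \<rho> \<in> sets lebesgue" "cball x0 \<rho> \<subseteq> cball x0 R" using \<rho> by auto
  have I0: "0 \<le> I" unfolding I_def
    using source_nonneg_AE[OF cm(1) KR, of \<gamma>] by (intro integral_nonneg_AE) (auto elim: eventually_mono)
  have \<kappa>: "0 < \<kappa>" "1 / \<kappa> = p / pstar" using \<tau>(3) p by (auto simp: \<kappa>_def)
  have sc: "0 \<le> step_const" using energy_const_nonneg c by (simp add: step_const_def)
  have um: "u \<in> borel_measurable ?L" "u \<in> borel_measurable ?K"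
    using weak_gradient_L1_on_compact[OF wg compact_cball] KR cm(3) by (auto dest: borel_measurable_integrable)
  define Zk where "Zk = step_const * ((1 + \<gamma>) powr (p + 1) * R powr (- P) * I)"
  have Zk0: "0 \<le> Zk" using sc I0 by (simp add: Zk_def)
  have Z_eq: "Z = (h powr (- (2 * P)) * Zk) powr \<kappa>" by (simp add: Z_def h_def Zk_def I_def)
  have step: "(\<integral>\<^sup>+x. ennreal (jtr k (u x) powr ((\<gamma> + p) * \<kappa>)) \<partial>?L) \<le> ennreal Z" if k: "1 \<le> k" for k
  proof -
    note asm = R KR k \<gamma> src
    define z where "z x = zz x0 R k \<gamma> x" for x
    define Y where "Y = (LINT x|?K. z x powr pstar)"
    have Y0: "0 \<le> Y" unfolding Y_def by (intro Bochner_Integration.integral_nonneg) simp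
    have mK: "measure lebesgue (cball x0 R) powr rst \<le> (1 + \<omega>) powr rst"
      using measure_cball_le_unit_ball[OF R, of x0] rest by (intro powr_mono2) (auto simp: \<omega>_def rst_def)
    have "Y powr (p / pstar) \<le> (\<tau> * measure lebesgue (cball x0 R) powr rst) powr p * (LINT x|?K. QQ x0 R k \<gamma> x)"
      using sobolev_estimate[OF asm] by (simp add: Y_def z_def)
    also have "\<dots> \<le> (\<tau> * (1 + \<omega>) powr rst) powr p * (2 powr p * (2 * energy_const p q c1 c2 c3 c4 M / c1 + (4 * P) powr p) * ((1 + \<gamma>) powr (p + 1) * R powr (- P) * I))"
    proof (rule mult_mono)
      show "(\<tau> * measure lebesgue (cball x0 R) powr rst) powr p \<le> (\<tau> * (1 + \<omega>) powr rst) powr p"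
        by (rule powr_mono2) (use \<tau>(1) p mult_left_mono[OF mK, of \<tau>] in auto)
      show "(LINT x|?K. QQ x0 R k \<gamma> x) \<le> 2 powr p * (2 * energy_const p q c1 c2 c3 c4 M / c1 + (4 * P) powr p) * ((1 + \<gamma>) powr (p + 1) * R powr (- P) * I)"
        unfolding I_def by (rule QQ_integral_le[OF asm])
      show "0 \<le> (LINT x|?K. QQ x0 R k \<gamma> x)"
        using QQ_nonneg[OF asm] by (intro Bochner_Integration.integral_nonneg)
    qed simp
    also have "\<dots> = Zk" by (simp add: Zk_def step_const_def mult.assoc)
    finally have "(Y powr (1 / \<kappa>)) powr \<kappa> \<le> Zk powr \<kappa>" unfolding \<kappa>(2)[symmetric] using \<kappa>(1) by (intro powr_mono2) auto
    then have Y: "Y \<le> Zk powr \<kappa>" using Y0 \<kappa>(1) by (simp add: powr_powr)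
    have zi: "integrable ?K (\<lambda>x. z x powr pstar)" unfolding z_def by (rule zz_integrable[OF asm])
    have ptw: "jtr k (u x) powr ((\<gamma> + p) * \<kappa>) \<le> h powr (- (2 * P * \<kappa>)) * (z x powr pstar)" if x: "x \<in> cball x0 \<rho>" for x
    proof -
      have ct: "h \<le> cutoff x0 R x" unfolding h_def by (rule cutoff_inside) (use \<rho> x in auto)
      have e1: "ex \<gamma> * pstar = (\<gamma> + p) * \<kappa>" "2 * P / p * pstar = 2 * P * \<kappa>" by (simp_all add: ex_def[OF asm] \<kappa>_def)
      have "z x powr pstar = jtr k (u x) powr ((\<gamma> + p) * \<kappa>) * cutoff x0 R x powr (2 * P * \<kappa>)"
        unfolding z_def zz_def[OF asm] powr_mult powr_powr e1 ..
      also have "\<dots> \<ge> jtr k (u x) powr ((\<gamma> + p) * \<kappa>) * h powr (2 * P * \<kappa>)"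
        using ct h P \<kappa> by (intro mult_left_mono powr_mono2) auto
      finally have "h powr (- (2 * P * \<kappa>)) * (jtr k (u x) powr ((\<gamma> + p) * \<kappa>) * h powr (2 * P * \<kappa>)) \<le> h powr (- (2 * P * \<kappa>)) * (z x powr pstar)"
        by (intro mult_left_mono) auto
      moreover have "h powr (- (2 * P * \<kappa>)) * h powr (2 * P * \<kappa>) = 1" using h by (simp add: powr_add[symmetric])
      ultimately show ?thesis by (metis mult.left_commute mult.right_neutral)
    qed
    have ziL: "integrable ?L (\<lambda>x. z x powr pstar)" by (rule integrable_lebesgue_on_subset[OF zi cm(2,1,3)])
    have "(\<integral>\<^sup>+x. ennreal (jtr k (u x) powr ((\<gamma> + p) * \<kappa>)) \<partial>?L) \<le> (\<integral>\<^sup>+x. ennreal (h powr (- (2 * P * \<kappa>)) * (z x powr pstar)) \<partial>?L)"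
      using ptw by (intro nn_integral_mono ennreal_leI) (simp add: space_restrict_space)
    also have "\<dots> = ennreal (h powr (- (2 * P * \<kappa>)) * (LINT x|?L. z x powr pstar))"
      using ziL by (subst nn_integral_eq_integral) auto
    also have "\<dots> \<le> ennreal (h powr (- (2 * P * \<kappa>)) * Y)"
    proof (intro ennreal_leI mult_left_mono)
      have "(LINT x|?L. z x powr pstar) = (LINT x|lebesgue. indicator (cball x0 \<rho>) x *\<^sub>R (z x powr pstar))"
        by (rule integral_restrict_space) simp
      also have "\<dots> \<le> (LINT x|lebesgue. indicator (cball x0 R) x *\<^sub>R (z x powr pstar))"
        using zi ziL cm(3) by (intro integral_mono) (auto simp: integrable_restrict_space indicator_def)
      also have "\<dots> = Y" unfolding Y_def by (rule integral_restrict_space[symmetric]) simp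
      finally show "(LINT x|?L. z x powr pstar) \<le> Y" .
    qed simp
    also have "\<dots> \<le> ennreal (h powr (- (2 * P * \<kappa>)) * Zk powr \<kappa>)" using Y by (intro ennreal_leI mult_left_mono) auto
    also have "h powr (- (2 * P * \<kappa>)) * Zk powr \<kappa> = Z" unfolding Z_eq powr_mult powr_powr by simp
    finally show ?thesis .
  qed
  have nn: "(\<integral>\<^sup>+x. ennreal (V x powr ((\<gamma> + p) * \<kappa>)) \<partial>?L) \<le> ennreal Z"
    by (rule nn_integral_powr_jtr_limit[OF um(1)]) (rule step, simp)
  have [measurable]: "jbr \<in> borel_measurable borel" using continuous_jbr by (rule borel_measurable_continuous_onI)
  note [measurable] = um(1)
  have meas: "(\<lambda>x. V x powr ((\<gamma> + p) * \<kappa>)) \<in> borel_measurable ?L" by measurable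
  show i: "integrable ?L (\<lambda>x. V x powr ((\<gamma> + p) * \<kappa>))"
    by (rule integrableI_bounded[OF meas]) (use nn in \<open>auto intro: le_less_trans\<close>)
  have "ennreal (LINT x|?L. V x powr ((\<gamma> + p) * \<kappa>)) \<le> ennreal Z"
    using nn i by (subst (asm) nn_integral_eq_integral) auto
  moreover have "0 \<le> Z" by (simp add: Z_def)
  ultimately show "(LINT x|?L. V x powr ((\<gamma> + p) * \<kappa>)) \<le> Z" by (simp add: ennreal_le_iff)
qed

text \<open>Since \<open>V x powr m = V x powr l * V x powr (pstar / s)\<close>, the source is
  \<open>V x powr (\<gamma> + l)\<close> times a function in \<open>L^s\<close> whose norm is
  controlled by \<open>S\<close>. Hoelder's inequality with the weights \<open>1 - 1 / s\<close> and
  \<open>1 / s\<close> then isolates the one integral of \<open>V\<close> that changes from step to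
  step.\<close>

lemma source_bound:
  assumes KR: "cball x0 R \<subseteq> \<Omega>" and s: "1 < s" "m = l + pstar / s"
    and b: "b0 \<in> borel_measurable (lebesgue_on (cball x0 R))" "b1 \<in> borel_measurable (lebesgue_on (cball x0 R))"
      "integrable (lebesgue_on (cball x0 R)) (\<lambda>x. \<bar>b0 x\<bar> powr s)" "integrable (lebesgue_on (cball x0 R)) (\<lambda>x. \<bar>b1 x\<bar> powr s)"
    and Vp: "integrable (lebesgue_on (cball x0 R)) (\<lambda>x. V x powr pstar)"
    and Vg: "integrable (lebesgue_on (cball x0 R)) (\<lambda>x. V x powr ((\<gamma> + l) / (1 - 1 / s)))"
    and S: "2 powr s * ((LINT x|lebesgue_on (cball x0 R). V x powr pstar) + 2 powr s * ((LINT x|lebesgue_on (cball x0 R). \<bar>b0 x\<bar> powr s) + (LINT x|lebesgue_on (cball x0 R). \<bar>b1 x\<bar> powr s))) \<le> S"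
  shows "integrable (lebesgue_on (cball x0 R)) (source \<gamma>)"
    and "(LINT x|lebesgue_on (cball x0 R). source \<gamma> x)
      \<le> (LINT x|lebesgue_on (cball x0 R). V x powr ((\<gamma> + l) / (1 - 1 / s))) powr (1 - 1 / s) * S powr (1 / s)"
proof -
  let ?K = "lebesgue_on (cball x0 R)"
  have [measurable]: "jbr \<in> borel_measurable borel" using continuous_jbr by (rule borel_measurable_continuous_onI)
  have [measurable]: "u \<in> borel_measurable ?K"
    using weak_gradient_L1_on_compact[OF wg compact_cball KR] by auto
  note [measurable] = b(1,2)
  have s': "0 < 1 - 1 / s" using s by simp
  define g where "g x = (V x powr (pstar / s) + (\<bar>b0 x\<bar> + \<bar>b1 x\<bar>)) powr s" for x
  define G where "G x = 2 powr s * (V x powr pstar + 2 powr s * (\<bar>b0 x\<bar> powr s + \<bar>b1 x\<bar> powr s))" for x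
  have gG: "g x \<le> G x" for x
  proof -
    have "g x \<le> 2 powr s * ((V x powr (pstar / s)) powr s + (\<bar>b0 x\<bar> + \<bar>b1 x\<bar>) powr s)"
      unfolding g_def using s by (intro powr_add_le_2) auto
    also have "\<dots> \<le> 2 powr s * ((V x powr (pstar / s)) powr s + 2 powr s * (\<bar>b0 x\<bar> powr s + \<bar>b1 x\<bar> powr s))"
      using s by (intro mult_left_mono add_left_mono powr_add_le_2) auto
    finally show ?thesis using s by (simp add: G_def powr_powr)
  qed
  have Gi: "integrable ?K G" unfolding G_def using b Vp by simp
  have gm: "g \<in> borel_measurable ?K" unfolding g_def by measurable
  have gi: "integrable ?K g"
    by (rule Bochner_Integration.integrable_bound[OF Gi gm])
      (use gG in \<open>auto simp: g_def G_def intro!: AE_I2\<close>)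
  have g0: "0 \<le> g x" for x by (simp add: g_def)
  have "(LINT x|?K. g x) \<le> (LINT x|?K. G x)" using gi Gi gG by (intro integral_mono)
  also have "\<dots> \<le> S" unfolding G_def using S b Vp by simp
  finally have gS: "(LINT x|?K. g x) \<le> S" .
  have sum1: "(1 - 1 / s) + 1 / s = 1" by simp
  note H = holder_powr[OF Vg gi powr_ge_zero g0 less_imp_le[OF s'] _ sum1]
  have s0: "0 \<le> 1 / s" using s by simp
  have eq: "(V x powr ((\<gamma> + l) / (1 - 1 / s))) powr (1 - 1 / s) * g x powr (1 / s)
     = V x powr (\<gamma> + l) * (V x powr (pstar / s) + (\<bar>b0 x\<bar> + \<bar>b1 x\<bar>))" for x
  proof -
    have "g x powr (1 / s) = V x powr (pstar / s) + (\<bar>b0 x\<bar> + \<bar>b1 x\<bar>)"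
      unfolding g_def powr_powr using s by (simp add: add_nonneg_nonneg)
    moreover have "(V x powr ((\<gamma> + l) / (1 - 1 / s))) powr (1 - 1 / s) = V x powr (\<gamma> + l)"
    proof -
      have "1 - 1 / s \<noteq> 0" using s' by linarith
      then have "(\<gamma> + l) / (1 - 1 / s) * (1 - 1 / s) = \<gamma> + l"
        using nonzero_mult_div_cancel_right[OF \<open>1 - 1 / s \<noteq> 0\<close>, of "\<gamma> + l"] by (simp only: times_divide_eq_left)
      then show ?thesis by (simp only: powr_powr)
    qed
    ultimately show ?thesis by simp
  qed
  have ptw: "\<bar>source \<gamma> x\<bar> \<le> V x powr (\<gamma> + l) * (V x powr (pstar / s) + (\<bar>b0 x\<bar> + \<bar>b1 x\<bar>))" for x
  proof -
    have "source \<gamma> x = V x powr (\<gamma> + l) * (V x powr (pstar / s) + (b0 x + b1 x))"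
    proof -
      have "V x powr m = V x powr l * V x powr (pstar / s)" unfolding s(2) by (rule powr_add)
      then show ?thesis by (simp add: source_def powr_add algebra_simps)
    qed
    then have "\<bar>source \<gamma> x\<bar> = V x powr (\<gamma> + l) * \<bar>V x powr (pstar / s) + (b0 x + b1 x)\<bar>" by (simp add: abs_mult)
    also have "\<dots> \<le> V x powr (\<gamma> + l) * (V x powr (pstar / s) + (\<bar>b0 x\<bar> + \<bar>b1 x\<bar>))"
    proof (rule mult_left_mono)
      have "\<bar>V x powr (pstar / s) + (b0 x + b1 x)\<bar> \<le> \<bar>V x powr (pstar / s)\<bar> + (\<bar>b0 x\<bar> + \<bar>b1 x\<bar>)" by linarith
      then show "\<bar>V x powr (pstar / s) + (b0 x + b1 x)\<bar> \<le> V x powr (pstar / s) + (\<bar>b0 x\<bar> + \<bar>b1 x\<bar>)" by simp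
    qed simp
    finally show ?thesis .
  qed
  have sm: "source \<gamma> \<in> borel_measurable ?K" unfolding source_def by measurable
  have Hi: "integrable ?K (\<lambda>x. V x powr (\<gamma> + l) * (V x powr (pstar / s) + (\<bar>b0 x\<bar> + \<bar>b1 x\<bar>)))"
    using H(1)[OF s0] unfolding eq .
  show si: "integrable ?K (source \<gamma>)"
  proof (rule Bochner_Integration.integrable_bound[OF Hi sm], rule AE_I2)
    fix x show "norm (source \<gamma> x) \<le> norm (V x powr (\<gamma> + l) * (V x powr (pstar / s) + (\<bar>b0 x\<bar> + \<bar>b1 x\<bar>)))"
      unfolding real_norm_def by (rule order_trans[OF ptw abs_ge_self])
  qed
  have "(LINT x|?K. source \<gamma> x) \<le> (LINT x|?K. V x powr (\<gamma> + l) * (V x powr (pstar / s) + (\<bar>b0 x\<bar> + \<bar>b1 x\<bar>)))"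
    using si Hi order_trans[OF abs_ge_self ptw] by (intro integral_mono)
  also have "\<dots> \<le> (LINT x|?K. V x powr ((\<gamma> + l) / (1 - 1 / s))) powr (1 - 1 / s) * (LINT x|?K. g x) powr (1 / s)"
    using H(2)[OF s0] unfolding eq .
  also have "\<dots> \<le> (LINT x|?K. V x powr ((\<gamma> + l) / (1 - 1 / s))) powr (1 - 1 / s) * S powr (1 / s)"
    using gS s g0 by (intro mult_left_mono powr_mono2) (auto intro!: Bochner_Integration.integral_nonneg)
  finally show "(LINT x|?K. source \<gamma> x) \<le> (LINT x|?K. V x powr ((\<gamma> + l) / (1 - 1 / s))) powr (1 - 1 / s) * S powr (1 / s)" .
qed

end

text \<open>After taking logarithms and dividing by \<open>chi ^ i\<close> the recursion becomes a
  convergent series: \<open>\<kappa> / (chi - 1)\<close> is the sum over \<open>j\<close> of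
  \<open>\<kappa> / chi ^ (j + 1)\<close>, and the exponent of \<open>H\<close> is the sum of
  \<open>j * \<kappa> / chi ^ (j + 1)\<close>.\<close>

lemma moser_recursion:
  fixes X :: "nat \<Rightarrow> real"
  assumes X0: "X 0 \<le> Z" "\<And>i. 0 \<le> X i" and Z: "0 < Z"
    and rec: "\<And>i. X (Suc i) \<le> (G * H ^ i * X i powr t) powr \<kappa>"
    and chi: "t * \<kappa> = chi" "1 < chi" and \<kappa>: "0 < \<kappa>" and t: "0 \<le> t" and GH: "1 \<le> G" "1 \<le> H"
  shows "X i \<le> (Z * G powr (\<kappa> / (chi - 1)) * H powr (\<kappa> / (chi - 1)\<^sup>2)) powr (chi ^ i)"
proof -
  define f where "f = \<kappa> / (chi - 1)"
  define g where "g = \<kappa> / (chi - 1)\<^sup>2"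
  have d: "0 < chi - 1" using chi by simp
  have fg: "0 \<le> f" "0 \<le> g" "f * (chi - 1) = \<kappa>" "g * (chi - 1) = f"
    using \<kappa> d by (auto simp: f_def g_def power2_eq_square)
  have pos: "0 < G" "0 < H" using GH by auto
  \<comment> \<open>With the exact partial sums as exponents the induction closes by
    \<open>f * (chi - 1) = \<kappa>\<close> and \<open>g * (chi - 1) = f\<close>; the weaker final
    bound would not reproduce itself.\<close>
  have "X i \<le> Z powr (chi ^ i) * G powr (f * (chi ^ i - 1)) * H powr (g * (chi ^ i - 1) - f * real i)"
  proof (induction i)
    case 0
    then show ?case using X0(1) Z pos by simp
  next
    case (Suc i)
    let ?B = "Z powr (chi ^ i) * G powr (f * (chi ^ i - 1)) * H powr (g * (chi ^ i - 1) - f * real i)"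
    have "X i powr t \<le> ?B powr t" using Suc X0(2) t by (intro powr_mono2)
    then have "G * H ^ i * X i powr t \<le> G * H ^ i * ?B powr t"
      using pos by (intro mult_left_mono) auto
    then have "(G * H ^ i * X i powr t) powr \<kappa> \<le> (G * H ^ i * ?B powr t) powr \<kappa>"
      by (rule powr_mono2[rotated 2]) (use pos \<kappa> in auto)
    also have "\<dots> = Z powr (chi ^ i * chi) * (G powr \<kappa> * G powr (f * (chi ^ i - 1) * chi))
        * (H powr (real i * \<kappa>) * H powr ((g * (chi ^ i - 1) - f * real i) * chi))"
    proof -
      have "H ^ i = H powr real i" using pos by (simp add: powr_realpow)
      then show ?thesis unfolding chi(1)[symmetric]
        by (simp only: powr_mult powr_powr mult.assoc) (simp only: ac_simps)
    qed
    also have "G powr \<kappa> * G powr (f * (chi ^ i - 1) * chi) = G powr (f * (chi ^ Suc i - 1))"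
    proof -
      have "\<kappa> + f * (chi ^ i - 1) * chi = f * (chi ^ Suc i - 1)"
        unfolding fg(3)[symmetric] by (simp add: algebra_simps)
      then show ?thesis by (simp only: powr_add[symmetric])
    qed
    also have "H powr (real i * \<kappa>) * H powr ((g * (chi ^ i - 1) - f * real i) * chi) = H powr (g * (chi ^ Suc i - 1) - f * real (Suc i))"
    proof -
      have "real i * \<kappa> + (g * (chi ^ i - 1) - f * real i) * chi = g * (chi ^ Suc i - 1) - f * real (Suc i)"
        unfolding fg(3)[symmetric] fg(4)[symmetric] by (simp add: algebra_simps)
      then show ?thesis by (simp only: powr_add[symmetric])
    qed
    finally have "(G * H ^ i * X i powr t) powr \<kappa>
      \<le> Z powr (chi ^ i * chi) * G powr (f * (chi ^ Suc i - 1)) * H powr (g * (chi ^ Suc i - 1) - f * real (Suc i))" .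
    then show ?case using rec[of i] by (simp add: mult.commute)
  qed
  also have "\<dots> \<le> Z powr (chi ^ i) * G powr (f * chi ^ i) * H powr (g * chi ^ i)"
  proof -
    have e1: "f * (chi ^ i - 1) \<le> f * chi ^ i" using fg(1) by (simp add: right_diff_distrib)
    have "0 \<le> f * real i" using fg(1) by simp
    then have e2: "g * (chi ^ i - 1) - f * real i \<le> g * chi ^ i" using fg(2) by (simp add: right_diff_distrib)
    show ?thesis
      by (rule mult_mono[OF mult_mono[OF order_refl powr_mono[OF e1 GH(1)]] powr_mono[OF e2 GH(2)]]) auto
  qed
  also have "\<dots> = (Z * G powr f * H powr g) powr (chi ^ i)" by (simp add: powr_mult powr_powr)
  finally show ?thesis by (simp add: f_def g_def)
qed

text \<open>By Bernoulli's inequality \<open>chi ^ i\<close> is at least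
  \<open>i * (chi - 1)\<close>, so a geometric sequence dominates.\<close>

lemma powr_power_tendsto_0:
  fixes \<theta> chi :: real
  assumes "0 \<le> \<theta>" "\<theta> < 1" "1 < chi"
  shows "(\<lambda>i. \<theta> powr (chi ^ i)) \<longlonglongrightarrow> 0"
proof (rule tendsto_sandwich[of "\<lambda>_. 0" _ _ "\<lambda>i. (\<theta> powr (chi - 1)) ^ i"])
  have "\<theta> powr (chi ^ i) \<le> (\<theta> powr (chi - 1)) ^ i" for i
  proof (cases "\<theta> = 0")
    case False
    have "1 + real i * (chi - 1) \<le> (1 + (chi - 1)) ^ i" using assms by (intro Bernoulli_inequality) auto
    then have "real i * (chi - 1) \<le> chi ^ i" by simp
    then have "\<theta> powr (chi ^ i) \<le> \<theta> powr (real i * (chi - 1))" using assms by (intro powr_mono') auto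
    also have "\<dots> = (\<theta> powr (chi - 1)) powr real i" by (simp add: powr_powr mult.commute)
    also have "\<dots> = (\<theta> powr (chi - 1)) ^ i" using False assms by (intro powr_realpow) auto
    finally show ?thesis .
  qed simp
  then show "\<forall>\<^sub>F i in sequentially. \<theta> powr (chi ^ i) \<le> (\<theta> powr (chi - 1)) ^ i" by simp
  have "\<theta> powr (chi - 1) < 1"
  proof (cases "\<theta> = 0")
    case False
    then have "\<theta> powr (chi - 1) < 1 powr (chi - 1)" using assms by (intro powr_less_mono2) auto
    then show ?thesis by simp
  qed simp
  then show "(\<lambda>i. (\<theta> powr (chi - 1)) ^ i) \<longlonglongrightarrow> 0" by (intro LIMSEQ_realpow_zero) auto
qed auto

section \<open>Exponents, radii and constants of the iteration\<close>

context moser_solution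
begin

context
  fixes s \<sigma> r S Z :: real and x0 :: "real ^ 'n"
  assumes s: "1 < s" "m = l + pstar / s" and \<sigma>: "0 < \<sigma>" "pstar = m + \<sigma>" "p < \<sigma> + l"
    and r: "0 < r" "r \<le> 1" and ball: "ball x0 r \<subseteq> \<Omega>"
    and bm: "b0 \<in> borel_measurable (lebesgue_on (ball x0 r))" "b1 \<in> borel_measurable (lebesgue_on (ball x0 r))"
    and bi: "integrable (lebesgue_on (ball x0 r)) (\<lambda>x. \<bar>b0 x\<bar> powr s)" "integrable (lebesgue_on (ball x0 r)) (\<lambda>x. \<bar>b1 x\<bar> powr s)"
    and Vi: "integrable (lebesgue_on (ball x0 r)) (\<lambda>x. V x powr pstar)"
    and Z: "1 \<le> Z" "(LINT x|lebesgue_on (ball x0 r). V x powr pstar) \<le> Z"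
    and S: "1 \<le> S" "2 powr s * (Z + 2 powr s * ((LINT x|lebesgue_on (ball x0 r). \<bar>b0 x\<bar> powr s) + (LINT x|lebesgue_on (ball x0 r). \<bar>b1 x\<bar> powr s))) \<le> S"
begin

text \<open>The gain per step: Hoelder's inequality costs the factor \<open>1 - 1 / s\<close>, the
  Sobolev inequality gains \<open>\<kappa> = pstar / p\<close>, and
  \<open>pstar * (1 - 1 / s) = \<sigma> + l\<close> makes this expression their product. It exceeds
  1 by the assumption \<open>p < \<sigma> + l\<close>.\<close>

definition "chi = (\<sigma> + l) / p"
text \<open>Starts at \<open>3 * r / 4\<close>, so that all closed balls lie inside the open ball
  \<open>ball x0 r\<close>, and decreases to \<open>r / 2\<close>; the gaps halve in each
  step.\<close>

definition "rad i = r * (1 / 2 + (1 / 2) ^ (i + 2))"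
text \<open>The exponents \<open>gam\<close> solve the recursion that identifies the Lebesgue exponent gained in
  step \<open>i\<close> with the one needed in step \<open>i + 1\<close>.\<close>

definition "gam i = \<sigma> * (chi ^ Suc i - 1) / (chi - 1)"
definition "bet i = (gam i + l) / (1 - 1 / s)"
definition "XX i = (LINT x|lebesgue_on (cball x0 (rad i)). V x powr bet i)"
definition "cgam = (1 + \<sigma> / (chi - 1)) * chi"
text \<open>Between consecutive radii \<open>1 - rad (Suc i) / rad i\<close> is at least
  \<open>(1 / 2) ^ (i + 3)\<close>; its power \<open>- (2 * P)\<close> gives
  \<open>8 powr (2 * P)\<close> here and the \<open>i\<close>-th power of \<open>4 powr P\<close> in
  \<open>HH\<close>. The factor \<open>2 powr P\<close> comes from \<open>rad i \<ge> r / 2\<close>,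
  and 1 is added to \<open>step_const\<close> to keep the whole constant at least 1.
  \<open>GG\<close> separates off what depends on \<open>r\<close> and \<open>S\<close>.\<close>

definition "G0 = 8 powr (2 * P) * (1 + step_const) * cgam powr (p + 1) * 2 powr P"
definition "GG = G0 * (r powr (- P) * S powr (1 / s))"
definition "HH = 4 powr P * chi powr (p + 1)"

lemma chi: "1 < chi" "(1 - 1 / s) * \<kappa> = chi" "0 < 1 - 1 / s" "chi * p - l = \<sigma>"
proof -
  show "1 < chi" using \<sigma> p by (simp add: chi_def)
  have "pstar - pstar / s = \<sigma> + l" using s \<sigma> by simp
  then have "(1 - 1 / s) * pstar = \<sigma> + l" by (simp add: left_diff_distrib)
  then show "(1 - 1 / s) * \<kappa> = chi" by (simp add: \<kappa>_def chi_def)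
  show "0 < 1 - 1 / s" using s by simp
  show "chi * p - l = \<sigma>" using p by (simp add: chi_def)
qed

lemma gam: "0 \<le> gam i" "gam (Suc i) + l = chi * (gam i + p)" "1 + gam i \<le> cgam * chi ^ i" "gam 0 = \<sigma>"
proof -
  have d: "0 < chi - 1" using chi by simp
  have c1: "1 \<le> chi ^ Suc i" using chi(1) by (intro one_le_power) simp
  show "0 \<le> gam i" unfolding gam_def using c1 d \<sigma> by (intro divide_nonneg_pos mult_nonneg_nonneg) auto
  have e: "gam i * (chi - 1) = \<sigma> * (chi ^ Suc i - 1)" for i using d by (simp add: gam_def)
  have "(gam (Suc i) - (chi * gam i + \<sigma>)) * (chi - 1) = 0"
    using e[of i] e[of "Suc i"] by (simp add: algebra_simps)
  then have "gam (Suc i) = chi * gam i + \<sigma>" using d by simp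
  then show "gam (Suc i) + l = chi * (gam i + p)" using chi(4) by (simp add: algebra_simps)
  have "gam i \<le> (\<sigma> / (chi - 1)) * chi ^ Suc i"
    unfolding gam_def using d \<sigma> by (simp add: divide_right_mono)
  then have "1 + gam i \<le> chi ^ Suc i + (\<sigma> / (chi - 1)) * chi ^ Suc i" using c1 by simp
  then show "1 + gam i \<le> cgam * chi ^ i" by (simp add: cgam_def algebra_simps)
  show "gam 0 = \<sigma>" using d by (simp add: gam_def)
qed

lemma bet: "bet 0 = pstar" "bet (Suc i) = (gam i + p) * \<kappa>"
proof -
  have n: "1 - 1 / s \<noteq> 0" using chi(3) by linarith
  have "pstar - pstar / s = \<sigma> + l" using s \<sigma> by simp
  then have e: "\<sigma> + l = pstar * (1 - 1 / s)" by (simp add: right_diff_distrib)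
  show "bet 0 = pstar" unfolding bet_def gam(4) e by (rule nonzero_mult_div_cancel_right[OF n])
  have "chi * (gam i + p) = ((gam i + p) * \<kappa>) * (1 - 1 / s)" unfolding chi(2)[symmetric] by (simp only: ac_simps)
  then show "bet (Suc i) = (gam i + p) * \<kappa>"
    by (simp only: bet_def gam(2) nonzero_mult_div_cancel_right[OF n])
qed

lemma rad: "r / 2 \<le> rad i" "0 < rad i" "rad i < r" "rad (Suc i) < rad i" "(1 / 2) ^ (i + 3) \<le> 1 - rad (Suc i) / rad i"
proof -
  have q: "(1 / 2 :: real) ^ (i + 2) \<le> (1 / 2) ^ 2" by (intro power_decreasing) auto
  have q0: "0 < (1 / 2 :: real) ^ (i + 2)" by simp
  show a: "r / 2 \<le> rad i" using r q0 by (simp add: rad_def distrib_left)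
  then show b: "0 < rad i" using r by linarith
  have "1 / 2 + (1 / 2 :: real) ^ (i + 2) < 1" using q by (simp add: power2_eq_square)
  then have "r * (1 / 2 + (1 / 2) ^ (i + 2)) < r * 1" using r by (intro mult_strict_left_mono)
  then show lt: "rad i < r" by (simp add: rad_def)
  have df: "rad i - rad (Suc i) = r * (1 / 2) ^ (i + 3)"
    by (simp add: rad_def power_add power_Suc algebra_simps power3_eq_cube power2_eq_square)
  then show "rad (Suc i) < rad i" using r by (metis diff_gt_0_iff_gt mult_pos_pos zero_less_power zero_less_divide_1_iff zero_less_numeral)
  have "(1 / 2) ^ (i + 3) * rad i \<le> (1 / 2) ^ (i + 3) * r" using lt by (intro mult_left_mono) auto
  also have "\<dots> = rad i - rad (Suc i)" using df by (simp add: mult.commute)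
  finally have "(1 / 2) ^ (i + 3) \<le> (rad i - rad (Suc i)) / rad i" using b by (simp add: le_divide_eq)
  also have "\<dots> = 1 - rad (Suc i) / rad i" using b by (simp add: diff_divide_distrib)
  finally show "(1 / 2) ^ (i + 3) \<le> 1 - rad (Suc i) / rad i" .
qed

lemma step_const_nonneg: "0 \<le> step_const"
  using energy_const_nonneg c by (simp add: step_const_def)

lemma cgam: "1 \<le> cgam"
proof -
  have "1 * 1 \<le> (1 + \<sigma> / (chi - 1)) * chi" using chi(1) \<sigma> by (intro mult_mono) auto
  then show ?thesis by (simp add: cgam_def)
qed

lemma G0: "1 \<le> G0"
proof -
  have "1 * 1 * 1 * 1 \<le> G0" unfolding G0_def
    using P step_const_nonneg cgam p by (intro mult_mono ge_one_powr_ge_zero mult_nonneg_nonneg) auto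
  then show ?thesis by simp
qed

lemma GH: "1 \<le> GG" "1 \<le> HH"
proof -
  have "1 \<le> r powr (- P)"
  proof -
    have "r powr 0 \<le> r powr (- P)" using r P by (intro powr_mono') auto
    then show ?thesis using r by simp
  qed
  moreover have "1 \<le> S powr (1 / s)" using S s by (intro ge_one_powr_ge_zero) auto
  ultimately have "1 * (1 * 1) \<le> GG" unfolding GG_def using G0 by (intro mult_mono) auto
  then show "1 \<le> GG" by simp
  have "1 * 1 \<le> HH" unfolding HH_def using P chi p by (intro mult_mono ge_one_powr_ge_zero) auto
  then show "1 \<le> HH" by simp
qed

lemma sub: "cball x0 (rad i) \<subseteq> ball x0 r" "cball x0 (rad i) \<subseteq> \<Omega>"
proof -
  show "cball x0 (rad i) \<subseteq> ball x0 r" using rad(3)[of i] by auto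
  then show "cball x0 (rad i) \<subseteq> \<Omega>" using ball by blast
qed

lemma integral_sub_le:
  fixes f :: "real ^ 'n \<Rightarrow> real"
  assumes "integrable (lebesgue_on (ball x0 r)) f" "\<And>x. 0 \<le> f x"
  shows "integrable (lebesgue_on (cball x0 (rad i))) f"
    "(LINT x|lebesgue_on (cball x0 (rad i)). f x) \<le> (LINT x|lebesgue_on (ball x0 r). f x)"
proof -
  show i: "integrable (lebesgue_on (cball x0 (rad i))) f"
    by (rule integrable_lebesgue_on_subset[OF assms(1) _ _ sub(1)]) auto
  have "(LINT x|lebesgue_on (cball x0 (rad i)). f x) = (LINT x|lebesgue. indicator (cball x0 (rad i)) x *\<^sub>R f x)"
    by (rule integral_restrict_space) simp
  also have "\<dots> \<le> (LINT x|lebesgue. indicator (ball x0 r) x *\<^sub>R f x)"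
  proof (rule integral_mono)
    fix x
    show "indicator (cball x0 (rad i)) x *\<^sub>R f x \<le> indicator (ball x0 r) x *\<^sub>R f x"
      using assms(2)[of x] sub(1)[of i] by (auto simp: indicator_def)
  qed (use i assms(1) in \<open>auto simp: integrable_restrict_space\<close>)
  also have "\<dots> = (LINT x|lebesgue_on (ball x0 r). f x)" by (rule integral_restrict_space[symmetric]) simp
  finally show "(LINT x|lebesgue_on (cball x0 (rad i)). f x) \<le> (LINT x|lebesgue_on (ball x0 r). f x)" .
qed

lemma src_i:
  assumes "integrable (lebesgue_on (cball x0 (rad i))) (\<lambda>x. V x powr bet i)"
  shows "integrable (lebesgue_on (cball x0 (rad i))) (source (gam i))"
    "(LINT x|lebesgue_on (cball x0 (rad i)). source (gam i) x) \<le> XX i powr (1 - 1 / s) * S powr (1 / s)"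
proof -
  let ?K = "lebesgue_on (cball x0 (rad i))"
  have bm': "b0 \<in> borel_measurable ?K" "b1 \<in> borel_measurable ?K"
    using bm sub(1) measurable_restrict_mono by blast+
  have bi': "integrable ?K (\<lambda>x. \<bar>b0 x\<bar> powr s)" "integrable ?K (\<lambda>x. \<bar>b1 x\<bar> powr s)" "integrable ?K (\<lambda>x. V x powr pstar)"
    by (rule integral_sub_le[OF bi(1)], simp, rule integral_sub_le[OF bi(2)], simp, rule integral_sub_le[OF Vi], simp)
  have le: "(LINT x|?K. \<bar>b0 x\<bar> powr s) \<le> (LINT x|lebesgue_on (ball x0 r). \<bar>b0 x\<bar> powr s)"
    "(LINT x|?K. \<bar>b1 x\<bar> powr s) \<le> (LINT x|lebesgue_on (ball x0 r). \<bar>b1 x\<bar> powr s)"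
    "(LINT x|?K. V x powr pstar) \<le> Z"
    using integral_sub_le(2)[OF bi(1), of i] integral_sub_le(2)[OF bi(2), of i] integral_sub_le(2)[OF Vi, of i] Z by auto
  have S': "2 powr s * ((LINT x|?K. V x powr pstar) + 2 powr s * ((LINT x|?K. \<bar>b0 x\<bar> powr s) + (LINT x|?K. \<bar>b1 x\<bar> powr s))) \<le> S"
    by (rule order_trans[OF _ S(2)]) (intro mult_left_mono add_mono le; simp)
  note sb = source_bound[OF sub(2) s bm' bi'(1,2,3) assms[unfolded bet_def] S']
  show "integrable ?K (source (gam i))" by (rule sb(1))
  show "(LINT x|?K. source (gam i) x) \<le> XX i powr (1 - 1 / s) * S powr (1 / s)"
    using sb(2) by (simp add: XX_def bet_def)
qed

text \<open>Integrability is carried along with the estimate: \<open>source_bound\<close> consumes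
  it for \<open>bet i\<close>, and \<open>moser_step\<close> returns it for
  \<open>(gam i + p) * \<kappa>\<close>, which is \<open>bet (Suc i)\<close>. The factors that grow
  with the step, namely the inverse cutoff and \<open>1 + gam i\<close>, are collected in
  \<open>HH ^ i\<close>.\<close>

lemma step_i:
  assumes "integrable (lebesgue_on (cball x0 (rad i))) (\<lambda>x. V x powr bet i)"
  shows "integrable (lebesgue_on (cball x0 (rad (Suc i)))) (\<lambda>x. V x powr bet (Suc i))"
    "XX (Suc i) \<le> (GG * HH ^ i * XX i powr (1 - 1 / s)) powr \<kappa>"
proof -
  let ?I = "LINT x|lebesgue_on (cball x0 (rad i)). source (gam i) x"
  let ?h = "1 - rad (Suc i) / rad i"
  have r1: "rad i \<le> 1" using rad(3)[of i] r by linarith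
  note ms = moser_step[OF rad(2) r1 sub(2) gam(1) rad(2) rad(4) src_i(1)[OF assms]]
  show "integrable (lebesgue_on (cball x0 (rad (Suc i)))) (\<lambda>x. V x powr bet (Suc i))"
    unfolding bet(2) by (rule ms(1))
  have cm: "cball x0 (rad i) \<in> sets lebesgue" by simp
  have I0: "0 \<le> ?I"
    using source_nonneg_AE[OF cm sub(2), of "gam i"] by (intro integral_nonneg_AE) (auto elim: eventually_mono)
  have h: "?h powr (- (2 * P)) \<le> 8 powr (2 * P) * (4 powr P) ^ i"
  proof -
    have "?h powr (- (2 * P)) \<le> ((1 / 2) ^ (i + 3)) powr (- (2 * P))"
      using rad(5)[of i] P by (intro powr_mono2') auto
    also have "\<dots> = (2 powr real (i + 3)) powr (2 * P)"
    proof -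
      have "(1 / 2 :: real) ^ (i + 3) = 2 powr (- real (i + 3))"
        by (simp only: power_one_over powr_minus powr_realpow zero_less_numeral inverse_eq_divide)
      moreover have "(- real (i + 3)) * (- (2 * P)) = real (i + 3) * (2 * P)" by (rule minus_mult_minus)
      ultimately show ?thesis by (simp only: powr_powr)
    qed
    also have "\<dots> = 8 powr (2 * P) * (2 powr real i) powr (2 * P)"
    proof -
      have "(2::real) powr real (i + 3) = 8 * 2 powr real i" by (simp add: powr_add)
      then show ?thesis by (simp only: powr_mult)
    qed
    also have "(2 powr real i) powr (2 * P) = (4 powr P) ^ i"
    proof -
      have "(2 powr 2) powr P = (2::real) powr (2 * P)" by (simp only: powr_powr)
      then have "(4::real) powr P = 2 powr (2 * P)" by simp
      then have "(4 powr P) ^ i = (2 powr (2 * P)) powr real i" by (simp add: powr_realpow)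
      then show ?thesis by (simp only: powr_powr mult.commute)
    qed
    finally show ?thesis .
  qed
  have g: "(1 + gam i) powr (p + 1) \<le> cgam powr (p + 1) * (chi powr (p + 1)) ^ i"
  proof -
    have "(1 + gam i) powr (p + 1) \<le> (cgam * chi ^ i) powr (p + 1)"
      using gam(1,3)[of i] p by (intro powr_mono2) auto
    also have "\<dots> = cgam powr (p + 1) * (chi ^ i) powr (p + 1)" by (rule powr_mult)
    also have "(chi ^ i) powr (p + 1) = (chi powr (p + 1)) ^ i"
    proof -
      have "chi ^ i = chi powr real i" "(chi powr (p + 1)) ^ i = (chi powr (p + 1)) powr real i"
        using chi(1) by (simp_all add: powr_realpow)
      then show ?thesis by (simp only: powr_powr mult.commute)
    qed
    finally show ?thesis .
  qed
  have rr: "rad i powr (- P) \<le> 2 powr P * r powr (- P)"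
  proof -
    have "rad i powr (- P) \<le> (r / 2) powr (- P)" using rad(1)[of i] r P by (intro powr_mono2') auto
    also have "\<dots> = 2 powr P * r powr (- P)"
    proof -
      have "r / 2 = 2 powr (- 1) * r" by (simp add: powr_minus)
      then have "(r / 2) powr (- P) = (2 powr (- 1)) powr (- P) * r powr (- P)" by (simp only: powr_mult)
      also have "(2 powr (- 1)) powr (- P) = 2 powr P" by (simp only: powr_powr) simp
      finally show ?thesis .
    qed
    finally show ?thesis .
  qed
  have sc: "0 \<le> step_const" "step_const \<le> 1 + step_const" using step_const_nonneg by auto
  let ?A = "cgam powr (p + 1) * (chi powr (p + 1)) ^ i" and ?J = "XX i powr (1 - 1 / s) * S powr (1 / s)"
  have A0: "0 \<le> ?A" using chi(1) by simp
  have "(1 + gam i) powr (p + 1) * rad i powr (- P) \<le> ?A * (2 powr P * r powr (- P))"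
    by (rule mult_mono[OF g rr A0]) simp
  from mult_mono[OF this src_i(2)[OF assms] _ I0]
  have 1: "(1 + gam i) powr (p + 1) * rad i powr (- P) * ?I \<le> ?A * (2 powr P * r powr (- P)) * ?J"
    using A0 by simp
  have 2: "step_const * ((1 + gam i) powr (p + 1) * rad i powr (- P) * ?I) \<le> (1 + step_const) * (?A * (2 powr P * r powr (- P)) * ?J)"
    by (rule mult_mono[OF sc(2) 1]) (use sc I0 in simp_all)
  have "?h powr (- (2 * P)) * (step_const * ((1 + gam i) powr (p + 1) * rad i powr (- P) * ?I))
    \<le> (8 powr (2 * P) * (4 powr P) ^ i) * ((1 + step_const) * (?A * (2 powr P * r powr (- P)) * ?J))"
    by (rule mult_mono[OF h 2]) (use sc I0 in simp_all)
  also have "\<dots> = GG * HH ^ i * XX i powr (1 - 1 / s)"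
    by (simp only: GG_def G0_def HH_def power_mult_distrib ac_simps)
  finally have le: "?h powr (- (2 * P)) * (step_const * ((1 + gam i) powr (p + 1) * rad i powr (- P) * ?I)) \<le> GG * HH ^ i * XX i powr (1 - 1 / s)" .
  have \<kappa>: "0 < \<kappa>" using \<tau>(3) p by (simp add: \<kappa>_def)
  have "XX (Suc i) \<le> (?h powr (- (2 * P)) * (step_const * ((1 + gam i) powr (p + 1) * rad i powr (- P) * ?I))) powr \<kappa>"
    using ms(2) by (simp add: XX_def bet(2))
  also have "\<dots> \<le> (GG * HH ^ i * XX i powr (1 - 1 / s)) powr \<kappa>"
    using le sc I0 \<kappa> by (intro powr_mono2) auto
  finally show "XX (Suc i) \<le> (GG * HH ^ i * XX i powr (1 - 1 / s)) powr \<kappa>" .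
qed

lemma int_i: "integrable (lebesgue_on (cball x0 (rad i))) (\<lambda>x. V x powr bet i)"
proof (induction i)
  case 0
  show ?case unfolding bet(1) by (rule integral_sub_le(1)[OF Vi]) simp
next
  case (Suc i)
  then show ?case by (rule step_i(1))
qed

definition "\<Lambda> = Z * GG powr (\<kappa> / (chi - 1)) * HH powr (\<kappa> / (chi - 1)\<^sup>2)"

lemma \<kappa>pos: "0 < \<kappa>" using \<tau>(3) p by (simp add: \<kappa>_def)

lemma \<Lambda>: "1 \<le> \<Lambda>"
proof -
  have "1 * 1 * 1 \<le> \<Lambda>" unfolding \<Lambda>_def
    using Z(1) GH chi(1) \<kappa>pos by (intro mult_mono ge_one_powr_ge_zero) auto
  then show ?thesis by simp
qed

lemma XX_le: "XX i \<le> \<Lambda> powr (chi ^ i)"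
  unfolding \<Lambda>_def
proof (rule moser_recursion[where t = "1 - 1 / s"])
  show "XX 0 \<le> Z" unfolding XX_def bet(1) using integral_sub_le(2)[OF Vi, of 0] Z(2) by simp
  show "0 \<le> XX i" for i unfolding XX_def by (intro Bochner_Integration.integral_nonneg) simp
qed (use Z chi \<kappa>pos GH step_i(2)[OF int_i] in auto)

text \<open>Chebyshev's inequality instead of a limit of Lebesgue norms: on the set \<open>A\<close>
  where \<open>V x \<ge> T\<close>, the product of \<open>T powr bet i\<close> and the measure of
  \<open>A\<close> is at most \<open>\<Lambda> powr (chi ^ i)\<close>. As \<open>bet i\<close> grows
  like \<open>w * chi ^ i\<close> and \<open>T powr w > \<Lambda>\<close>, the measure is at most a
  constant times \<open>qq powr (chi ^ i)\<close> with \<open>qq < 1\<close>, hence zero.\<close>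

lemma sup_bound_lt:
  assumes T: "\<Lambda> powr ((chi - 1) / (\<kappa> * \<sigma>)) < T"
  shows "AE x in lebesgue_on (ball x0 (r / 2)). V x < T"
proof -
  \<comment> \<open>Leading coefficient of \<open>bet i\<close> with respect to
    \<open>chi ^ i\<close>; its reciprocal is the power of \<open>\<Lambda>\<close> in the final
    bound.\<close>
  define w where "w = \<kappa> * \<sigma> / (chi - 1)"
  define d where "d = \<sigma> / (1 - 1 / s) / (chi - 1)"
  have c1: "0 < chi - 1" using chi(1) by simp
  have w: "0 < w" "(chi - 1) / (\<kappa> * \<sigma>) = 1 / w" using \<kappa>pos \<sigma> c1 by (auto simp: w_def)
  have T1: "1 < T"
  proof -
    have "1 \<le> \<Lambda> powr ((chi - 1) / (\<kappa> * \<sigma>))" using \<Lambda> w by (intro ge_one_powr_ge_zero) auto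
    then show ?thesis using T by linarith
  qed
  have "(\<Lambda> powr (1 / w)) powr w < T powr w" using T[unfolded w(2)] w(1) by (intro powr_less_mono2) auto
  then have LT: "\<Lambda> < T powr w" using \<Lambda> w(1) by (simp add: powr_powr)
  define qq where "qq = \<Lambda> * T powr (- w)"
  have qq: "0 \<le> qq" "qq < 1"
    using LT \<Lambda> T1 by (auto simp: qq_def powr_minus field_simps)
  have bet_ge: "w * chi ^ i - d \<le> bet i" for i
  proof -
    have "w * chi ^ i - d = \<sigma> * (\<kappa> * chi ^ i - 1 / (1 - 1 / s)) / (chi - 1)"
      by (simp add: w_def d_def algebra_simps diff_divide_distrib)
    also have "\<kappa> * chi ^ i - 1 / (1 - 1 / s) = (chi ^ Suc i - 1) / (1 - 1 / s)"
    proof -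
      have n: "1 - 1 / s \<noteq> 0" using chi(3) by linarith
      have "\<kappa> = chi / (1 - 1 / s)" using chi(2) n by (metis nonzero_mult_div_cancel_left)
      then show ?thesis by (simp add: diff_divide_distrib)
    qed
    also have "\<sigma> * ((chi ^ Suc i - 1) / (1 - 1 / s)) / (chi - 1) = gam i / (1 - 1 / s)"
      by (simp add: gam_def)
    also have "\<dots> \<le> bet i" unfolding bet_def using l chi(3) by (intro divide_right_mono) auto
    finally show ?thesis .
  qed
  define A where "A = {x \<in> cball x0 (r / 2). T \<le> V x}"
  have [measurable]: "jbr \<in> borel_measurable borel" using continuous_jbr by (rule borel_measurable_continuous_onI)
  have cs: "cball x0 (r / 2) \<subseteq> \<Omega>" using sub(2)[of 0] rad(1)[of 0] by (metis cball_subset_cball_iff dist_self add_0 order_trans)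
  have [measurable]: "u \<in> borel_measurable (lebesgue_on (cball x0 (r / 2)))"
    using weak_gradient_L1_on_compact[OF wg compact_cball cs] by auto
  have "{x \<in> space (lebesgue_on (cball x0 (r / 2))). T \<le> V x} \<in> sets (lebesgue_on (cball x0 (r / 2)))" by measurable
  then have Am: "A \<in> sets lebesgue"
    by (simp add: A_def space_restrict_space sets_restrict_space_iff)
  have Afin: "emeasure lebesgue A < \<infinity>"
  proof -
    have "emeasure lebesgue A \<le> emeasure lebesgue (cball x0 (r / 2))" by (intro emeasure_mono) (auto simp: A_def)
    also have "\<dots> < \<infinity>" using emeasure_compact_finite[OF compact_cball, of x0 "r / 2"] by simp
    finally show ?thesis .
  qed
  have meas: "measure lebesgue A \<le> T powr d * qq powr (chi ^ i)" for i
  proof -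
    have Ai: "A \<subseteq> cball x0 (rad i)" using rad(1)[of i] by (auto simp: A_def)
    have "T powr bet i * measure lebesgue A = (LINT x|lebesgue. indicator A x *\<^sub>R (T powr bet i))"
      using Am Afin by simp
    also have "\<dots> \<le> (LINT x|lebesgue. indicator (cball x0 (rad i)) x *\<^sub>R (V x powr bet i))"
    proof (rule integral_mono)
      show "integrable lebesgue (\<lambda>x. indicator A x *\<^sub>R (T powr bet i))" using Am Afin by simp
      show "integrable lebesgue (\<lambda>x. indicator (cball x0 (rad i)) x *\<^sub>R (V x powr bet i))"
        using int_i[of i] by (simp add: integrable_restrict_space)
      fix x
      have "0 \<le> bet i" unfolding bet_def using gam(1)[of i] l chi(3) by simp
      then show "indicator A x *\<^sub>R (T powr bet i) \<le> indicator (cball x0 (rad i)) x *\<^sub>R (V x powr bet i)"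
        using Ai T1 by (cases "x \<in> A") (auto simp: A_def powr_mono2)
    qed
    also have "\<dots> = XX i" unfolding XX_def by (rule integral_restrict_space[symmetric]) simp
    also have "\<dots> \<le> \<Lambda> powr (chi ^ i)" by (rule XX_le)
    finally have "T powr (- bet i) * (T powr bet i * measure lebesgue A) \<le> T powr (- bet i) * \<Lambda> powr (chi ^ i)"
      by (intro mult_left_mono) auto
    moreover have "T powr (- bet i) * T powr bet i = 1" using T1 by (simp add: powr_add[symmetric])
    ultimately have "measure lebesgue A \<le> T powr (- bet i) * \<Lambda> powr (chi ^ i)" by (metis mult.assoc mult_1)
    also have "\<dots> \<le> T powr (d + (- w) * chi ^ i) * \<Lambda> powr (chi ^ i)"
      using T1 bet_ge[of i] by (intro mult_right_mono powr_mono) auto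
    also have "\<dots> = T powr d * qq powr (chi ^ i)"
      unfolding powr_add qq_def powr_mult powr_powr[symmetric] by (simp only: ac_simps)
    finally show ?thesis .
  qed
  have "(\<lambda>i. T powr d * qq powr (chi ^ i)) \<longlonglongrightarrow> T powr d * 0"
    by (intro tendsto_intros powr_power_tendsto_0 qq chi(1))
  then have "measure lebesgue A \<le> T powr d * 0"
    by (rule LIMSEQ_le_const) (use meas in auto)
  then have "measure lebesgue A = 0" by (simp add: measure_le_0_iff)
  then have "A \<in> null_sets lebesgue" using Am Afin by (simp add: null_sets_def emeasure_eq_ennreal_measure)
  then have "AE x in lebesgue. x \<notin> A" by (rule AE_not_in)
  then have "AE x in lebesgue. x \<in> ball x0 (r / 2) \<longrightarrow> V x < T"
    by eventually_elim (auto simp: A_def)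
  then show ?thesis by (subst AE_restrict_space_iff) auto
qed

text \<open>The strict inequality above the threshold is used along a sequence decreasing to it, so
  that the exceptional null sets remain countably many.\<close>

lemma sup_bound: "AE x in lebesgue_on (ball x0 (r / 2)). \<bar>u x\<bar> \<le> \<Lambda> powr ((chi - 1) / (\<kappa> * \<sigma>))"
proof -
  let ?T = "\<Lambda> powr ((chi - 1) / (\<kappa> * \<sigma>))"
  have "AE x in lebesgue_on (ball x0 (r / 2)). V x < ?T + inverse (real (Suc j))" for j
    by (rule sup_bound_lt) simp
  then have "AE x in lebesgue_on (ball x0 (r / 2)). \<forall>j. V x < ?T + inverse (real (Suc j))"
    by (simp only: AE_all_countable) blast
  then show ?thesis
  proof eventually_elim
    fix x assume *: "\<forall>j. V x < ?T + inverse (real (Suc j))"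
    have "(\<lambda>j. ?T + inverse (real (Suc j))) \<longlonglongrightarrow> ?T + 0" by (intro tendsto_intros LIMSEQ_inverse_real_of_nat)
    then have "V x \<le> ?T + 0" by (rule LIMSEQ_le_const) (use * in \<open>auto intro: less_imp_le\<close>)
    then show "\<bar>u x\<bar> \<le> ?T" using jbr_ge(2)[of "u x"] by linarith
  qed
qed

end

end

section \<open>The local bound\<close>

lemma Lp_norm_eq:
  assumes "Lp s A f" "0 < s"
  shows "(LINT x|lebesgue_on A. norm (f x) powr s) = enn2real (Lp_norm s A f) powr s"
proof -
  have i: "integrable (lebesgue_on A) (\<lambda>x. norm (f x) powr s)" using assms by (simp add: Lp_def)
  let ?I = "LINT x|lebesgue_on A. norm (f x) powr s"
  have I0: "0 \<le> ?I" by (intro Bochner_Integration.integral_nonneg) simp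
  have "Lp_norm s A f = ennreal (?I powr (1 / s))"
    unfolding Lp_norm_def using i I0 by (simp add: nn_integral_eq_integral epow_ennreal)
  then show ?thesis using I0 assms(2) by (simp add: powr_powr)
qed

lemma Lp_norm_finite_imp_Lp:
  assumes [measurable]: "f \<in> borel_measurable (lebesgue_on A)" and "Lp_norm s A f \<noteq> \<infinity>"
  shows "Lp s A f"
proof -
  have "(\<integral>\<^sup>+x. ennreal (norm (f x) powr s) \<partial>lebesgue_on A) \<noteq> \<infinity>"
    using assms(2) by (auto simp: Lp_norm_def)
  then have "integrable (lebesgue_on A) (\<lambda>x. norm (f x) powr s)"
    by (intro integrableI_bounded) (auto simp: less_top)
  then show ?thesis by (simp add: Lp_def)
qed

text \<open>The only place in the proof where the cases \<open>p < n\<close> and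
  \<open>p \<ge> n\<close> are distinguished. For \<open>p < N\<close> the identity
  \<open>pstar * (1 - p / N) = p\<close> turns \<open>s > N / p\<close> into
  \<open>p < pstar - pstar / s\<close>, the formula for \<open>pstar\<close> turns
  \<open>q / p < 1 + 1 / N\<close> into \<open>p / (p - q + 1) < pstar\<close>, and the last
  expression is exactly zero. For \<open>p \<ge> N\<close> one has \<open>pstar > 2\<close>, which
  gives the bound with \<open>N - 1\<close>.\<close>

lemma exponent_relations:
  fixes N p q \<theta> \<delta> s0 s1 pstar :: real
  assumes N: "2 \<le> N" and exponents: "1 \<le> p" "p \<le> q" "q < p + 1" "0 \<le> \<theta>" "1 \<le> \<delta>"
    and sub: "p < N \<Longrightarrow> pstar = N * p / (N - p) \<and> q / p < 1 + 1 / N \<and> \<theta> < pstar \<and> \<delta> < pstar \<and>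
        N / p < s0 \<and> N / p < s1"
    and sup: "N \<le> p \<Longrightarrow> 1 < s0 \<and> 1 < s1 \<and> p < pstar \<and>
        Max {p / (p - q + 1), \<theta>, \<delta>, p * s1 / (s1 - 1), p * s0 / (s0 - 1)} < pstar"
  shows "p < pstar" "1 < s0" "1 < s1" "p < pstar - pstar / s0" "p < pstar - pstar / s1"
    "p / (p - q + 1) < pstar" "\<theta> < pstar" "\<delta> < pstar"
    "1 \<le> pstar * (N - 1) / N" "0 \<le> 1 / N - 1 / p + 1 / pstar"
proof -
  have d: "0 < p - q + 1" "0 < p" "0 < N" using exponents N by auto
  have "p < pstar \<and> 1 < s0 \<and> 1 < s1 \<and> p < pstar - pstar / s0 \<and> p < pstar - pstar / s1 \<and>
    p / (p - q + 1) < pstar \<and> \<theta> < pstar \<and> \<delta> < pstar \<and> 1 \<le> pstar * (N - 1) / N \<and> 0 \<le> 1 / N - 1 / p + 1 / pstar"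
  proof (cases "p < N")
    case True
    note S = sub[OF True]
    have np: "0 < N - p" using True by simp
    have ps: "pstar = N * p / (N - p)" using S by simp
    have ps0: "0 < pstar" unfolding ps using d np by simp
    have inv: "1 / pstar = 1 / p - 1 / N" unfolding ps using d np by (simp add: field_simps)
    have 1: "p < pstar"
    proof -
      have "p * (N - p) < N * p" using d by (simp add: algebra_simps)
      then show ?thesis unfolding ps using np by (simp add: less_divide_eq)
    qed
    have N1: "1 < N / p" using True d by simp
    have pe: "pstar - pstar * p / N = p"
    proof -
      have "pstar * (1 - p / N) = p" unfolding ps using d np by (simp add: field_simps)
      then show ?thesis by (simp add: right_diff_distrib)
    qed
    have s: "p < pstar - pstar / t" if "N / p < t" for t
    proof -
      have t0: "0 < t" using that N1 by linarith
      have "1 / t < p / N" using that d t0 by (simp add: field_simps)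
      then have "pstar * (1 / t) < pstar * (p / N)" using ps0 by (intro mult_strict_left_mono)
      then show ?thesis using pe by simp
    qed
    have P: "p / (p - q + 1) < pstar"
    proof -
      have "q < p * (1 + 1 / N)" using S d by (simp add: divide_less_eq mult.commute)
      then have "(N - p) / N < p - q + 1" using d by (simp add: field_simps)
      then have "p / (p - q + 1) < p / ((N - p) / N)" using d np by (intro divide_strict_left_mono) auto
      then show ?thesis unfolding ps by (simp add: mult.commute)
    qed
    have t: "1 \<le> pstar * (N - 1) / N"
    proof -
      have "1 * N \<le> p * N" using exponents d by (intro mult_right_mono) auto
      then have "N - p \<le> p * (N - 1)" by (simp add: algebra_simps)
      moreover have "pstar * (N - 1) / N = p * (N - 1) / (N - p)" unfolding ps using d by simp
      ultimately show ?thesis using np by (simp add: le_divide_eq)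
    qed
    show ?thesis using 1 S N1 s P t inv by auto
  next
    case False
    then have Np: "N \<le> p" by simp
    note S = sup[OF Np]
    have mx: "p / (p - q + 1) < pstar" "\<theta> < pstar" "\<delta> < pstar" "p * s1 / (s1 - 1) < pstar" "p * s0 / (s0 - 1) < pstar"
      using S by auto
    have ps: "2 < pstar" using S Np N by linarith
    have s: "p < pstar - pstar / t" if "1 < t" "p * t / (t - 1) < pstar" for t
    proof -
      have "p * t < pstar * (t - 1)" using that by (simp add: divide_less_eq)
      then have "p * t / t < pstar * (t - 1) / t" using that by (intro divide_strict_right_mono) auto
      then show ?thesis using that by (simp add: diff_divide_distrib right_diff_distrib)
    qed
    have t: "1 \<le> pstar * (N - 1) / N"
    proof -
      have "N * 1 \<le> 2 * (N - 1)" using N by simp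
      also have "\<dots> \<le> pstar * (N - 1)" using ps N by (intro mult_right_mono) auto
      finally show ?thesis using d by (simp add: le_divide_eq)
    qed
    have "1 / p \<le> 1 / N" using Np d by (intro divide_left_mono) auto
    then have "0 \<le> 1 / N - 1 / p + 1 / pstar" using ps by simp
    then show ?thesis using S mx s t by auto
  qed
  then show "p < pstar" "1 < s0" "1 < s1" "p < pstar - pstar / s0" "p < pstar - pstar / s1"
    "p / (p - q + 1) < pstar" "\<theta> < pstar" "\<delta> < pstar"
    "1 \<le> pstar * (N - 1) / N" "0 \<le> 1 / N - 1 / p + 1 / pstar" by auto
qed

text \<open>An explicit constant: it must not depend on the solution or on the domain.\<close>

definition bound_const :: "real \<Rightarrow> real \<Rightarrow> real \<Rightarrow> real \<Rightarrow> real \<Rightarrow> real \<Rightarrow> real \<Rightarrow> real \<Rightarrow> real \<Rightarrow> real \<Rightarrow> real \<Rightarrow> real \<Rightarrow> real \<Rightarrow> real" where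
  "bound_const N p q c1 c2 c3 c4 M pstar l s \<sigma> B = (let P = p / (p - q + 1); \<kappa> = pstar / p; ch = (\<sigma> + l) / p;
     \<omega> = unit_ball_vol N; z = 2 powr pstar * (1 + \<omega>);
     A = ((pstar * (N - 1) / N) * (1 + \<omega>) powr (1 / N - 1 / p + 1 / pstar)) powr p
        * (2 powr p * (2 * energy_const p q c1 c2 c3 c4 M / c1 + (4 * P) powr p));
     G = 8 powr (2 * P) * (1 + A) * ((1 + \<sigma> / (ch - 1)) * ch) powr (p + 1) * 2 powr P;
     H = 4 powr P * ch powr (p + 1);
     S = 2 powr s * (z + 2 powr s * B)
   in z powr ((ch - 1) / (\<kappa> * \<sigma>)) * (G * S powr (1 / s)) powr (1 / \<sigma>) * H powr (1 / ((ch - 1) * \<sigma>)))"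

text \<open>Here \<open>w\<close> stands for 1 plus the norm of \<open>u\<close>, which enters
  \<open>\<Lambda>\<close> through both \<open>Z\<close> and \<open>S\<close>. The two contributions
  to its exponent add up to \<open>(pstar - p) / \<sigma>\<close> because
  \<open>ch * p = \<sigma> + l\<close> and \<open>pstar = l + pstar / s + \<sigma>\<close>; the
  power of \<open>r\<close> comes from the single factor \<open>r powr (- P)\<close>.\<close>

lemma moser_exponents:
  fixes z G S0 H w r P k ch s \<sigma> pstar p l :: real
  assumes ch: "1 < ch" "ch = (\<sigma> + l) / p" and k: "k = pstar / p" and pos: "0 < p" "0 < pstar" "0 < \<sigma>" "0 < s"
    and eq: "pstar = l + pstar / s + \<sigma>"
  shows "(z * w powr pstar * (G * (r powr (- P) * (S0 * w powr pstar) powr (1 / s))) powr (k / (ch - 1)) * H powr (k / (ch - 1)\<^sup>2))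
      powr ((ch - 1) / (k * \<sigma>))
    = z powr ((ch - 1) / (k * \<sigma>)) * (G * S0 powr (1 / s)) powr (1 / \<sigma>) * H powr (1 / ((ch - 1) * \<sigma>))
      * r powr (- (P / \<sigma>)) * w powr ((pstar - p) / \<sigma>)"
proof -
  have k0: "0 < k" "0 < ch - 1" using k pos ch by auto
  have e1: "k / (ch - 1) * ((ch - 1) / (k * \<sigma>)) = 1 / \<sigma>" using k0 by simp
  have e2: "k / (ch - 1)\<^sup>2 * ((ch - 1) / (k * \<sigma>)) = 1 / ((ch - 1) * \<sigma>)" using k0 by (simp add: power2_eq_square)
  have e3: "pstar * ((ch - 1) / (k * \<sigma>)) + pstar / s / \<sigma> = (pstar - p) / \<sigma>"
  proof -
    have "pstar * ((ch - 1) / (k * \<sigma>)) = (p * ch - p) / \<sigma>" using pos by (simp add: k field_simps)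
    also have "p * ch = \<sigma> + l" using pos ch by simp
    finally have "pstar * ((ch - 1) / (k * \<sigma>)) + pstar / s / \<sigma> = (\<sigma> + l - p + pstar / s) / \<sigma>"
      by (simp add: add_divide_distrib)
    then show ?thesis using eq by (simp add: algebra_simps)
  qed
  let ?A = "G * (r powr (- P) * (S0 * w powr pstar) powr (1 / s))" and ?e = "(ch - 1) / (k * \<sigma>)"
  have "(z * w powr pstar * ?A powr (k / (ch - 1)) * H powr (k / (ch - 1)\<^sup>2)) powr ?e
      = z powr ?e * (w powr pstar) powr ?e * (?A powr (k / (ch - 1))) powr ?e * (H powr (k / (ch - 1)\<^sup>2)) powr ?e"
    by (simp only: powr_mult)
  also have "\<dots> = z powr ?e * w powr (pstar * ?e) * ?A powr (1 / \<sigma>) * H powr (1 / ((ch - 1) * \<sigma>))"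
    by (simp only: powr_powr e1 e2)
  also have "?A powr (1 / \<sigma>) = (G * S0 powr (1 / s)) powr (1 / \<sigma>) * r powr (- (P / \<sigma>)) * w powr (pstar / s / \<sigma>)"
    by (simp add: powr_mult powr_powr)
  finally show ?thesis unfolding e3[symmetric] powr_add by (simp only: mult_ac)
qed

lemma bound_const_pos:
  assumes "0 \<le> N" "0 < c1" "0 < M" "0 < c2" "0 < c3" "0 < c4" "1 \<le> p" "p \<le> q" "q < p + 1" "p < \<sigma> + l" "0 < \<sigma>"
    "1 < s" "0 \<le> B"
  shows "0 < bound_const N p q c1 c2 c3 c4 M pstar l s \<sigma> B"
proof -
  have ch: "1 < (\<sigma> + l) / p" using assms by simp
  define A where "A = ((pstar * (N - 1) / N) * (1 + unit_ball_vol N) powr (1 / N - 1 / p + 1 / pstar)) powr p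
        * (2 powr p * (2 * energy_const p q c1 c2 c3 c4 M / c1 + (4 * (p / (p - q + 1))) powr p))"
  have \<omega>: "0 \<le> unit_ball_vol N" using assms(1) by simp
  have e: "0 \<le> energy_const p q c1 c2 c3 c4 M" using assms by (intro energy_const_ge_0) auto
  have A0: "0 \<le> A" unfolding A_def using e assms by (intro mult_nonneg_nonneg add_nonneg_nonneg) auto
  have cg: "0 < (1 + \<sigma> / ((\<sigma> + l) / p - 1)) * ((\<sigma> + l) / p)"
    using ch assms by (intro mult_pos_pos add_pos_nonneg divide_nonneg_nonneg) auto
  have B0: "0 < 2 powr pstar * (1 + unit_ball_vol N) + 2 powr s * B"
    using \<omega> assms by (intro add_pos_nonneg mult_pos_pos mult_nonneg_nonneg) auto
  have pw: "0 < x powr y" if "0 < x" for x y :: real using that by simp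
  have "0 \<le> p - q + 1" using assms by simp
  moreover have "0 \<le> \<sigma> / ((\<sigma> + l) / p - 1)" "0 \<le> 2 powr s * B" using ch assms by auto
  ultimately show ?thesis unfolding bound_const_def Let_def A_def[symmetric]
    using ch A0 cg B0 \<omega> by (intro mult_pos_pos[of "_ powr _ * _ powr _"] mult_pos_pos[of "_ powr _" "_ powr _"] pw mult_pos_pos add_pos_nonneg) auto
qed

lemma finite_measure_lebesgue_on_ball: "finite_measure (lebesgue_on (ball (x0::'a::euclidean_space) r))"
proof
  have "emeasure lborel (ball x0 r) < \<infinity>" by (rule emeasure_bounded_finite[OF bounded_ball])
  then show "emeasure (lebesgue_on (ball x0 r)) (space (lebesgue_on (ball x0 r))) \<noteq> \<infinity>"
    by (simp add: space_restrict_space emeasure_restrict_space)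
qed

lemma measure_ball_le_unit_ball:
  fixes x0 :: "'a::euclidean_space"
  assumes "0 < r" "r \<le> 1"
  shows "measure lebesgue (ball x0 r) \<le> unit_ball_vol (real DIM('a))"
proof -
  have "measure lebesgue (ball x0 r) \<le> measure lebesgue (cball x0 r)"
    by (intro measure_mono_fmeasurable) auto
  also have "\<dots> \<le> unit_ball_vol (real DIM('a))" by (rule measure_cball_le_unit_ball[OF assms])
  finally show ?thesis .
qed

text \<open>Lowers the exponent from \<open>t\<close> to \<open>s\<close> by
  \<open>\<bar>f x\<bar> powr s \<le> 1 + \<bar>f x\<bar> powr t\<close>, at the cost of the volume
  of the ball, and enlarges the ball from radius \<open>r\<close> to \<open>R\<close>. Thus one
  exponent serves \<open>b0\<close> and \<open>b1\<close>, while the bound depends only on their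
  norms on the largest ball.\<close>

lemma Lp_powr_smaller_ball:
  fixes f :: "'a::euclidean_space \<Rightarrow> real"
  assumes f: "Lp t (ball x0 R) f" and s: "0 \<le> s" "s \<le> t" "0 < t" and r: "0 < r" "r \<le> R" "R \<le> 1"
  shows "f \<in> borel_measurable (lebesgue_on (ball x0 r))" "integrable (lebesgue_on (ball x0 r)) (\<lambda>x. \<bar>f x\<bar> powr s)"
    "(LINT x|lebesgue_on (ball x0 r). \<bar>f x\<bar> powr s) \<le> unit_ball_vol (real DIM('a)) + enn2real (Lp_norm t (ball x0 R) f) powr t"
proof -
  have fr: "Lp t (ball x0 r) f" using r by (intro Lp_subset[OF f]) auto
  then show m[measurable]: "f \<in> borel_measurable (lebesgue_on (ball x0 r))" by (simp add: Lp_def)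
  have it: "integrable (lebesgue_on (ball x0 r)) (\<lambda>x. \<bar>f x\<bar> powr t)"
    and iR: "integrable (lebesgue_on (ball x0 R)) (\<lambda>x. \<bar>f x\<bar> powr t)" using fr f by (auto simp: Lp_def)
  interpret finite_measure "lebesgue_on (ball x0 r)" by (rule finite_measure_lebesgue_on_ball)
  have i1: "integrable (lebesgue_on (ball x0 r)) (\<lambda>x. 1 + \<bar>f x\<bar> powr t)" using it by simp
  have le: "\<bar>f x\<bar> powr s \<le> 1 + \<bar>f x\<bar> powr t" for x
  proof (cases "\<bar>f x\<bar> \<le> 1")
    case True
    then have "\<bar>f x\<bar> powr s \<le> 1" using s by (intro powr_le1) auto
    then show ?thesis using powr_ge_zero[of "\<bar>f x\<bar>" t] by linarith
  next
    case False
    then have "\<bar>f x\<bar> powr s \<le> \<bar>f x\<bar> powr t" using s by (intro powr_mono) auto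
    then show ?thesis by linarith
  qed
  show is': "integrable (lebesgue_on (ball x0 r)) (\<lambda>x. \<bar>f x\<bar> powr s)"
  proof (rule Bochner_Integration.integrable_bound[OF i1])
    show "AE x in lebesgue_on (ball x0 r). norm (\<bar>f x\<bar> powr s) \<le> norm (1 + \<bar>f x\<bar> powr t)"
    proof (rule AE_I2)
      fix x show "norm (\<bar>f x\<bar> powr s) \<le> norm (1 + \<bar>f x\<bar> powr t)" using le[of x] by simp
    qed
  qed measurable
  have "(LINT x|lebesgue_on (ball x0 r). \<bar>f x\<bar> powr s) \<le> (LINT x|lebesgue_on (ball x0 r). 1 + \<bar>f x\<bar> powr t)"
    by (intro integral_mono is' i1 le)
  also have "\<dots> = measure lebesgue (ball x0 r) + (LINT x|lebesgue_on (ball x0 r). \<bar>f x\<bar> powr t)"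
    using it by (simp add: measure_restrict_space space_restrict_space)
  also have "\<dots> \<le> unit_ball_vol (real DIM('a)) + enn2real (Lp_norm t (ball x0 R) f) powr t"
  proof (intro add_mono)
    show "measure lebesgue (ball x0 r) \<le> unit_ball_vol (real DIM('a))" using r by (intro measure_ball_le_unit_ball) auto
    have sp: "ball x0 r \<inter> space lebesgue \<in> sets lebesgue" "ball x0 R \<inter> space lebesgue \<in> sets lebesgue" by auto
    have "(LINT x|lebesgue. indicator (ball x0 r) x *\<^sub>R (\<bar>f x\<bar> powr t)) \<le> (LINT x|lebesgue. indicator (ball x0 R) x *\<^sub>R (\<bar>f x\<bar> powr t))"
    proof (rule integral_mono)
      show "integrable lebesgue (\<lambda>x. indicator (ball x0 r) x *\<^sub>R (\<bar>f x\<bar> powr t))"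
        using it by (simp add: integrable_restrict_space[OF sp(1)])
      show "integrable lebesgue (\<lambda>x. indicator (ball x0 R) x *\<^sub>R (\<bar>f x\<bar> powr t))"
        using iR by (simp add: integrable_restrict_space[OF sp(2)])
    qed (use r in \<open>auto simp: indicator_def\<close>)
    then have "(LINT x|lebesgue_on (ball x0 r). \<bar>f x\<bar> powr t) \<le> (LINT x|lebesgue_on (ball x0 R). \<bar>f x\<bar> powr t)"
      by (simp add: integral_restrict_space[OF sp(1)] integral_restrict_space[OF sp(2)])
    then show "(LINT x|lebesgue_on (ball x0 r). \<bar>f x\<bar> powr t) \<le> enn2real (Lp_norm t (ball x0 R) f) powr t"
      using Lp_norm_eq[OF f s(3)] by simp
  qed
  finally show "(LINT x|lebesgue_on (ball x0 r). \<bar>f x\<bar> powr s) \<le> unit_ball_vol (real DIM('a)) + enn2real (Lp_norm t (ball x0 R) f) powr t" .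
qed

context moser_solution
begin

lemma moser_bound:
  fixes s \<sigma> r U B :: real and x0 :: "real ^ 'n"
  assumes s: "1 < s" "m = l + pstar / s" and \<sigma>: "0 < \<sigma>" "pstar = m + \<sigma>" "p < \<sigma> + l"
    and r: "0 < r" "r \<le> 1" and ball: "ball x0 r \<subseteq> \<Omega>"
    and bm: "b0 \<in> borel_measurable (lebesgue_on (ball x0 r))" "b1 \<in> borel_measurable (lebesgue_on (ball x0 r))"
    and bi: "integrable (lebesgue_on (ball x0 r)) (\<lambda>x. \<bar>b0 x\<bar> powr s)" "integrable (lebesgue_on (ball x0 r)) (\<lambda>x. \<bar>b1 x\<bar> powr s)"
    and B: "(LINT x|lebesgue_on (ball x0 r). \<bar>b0 x\<bar> powr s) + (LINT x|lebesgue_on (ball x0 r). \<bar>b1 x\<bar> powr s) \<le> B"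
    and um: "u \<in> borel_measurable (lebesgue_on (ball x0 r))"
    and ui: "integrable (lebesgue_on (ball x0 r)) (\<lambda>x. \<bar>u x\<bar> powr pstar)"
    and U: "0 \<le> U" "(LINT x|lebesgue_on (ball x0 r). \<bar>u x\<bar> powr pstar) \<le> U powr pstar"
  shows "AE x in lebesgue_on (ball x0 (r / 2)). \<bar>u x\<bar> \<le>
    bound_const (real CARD('n)) p q c1 c2 c3 c4 M pstar l s \<sigma> B * r powr (- (P / \<sigma>)) * (1 + U) powr ((pstar - p) / \<sigma>)"
proof -
  define z where "z = 2 powr pstar * (1 + unit_ball_vol (real CARD('n)))"
  \<comment> \<open>At least 1, hence it can be pulled out as a factor of both \<open>Z\<close> and
    \<open>S\<close>, also from the summands without \<open>u\<close>. What is left,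
    \<open>z\<close> and \<open>S0\<close>, is independent of the solution.\<close>
  define W where "W = (1 + U) powr pstar"
  define Z where "Z = z * W"
  define S0 where "S0 = 2 powr s * (z + 2 powr s * B)"
  define S where "S = S0 * W"
  have \<omega>0: "0 \<le> unit_ball_vol (real CARD('n))" by simp
  have W: "1 \<le> W" "U powr pstar \<le> W" using U \<tau>(3) by (auto simp: W_def intro!: ge_one_powr_ge_zero powr_mono2)
  have z1: "1 \<le> z"
  proof -
    have "1 * 1 \<le> z" unfolding z_def using \<tau>(3) \<omega>0 by (intro mult_mono ge_one_powr_ge_zero) auto
    then show ?thesis by simp
  qed
  have I0: "0 \<le> (LINT x|lebesgue_on (ball x0 r). \<bar>b0 x\<bar> powr s) + (LINT x|lebesgue_on (ball x0 r). \<bar>b1 x\<bar> powr s)"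
    by (intro add_nonneg_nonneg Bochner_Integration.integral_nonneg) auto
  have B0: "0 \<le> B" using I0 B by linarith
  have Z1: "1 \<le> Z"
  proof -
    have "1 * 1 \<le> Z" unfolding Z_def using z1 W by (intro mult_mono) auto
    then show ?thesis by simp
  qed
  have s2: "1 \<le> 2 powr s" using s by (intro ge_one_powr_ge_zero) auto
  have S_ge: "2 powr s * (Z + 2 powr s * ((LINT x|lebesgue_on (ball x0 r). \<bar>b0 x\<bar> powr s) + (LINT x|lebesgue_on (ball x0 r). \<bar>b1 x\<bar> powr s))) \<le> S"
  proof -
    have "2 powr s * ((LINT x|lebesgue_on (ball x0 r). \<bar>b0 x\<bar> powr s) + (LINT x|lebesgue_on (ball x0 r). \<bar>b1 x\<bar> powr s))
        \<le> 2 powr s * (B * W)"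
    proof -
      have "B * 1 \<le> B * W" using B0 W by (intro mult_left_mono) auto
      then show ?thesis using B by (intro mult_left_mono) auto
    qed
    then have "2 powr s * (Z + 2 powr s * ((LINT x|lebesgue_on (ball x0 r). \<bar>b0 x\<bar> powr s) + (LINT x|lebesgue_on (ball x0 r). \<bar>b1 x\<bar> powr s)))
      \<le> 2 powr s * (Z + 2 powr s * (B * W))" by (intro mult_left_mono add_left_mono) auto
    then show ?thesis by (simp add: S_def S0_def Z_def algebra_simps)
  qed
  have S1: "1 \<le> S"
  proof -
    have "1 * 1 \<le> 2 powr s * (Z + 2 powr s * ((LINT x|lebesgue_on (ball x0 r). \<bar>b0 x\<bar> powr s) + (LINT x|lebesgue_on (ball x0 r). \<bar>b1 x\<bar> powr s)))"
    proof (intro mult_mono)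
      have "0 \<le> 2 powr s * ((LINT x|lebesgue_on (ball x0 r). \<bar>b0 x\<bar> powr s) + (LINT x|lebesgue_on (ball x0 r). \<bar>b1 x\<bar> powr s))"
        using I0 by (intro mult_nonneg_nonneg) auto
      then show "1 \<le> Z + 2 powr s * ((LINT x|lebesgue_on (ball x0 r). \<bar>b0 x\<bar> powr s) + (LINT x|lebesgue_on (ball x0 r). \<bar>b1 x\<bar> powr s))"
        using Z1 by linarith
    qed (use s2 in auto)
    then show ?thesis using S_ge by linarith
  qed
  have mb: "measure lebesgue (ball x0 r) \<le> unit_ball_vol (real CARD('n))"
    using measure_ball_le_unit_ball[OF r, of x0] by simp
  interpret finite_measure "lebesgue_on (ball x0 r)" by (rule finite_measure_lebesgue_on_ball)
  have [measurable]: "jbr \<in> borel_measurable borel" using continuous_jbr by (rule borel_measurable_continuous_onI)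
  note um[measurable]
  have Vle: "V x powr pstar \<le> 2 powr pstar * (1 + \<bar>u x\<bar> powr pstar)" for x
  proof -
    have "V x powr pstar \<le> (1 + \<bar>u x\<bar>) powr pstar" using \<tau>(3) jbr_ge[of "u x"] by (intro powr_mono2) auto
    also have "\<dots> \<le> 2 powr pstar * (1 powr pstar + \<bar>u x\<bar> powr pstar)" using \<tau>(3) by (intro powr_add_le_2) auto
    finally show ?thesis by simp
  qed
  have di: "integrable (lebesgue_on (ball x0 r)) (\<lambda>x. 2 powr pstar * (1 + \<bar>u x\<bar> powr pstar))" using ui by simp
  have Vi: "integrable (lebesgue_on (ball x0 r)) (\<lambda>x. V x powr pstar)"
  proof (rule Bochner_Integration.integrable_bound[OF di])
    show "AE x in lebesgue_on (ball x0 r). norm (V x powr pstar) \<le> norm (2 powr pstar * (1 + \<bar>u x\<bar> powr pstar))"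
    proof (rule AE_I2)
      fix x show "norm (V x powr pstar) \<le> norm (2 powr pstar * (1 + \<bar>u x\<bar> powr pstar))" using Vle[of x] by simp
    qed
  qed measurable
  have VZ: "(LINT x|lebesgue_on (ball x0 r). V x powr pstar) \<le> Z"
  proof -
    have "(LINT x|lebesgue_on (ball x0 r). V x powr pstar) \<le> (LINT x|lebesgue_on (ball x0 r). 2 powr pstar * (1 + \<bar>u x\<bar> powr pstar))"
      by (intro integral_mono Vi di Vle)
    also have "\<dots> = 2 powr pstar * (measure lebesgue (ball x0 r) + (LINT x|lebesgue_on (ball x0 r). \<bar>u x\<bar> powr pstar))"
      using ui by (simp add: measure_restrict_space space_restrict_space)
    also have "\<dots> \<le> 2 powr pstar * (unit_ball_vol (real CARD('n)) * W + 1 * W)"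
    proof (intro mult_left_mono add_mono)
      have "unit_ball_vol (real CARD('n)) * 1 \<le> unit_ball_vol (real CARD('n)) * W" using W by (intro mult_left_mono) auto
      then show "measure lebesgue (ball x0 r) \<le> unit_ball_vol (real CARD('n)) * W" using mb by linarith
      show "(LINT x|lebesgue_on (ball x0 r). \<bar>u x\<bar> powr pstar) \<le> 1 * W" using U W by linarith
    qed auto
    finally show ?thesis by (simp add: Z_def z_def algebra_simps)
  qed
  note prems = s \<sigma> r ball bm bi Vi Z1 VZ S1 S_ge
  have chi': "1 < (\<sigma> + l) / p" using \<sigma> p by simp
  have eq: "pstar = l + pstar / s + \<sigma>" using s \<sigma> by simp
  have p0: "0 < p" "0 < s" using p s by auto
  note me = moser_exponents[OF chi' refl refl p0(1) \<tau>(3) \<sigma>(1) p0(2) eq]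
  have "AE x in lebesgue_on (ball x0 (r / 2)). \<bar>u x\<bar> \<le> \<Lambda> s \<sigma> r S Z powr (((\<sigma> + l) / p - 1) / (pstar / p * \<sigma>))"
    using sup_bound[OF prems] by (simp only: chi_def[OF prems] \<kappa>_def)
  also have "\<Lambda> s \<sigma> r S Z powr (((\<sigma> + l) / p - 1) / (pstar / p * \<sigma>))
    = bound_const (real CARD('n)) p q c1 c2 c3 c4 M pstar l s \<sigma> B * r powr (- (P / \<sigma>)) * (1 + U) powr ((pstar - p) / \<sigma>)"
  proof -
    have "\<Lambda> s \<sigma> r S Z = Z * GG s \<sigma> r S powr (pstar / p / ((\<sigma> + l) / p - 1)) * HH \<sigma> powr (pstar / p / ((\<sigma> + l) / p - 1)\<^sup>2)"
      unfolding \<Lambda>_def[OF prems] chi_def[OF prems] \<kappa>_def ..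
    moreover have "GG s \<sigma> r S = G0 \<sigma> * (r powr (- P) * (S0 * W) powr (1 / s))"
      unfolding GG_def[OF prems] S_def[symmetric] ..
    ultimately have "\<Lambda> s \<sigma> r S Z powr (((\<sigma> + l) / p - 1) / (pstar / p * \<sigma>))
      = z powr (((\<sigma> + l) / p - 1) / (pstar / p * \<sigma>)) * (G0 \<sigma> * S0 powr (1 / s)) powr (1 / \<sigma>)
        * HH \<sigma> powr (1 / (((\<sigma> + l) / p - 1) * \<sigma>)) * r powr (- (P / \<sigma>)) * (1 + U) powr ((pstar - p) / \<sigma>)"
      by (simp only: Z_def W_def me[of z "1 + U" "G0 \<sigma>" r P S0 "HH \<sigma>"])
    also have "z powr (((\<sigma> + l) / p - 1) / (pstar / p * \<sigma>)) * (G0 \<sigma> * S0 powr (1 / s)) powr (1 / \<sigma>)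
        * HH \<sigma> powr (1 / (((\<sigma> + l) / p - 1) * \<sigma>)) = bound_const (real CARD('n)) p q c1 c2 c3 c4 M pstar l s \<sigma> B"
      by (simp only: bound_const_def Let_def G0_def[OF prems] HH_def[OF prems] cgam_def[OF prems] chi_def[OF prems]
        step_const_def \<omega>_def \<tau>_def rst_def P_def z_def S0_def)
    finally show ?thesis .
  qed
  finally show ?thesis .
qed

end

theorem theorem4p2:
  fixes p q \<theta> \<delta> c1 c2 c3 c4 M s0 s1 pstar :: real
  assumes dim: "CARD('n::finite) \<ge> 2"
    and exponents: "1 \<le> p" "p \<le> q" "q < p + 1" "0 \<le> \<theta>" "1 \<le> \<delta>"
    and constants: "0 < c1" "0 < c2" "0 < c3" "0 < c4" "0 < M"
    and subcritical: "p < real CARD('n) \<Longrightarrow>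
        pstar = real CARD('n) * p / (real CARD('n) - p) \<and>
        q / p < 1 + 1 / real CARD('n) \<and> \<theta> < pstar \<and> \<delta> < pstar \<and>
        real CARD('n) / p < s0 \<and> real CARD('n) / p < s1"
    and supercritical: "real CARD('n) \<le> p \<Longrightarrow>
        1 < s0 \<and> 1 < s1 \<and> p < pstar \<and>
        Max {p / (p - q + 1), \<theta>, \<delta>, p * s1 / (s1 - 1), p * s0 / (s0 - 1)} < pstar"
  shows "\<exists>\<sigma>>0.
    \<sigma> = pstar - Max {p / (p - q + 1), pstar / s1 + 1, pstar / s0 + 1, \<theta>, \<delta>} \<and>
    (\<exists>C :: ennreal \<Rightarrow> ennreal \<Rightarrow> real. (\<forall>N0 N1. 0 < C N0 N1) \<and>
      (\<forall>(\<Omega> :: (real ^ 'n) set)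
         (a :: real ^ 'n \<Rightarrow> real \<Rightarrow> real ^ 'n \<Rightarrow> real ^ 'n)
         (b :: real ^ 'n \<Rightarrow> real \<Rightarrow> real ^ 'n \<Rightarrow> real)
         (b0 :: real ^ 'n \<Rightarrow> real) (b1 :: real ^ 'n \<Rightarrow> real)
         (u :: real ^ 'n \<Rightarrow> real) x0 R0 r.
         open \<Omega> \<and> caratheodory \<Omega> a \<and> caratheodory \<Omega> b \<and>
         Lp_loc s0 \<Omega> b0 \<and> Lp_loc s1 \<Omega> b1 \<and>
         (AE x in lebesgue_on \<Omega>. 0 \<le> b0 x \<and> 0 \<le> b1 x) \<and>
         (AE x in lebesgue_on \<Omega>. \<forall>t \<xi>.
            a x t \<xi> \<bullet> \<xi> \<ge> c1 * rpow (norm \<xi>) p - c2 * rpow \<bar>t\<bar> \<theta> - b1 x \<and>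
            norm (a x t \<xi>) \<le> c3 * rpow (norm \<xi>) (q - 1)
              + c4 * rpow \<bar>t\<bar> ((q - 1) * (2 / (q - p + 2))) + b1 x \<and>
            \<bar>b x t \<xi>\<bar> \<le> M * rpow (1 + (norm \<xi>)\<^sup>2) ((p + q - 2) / 4)
              + M * rpow \<bar>t\<bar> (\<delta> - 1) + b0 x) \<and>
         weak_solution q \<Omega> a b u \<and>
         0 < R0 \<and> R0 \<le> 1 \<and> compactly_contained (ball x0 R0) \<Omega> \<and>
         0 < r \<and> r \<le> R0 \<longrightarrow>
         Linf_norm (ball x0 (r / 2)) u \<le>
           ennreal (C (Lp_norm s0 (ball x0 R0) b0) (Lp_norm s1 (ball x0 R0) b1)
                      / r powr (p / (\<sigma> * (p - q + 1))))
           * epow (1 + Lp_norm pstar (ball x0 r) u) ((pstar - p) / \<sigma>)))"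
proof -
  let ?N = "real CARD('n)" and ?\<omega> = "unit_ball_vol (real CARD('n))"
  have N: "2 \<le> ?N" using dim by simp
  have er: "p < pstar" "1 < s0" "1 < s1" "p < pstar - pstar / s0" "p < pstar - pstar / s1"
    "p / (p - q + 1) < pstar" "\<theta> < pstar" "\<delta> < pstar"
    "1 \<le> pstar * (?N - 1) / ?N" "0 \<le> 1 / ?N - 1 / p + 1 / pstar"
    by (rule exponent_relations[OF N exponents]; fact subcritical supercritical)+
  define mx where "mx = Max {p / (p - q + 1), pstar / s1 + 1, pstar / s0 + 1, \<theta>, \<delta>}"
  define \<sigma> where "\<sigma> = pstar - mx"
  \<comment> \<open>On bounded sets higher integrability implies lower, so \<open>b0\<close> and
    \<open>b1\<close> can be treated with one exponent.\<close>
  define s where "s = min s0 s1"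
  \<comment> \<open>The summands 1 in the maximum are exactly what makes \<open>l \<ge> 1\<close>,
    by which \<open>V\<close> is bounded by \<open>V powr l\<close> in the terms with
    \<open>b0\<close> and \<open>b1\<close>.\<close>
  define l where "l = mx - pstar / s"
  \<comment> \<open>\<open>enn2real\<close> loses nothing: the norms inserted later are finite,
    because the closed ball is a compact subset of \<Omega>. The volume of the unit ball pays for
    lowering the exponents to \<open>s\<close>.\<close>
  define C where "C N0 N1 = bound_const ?N p q c1 c2 c3 c4 M pstar l s \<sigma>
    ((?\<omega> + enn2real N0 powr s0) + (?\<omega> + enn2real N1 powr s1))" for N0 N1
  have mx: "p / (p - q + 1) \<le> mx" "pstar / s1 + 1 \<le> mx" "pstar / s0 + 1 \<le> mx" "\<theta> \<le> mx" "\<delta> \<le> mx"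
    by (simp_all add: mx_def)
  have "pstar / s1 + 1 < pstar" "pstar / s0 + 1 < pstar" using er(4,5) exponents(1) by linarith+
  then have "mx < pstar" using er(6-8) by (simp add: mx_def)
  then have \<sigma>: "0 < \<sigma>" "pstar = mx + \<sigma>" by (simp_all add: \<sigma>_def)
  have s: "1 < s" "s \<le> s0" "s \<le> s1" using er(2,3) by (auto simp: s_def)
  have ps: "pstar / s + 1 \<le> mx" "p < pstar - pstar / s"
    using mx(2,3) er(4,5) by (auto simp: s_def min_def)
  have l: "1 \<le> l" "mx = l + pstar / s" "p < \<sigma> + l" using ps by (auto simp: l_def \<sigma>_def)
  have C: "0 < C N0 N1" for N0 N1
    unfolding C_def using constants exponents l(3) \<sigma>(1) s(1)
    by (intro bound_const_pos add_nonneg_nonneg) auto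
  have main: "Linf_norm (ball x0 (r / 2)) u \<le>
           ennreal (C (Lp_norm s0 (ball x0 R0) b0) (Lp_norm s1 (ball x0 R0) b1)
                      / r powr (p / (\<sigma> * (p - q + 1))))
           * epow (1 + Lp_norm pstar (ball x0 r) u) ((pstar - p) / \<sigma>)"
    if \<Omega>: "open \<Omega>" and b: "Lp_loc s0 \<Omega> b0" "Lp_loc s1 \<Omega> b1"
      and nn: "AE x in lebesgue_on \<Omega>. 0 \<le> b0 x \<and> 0 \<le> b1 x"
      and st: "AE x in lebesgue_on \<Omega>. \<forall>t \<xi>.
            a x t \<xi> \<bullet> \<xi> \<ge> c1 * rpow (norm \<xi>) p - c2 * rpow \<bar>t\<bar> \<theta> - b1 x \<and>
            norm (a x t \<xi>) \<le> c3 * rpow (norm \<xi>) (q - 1)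
              + c4 * rpow \<bar>t\<bar> ((q - 1) * (2 / (q - p + 2))) + b1 x \<and>
            \<bar>b x t \<xi>\<bar> \<le> M * rpow (1 + (norm \<xi>)\<^sup>2) ((p + q - 2) / 4)
              + M * rpow \<bar>t\<bar> (\<delta> - 1) + b0 x"
      and sol: "weak_solution q \<Omega> a b u" and R0: "0 < R0" "R0 \<le> 1" "compactly_contained (ball x0 R0) \<Omega>"
      and r: "0 < r" "r \<le> R0"
    for \<Omega> :: "(real ^ 'n) set" and a b b0 b1 u x0 R0 r
  proof -
    obtain Du where Du: "sobolev_loc q \<Omega> u Du"
      and weak: "\<forall>\<phi> D\<phi>. sobolev q \<Omega> \<phi> D\<phi> \<and> compactly_contained {x \<in> \<Omega>. \<phi> x \<noteq> 0} \<Omega> \<longrightarrow>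
          has_bochner_integral (lebesgue_on \<Omega>)
            (\<lambda>x. (\<Sum>i\<in>UNIV. a x (u x) (Du x) $ i * D\<phi> x $ i) + b x (u x) (Du x) * \<phi> x) 0"
      using sol unfolding weak_solution_def by blast
    interpret ms: moser_solution p q \<theta> \<delta> c1 c2 c3 c4 M mx l pstar \<Omega> a b b0 b1 u Du
    proof
      show "has_bochner_integral (lebesgue_on \<Omega>)
            (\<lambda>x. (\<Sum>i\<in>UNIV. a x (u x) (Du x) $ i * D\<phi> x $ i) + b x (u x) (Du x) * \<phi> x) 0"
        if "sobolev q \<Omega> \<phi> D\<phi>" "compactly_contained {x \<in> \<Omega>. \<phi> x \<noteq> 0} \<Omega>" for \<phi> D\<phi>
        using weak that by blast
    qed (fact dim exponents mx constants l er \<Omega> Du nn st)+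
    have cs: "cball x0 R0 \<subseteq> \<Omega>" using R0 by (simp add: compactly_contained_def closure_ball)
    have Lp_ball: "Lp t (ball x0 R0) f" if "Lp_loc t \<Omega> f" for t and f :: "real ^ 'n \<Rightarrow> real"
    proof (rule Lp_subset)
      show "Lp t (cball x0 R0) f" using that cs by (simp add: Lp_loc_def)
    qed auto
    note b0 = Lp_powr_smaller_ball[OF Lp_ball[OF b(1)] _ s(2) _ r R0(2)]
    note b1 = Lp_powr_smaller_ball[OF Lp_ball[OF b(2)] _ s(3) _ r R0(2)]
    have s': "0 \<le> s" "0 < s0" "0 < s1" using s by auto
    have um: "u \<in> borel_measurable (lebesgue_on S)" if "S \<in> sets lebesgue" "S \<subseteq> ball x0 R0" for S
      using Lp_subset[OF Lp_ball[OF ms.Lpu(1)] that(1) _ that(2)] by (simp add: Lp_def)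
    let ?K = "C (Lp_norm s0 (ball x0 R0) b0) (Lp_norm s1 (ball x0 R0) b1)"
    have K: "0 < ?K / r powr (p / (\<sigma> * (p - q + 1)))" using C r by simp
    show ?thesis
    \<comment> \<open>Finiteness of this norm is not derived from a Sobolev embedding: if it is
      infinite, so is the right hand side, since the constant is positive and \<open>epow\<close>
      maps infinity to infinity.\<close>
    proof (cases "Lp_norm pstar (ball x0 r) u = \<infinity>")
      case True
      then show ?thesis using C[of "Lp_norm s0 (ball x0 R0) b0" "Lp_norm s1 (ball x0 R0) b1"] r by (simp add: ennreal_mult_top)
    next
      case False
      have br: "ball x0 r \<subseteq> ball x0 R0" "ball x0 (r / 2) \<subseteq> ball x0 R0" using r by auto
      have ur: "u \<in> borel_measurable (lebesgue_on (ball x0 r))" using br by (intro um) auto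
      have Lpr: "Lp pstar (ball x0 r) u" using ur False by (rule Lp_norm_finite_imp_Lp)
      define U where "U = enn2real (Lp_norm pstar (ball x0 r) u)"
      have U: "0 \<le> U" "Lp_norm pstar (ball x0 r) u = ennreal U" using False by (auto simp: U_def less_top)
      have Ui: "(LINT x|lebesgue_on (ball x0 r). \<bar>u x\<bar> powr pstar) \<le> U powr pstar"
        using Lp_norm_eq[OF Lpr] er(1) exponents(1) by (simp add: U_def)
      have ui: "integrable (lebesgue_on (ball x0 r)) (\<lambda>x. \<bar>u x\<bar> powr pstar)" using Lpr by (simp add: Lp_def)
      have "ball x0 r \<subseteq> \<Omega>" using br(1) cs ball_subset_cball[of x0 R0] by blast
      note bound = ms.moser_bound[OF s(1) l(2) \<sigma> l(3) r(1) order_trans[OF r(2) R0(2)] this b0(1)[OF s'(1,2)] b1(1)[OF s'(1,3)]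
        b0(2)[OF s'(1,2)] b1(2)[OF s'(1,3)] add_mono[OF b0(3)[OF s'(1,2)] b1(3)[OF s'(1,3)]] ur ui U(1) Ui]
      have eq: "ms.P / \<sigma> = p / (\<sigma> * (p - q + 1))" by (simp add: ms.P_def mult.commute)
      have bound': "AE x in lebesgue_on (ball x0 (r / 2)).
          \<bar>u x\<bar> \<le> ?K / r powr (p / (\<sigma> * (p - q + 1))) * (1 + U) powr ((pstar - p) / \<sigma>)"
        using bound by (simp add: C_def eq powr_minus_divide)
      have uh[measurable]: "u \<in> borel_measurable (lebesgue_on (ball x0 (r / 2)))" using br by (intro um) auto
      have "Linf_norm (ball x0 (r / 2)) u \<le> ennreal (?K / r powr (p / (\<sigma> * (p - q + 1))) * (1 + U) powr ((pstar - p) / \<sigma>))"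
        unfolding Linf_norm_def
      proof (rule esssup_I)
        show "AE x in lebesgue_on (ball x0 (r / 2)). ennreal (norm (u x))
            \<le> ennreal (?K / r powr (p / (\<sigma> * (p - q + 1))) * (1 + U) powr ((pstar - p) / \<sigma>))"
          using bound' by eventually_elim (auto intro: ennreal_leI)
      qed measurable
      also have "\<dots> = ennreal (?K / r powr (p / (\<sigma> * (p - q + 1)))) * ennreal ((1 + U) powr ((pstar - p) / \<sigma>))"
        using K by (intro ennreal_mult) auto
      also have "ennreal ((1 + U) powr ((pstar - p) / \<sigma>)) = epow (1 + Lp_norm pstar (ball x0 r) u) ((pstar - p) / \<sigma>)"
      proof -
        have "1 + ennreal U = ennreal (1 + U)" using U(1) by simp
        then show ?thesis using U(1) by (simp only: U(2) epow_ennreal add_nonneg_nonneg zero_le_one)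
      qed
      finally show ?thesis .
    qed
  qed
  show ?thesis
  proof (intro exI[of _ \<sigma>] exI[of _ C] conjI allI impI)
    show "\<sigma> = pstar - Max {p / (p - q + 1), pstar / s1 + 1, pstar / s0 + 1, \<theta>, \<delta>}"
      by (simp only: \<sigma>_def mx_def)
    show "0 < \<sigma>" by (rule \<sigma>(1))
    show "0 < C N0 N1" for N0 N1 by (rule C)
  qed (elim conjE, rule main; assumption)
qed

end
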